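(* Let $\lambda>-\frac12$, $\lambda\neq0$, and $1<p<\infty$. Weights below are non-negative measurable functions on $\mathbb{R}_+$ that are not almost everywhere zero. (1) If $w\in A_{p,\lambda}$, then $$[w]_{A_{p,\lambda}}:=\sup_{B\subset\mathbb{R}_+}\Big(\frac1{\nu_\lambda(B)}\int_Bt^pw(t)\,dt\Big)\Big(\frac1{\nu_\lambda(B)}\int_Bt^{2\lambda p'}w(t)^{-\frac1{p-1}}\,dt\Big)^{p-1}\ge1.$$ (2) If $w\in A_{p,\lambda}$, then the measures $d\mu(t)=t^pw(t)\,dt$ and $d\sigma(t)=t^{2\lambda p'}w(t)^{-\frac1{p-1}}\,dt$ are both doubling measures on $\mathbb{R}_+$. (3) (Dual factor) $w\in A_{p,\lambda}$ if and only if $t^{(2\lambda-1)p'}w(t)^{-\frac1{p-1}}\in A_{p',\lambda}$. (4) (Nesting structure) For all $\lambda>-\frac12$, $\lambda\ne0$, and all $1\le p_1<p_2<\infty$, one has $A_{p_1,\lambda}\subset A_{p_2,\lambda}$; and for all $p\in(1,\infty)$ and all $\lambda_2>\lambda_1>-\frac12$ with $\lambda_1,\lambda_2\ne0$, one has $A_{p,\lambda_1}\subset A_{p,\lambda_2}$.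
   Context: $\mathbb{R}_+=(0,\infty)$. Intervals $B\subset\mathbb{R}_+$ are intervals $B=(a,b)$ with $0\le a<b<\infty$. $d\nu_\lambda(t)=t^{2\lambda+1}dt$, $\nu_\lambda(B)=\int_Bt^{2\lambda+1}dt$, $p'=p/(p-1)$. For $1<p<\infty$, $w\in A_{p,\lambda}$ means that there is $C>0$ such that for all $0<a<b<\infty$, $$\Big(\int_a^bt^pw(t)\,dt\Big)\Big(\int_a^bt^{2\lambda p'}w(t)^{-\frac1{p-1}}\,dt\Big)^{p-1}<C\big(b^{2(\lambda+1)}-a^{2(\lambda+1)}\big)^p .$$ A measure $\mu$ on $\mathbb{R}_+$ is doubling if there is $C>0$ with $0<\mu(2B\cap\mathbb{R}_+)\le C\mu(B)<\infty$ for all intervals $B\subset\mathbb{R}_+$, where $2B$ is the interval with the same center as $B$ and twice its length. For $p=1$: $w\in A_{1,\lambda}$ means that there is $C>0$ such that $\int_{\{x:|R_\lambda f(x)|>s\}}w(x)\,dx\le\frac Cs\int_{\mathbb{R}_+}|f(x)|w(x)\,dx$ for all $s>0$ and all bounded measurable $f$ with compact support in $(0,\infty)$. Here $R_\lambda=\frac{d}{dx}(\triangle_\lambda)^{-1/2}$ is the Bessel Riesz transform, with $\triangle_\lambda=-\frac{d^2}{dx^2}-\frac{2\lambda}{x}\frac{d}{dx}$ on $L^2(\mathbb{R}_+,x^{2\lambda}dx)$. Concretely, $R_\lambda f=-\widetilde h_\lambda(h_\lambda f)$, where $h_\lambda g(x)=\int_0^\infty(xy)^{\frac12-\lambda}J_{\lambda-\frac12}(xy)g(y)y^{2\lambda}dy$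 and $\widetilde h_\lambda g(x)=\int_0^\infty(xy)^{\frac12-\lambda}J_{\lambda+\frac12}(xy)g(y)y^{2\lambda}dy$ ($J_\nu$ the Bessel function of the first kind), both extended to isometries of $L^2(\mathbb{R}_+,x^{2\lambda}dx)$; $h_\lambda$ diagonalizes $\triangle_\lambda$, i.e. $h_\lambda(\triangle_\lambda f)(y)=y^2h_\lambda f(y)$. *)

theory Defs
  imports "HOL-Analysis.Analysis"
begin

abbreviation Rplus :: "real measure"
  where "Rplus \<equiv> lebesgue_on {0<..}"

text \<open>
  Functions on the half line are total functions on \<^typ>\<open>real\<close> of which only the values on
  \<^term>\<open>{0::real<..}\<close> matter. Weights take values in \<open>[0,\<infinity>]\<close>, so that a negative power of a weight
  has the value \<open>\<infinity>\<close> where the weight vanishes; a weight itself may be infinite only on a null set.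
\<close>

definition weight :: "(real \<Rightarrow> ennreal) \<Rightarrow> bool"
  where "weight w \<longleftrightarrow>
    w \<in> borel_measurable Rplus \<and> (AE t in Rplus. w t < \<infinity>) \<and> \<not> (AE t in Rplus. w t = 0)"

text \<open>Real powers on \<open>[0,\<infinity>]\<close>, with \<open>0\<^sup>r = \<infinity>\<close> and \<open>\<infinity>\<^sup>r = 0\<close> for \<open>r < 0\<close>.\<close>

definition epowr :: "ennreal \<Rightarrow> real \<Rightarrow> ennreal"
  where "epowr x r =
    (if r = 0 then 1
     else if x = 0 then (if r > 0 then 0 else \<infinity>)
     else if x = \<infinity> then (if r > 0 then \<infinity> else 0)
     else ennreal (enn2real x powr r))"

definition conj_exp :: "real \<Rightarrow> real"
  where "conj_exp p = p / (p - 1)"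

definition mu_density :: "real \<Rightarrow> (real \<Rightarrow> ennreal) \<Rightarrow> real \<Rightarrow> ennreal"
  where "mu_density p w t = ennreal (t powr p) * w t"

definition sigma_density :: "real \<Rightarrow> real \<Rightarrow> (real \<Rightarrow> ennreal) \<Rightarrow> real \<Rightarrow> ennreal"
  where "sigma_density l p w t = ennreal (t powr (2 * l * conj_exp p)) * epowr (w t) (- 1 / (p - 1))"

definition dual_weight :: "real \<Rightarrow> real \<Rightarrow> (real \<Rightarrow> ennreal) \<Rightarrow> real \<Rightarrow> ennreal"
  where "dual_weight l p w t =
    ennreal (t powr ((2 * l - 1) * conj_exp p)) * epowr (w t) (- 1 / (p - 1))"

definition nu :: "real \<Rightarrow> real set \<Rightarrow> ennreal"
  where "nu l B = (\<integral>\<^sup>+t\<in>B. ennreal (t powr (2 * l + 1)) \<partial>lebesgue)"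

definition Ap_condition :: "real \<Rightarrow> real \<Rightarrow> (real \<Rightarrow> ennreal) \<Rightarrow> bool"
  where "Ap_condition p l w \<longleftrightarrow>
    (\<exists>C>0. \<forall>a b. 0 < a \<and> a < b \<longrightarrow>
      (\<integral>\<^sup>+t\<in>{a<..<b}. mu_density p w t \<partial>lebesgue)
        * epowr (\<integral>\<^sup>+t\<in>{a<..<b}. sigma_density l p w t \<partial>lebesgue) (p - 1)
      < ennreal (C * (b powr (2 * (l + 1)) - a powr (2 * (l + 1))) powr p))"

definition Ap_char :: "real \<Rightarrow> real \<Rightarrow> (real \<Rightarrow> ennreal) \<Rightarrow> ennreal"
  where "Ap_char p l w =
    (SUP (a, b) \<in> {(a, b). 0 \<le> a \<and> a < b}.
      ((\<integral>\<^sup>+t\<in>{a<..<b}. mu_density p w t \<partial>lebesgue) / nu l {a<..<b})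
      * epowr ((\<integral>\<^sup>+t\<in>{a<..<b}. sigma_density l p w t \<partial>lebesgue) / nu l {a<..<b}) (p - 1))"

text \<open>The interval \<open>2B\<close> is given by its centre \<open>(a + b) / 2\<close> and its half length \<open>b - a\<close>.\<close>

definition doubling :: "real measure \<Rightarrow> bool"
  where "doubling M \<longleftrightarrow>
    (\<exists>C>0. \<forall>a b. 0 \<le> a \<and> a < b \<longrightarrow>
      0 < emeasure M ({(a + b) / 2 - (b - a)<..<(a + b) / 2 + (b - a)} \<inter> {0<..}) \<and>
      emeasure M ({(a + b) / 2 - (b - a)<..<(a + b) / 2 + (b - a)} \<inter> {0<..})
        \<le> ennreal C * emeasure M {a<..<b} \<and>
      ennreal C * emeasure M {a<..<b} < \<infinity>)"

text \<open>The Bessel function of the first kind, for \<open>z > 0\<close>.\<close>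

definition bessel_J :: "real \<Rightarrow> real \<Rightarrow> real"
  where "bessel_J v z =
    (\<Sum>k. (- 1) ^ k / fact k * rGamma (v + real k + 1) * (z / 2) powr (2 * real k + v))"

definition bessel_measure :: "real \<Rightarrow> real measure"
  where "bessel_measure l = density Rplus (\<lambda>x. ennreal (x powr (2 * l)))"

definition L2 :: "real \<Rightarrow> (real \<Rightarrow> real) set"
  where "L2 l = {g \<in> borel_measurable Rplus. (\<integral>\<^sup>+x. ennreal ((g x)\<^sup>2) \<partial>bessel_measure l) < \<infinity>}"

definition L2_tendsto :: "real \<Rightarrow> (nat \<Rightarrow> real \<Rightarrow> real) \<Rightarrow> (real \<Rightarrow> real) \<Rightarrow> bool"
  where "L2_tendsto l g G \<longleftrightarrow>
    (\<lambda>n. \<integral>\<^sup>+x. ennreal ((g n x - G x)\<^sup>2) \<partial>bessel_measure l) \<longlonglongrightarrow> 0"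

definition test_functions :: "(real \<Rightarrow> real) set"
  where "test_functions = {f \<in> borel_measurable Rplus.
    (\<exists>M. \<forall>x>0. \<bar>f x\<bar> \<le> M) \<and> (\<exists>a>0. \<exists>b. \<forall>x>0. x \<notin> {a..b} \<longrightarrow> f x = 0)}"

text \<open>
  The continuous extension to \<^term>\<open>L2 l\<close> of an operator given on the dense subspace of test
  functions. The result is a representative chosen from an almost-everywhere class.
\<close>

definition L2_extension ::
    "real \<Rightarrow> ((real \<Rightarrow> real) \<Rightarrow> real \<Rightarrow> real) \<Rightarrow> (real \<Rightarrow> real) \<Rightarrow> real \<Rightarrow> real"
  where "L2_extension l T G =
    (SOME H. H \<in> L2 l \<and>
      (\<forall>g. (\<forall>n. g n \<in> test_functions) \<and> L2_tendsto l g G \<longrightarrow> L2_tendsto l (\<lambda>n. T (g n)) H))"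

definition hankel_integral :: "real \<Rightarrow> real \<Rightarrow> (real \<Rightarrow> real) \<Rightarrow> real \<Rightarrow> real"
  where "hankel_integral l v g x =
    (\<integral>y. (x * y) powr (1 / 2 - l) * bessel_J v (x * y) * g y \<partial>bessel_measure l)"

definition hankel :: "real \<Rightarrow> (real \<Rightarrow> real) \<Rightarrow> real \<Rightarrow> real"
  where "hankel l = L2_extension l (hankel_integral l (l - 1 / 2))"

definition hankel_conj :: "real \<Rightarrow> (real \<Rightarrow> real) \<Rightarrow> real \<Rightarrow> real"
  where "hankel_conj l = L2_extension l (hankel_integral l (l + 1 / 2))"

definition bessel_riesz :: "real \<Rightarrow> (real \<Rightarrow> real) \<Rightarrow> real \<Rightarrow> real"
  where "bessel_riesz l f x = - hankel_conj l (hankel l f) x"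

definition A1_condition :: "real \<Rightarrow> (real \<Rightarrow> ennreal) \<Rightarrow> bool"
  where "A1_condition l w \<longleftrightarrow>
    (\<exists>C>0. \<forall>s>0. \<forall>f\<in>test_functions.
      (\<integral>\<^sup>+x\<in>{x. 0 < x \<and> s < \<bar>bessel_riesz l f x\<bar>}. w x \<partial>lebesgue)
        \<le> ennreal (C / s) * (\<integral>\<^sup>+x\<in>{0<..}. ennreal \<bar>f x\<bar> * w x \<partial>lebesgue))"

definition A_class :: "real \<Rightarrow> real \<Rightarrow> (real \<Rightarrow> ennreal) set"
  where "A_class p l = {w. weight w \<and> (if p = 1 then A1_condition l w else Ap_condition p l w)}"

end

theory Submission
  imports Defs
begin

text \<open>
  For \<open>p > 1\<close> everything rests on Hoelder's inequality \<open>\<nu>(B)\<^sup>p \<le> \<mu>(B) \<sigma>(B)\<^sup>p\<^sup>-\<^sup>1\<close>: it gives the lower bound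
  for the characteristic, and combined with the \<open>A\<^sub>p\<close> condition on \<open>2B\<close> it transfers the doubling
  property of \<open>\<nu>\<close> to \<open>\<mu>\<close>. The roles of \<open>\<mu>\<close> and \<open>\<sigma>\<close> are exchanged by the dual weight.

  For \<open>p = 1\<close> the weak type estimate must be turned into a pointwise lower bound for the weight, which
  needs the kernel of the Riesz transform. Testing \<open>R f\<close> against \<open>\<psi>\<close>, writing \<open>1\<close> as an integral of
  \<open>z s\<^sup>-\<^sup>1\<^sup>/\<^sup>2 exp (- s z\<^sup>2)\<close> over \<open>s\<close> and using Weber's second exponential integral produces the kernel as a
  subordination integral of the differentiated heat kernel. Expanded in powers of
  \<open>1 - \<tau>\<^sup>2\<close>, where \<open>\<tau> = (x\<^sup>2 - y\<^sup>2) / (x\<^sup>2 + y\<^sup>2)\<close>, it has a definite sign and the expected size both for \<open>\<tau>\<close>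
  near \<open>0\<close> and for \<open>\<bar>\<tau>\<bar>\<close> near \<open>1\<close>. Hence \<open>\<bar>R 1\<^sub>E\<bar>\<close> is large on a companion interval \<open>J\<close> of \<open>[a, b]\<close> for every
  \<open>E \<subseteq> [a, b]\<close>, and applying the weak type estimate in both directions shows that on \<open>[a, b]\<close>
  the weight is at least a multiple \<open>\<theta>\<close> of \<open>t\<^sup>2\<^sup>\<lambda>\<close>, with \<open>\<theta>\<close> comparable to its average.
\<close>

section \<open>Bessel functions and Weber's integral\<close>

text \<open>The Riesz transform is a composition of two extensions, each a chosen representative of
  an \<open>L^2\<close> class, so it has no values that could be estimated directly. Its kernel is
  visible only in pairings of functions with separated supports, and every pointwise bound holds
  almost everywhere. In the kernel series \<tau> is added to
  \<open>\<lambda> / (\<lambda> + 1 + 2k)\<close>. For intermediate \<tau> the two compete and the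
  sign is unclear. Near the diagonal a singularity \<open>1 / \<tau>\<close> beats a logarithm, and
  far away \<open>|\<tau>| > |\<lambda>| / (\<lambda> + 1)\<close> settles the sign. Hence short
  intervals get an adjacent companion, long ones a remote companion. The weight is compared with
  \<open>t^(2\<lambda>)\<close> because the lower bound for \<open>R 1_E\<close> is proportional to
  the measure of \<open>E\<close> with that density. A weight in the weak type class is not assumed
  locally integrable; its finite mean is a by-product. The condition for \<open>p > 1\<close> speaks
  of intervals with \<open>a > 0\<close>, doubling also of those starting at 0, and a limit bridges
  the two.\<close>

lemma has_sum_mult:
  fixes f :: "'a \<Rightarrow> real" and g :: "'b \<Rightarrow> real"
  assumes "(f has_sum A) S" "(g has_sum B) T"
  shows "((\<lambda>(x, y). f x * g y) has_sum A * B) (S \<times> T)"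
proof (rule has_sum_SigmaI)
  show "((\<lambda>y. case (x, y) of (x, y) \<Rightarrow> f x * g y) has_sum f x * B) T" for x
    using has_sum_cmult_right[OF assms(2)] by simp
  show "((\<lambda>x. f x * B) has_sum A * B) S"
    by (rule has_sum_cmult_left[OF assms(1)])
  \<comment> \<open>On the reals \<open>summable_on\<close> already means absolute summability, so
    the double family is controlled factor by factor.\<close>
  have f: "(\<lambda>x. \<bar>f x\<bar>) summable_on S" and g: "(\<lambda>y. \<bar>g y\<bar>) summable_on T"
    using assms summable_on_iff_abs_summable_on_real[of f S] summable_on_iff_abs_summable_on_real[of g T]
    by (auto simp: has_sum_imp_summable)
  have *: "(\<Sum>\<^sub>\<infinity>y\<in>T. \<bar>f x\<bar> * \<bar>g y\<bar>) = \<bar>f x\<bar> * (\<Sum>\<^sub>\<infinity>y\<in>T. \<bar>g y\<bar>)" for x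
    using g by (simp add: infsum_cmult_right)
  have "0 \<le> (\<Sum>\<^sub>\<infinity>y\<in>T. \<bar>g y\<bar>)"
    by (rule infsum_nonneg) simp
  then have "(\<lambda>p. norm (case p of (x, y) \<Rightarrow> f x * g y)) summable_on (S \<times> T)"
    unfolding Infinite_Sum.abs_summable_on_Sigma_iff
    using f g by (auto simp: abs_mult * intro!: summable_on_cmult_right summable_on_cmult_left)
  then show "(\<lambda>(x, y). f x * g y) summable_on (S \<times> T)"
    by (rule Infinite_Sum.abs_summable_summable)
qed

text \<open>
  The entire function \<open>bes a w = \<Sum>k. w\<^sup>k / (k! \<Gamma>(a + k))\<close>: with \<open>a = \<nu> + 1\<close> it is
  \<open>(z/2)\<^sup>-\<^sup>\<nu> J\<^sub>\<nu>(z)\<close> for \<open>w = -z\<^sup>2/4\<close> and \<open>(z/2)\<^sup>-\<^sup>\<nu> I\<^sub>\<nu>(z)\<close> for \<open>w = z\<^sup>2/4\<close>.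
\<close>

definition bes_coeff :: "real \<Rightarrow> nat \<Rightarrow> real"
  where "bes_coeff a k = rGamma (a + real k) / fact k"

definition bes :: "real \<Rightarrow> real \<Rightarrow> real"
  where "bes a w = (\<Sum>k. bes_coeff a k * w ^ k)"

lemma rGamma_pos: "0 < rGamma a" if "0 < a" for a :: real
  using Gamma_real_pos[OF that] by (simp add: rGamma_inverse_Gamma)

lemma rGamma_eq: "rGamma a = a * rGamma (a + 1)" for a :: real
  by (simp add: rGamma_plus1)

lemma bes_coeff_pos: "0 < bes_coeff a k" if "0 < a"
  using that by (simp add: bes_coeff_def rGamma_pos)

text \<open>Functional equation of \<open>rGamma\<close>, kept multiplied out: in this form it holds
  for every real \<open>a\<close>, also where the factor vanishes.\<close>

lemma bes_coeff_Suc: "bes_coeff a k = (a + real k) * real (Suc k) * bes_coeff a (Suc k)"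
proof -
  have "rGamma (a + real k) = (a + real k) * rGamma (a + real (Suc k))"
    using rGamma_eq[of "a + real k"] by (simp add: add_ac)
  then show ?thesis by (simp add: bes_coeff_def)
qed

lemma summable_bes_norm: "summable (\<lambda>k. norm (bes_coeff a k * w ^ k))" if "0 < a"
proof -
  \<comment> \<open>Beyond \<open>N\<close> the factor \<open>(a + k) (k + 1)\<close> is at least
    \<open>2 |w|\<close>, so consecutive terms at least halve.\<close>
  define N where "N = nat \<lceil>2 * \<bar>w\<bar>\<rceil>"
  have N: "2 * \<bar>w\<bar> \<le> real N" unfolding N_def by linarith
  show ?thesis
  proof (rule summable_ratio_test[of "1/2" "Suc N"])
    fix k assume k: "Suc N \<le> k"
    have c: "0 < bes_coeff a (Suc k)" using that by (rule bes_coeff_pos)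
    have 1: "2 * \<bar>w\<bar> \<le> (a + real k) * real (Suc k)"
    proof -
      have "2 * \<bar>w\<bar> \<le> real k * 1" using N k by linarith
      also have "\<dots> \<le> (a + real k) * real (Suc k)" using that by (intro mult_mono) auto
      finally show ?thesis .
    qed
    have "norm (bes_coeff a (Suc k) * w ^ Suc k) = (bes_coeff a (Suc k) * \<bar>w\<bar> ^ k) * \<bar>w\<bar>"
      using c by (simp add: abs_mult power_abs)
    also have "\<dots> \<le> (bes_coeff a (Suc k) * \<bar>w\<bar> ^ k) * ((a + real k) * real (Suc k) / 2)"
      using c 1 by (intro mult_left_mono) auto
    also have "\<dots> = 1/2 * norm (bes_coeff a k * w ^ k)"
      using c that by (subst (2) bes_coeff_Suc) (simp add: abs_mult power_abs)
    finally show "norm (norm (bes_coeff a (Suc k) * w ^ Suc k)) \<le> 1/2 * norm (norm (bes_coeff a k * w ^ k))"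
      by simp
  qed simp
qed

lemma bes_sums: "(\<lambda>k. bes_coeff a k * w ^ k) sums bes a w" if "0 < a"
  using summable_norm_cancel[OF summable_bes_norm[OF that]] unfolding bes_def by (rule summable_sums)

lemma bes_has_sum: "((\<lambda>k. bes_coeff a k * w ^ k) has_sum bes a w) UNIV" if "0 < a"
  using summable_bes_norm[OF that] bes_sums[OF that] by (rule norm_summable_imp_has_sum)

lemma bes_nonneg: "0 \<le> bes a w" if "0 < a" "0 \<le> w"
  by (rule has_sum_nonneg[OF bes_has_sum[OF that(1)]])
     (use that less_imp_le[OF bes_coeff_pos[OF that(1)]] in auto)

lemma borel_measurable_bes [measurable]: "bes a \<in> borel_measurable borel"
  unfolding bes_def by measurable

lemma exp_has_sum: "((\<lambda>k. w ^ k / fact k) has_sum exp w) UNIV" for w :: real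
  using norm_summable_imp_has_sum[OF _ exp_converges[of w]] summable_norm_exp[of w]
  by (simp add: divide_inverse mult.commute)

section \<open>Coefficients of Weber's integral, for equal and for neighbouring orders\<close>

definition weber_coeff :: "real \<Rightarrow> nat \<Rightarrow> nat \<Rightarrow> real"
  where "weber_coeff a j k = Gamma (a + real (j + k)) * bes_coeff a j * bes_coeff a k"

text \<open>Chu-Vandermonde. The right side is the coefficient of \<open>X^j Y^k\<close> in
  \<open>exp X * exp Y * bes a (X * Y)\<close>: \<open>m\<close> powers of \<open>X * Y\<close> come
  from \<open>bes\<close>, the rest from the exponentials. The left side is what Gaussian moments
  make of a product of two Bessel series. The identity is therefore Weber's second exponential
  integral at the level of coefficients.\<close>

lemma weber_coeff_eq_sum:
  assumes a: "0 < a"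
  shows "weber_coeff a j k
    = (\<Sum>m\<le>min j k. bes_coeff a m / (fact (j - m) * fact (k - m)))"
proof -
  have poch: "Gamma (a + real n) = pochhammer a n * Gamma a" for n
  proof -
    have "a \<notin> \<int>\<^sub>\<le>\<^sub>0" using a nonpos_Ints_nonpos[of a] by auto
    then show ?thesis using pochhammer_Gamma[of a n] Gamma_real_pos[OF a] by simp
  qed
  have G: "Gamma a \<noteq> 0" using Gamma_real_pos[OF a] by simp
  have pos: "pochhammer a n > 0" for n
    using a by (rule pochhammer_pos)
  have bc: "bes_coeff a m = 1 / (pochhammer a m * Gamma a * fact m)" for m
    by (simp add: bes_coeff_def rGamma_inverse_Gamma poch field_simps)
  have neg: "pochhammer (- real n) m = (-1) ^ m * (fact n / fact (n - m))" if "m \<le> n" for m n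
    using that
  proof (induction m)
    case (Suc m)
    then have "n - m = Suc (n - Suc m)" by simp
    then have "fact (n - m) = (real n - real m) * fact (n - Suc m)"
      using Suc.prems by (simp only: fact_Suc) (simp add: of_nat_diff)
    moreover have "pochhammer (- real n) m = (-1) ^ m * (fact n / fact (n - m))"
      using Suc by simp
    moreover have "real n - real m \<noteq> 0" using Suc.prems by simp
    ultimately show ?case
      unfolding pochhammer_Suc by (simp add: divide_simps) (simp add: algebra_simps)
  qed simp
  have neg0: "pochhammer (- real j) m = 0" if "j < m" for m
    using that by (simp add: pochhammer_of_nat_eq_0_iff)
  \<comment> \<open>The value at 1 of the hypergeometric sum with parameters \<open>-j\<close>,
    \<open>-k\<close> and \<open>a\<close>. The range \<open>0..k\<close> shrinks to
    \<open>m \<le> min j k\<close> because \<open>(-j)_m\<close> vanishes for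
    \<open>m > j\<close>.\<close>
  have "(\<Sum>m\<in>{0..k}. pochhammer (- real j) m * pochhammer (- real k) m / (fact m * pochhammer a m))
     = pochhammer (a + real j) k / pochhammer a k"
    using Vandermonde_pochhammer[of k a "- real j"] a by (auto simp: of_nat_fact)
  moreover have "(\<Sum>m\<in>{0..k}. pochhammer (- real j) m * pochhammer (- real k) m / (fact m * pochhammer a m))
    = (\<Sum>m\<le>min j k. pochhammer (- real j) m * pochhammer (- real k) m / (fact m * pochhammer a m))"
    by (rule sum.mono_neutral_right) (auto simp: neg0 not_le)
  moreover have "\<dots> = (\<Sum>m\<le>min j k. fact j * fact k * Gamma a * (bes_coeff a m / (fact (j - m) * fact (k - m))))"
  proof (intro sum.cong refl)
    fix m assume "m \<in> {..min j k}"
    then have m: "m \<le> j" "m \<le> k" by auto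
    have sq: "(-1::real) ^ m * (-1) ^ m = 1" by (simp flip: power_mult_distrib)
    have "pochhammer (- real j) m * pochhammer (- real k) m
        = ((-1) ^ m * (-1) ^ m) * ((fact j / fact (j - m)) * (fact k / fact (k - m)))"
      using m by (simp add: neg)
    then show "pochhammer (- real j) m * pochhammer (- real k) m / (fact m * pochhammer a m)
      = fact j * fact k * Gamma a * (bes_coeff a m / (fact (j - m) * fact (k - m)))"
      using G unfolding sq bc by (simp add: mult_ac)
  qed
  ultimately have "fact j * fact k * Gamma a * (\<Sum>m\<le>min j k. bes_coeff a m / (fact (j - m) * fact (k - m)))
    = pochhammer (a + real j) k / pochhammer a k"
    by (simp add: sum_distrib_left)
  moreover have "weber_coeff a j k = pochhammer (a + real j) k / pochhammer a k / (fact j * fact k * Gamma a)"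
    using G pos[of j] unfolding weber_coeff_def poch bc
    by (simp add: pochhammer_product' field_simps)
  moreover have "fact j * fact k * Gamma a \<noteq> 0" using G by simp
  ultimately show ?thesis by (metis nonzero_mult_div_cancel_left)
qed

text \<open>Three absolutely convergent series are multiplied out, and the triples
  \<open>(m, i, l)\<close> are regrouped by \<open>(j, k) = (m + i, m + l)\<close>. The fibre over
  \<open>(j, k)\<close> is \<open>m \<le> min j k\<close>, the range of the sum in
  \<open>weber_coeff_eq_sum\<close>.\<close>

lemma weber_has_sum:
  assumes a: "0 < a"
  shows "((\<lambda>(j, k). weber_coeff a j k * X ^ j * Y ^ k) has_sum exp (X + Y) * bes a (X * Y)) UNIV"
proof -
  let ?g = "\<lambda>(m, i, l). bes_coeff a m * (X * Y) ^ m * (X ^ i / fact i * (Y ^ l / fact l))"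
  have "(?g has_sum bes a (X * Y) * (exp X * exp Y)) (UNIV \<times> UNIV \<times> UNIV)"
    using has_sum_mult[OF bes_has_sum[OF a] has_sum_mult[OF exp_has_sum exp_has_sum]]
    by (simp add: case_prod_unfold)
  then have "((\<lambda>((j, k), m). bes_coeff a m / (fact (j - m) * fact (k - m)) * X ^ j * Y ^ k)
      has_sum exp (X + Y) * bes a (X * Y)) (SIGMA p:UNIV. {..min (fst p) (snd p)})"
  proof (subst has_sum_reindex_bij_witness[where
        i = "\<lambda>(m, i, l). ((m + i, m + l), m)" and j = "\<lambda>((j, k), m). (m, j - m, k - m)"
        and T = "UNIV \<times> UNIV \<times> UNIV" and h = ?g and s' = "bes a (X * Y) * (exp X * exp Y)"], goal_cases)
    case (5 q)
    then obtain j k m where q: "q = ((j, k), m)" "m \<le> j" "m \<le> k" by (cases q) auto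
    then obtain i l where "j = m + i" "k = m + l" by (metis le_Suc_ex)
    with q show ?case by (simp add: power_mult_distrib power_add)
  qed (auto simp: exp_add)
  then have "((\<lambda>p. (\<Sum>m\<le>min (fst p) (snd p). bes_coeff a m / (fact (fst p - m) * fact (snd p - m)) * X ^ fst p * Y ^ snd p))
      has_sum exp (X + Y) * bes a (X * Y)) UNIV"
    by (rule has_sum_SigmaD) (auto simp: case_prod_unfold intro!: has_sum_finiteI)
  then show ?thesis
    by (simp add: weber_coeff_eq_sum[OF a] case_prod_unfold sum_distrib_right)
qed

text \<open>Counterpart of \<open>weber_coeff\<close> for the orders \<open>a\<close> and
  \<open>a + 1\<close>, which meet in the Riesz transform because it pairs the Hankel transform with
  its conjugate.\<close>

definition weber_coeff' :: "real \<Rightarrow> nat \<Rightarrow> nat \<Rightarrow> real"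
  where "weber_coeff' a j k = Gamma (a + 1 + real (j + k)) * bes_coeff a j * bes_coeff (a + 1) k"

text \<open>Split \<open>a + j + k = (a + k) + j\<close> in
  \<open>Gamma (a + 1 + j + k) = (a + j + k) * Gamma (a + j + k)\<close>. The summand
  \<open>a + k\<close> lowers the second order from \<open>a + 1\<close> to \<open>a\<close>; the
  summand \<open>j\<close> raises the first order to \<open>a + 1\<close> and shifts its index by
  one. Both parts are then coefficients for equal orders.\<close>

lemma weber_coeff'_eq:
  assumes a: "0 < a"
  shows "weber_coeff' a j k = weber_coeff a j k + (if j = 0 then 0 else weber_coeff (a + 1) (j - 1) k)"
proof -
  have 1: "rGamma (a + real k) = (a + real k) * rGamma (a + real k + 1)"
    by (rule rGamma_eq)
  have 2: "Gamma (a + 1 + real (j + k)) = (a + real (j + k)) * Gamma (a + real (j + k))"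
    using Gamma_plus1[of "a + real (j + k)"] a nonpos_Ints_nonpos[of "a + real (j + k)"]
    by (force simp: add_ac)
  show ?thesis
  proof (cases j)
    case 0
    then show ?thesis using 1 2 unfolding weber_coeff'_def weber_coeff_def bes_coeff_def by (simp add: add_ac)
  next
    case (Suc i)
    have 3: "Gamma (a + 1 + real (i + k)) = Gamma (a + real (j + k))"
      by (simp add: Suc algebra_simps)
    have 4: "bes_coeff (a + 1) i = real j * bes_coeff a j"
    proof -
      have "rGamma (a + real j) = rGamma (a + 1 + real i)" by (simp add: Suc add_ac)
      moreover have "fact j = real j * fact i" "real j \<noteq> 0" by (simp_all add: Suc)
      ultimately show ?thesis by (simp add: bes_coeff_def)
    qed
    have 5: "bes_coeff a k = (a + real k) * bes_coeff (a + 1) k"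
      using 1 by (simp add: bes_coeff_def algebra_simps)
    show ?thesis
      unfolding weber_coeff'_def weber_coeff_def 2 5
      using 3 4 Suc by (simp add: algebra_simps)
  qed
qed

lemma weber'_has_sum:
  assumes a: "0 < a"
  shows "((\<lambda>(j, k). weber_coeff' a j k * X ^ j * Y ^ k)
    has_sum exp (X + Y) * (bes a (X * Y) + X * bes (a + 1) (X * Y))) UNIV"
proof -
  have "((\<lambda>(j, k). X * (weber_coeff (a + 1) j k * X ^ j * Y ^ k)) has_sum
      X * (exp (X + Y) * bes (a + 1) (X * Y))) UNIV"
    using has_sum_cmult_right[OF weber_has_sum[of "a + 1" X Y]] a by (simp add: case_prod_unfold)
  then have "((\<lambda>(j, k). weber_coeff (a + 1) (j - 1) k * X ^ j * Y ^ k) has_sum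
      X * (exp (X + Y) * bes (a + 1) (X * Y))) ({1..} \<times> UNIV)"
    by (subst has_sum_reindex_bij_witness[where S = "{1..} \<times> UNIV" and
        i = "\<lambda>(j, k). (j + 1, k)" and j = "\<lambda>(j, k). (j - 1, k)"
        and T = UNIV and h = "\<lambda>(j, k). X * (weber_coeff (a + 1) j k * X ^ j * Y ^ k)"
        and s' = "X * (exp (X + Y) * bes (a + 1) (X * Y))"])
       (auto simp: power_eq_if)
  then have "((\<lambda>(j, k). (if j = 0 then 0 else weber_coeff (a + 1) (j - 1) k) * X ^ j * Y ^ k) has_sum
      X * (exp (X + Y) * bes (a + 1) (X * Y))) UNIV"
    by (subst has_sum_cong_neutral[where T = "{1..} \<times> UNIV"]) (auto split: if_splits)
  from has_sum_add[OF weber_has_sum[OF a, of X Y] this] show ?thesis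
    by (simp add: weber_coeff'_eq[OF a] case_prod_unfold algebra_simps)
qed

section \<open>Gamma integrals, termwise integration and Weber's formulas\<close>

lemma borel_measurable_lebesgue_on_borel:
  "f \<in> borel_measurable borel \<Longrightarrow> f \<in> borel_measurable (lebesgue_on S)"
  by (rule measurable_restrict_space1) (simp add: measurable_completion)

text \<open>Substitution \<open>u = c * z^r\<close> in the Gamma integral, for either sign of
  \<open>r\<close>. The case \<open>r = 2\<close> gives Gaussian moments, \<open>r = 1\<close> the
  subordination integral and \<open>r = -1\<close> the integrals in heat time.\<close>

lemma nn_integral_powr_exp:
  fixes b c r :: real
  assumes b: "0 < b" and c: "0 < c" and r: "r \<noteq> 0"
  shows "(\<integral>\<^sup>+z. ennreal (z powr (r * b - 1) * exp (- (c * z powr r))) \<partial>Rplus)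
    = ennreal (Gamma b / (\<bar>r\<bar> * c powr b))"
proof -
  define f :: "real \<Rightarrow> real" where "f = (\<lambda>u. u powr (b - 1) / exp u)"
  define g :: "real \<Rightarrow> real" where "g = (\<lambda>z. c * z powr r)"
  have img: "g ` {0<..} = {0<..}"
  proof (intro equalityI subsetI)
    fix y :: real assume y: "y \<in> {0<..}"
    then have "y = g ((y / c) powr (1 / r))" using c r by (simp add: g_def powr_powr)
    then show "y \<in> g ` {0<..}" using y c by auto
  qed (use c in \<open>auto simp: g_def\<close>)
  have inj: "inj_on g {0<..}"
  proof (rule inj_onI)
    fix x y assume "x \<in> {0<..}" "y \<in> {0<..}" "g x = g y"
    then have "x powr r = y powr r" using c by (simp add: g_def)
    then have "(x powr r) powr (1 / r) = (y powr r) powr (1 / r)" by simp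
    then show "x = y" using r \<open>x \<in> _\<close> \<open>y \<in> _\<close> by (simp add: powr_powr)
  qed
  have der: "(g has_field_derivative (c * (r * z powr (r - 1)))) (at z within {0<..})" if "z \<in> {0<..}" for z
    using that unfolding g_def
    by (auto intro!: has_field_derivative_at_within[OF DERIV_cmult[OF has_real_derivative_powr]])
  have fint: "f absolutely_integrable_on {0<..} \<and> integral {0<..} f = Gamma b"
  proof -
    have 1: "(f has_integral Gamma b) {0..}" using Gamma_integral_real[OF b] by (simp add: f_def)
    then have 2: "(f has_integral Gamma b) {0<..}"
    proof (rule has_integral_spike_set_eq[THEN iffD1, rotated 2])
      show "negligible {x \<in> {0..} - {0<..}. f x \<noteq> 0}" "negligible {x \<in> {0<..} - {0..}. f x \<noteq> 0}"
        by (rule negligible_subset[of "{0}"]; force)+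
    qed
    then show ?thesis
      by (auto simp: has_integral_iff f_def intro!: nonnegative_absolutely_integrable_1)
  qed
  then have I: "(\<lambda>z. \<bar>c * (r * z powr (r - 1))\<bar> * f (g z)) absolutely_integrable_on {0<..}
      \<and> integral {0<..} (\<lambda>z. \<bar>c * (r * z powr (r - 1))\<bar> * f (g z)) = Gamma b"
    using has_absolute_integral_change_of_variables_1'[OF _ der inj, of f "Gamma b"] img by simp
  have eq: "\<bar>c * (r * z powr (r - 1))\<bar> * f (g z)
      = (\<bar>r\<bar> * c powr b) * (z powr (r * b - 1) * exp (- (c * z powr r)))" if "0 < z" for z
  proof -
    have "c * (c powr (b - 1)) = c powr b" using c by (simp add: powr_diff)
    moreover have "z powr (r - 1) * z powr (r * (b - 1)) = z powr (r * b - 1)"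
      by (simp add: algebra_simps flip: powr_add)
    moreover have "\<bar>c * (r * z powr (r - 1))\<bar> * f (g z)
        = \<bar>r\<bar> * ((c * c powr (b - 1)) * (z powr (r - 1) * z powr (r * (b - 1)))) * exp (- (c * z powr r))"
      using c that by (simp add: f_def g_def abs_mult powr_mult powr_powr exp_minus divide_inverse)
    ultimately show ?thesis by simp
  qed
  let ?F = "\<lambda>z. \<bar>c * (r * z powr (r - 1))\<bar> * f (g z)"
  have int: "integrable Rplus ?F"
    using I by (simp add: integrable_restrict_space set_integrable_def)
  have "integral\<^sup>L Rplus ?F = Gamma b"
    using I lebesgue_integral_eq_integral[OF int] by simp
  then have "(\<integral>\<^sup>+z. ennreal (?F z) \<partial>Rplus) = ennreal (Gamma b)"
    using nn_integral_eq_integral[OF int] by (simp add: f_def)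
  also have "(\<integral>\<^sup>+z. ennreal (?F z) \<partial>Rplus)
      = (\<integral>\<^sup>+z. ennreal (\<bar>r\<bar> * c powr b) * ennreal (z powr (r * b - 1) * exp (- (c * z powr r))) \<partial>Rplus)"
    by (rule nn_integral_cong) (simp add: eq flip: ennreal_mult)
  also have "\<dots> = ennreal (\<bar>r\<bar> * c powr b) * (\<integral>\<^sup>+z. ennreal (z powr (r * b - 1) * exp (- (c * z powr r))) \<partial>Rplus)"
    by (rule nn_integral_cmult) (rule borel_measurable_lebesgue_on_borel, measurable)
  finally have "ennreal (1 / (\<bar>r\<bar> * c powr b)) * (ennreal (\<bar>r\<bar> * c powr b) * (\<integral>\<^sup>+z. ennreal (z powr (r * b - 1) * exp (- (c * z powr r))) \<partial>Rplus))
      = ennreal (1 / (\<bar>r\<bar> * c powr b)) * ennreal (Gamma b)" by simp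
  then show ?thesis
    using c r Gamma_real_pos[OF b] by (simp add: mult.assoc[symmetric] flip: ennreal_mult)
qed

text \<open>Pairs are enumerated by \<open>prod_decode\<close> so that the theorems on series of
  integrable functions apply; absolute summability makes the result independent of the
  enumeration.\<close>

lemma termwise_integral:
  fixes f :: "nat \<times> nat \<Rightarrow> 'a \<Rightarrow> real"
  assumes int: "\<And>i. integrable M (f i)"
    and sums: "(\<lambda>i. \<integral>x. \<bar>f i x\<bar> \<partial>M) summable_on UNIV"
    and F: "\<And>x. x \<in> space M \<Longrightarrow> ((\<lambda>i. f i x) has_sum F x) UNIV"
  shows "integrable M F" "((\<lambda>i. \<integral>x. f i x \<partial>M) has_sum (\<integral>x. F x \<partial>M)) UNIV"
proof -
  let ?g = "\<lambda>n. f (prod_decode n)"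
  have bij: "bij_betw prod_decode UNIV UNIV" by (simp add: bij_prod_decode)
  have s: "summable (\<lambda>n. \<integral>x. \<bar>?g n x\<bar> \<partial>M)"
    using sums summable_on_reindex_bij_betw[OF bij, of "\<lambda>i. \<integral>x. \<bar>f i x\<bar> \<partial>M"]
    by (simp add: summable_on_imp_summable)
  have sF: "(\<lambda>n. ?g n x) sums F x" and sA: "summable (\<lambda>n. \<bar>?g n x\<bar>)" if "x \<in> space M" for x
  proof -
    have *: "((\<lambda>n. ?g n x) has_sum F x) UNIV"
      using F[OF that] has_sum_reindex_bij_betw[OF bij, of "\<lambda>i. f i x"] by simp
    then show "(\<lambda>n. ?g n x) sums F x" by (rule has_sum_imp_sums)
    have "(\<lambda>n. \<bar>?g n x\<bar>) summable_on UNIV"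
      using has_sum_imp_summable[OF *] summable_on_iff_abs_summable_on_real by fastforce
    then show "summable (\<lambda>n. \<bar>?g n x\<bar>)" by (rule summable_on_imp_summable)
  qed
  have int': "integrable M (?g n)" for n using int by (cases "prod_decode n") simp
  have 1: "integrable M (\<lambda>x. \<Sum>n. ?g n x)" and 2: "(\<integral>x. (\<Sum>n. ?g n x) \<partial>M) = (\<Sum>n. \<integral>x. ?g n x \<partial>M)"
    using int' sA s by (auto intro!: integrable_suminf integral_suminf)
  have eq: "(\<Sum>n. ?g n x) = F x" if "x \<in> space M" for x using sF[OF that] by (simp add: sums_iff)
  show "integrable M F" using 1 by (rule Bochner_Integration.integrable_cong[THEN iffD1, rotated 2]) (auto simp: eq)
  have le: "norm (\<integral>x. f i x \<partial>M) \<le> (\<integral>x. \<bar>f i x\<bar> \<partial>M)" for i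
    using integral_norm_bound[of M "f i"] by simp
  have "(\<lambda>i. norm (\<integral>x. f i x \<partial>M)) summable_on UNIV"
    by (rule summable_on_comparison_test[OF sums]) (use le in auto)
  then have *: "((\<lambda>i. \<integral>x. f i x \<partial>M) has_sum (\<Sum>\<^sub>\<infinity>i. \<integral>x. f i x \<partial>M)) UNIV"
    by (rule has_sum_infsum[OF Infinite_Sum.abs_summable_summable])
  then have "((\<lambda>n. \<integral>x. ?g n x \<partial>M) has_sum (\<Sum>\<^sub>\<infinity>i. \<integral>x. f i x \<partial>M)) UNIV"
    using has_sum_reindex_bij_betw[OF bij, of "\<lambda>i. \<integral>x. f i x \<partial>M"] by simp
  then have "(\<Sum>\<^sub>\<infinity>i. \<integral>x. f i x \<partial>M) = (\<Sum>n. \<integral>x. ?g n x \<partial>M)"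
    by (rule sums_unique[OF has_sum_imp_sums])
  also have "\<dots> = (\<integral>x. (\<Sum>n. ?g n x) \<partial>M)" using 2 by simp
  also have "\<dots> = (\<integral>x. F x \<partial>M)" by (rule Bochner_Integration.integral_cong) (auto simp: eq)
  finally show "((\<lambda>i. \<integral>x. f i x \<partial>M) has_sum (\<integral>x. F x \<partial>M)) UNIV" using * by simp
qed

lemma has_bochner_integral_gauss:
  assumes "0 < b" "0 < s"
  shows "has_bochner_integral Rplus (\<lambda>z. z powr (2 * b - 1) * exp (- (s * z\<^sup>2))) (Gamma b / (2 * s powr b))"
proof (rule has_bochner_integral_nn_integral)
  show "(\<lambda>z. z powr (2 * b - 1) * exp (- (s * z\<^sup>2))) \<in> borel_measurable Rplus"
    by (rule borel_measurable_lebesgue_on_borel) measurable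
  have "(\<integral>\<^sup>+z. ennreal (z powr (2 * b - 1) * exp (- (s * z\<^sup>2))) \<partial>Rplus)
    = (\<integral>\<^sup>+z. ennreal (z powr (2 * b - 1) * exp (- (s * z powr 2))) \<partial>Rplus)"
    by (rule nn_integral_cong) simp
  then show "(\<integral>\<^sup>+z. ennreal (z powr (2 * b - 1) * exp (- (s * z\<^sup>2))) \<partial>Rplus) = ennreal (Gamma b / (2 * s powr b))"
    using nn_integral_powr_exp[OF assms, of 2] by simp
  show "0 \<le> Gamma b / (2 * s powr b)"
    using Gamma_real_pos[OF assms(1)] by simp
qed simp

text \<open>Each term of the expanded integrand is a constant times a positive function, so the
  integral of its modulus is the modulus of its integral. Unconditional convergence of the moment
  series to \<open>V\<close> is therefore already the domination that termwise integration requires,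
  for \<open>P\<close> and \<open>Q\<close> of any sign.\<close>

lemma has_bochner_integral_gauss_bes:
  assumes a: "0 < a" "0 < a'" and b: "0 < b" and s: "0 < s"
    and V: "((\<lambda>(j, k). Gamma (b + real (j + k)) * bes_coeff a j * bes_coeff a' k * (P / s) ^ j * (Q / s) ^ k)
      has_sum V) UNIV"
  shows "has_bochner_integral Rplus
    (\<lambda>z. z powr (2 * b - 1) * exp (- (s * z\<^sup>2)) * bes a (P * z\<^sup>2) * bes a' (Q * z\<^sup>2)) (V / (2 * s powr b))"
    (is "has_bochner_integral _ ?F _")
proof -
  define c where "c = (\<lambda>(j, k). bes_coeff a j * bes_coeff a' k * P ^ j * Q ^ k)"
  define f where "f = (\<lambda>(j, k) z. c (j, k) * (z powr (2 * (b + real (j + k)) - 1) * exp (- (s * z\<^sup>2))))"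
  have hb: "has_bochner_integral Rplus (\<lambda>z. z powr (2 * (b + real (j + k)) - 1) * exp (- (s * z\<^sup>2)))
      (Gamma (b + real (j + k)) / (2 * s powr (b + real (j + k))))" for j k
    using b s by (intro has_bochner_integral_gauss) auto
  have fhb: "has_bochner_integral Rplus (f (j, k))
      (c (j, k) * (Gamma (b + real (j + k)) / (2 * s powr (b + real (j + k)))))" for j k
    unfolding f_def using has_bochner_integral_mult_right[OF hb] by simp
  have Gpos: "Gamma (b + real n) > 0" for n
    using b by (intro Gamma_real_pos) simp
  have fabs: "(\<integral>z. \<bar>f (j, k) z\<bar> \<partial>Rplus) = \<bar>\<integral>z. f (j, k) z \<partial>Rplus\<bar>" for j k
  proof -
    have "(\<integral>z. \<bar>f (j, k) z\<bar> \<partial>Rplus) = \<bar>c (j, k)\<bar> * (\<integral>z. z powr (2 * (b + real (j + k)) - 1) * exp (- (s * z\<^sup>2)) \<partial>Rplus)"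
      by (simp add: f_def abs_mult)
    also have "\<dots> = \<bar>\<integral>z. f (j, k) z \<partial>Rplus\<bar>"
      unfolding has_bochner_integral_integral_eq[OF hb] has_bochner_integral_integral_eq[OF fhb]
      using Gpos[of "j + k"] by (simp add: abs_mult)
    finally show ?thesis .
  qed
  have fint: "(\<integral>z. f (j, k) z \<partial>Rplus)
      = (Gamma (b + real (j + k)) * bes_coeff a j * bes_coeff a' k * (P / s) ^ j * (Q / s) ^ k) / (2 * s powr b)" for j k
    using s by (simp add: has_bochner_integral_integral_eq[OF fhb] c_def powr_add powr_realpow power_add power_divide)
      (simp add: field_simps)
  have hs: "((\<lambda>i. \<integral>z. f i z \<partial>Rplus) has_sum V / (2 * s powr b)) UNIV"
  proof -
    have "(\<lambda>i. \<integral>z. f i z \<partial>Rplus) = (\<lambda>i. (case i of (j, k) \<Rightarrow>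
        Gamma (b + real (j + k)) * bes_coeff a j * bes_coeff a' k * (P / s) ^ j * (Q / s) ^ k) * (1 / (2 * s powr b)))"
      by (auto simp: fun_eq_iff fint)
    then show ?thesis
      using has_sum_cmult_left[OF V, of "1 / (2 * s powr b)"] by simp
  qed
  have F: "((\<lambda>i. f i z) has_sum ?F z) UNIV" if "z \<in> space Rplus" for z
  proof -
    have z: "0 < z" using that by simp
    have "((\<lambda>i. z powr (2 * b - 1) * exp (- (s * z\<^sup>2)) * (case i of (j, k) \<Rightarrow>
          bes_coeff a j * (P * z\<^sup>2) ^ j * (bes_coeff a' k * (Q * z\<^sup>2) ^ k)))
        has_sum z powr (2 * b - 1) * exp (- (s * z\<^sup>2)) * (bes a (P * z\<^sup>2) * bes a' (Q * z\<^sup>2))) UNIV"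
      using has_sum_mult[OF bes_has_sum[OF a(1)] bes_has_sum[OF a(2)]]
      by (intro has_sum_cmult_right) simp
    moreover have "z powr (2 * b - 1) * exp (- (s * z\<^sup>2)) * (bes_coeff a j * (P * z\<^sup>2) ^ j * (bes_coeff a' k * (Q * z\<^sup>2) ^ k))
        = f (j, k) z" for j k
    proof -
      have "z powr (2 * (b + real (j + k)) - 1) = z powr (2 * b - 1 + real (2 * j) + real (2 * k))"
        by (simp add: algebra_simps)
      also have "\<dots> = z powr (2 * b - 1) * (z\<^sup>2) ^ j * (z\<^sup>2) ^ k"
        using z by (simp only: powr_add powr_realpow power_mult)
      finally show ?thesis by (simp add: f_def c_def power_mult_distrib)
    qed
    then have "(\<lambda>i. f i z) = (\<lambda>i. z powr (2 * b - 1) * exp (- (s * z\<^sup>2)) * (case i of (j, k) \<Rightarrow>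
          bes_coeff a j * (P * z\<^sup>2) ^ j * (bes_coeff a' k * (Q * z\<^sup>2) ^ k)))"
      by (auto simp: fun_eq_iff)
    ultimately show ?thesis by (simp add: mult.assoc)
  qed
  have integ: "integrable Rplus (f i)" for i
    using fhb by (cases i) (auto simp: has_bochner_integral_iff)
  have summ: "(\<lambda>i. \<integral>z. \<bar>f i z\<bar> \<partial>Rplus) summable_on UNIV"
  proof -
    have "(\<lambda>i. \<bar>\<integral>z. f i z \<partial>Rplus\<bar>) summable_on UNIV"
      using has_sum_imp_summable[OF hs] summable_on_iff_abs_summable_on_real by fastforce
    moreover have "(\<lambda>i. \<bar>\<integral>z. f i z \<partial>Rplus\<bar>) = (\<lambda>i. \<integral>z. \<bar>f i z\<bar> \<partial>Rplus)"
      using fabs by (auto simp: fun_eq_iff)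
    ultimately show ?thesis by simp
  qed
  show ?thesis
    using termwise_integral[OF integ summ F] has_sum_unique[OF hs]
    by (simp add: has_bochner_integral_iff)
qed

lemma has_bochner_integral_weber:
  assumes a: "0 < a" and s: "0 < s"
  shows "has_bochner_integral Rplus
    (\<lambda>z. z powr (2 * a - 1) * exp (- (s * z\<^sup>2)) * bes a (P * z\<^sup>2) * bes a (Q * z\<^sup>2))
    (exp ((P + Q) / s) * bes a (P * Q / s\<^sup>2) / (2 * s powr a))"
  using has_bochner_integral_gauss_bes[OF a a a s, of P Q] weber_has_sum[OF a, of "P / s" "Q / s"]
  by (simp add: weber_coeff_def power2_eq_square add_divide_distrib)

lemma has_bochner_integral_weber':
  assumes a: "0 < a" and s: "0 < s"
  shows "has_bochner_integral Rplus
    (\<lambda>z. z powr (2 * a + 1) * exp (- (s * z\<^sup>2)) * bes a (P * z\<^sup>2) * bes (a + 1) (Q * z\<^sup>2))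
    (exp ((P + Q) / s) * (bes a (P * Q / s\<^sup>2) + P / s * bes (a + 1) (P * Q / s\<^sup>2)) / (2 * s powr (a + 1)))"
proof -
  have eq: "2 * (a + 1) - 1 = 2 * a + 1" "P / s * (Q / s) = P * Q / s\<^sup>2" "P / s + Q / s = (P + Q) / s"
    by (simp_all add: power2_eq_square add_divide_distrib)
  show ?thesis
    using has_bochner_integral_gauss_bes[OF a _ _ s weber'_has_sum[OF a, of "P / s" "Q / s", unfolded weber_coeff'_def]] a
    unfolding eq by simp
qed

lemma bes_0: "bes a 0 = rGamma a"
  unfolding bes_def powser_zero by (simp add: bes_coeff_def)

text \<open>Weber's formula with \<open>Q = 0\<close>, divided by
  \<open>bes a 0 = rGamma a\<close>.\<close>

lemma has_bochner_integral_gauss_bes1: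
  assumes a: "0 < a" and s: "0 < s"
  shows "has_bochner_integral Rplus (\<lambda>z. z powr (2 * a - 1) * exp (- (s * z\<^sup>2)) * bes a (P * z\<^sup>2))
    (exp (P / s) / (2 * s powr a))"
  using has_bochner_integral_mult_left[OF has_bochner_integral_weber[OF a s, of P 0], of "1 / rGamma a"] rGamma_pos[OF a]
  by (simp add: bes_0)

section \<open>The Hankel transforms\<close>

lemma dominated_Fubini:
  fixes K :: "'a \<Rightarrow> 'b \<Rightarrow> real"
  assumes "sigma_finite_measure M" "sigma_finite_measure N"
    and K: "(\<lambda>(x, y). K x y) \<in> borel_measurable (M \<Otimes>\<^sub>M N)"
    and G: "integrable M G" and H: "integrable N H"
    and le: "\<And>x y. x \<in> space M \<Longrightarrow> y \<in> space N \<Longrightarrow> \<bar>K x y\<bar> \<le> G x * H y"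
  shows "(\<integral>x. (\<integral>y. K x y \<partial>N) \<partial>M) = (\<integral>y. (\<integral>x. K x y \<partial>M) \<partial>N)"
    and "integrable M (\<lambda>x. \<integral>y. K x y \<partial>N)"
    and "integrable N (\<lambda>y. \<integral>x. K x y \<partial>M)"
    and "\<And>x. x \<in> space M \<Longrightarrow> integrable N (\<lambda>y. K x y)"
proof -
  interpret pair_sigma_finite M N using assms(1,2) by (simp add: pair_sigma_finite_def)
  have Kx: "(\<lambda>y. K x y) \<in> borel_measurable N" if "x \<in> space M" for x
    using measurable_compose[OF measurable_Pair1'[OF that] K] by simp
  show Ki: "integrable N (\<lambda>y. K x y)" if "x \<in> space M" for x
    by (rule Bochner_Integration.integrable_bound[OF integrable_mult_right[OF H, of "G x"] Kx[OF that]])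
       (rule AE_I2, use le[OF that] in \<open>force intro: order_trans[OF _ abs_ge_self]\<close>)
  have int: "integrable (M \<Otimes>\<^sub>M N) (\<lambda>(x, y). K x y)"
  proof (rule Fubini_integrable)
    show "integrable M (\<lambda>x. \<integral>y. norm (case (x, y) of (x, y) \<Rightarrow> K x y) \<partial>N)"
    proof (rule Bochner_Integration.integrable_bound[OF integrable_mult_left[OF G, of "\<integral>y. H y \<partial>N"]])
      show "(\<lambda>x. \<integral>y. norm (case (x, y) of (x, y) \<Rightarrow> K x y) \<partial>N) \<in> borel_measurable M"
        using K by (intro M2.borel_measurable_lebesgue_integral) (simp add: case_prod_unfold)
      show "AE x in M. norm (\<integral>y. norm (case (x, y) of (x, y) \<Rightarrow> K x y) \<partial>N) \<le> norm (G x * (\<integral>y. H y \<partial>N))"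
      proof (rule AE_I2)
        fix x assume x: "x \<in> space M"
        have "(\<integral>y. \<bar>K x y\<bar> \<partial>N) \<le> (\<integral>y. G x * H y \<partial>N)"
          using Ki[OF x] H le[OF x] by (intro integral_mono) auto
        then show "norm (\<integral>y. norm (case (x, y) of (x, y) \<Rightarrow> K x y) \<partial>N) \<le> norm (G x * (\<integral>y. H y \<partial>N))"
          by (simp add: integral_nonneg_AE)
      qed
    qed
    show "AE x in M. integrable N (\<lambda>y. case (x, y) of (x, y) \<Rightarrow> K x y)"
      using Ki by (intro AE_I2) simp
  qed (rule K)
  show "(\<integral>x. (\<integral>y. K x y \<partial>N) \<partial>M) = (\<integral>y. (\<integral>x. K x y \<partial>M) \<partial>N)"
    by (rule Fubini_integral[OF int, symmetric])
  show "integrable M (\<lambda>x. \<integral>y. K x y \<partial>N)"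
    using integrable_fst'[OF int] by simp
  show "integrable N (\<lambda>y. \<integral>x. K x y \<partial>M)"
    using integrable_snd[OF int] by simp
qed

text \<open>Tailored to the pairing of two integral transforms under a Gaussian weight
  \<open>w\<close>. The kernels grow in \<open>z\<close> at a rate given by the supports of
  \<open>f\<close> and \<open>g\<close>, so the bounds \<open>B1\<close> and \<open>B2\<close> are
  required only where \<open>f\<close> and \<open>g\<close> do not vanish.\<close>

lemma triple_Fubini:
  fixes f g :: "'b \<Rightarrow> real" and k1 k2 :: "'a \<Rightarrow> 'b \<Rightarrow> real" and w B1 B2 :: "'a \<Rightarrow> real"
  assumes M: "sigma_finite_measure M" and N: "sigma_finite_measure N"
    and f: "integrable N f" and g: "integrable N g"
    and k1: "(\<lambda>(z, x). k1 z x) \<in> borel_measurable (M \<Otimes>\<^sub>M N)"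
    and k2: "(\<lambda>(z, x). k2 z x) \<in> borel_measurable (M \<Otimes>\<^sub>M N)"
    and w: "w \<in> borel_measurable M" "\<And>z. z \<in> space M \<Longrightarrow> 0 \<le> w z"
    and B1: "\<And>z x. z \<in> space M \<Longrightarrow> x \<in> space N \<Longrightarrow> f x \<noteq> 0 \<Longrightarrow> \<bar>k1 z x\<bar> \<le> B1 z"
    and B2: "\<And>z y. z \<in> space M \<Longrightarrow> y \<in> space N \<Longrightarrow> g y \<noteq> 0 \<Longrightarrow> \<bar>k2 z y\<bar> \<le> B2 z"
    and B: "integrable M (\<lambda>z. w z * B1 z * B2 z)" "\<And>z. z \<in> space M \<Longrightarrow> 0 \<le> B1 z" "\<And>z. z \<in> space M \<Longrightarrow> 0 \<le> B2 z"
  shows "(\<integral>z. w z * (\<integral>x. f x * k1 z x \<partial>N) * (\<integral>y. g y * k2 z y \<partial>N) \<partial>M)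
    = (\<integral>x. f x * (\<integral>y. g y * (\<integral>z. w z * k1 z x * k2 z y \<partial>M) \<partial>N) \<partial>N)" (is ?eq)
    and "integrable M (\<lambda>z. w z * (\<integral>x. f x * k1 z x \<partial>N) * (\<integral>y. g y * k2 z y \<partial>N))" (is ?int)
proof -
  interpret M: sigma_finite_measure M by fact
  interpret N: sigma_finite_measure N by fact
  note [measurable] = k1 k2 w(1) borel_measurable_integrable[OF f] borel_measurable_integrable[OF g]
  have k1': "\<bar>f x * k1 z x\<bar> \<le> \<bar>f x\<bar> * B1 z" if "z \<in> space M" "x \<in> space N" for z x
    using B1[OF that] by (cases "f x = 0") (auto simp: abs_mult intro: mult_left_mono)
  have k2': "\<bar>g x * k2 z x\<bar> \<le> \<bar>g x\<bar> * B2 z" if "z \<in> space M" "x \<in> space N" for z x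
    using B2[OF that] by (cases "g x = 0") (auto simp: abs_mult intro: mult_left_mono)
  define C where "C = (\<integral>y. \<bar>g y\<bar> \<partial>N)"
  have C0: "0 \<le> C" unfolding C_def by (rule integral_nonneg_AE) simp
  have Ag: "\<bar>\<integral>y. g y * k2 z y \<partial>N\<bar> \<le> C * B2 z" if z: "z \<in> space M" for z
  proof -
    have [measurable]: "(\<lambda>y. k2 z y) \<in> borel_measurable N"
      using measurable_compose[OF measurable_Pair1'[OF z] k2] by simp
    have int: "integrable N (\<lambda>y. g y * k2 z y)"
      by (rule Bochner_Integration.integrable_bound[OF integrable_mult_left[OF integrable_abs[OF g], of "B2 z"]])
         (measurable, rule AE_I2, use k2'[OF z] in \<open>force intro: order_trans[OF _ abs_ge_self]\<close>)
    have "\<bar>\<integral>y. g y * k2 z y \<partial>N\<bar> \<le> (\<integral>y. \<bar>g y * k2 z y\<bar> \<partial>N)"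
      by (rule integral_abs_bound)
    also have "\<dots> \<le> (\<integral>y. \<bar>g y\<bar> * B2 z \<partial>N)"
      using int g k2'[OF z] by (intro integral_mono) auto
    finally have "\<bar>\<integral>y. g y * k2 z y \<partial>N\<bar> \<le> (\<integral>y. \<bar>g y\<bar> * B2 z \<partial>N)" .
    then show ?thesis by (simp add: C_def)
  qed
  have 1: "(\<lambda>(z, x). w z * (f x * k1 z x) * (\<integral>y. g y * k2 z y \<partial>N)) \<in> borel_measurable (M \<Otimes>\<^sub>M N)"
    by measurable
  have le1: "\<bar>w z * (f x * k1 z x) * (\<integral>y. g y * k2 z y \<partial>N)\<bar> \<le> (w z * B1 z * B2 z * C) * \<bar>f x\<bar>"
    if "z \<in> space M" "x \<in> space N" for z x
  proof -
    have "\<bar>w z * (f x * k1 z x) * (\<integral>y. g y * k2 z y \<partial>N)\<bar> = w z * (\<bar>f x * k1 z x\<bar> * \<bar>\<integral>y. g y * k2 z y \<partial>N\<bar>)"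
      using w(2)[OF that(1)] by (simp add: abs_mult)
    also have "\<dots> \<le> w z * ((\<bar>f x\<bar> * B1 z) * (C * B2 z))"
      using k1'[OF that] Ag[OF that(1)] w(2)[OF that(1)] B(2)[OF that(1)] by (intro mult_left_mono mult_mono) auto
    finally show ?thesis by (simp add: mult_ac)
  qed
  note F1 = dominated_Fubini[OF M N 1 integrable_mult_left[OF B(1)] integrable_abs[OF f] le1]
  have 2: "(\<lambda>(z, y). w z * k1 z x * (g y * k2 z y)) \<in> borel_measurable (M \<Otimes>\<^sub>M N)" if [measurable]: "x \<in> space N" for x
    by measurable
  have le2: "\<bar>w z * k1 z x * (g y * k2 z y)\<bar> \<le> (w z * B1 z * B2 z) * \<bar>g y\<bar>"
    if x: "x \<in> space N" "f x \<noteq> 0" and zy: "z \<in> space M" "y \<in> space N" for x z y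
  proof -
    have "\<bar>w z * k1 z x * (g y * k2 z y)\<bar> = w z * (\<bar>k1 z x\<bar> * \<bar>g y * k2 z y\<bar>)"
      using w(2)[OF zy(1)] by (simp add: abs_mult)
    also have "\<dots> \<le> w z * (B1 z * (\<bar>g y\<bar> * B2 z))"
      using k2'[OF zy] B1[OF zy(1) x] w(2)[OF zy(1)] B(2)[OF zy(1)] by (intro mult_left_mono mult_mono) auto
    finally show ?thesis by (simp add: mult_ac)
  qed
  \<comment> \<open>\<open>B1\<close> controls \<open>k1\<close> only at points \<open>x\<close>
    with \<open>f x \<noteq> 0\<close>, hence the case distinction before the exchange of
    \<open>z\<close> and \<open>y\<close>.\<close>
  have inner: "(\<integral>z. w z * (f x * k1 z x) * (\<integral>y. g y * k2 z y \<partial>N) \<partial>M)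
      = f x * (\<integral>y. g y * (\<integral>z. w z * k1 z x * k2 z y \<partial>M) \<partial>N)" if x: "x \<in> space N" for x
  proof (cases "f x = 0")
    case False
    have "(\<integral>z. w z * (f x * k1 z x) * (\<integral>y. g y * k2 z y \<partial>N) \<partial>M)
        = (\<integral>z. f x * (w z * k1 z x * (\<integral>y. g y * k2 z y \<partial>N)) \<partial>M)"
      by (simp add: mult_ac)
    also have "\<dots> = f x * (\<integral>z. (\<integral>y. w z * k1 z x * (g y * k2 z y) \<partial>N) \<partial>M)"
      by simp
    also have "(\<integral>z. (\<integral>y. w z * k1 z x * (g y * k2 z y) \<partial>N) \<partial>M) = (\<integral>y. (\<integral>z. w z * k1 z x * (g y * k2 z y) \<partial>M) \<partial>N)"
      by (rule dominated_Fubini(1)[OF M N 2[OF x] B(1) integrable_abs[OF g] le2[OF x False]])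
    also have "\<dots> = (\<integral>y. g y * (\<integral>z. w z * k1 z x * k2 z y \<partial>M) \<partial>N)"
      by (simp add: mult_ac flip: integral_mult_right_zero)
    finally show ?thesis .
  qed simp
  have lhs: "(\<integral>x. w z * (f x * k1 z x) * (\<integral>y. g y * k2 z y \<partial>N) \<partial>N)
      = w z * (\<integral>x. f x * k1 z x \<partial>N) * (\<integral>y. g y * k2 z y \<partial>N)" for z
    by simp
  show ?int using F1(2) unfolding lhs .
  have "(\<integral>z. w z * (\<integral>x. f x * k1 z x \<partial>N) * (\<integral>y. g y * k2 z y \<partial>N) \<partial>M)
      = (\<integral>x. (\<integral>z. w z * (f x * k1 z x) * (\<integral>y. g y * k2 z y \<partial>N) \<partial>M) \<partial>N)"
    using F1(1) unfolding lhs .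
  also have "\<dots> = (\<integral>x. f x * (\<integral>y. g y * (\<integral>z. w z * k1 z x * k2 z y \<partial>M) \<partial>N) \<partial>N)"
    by (rule Bochner_Integration.integral_cong) (simp_all add: inner)
  finally show ?eq .
qed

section \<open>The measure with density \<open>x^(2\<lambda>)\<close> and its test functions\<close>

lemma space_bessel_measure [simp]: "space (bessel_measure l) = {0<..}"
  by (simp add: bessel_measure_def)

lemma sets_bessel_measure: "sets (bessel_measure l) = sets Rplus"
  by (simp add: bessel_measure_def)

lemma measurable_bessel_measure: "measurable (bessel_measure l) N = measurable Rplus N"
  by (rule measurable_cong_sets) (simp_all add: bessel_measure_def)

lemma borel_measurable_bessel_measure:
  "f \<in> borel_measurable borel \<Longrightarrow> f \<in> borel_measurable (bessel_measure l)"
  by (simp add: measurable_bessel_measure borel_measurable_lebesgue_on_borel)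

lemma powr_measurable_Rplus: "(\<lambda>x. x powr r) \<in> borel_measurable Rplus"
  by (rule borel_measurable_lebesgue_on_borel) measurable

lemma sigma_finite_Rplus: "sigma_finite_measure Rplus"
proof (rule sigma_finite_measure_restrict_space)
  have "\<exists>n. x \<in> {- real n..real n}" for x
    using real_arch_simple[of "\<bar>x\<bar>"] by (force simp: abs_le_iff)
  then have "(\<Union>n. {- real n..real n}) = UNIV" by blast
  then show "sigma_finite_measure (lebesgue :: real measure)"
    by unfold_locales (rule exI[of _ "range (\<lambda>n. {- real n..real n})"], auto)
qed simp

lemma sigma_finite_bessel_measure: "sigma_finite_measure (bessel_measure l)"
proof -
  interpret sigma_finite_measure Rplus by (rule sigma_finite_Rplus)
  show ?thesis unfolding bessel_measure_def
    using powr_measurable_Rplus[of "2 * l"] by (simp add: sigma_finite_iff_density_finite)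
qed

text \<open>Passing from \<lambda> to \<open>\<lambda> + 1\<close> multiplies the density by
  \<open>x^2\<close>; the conjugate transform is studied on the second of these measures.\<close>

lemma bessel_measure_add:
  "bessel_measure (l + r) = density (bessel_measure l) (\<lambda>x. ennreal (x powr (2 * r)))"
proof -
  have "(\<lambda>x. ennreal (x powr (2 * l)) * ennreal (x powr (2 * r))) = (\<lambda>x. ennreal (x powr (2 * (l + r))))"
    by (simp add: distrib_left powr_add ennreal_mult)
  then show ?thesis
    using powr_measurable_Rplus by (simp add: bessel_measure_def density_density_eq)
qed

lemma has_bochner_integral_bessel_measure:
  fixes g :: "real \<Rightarrow> real"
  assumes "g \<in> borel_measurable Rplus" "has_bochner_integral Rplus (\<lambda>x. x powr (2 * l) * g x) v"
  shows "has_bochner_integral (bessel_measure l) g v"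
  unfolding bessel_measure_def using assms powr_measurable_Rplus
  by (intro has_bochner_integral_density) auto

text \<open>The density is positive on the half line, so both measures have the same null
  sets.\<close>

lemma AE_bessel_measure: "(AE x in bessel_measure l. P x) \<longleftrightarrow> (AE x in Rplus. P x)"
  unfolding bessel_measure_def
  by (subst AE_density) (auto simp: powr_measurable_Rplus intro!: AE_cong)

text \<open>Normalised to \<open>p < q\<close> and \<open>0 < M\<close>, which the bounds occurring
  in the definition do not guarantee by themselves.\<close>

lemma test_functionsE:
  assumes "f \<in> test_functions"
  obtains p q M where "0 < p" "p < q" "0 < M" "\<And>x. 0 < x \<Longrightarrow> f x \<noteq> 0 \<Longrightarrow> p \<le> x \<and> x \<le> q"
    "\<And>x. 0 < x \<Longrightarrow> \<bar>f x\<bar> \<le> M" "f \<in> borel_measurable Rplus"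
proof -
  from assms obtain M p q where *: "f \<in> borel_measurable Rplus" "\<And>x. 0 < x \<Longrightarrow> \<bar>f x\<bar> \<le> M"
    "0 < p" "\<And>x. 0 < x \<Longrightarrow> x \<notin> {p..q} \<Longrightarrow> f x = 0"
    unfolding test_functions_def by auto
  show ?thesis
  proof (rule that[of p "max q (p + 1)" "max M 1"])
    fix x :: real assume "0 < x" "f x \<noteq> 0"
    then show "p \<le> x \<and> x \<le> max q (p + 1)" using *(4)[of x] by (auto simp: le_max_iff_disj)
  next
    fix x :: real assume "0 < x"
    then show "\<bar>f x\<bar> \<le> max M 1" using *(2)[of x] by (simp add: le_max_iff_disj)
  qed (use * in auto)
qed

lemma test_functionsI:
  assumes "f \<in> borel_measurable Rplus" "\<And>x. 0 < x \<Longrightarrow> \<bar>f x\<bar> \<le> M" "0 < p"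
    "\<And>x. 0 < x \<Longrightarrow> f x \<noteq> 0 \<Longrightarrow> p \<le> x \<and> x \<le> q"
  shows "f \<in> test_functions"
proof -
  have "\<forall>x>0. \<bar>f x\<bar> \<le> M" "\<forall>x>0. x \<notin> {p..q} \<longrightarrow> f x = 0" using assms by auto
  then show ?thesis using assms(1,3) unfolding test_functions_def by blast
qed

lemma emeasure_bessel_measure_Icc: "emeasure (bessel_measure l) {p..q} < \<infinity>" if p: "0 < p"
proof -
  have "emeasure (bessel_measure l) {p..q} = (\<integral>\<^sup>+x. ennreal (x powr (2 * l)) * indicator {p..q} x \<partial>Rplus)"
    unfolding bessel_measure_def using powr_measurable_Rplus p
    by (subst emeasure_density) (auto simp: sets_restrict_space intro!: image_eqI[of _ _ "{p..q}"])
  also have "\<dots> \<le> (\<integral>\<^sup>+x. ennreal (p powr (2 * l) + q powr (2 * l)) * indicator {p..q} x \<partial>Rplus)"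
  proof (rule nn_integral_mono)
    fix x
    \<comment> \<open>The sum of the two endpoint values dominates whichever way the power is
      monotone.\<close>
    have "x powr (2 * l) \<le> p powr (2 * l) + q powr (2 * l)" if "p \<le> x" "x \<le> q"
    proof (cases "0 \<le> l")
      case True
      then have "x powr (2 * l) \<le> q powr (2 * l)" using that p by (intro powr_mono2) auto
      then show ?thesis by (simp add: add_increasing)
    next
      case False
      then have "x powr (2 * l) \<le> p powr (2 * l)" using that p by (intro powr_mono2') auto
      then show ?thesis by (simp add: add_increasing2)
    qed
    then show "ennreal (x powr (2 * l)) * indicator {p..q} x \<le> ennreal (p powr (2 * l) + q powr (2 * l)) * indicator {p..q} x"
      by (auto simp: indicator_def intro: ennreal_leI simp del: ennreal_plus)
  qed
  also have "\<dots> = ennreal (p powr (2 * l) + q powr (2 * l)) * emeasure Rplus {p..q}"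
    using p by (subst nn_integral_cmult_indicator) (auto simp: sets_restrict_space intro!: image_eqI[of _ _ "{p..q}"])
  also have "emeasure Rplus {p..q} = emeasure lebesgue {p..q}"
    using p by (intro emeasure_restrict_space) auto
  also have "ennreal (p powr (2 * l) + q powr (2 * l)) * emeasure lebesgue {p..q} < \<infinity>"
    by (cases "p \<le> q") (auto simp: ennreal_mult_less_top simp flip: ennreal_plus simp del: ennreal_plus)
  finally show ?thesis .
qed

lemma test_integrable:
  assumes "f \<in> test_functions"
  shows "integrable (bessel_measure l) f"
proof -
  obtain p q M where f: "0 < p" "p < q" "0 < M" "\<And>x. 0 < x \<Longrightarrow> f x \<noteq> 0 \<Longrightarrow> p \<le> x \<and> x \<le> q"
    "\<And>x. 0 < x \<Longrightarrow> \<bar>f x\<bar> \<le> M" "f \<in> borel_measurable Rplus"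
    using test_functionsE[OF assms] by blast
  have "integrable (bessel_measure l) (\<lambda>x. M * indicator {p..q} x)"
    using emeasure_bessel_measure_Icc[OF f(1)] f(1)
    by (intro integrable_mult_right integrable_real_indicator)
       (auto simp: sets_bessel_measure sets_restrict_space intro!: image_eqI[of _ _ "{p..q}"])
  then show ?thesis
  proof (rule Bochner_Integration.integrable_bound)
    show "f \<in> borel_measurable (bessel_measure l)" using f(6) by (simp add: measurable_bessel_measure)
    show "AE x in bessel_measure l. norm (f x) \<le> norm (M * indicator {p..q} x)"
    proof (rule AE_I2)
      fix x assume "x \<in> space (bessel_measure l)"
      then have x: "0 < x" by simp
      show "norm (f x) \<le> norm (M * indicator {p..q} x)"
        using f(3) f(4)[OF x] f(5)[OF x] by (cases "f x = 0") (auto simp: indicator_def)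
    qed
  qed
qed

lemma test_diff: "(\<lambda>x. f x - g x) \<in> test_functions" if ft: "f \<in> test_functions" and gt: "g \<in> test_functions"
proof -
  obtain p q M where f: "0 < p" "p < q" "0 < M" "\<And>x. 0 < x \<Longrightarrow> f x \<noteq> 0 \<Longrightarrow> p \<le> x \<and> x \<le> q"
    "\<And>x. 0 < x \<Longrightarrow> \<bar>f x\<bar> \<le> M" "f \<in> borel_measurable Rplus"
    using test_functionsE[OF ft] by blast
  obtain p' q' M' where g: "0 < p'" "p' < q'" "0 < M'" "\<And>x. 0 < x \<Longrightarrow> g x \<noteq> 0 \<Longrightarrow> p' \<le> x \<and> x \<le> q'"
    "\<And>x. 0 < x \<Longrightarrow> \<bar>g x\<bar> \<le> M'" "g \<in> borel_measurable Rplus"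
    using test_functionsE[OF gt] by blast
  show ?thesis
  proof (rule test_functionsI[of _ "M + M'" "min p p'" "max q q'"])
    fix x :: real assume x: "0 < x"
    show "\<bar>f x - g x\<bar> \<le> M + M'" using f(5)[OF x] g(5)[OF x] by linarith
    assume "f x - g x \<noteq> 0"
    then have "f x \<noteq> 0 \<or> g x \<noteq> 0" by auto
    then show "min p p' \<le> x \<and> x \<le> max q q'" using f(4)[OF x] g(4)[OF x] by linarith
  qed (use f g in auto)
qed

lemma test_divide: "(\<lambda>x. f x / x) \<in> test_functions" if ft: "f \<in> test_functions"
proof -
  obtain p q M where f: "0 < p" "p < q" "0 < M" "\<And>x. 0 < x \<Longrightarrow> f x \<noteq> 0 \<Longrightarrow> p \<le> x \<and> x \<le> q"
    "\<And>x. 0 < x \<Longrightarrow> \<bar>f x\<bar> \<le> M" "f \<in> borel_measurable Rplus"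
    using test_functionsE[OF ft] by blast
  have "(\<lambda>x. f x / x) \<in> borel_measurable Rplus"
    using f(6) borel_measurable_lebesgue_on_borel[of "\<lambda>x. x"] by (intro borel_measurable_divide) auto
  then show ?thesis
  proof (rule test_functionsI[of _ "M / p" p q])
    fix x :: real assume x: "0 < x"
    show "\<bar>f x / x\<bar> \<le> M / p"
      using f(4)[OF x] f(5)[OF x] f(1,3) x by (cases "f x = 0") (auto intro!: frac_le)
  qed (use f in auto)
qed

text \<open>Up to a constant, \<open>hk a\<close> is the kernel of the Hankel transform of order \<open>a - 1\<close>.\<close>

definition hk :: "real \<Rightarrow> real \<Rightarrow> real \<Rightarrow> real"
  where "hk a z x = bes a (- (z * x / 2)\<^sup>2)"

lemma bes_abs_le: "\<bar>bes a w\<bar> \<le> bes a u" if "0 < a" "\<bar>w\<bar> \<le> u"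
proof -
  have "\<bar>bes a w\<bar> \<le> (\<Sum>k. norm (bes_coeff a k * w ^ k))"
    using summable_norm[OF summable_bes_norm[OF that(1), of w]] by (simp add: bes_def)
  also have "\<dots> \<le> (\<Sum>k. bes_coeff a k * u ^ k)"
  proof (rule suminf_le)
    fix k
    show "norm (bes_coeff a k * w ^ k) \<le> bes_coeff a k * u ^ k"
      using bes_coeff_pos[OF that(1), of k] that(2)
      by (auto simp: abs_mult power_abs intro!: mult_left_mono power_mono)
  qed (use summable_bes_norm[OF that(1)] bes_sums[OF that(1)] in \<open>auto simp: sums_iff\<close>)
  finally show ?thesis by (simp add: bes_def)
qed

text \<open>Replacing the argument by its modulus makes all terms of the series nonnegative. The
  bound is again a \<open>bes\<close>, so Weber's formula itself shows that it is integrable against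
  a Gaussian.\<close>

lemma hk_bound:
  assumes "0 < a" "0 < x" "x \<le> q"
  shows "\<bar>hk a z x\<bar> \<le> bes a ((q / 2)\<^sup>2 * z\<^sup>2)"
  unfolding hk_def
proof (rule bes_abs_le[OF assms(1)])
  have "(z * x / 2)\<^sup>2 = (x / 2)\<^sup>2 * z\<^sup>2" by (simp add: power2_eq_square)
  also have "\<dots> \<le> (q / 2)\<^sup>2 * z\<^sup>2" using assms by (intro mult_right_mono power_mono) auto
  finally show "\<bar>- (z * x / 2)\<^sup>2\<bar> \<le> (q / 2)\<^sup>2 * z\<^sup>2" by simp
qed

section \<open>The Hankel transforms as contractions, by way of the heat kernel\<close>

lemma measurable_pair_bessel:
  assumes "(\<lambda>(z, x). h z x) \<in> borel_measurable (borel \<Otimes>\<^sub>M borel :: (real \<times> real) measure)"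
  shows "(\<lambda>(z, x). h z x) \<in> borel_measurable (bessel_measure l \<Otimes>\<^sub>M bessel_measure r)"
proof -
  have "(\<lambda>p. (fst p, snd p)) \<in> measurable (bessel_measure l \<Otimes>\<^sub>M bessel_measure r) (borel \<Otimes>\<^sub>M borel :: (real \<times> real) measure)"
    by (intro measurable_Pair measurable_compose[OF measurable_fst] measurable_compose[OF measurable_snd]
        borel_measurable_bessel_measure) auto
  from measurable_compose[OF this assms] show ?thesis by (simp add: case_prod_unfold)
qed

lemma hk_measurable: "(\<lambda>(z, x). hk a z x) \<in> borel_measurable (bessel_measure l \<Otimes>\<^sub>M bessel_measure r)"
  by (rule measurable_pair_bessel) (unfold hk_def, measurable)

text \<open>With \<open>a = \<lambda> + 1/2\<close> this is the transform
  \<open>h_\<lambda>\<close>. With \<open>a = \<lambda> + 3/2\<close> it belongs to the measure of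
  parameter \<open>\<lambda> + 1\<close> and yields the conjugate transform after division of the
  input and multiplication of the output by the variable.\<close>

definition hop :: "real \<Rightarrow> (real \<Rightarrow> real) \<Rightarrow> real \<Rightarrow> real"
  where "hop a f z = 2 powr (1 - a) * (\<integral>x. f x * hk a z x \<partial>bessel_measure (a - 1 / 2))"

text \<open>Up to a constant, \<open>wk (\<lambda> + 1 / 2) s\<close> is the heat kernel of the Bessel operator at time \<open>s\<close>, and
  \<open>x wk' (\<lambda> + 1 / 2) s x y\<close> below is \<open>- 2\<close> times the derivative of \<open>wk\<close> in \<open>x\<close>.\<close>

definition wk :: "real \<Rightarrow> real \<Rightarrow> real \<Rightarrow> real \<Rightarrow> real"
  where "wk a s x y = exp (- ((x\<^sup>2 + y\<^sup>2) / (4 * s))) * bes a ((x * y / (4 * s))\<^sup>2) / (2 * s powr a)"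

lemma weber_bessel_measure:
  assumes a: "0 < a" and s: "0 < s"
  shows "has_bochner_integral (bessel_measure (a - 1 / 2)) (\<lambda>z. exp (- (s * z\<^sup>2)) * hk a z x * hk a z y) (wk a s x y)"
proof (rule has_bochner_integral_bessel_measure)
  show "(\<lambda>z. exp (- (s * z\<^sup>2)) * hk a z x * hk a z y) \<in> borel_measurable Rplus"
    by (rule borel_measurable_lebesgue_on_borel) (unfold hk_def, measurable)
  have *: "- (x / 2)\<^sup>2 * z\<^sup>2 = - (z * x / 2)\<^sup>2" for x z :: real
    by (simp add: power2_eq_square)
  have "(- (x / 2)\<^sup>2 + - (y / 2)\<^sup>2) / s = - ((x\<^sup>2 + y\<^sup>2) / (4 * s))"
    "- (x / 2)\<^sup>2 * - (y / 2)\<^sup>2 / s\<^sup>2 = (x * y / (4 * s))\<^sup>2"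
    using s by (simp_all add: power2_eq_square field_simps)
  moreover have "2 * (a - 1 / 2) = 2 * a - 1" by simp
  ultimately show "has_bochner_integral Rplus (\<lambda>z. z powr (2 * (a - 1 / 2)) * (exp (- (s * z\<^sup>2)) * hk a z x * hk a z y)) (wk a s x y)"
    using has_bochner_integral_weber[OF a s, of "- (x / 2)\<^sup>2" "- (y / 2)\<^sup>2"]
    unfolding * hk_def wk_def by (simp only: mult.assoc)
qed

lemma wk_nonneg: "0 \<le> wk a s x y" if "0 < a"
  using that by (simp add: wk_def bes_nonneg)

lemma wk_commute: "wk a s x y = wk a s y x"
  by (simp add: wk_def add.commute mult.commute)

lemma integrable_weber_bound:
  assumes a: "0 < a" and s: "0 < s"
  shows "integrable (bessel_measure (a - 1 / 2)) (\<lambda>z. exp (- (s * z\<^sup>2)) * bes a (c * z\<^sup>2) * bes a (d * z\<^sup>2))"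
proof -
  have "has_bochner_integral (bessel_measure (a - 1 / 2)) (\<lambda>z. exp (- (s * z\<^sup>2)) * bes a (c * z\<^sup>2) * bes a (d * z\<^sup>2))
    (exp ((c + d) / s) * bes a (c * d / s\<^sup>2) / (2 * s powr a))"
  proof (rule has_bochner_integral_bessel_measure)
    show "(\<lambda>z. exp (- (s * z\<^sup>2)) * bes a (c * z\<^sup>2) * bes a (d * z\<^sup>2)) \<in> borel_measurable Rplus"
      by (rule borel_measurable_lebesgue_on_borel) measurable
    have "2 * (a - 1 / 2) = 2 * a - 1" by simp
    then show "has_bochner_integral Rplus (\<lambda>z. z powr (2 * (a - 1 / 2)) * (exp (- (s * z\<^sup>2)) * bes a (c * z\<^sup>2) * bes a (d * z\<^sup>2)))
      (exp ((c + d) / s) * bes a (c * d / s\<^sup>2) / (2 * s powr a))"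
      using has_bochner_integral_weber[OF a s, of c d] by (simp only: mult.assoc)
  qed
  then show ?thesis by (simp add: has_bochner_integral_iff)
qed

text \<open>The heat semigroup preserves constants; this gives the row sums in Schur's test.\<close>

lemma nn_integral_wk:
  assumes a: "0 < a" and s: "0 < s"
  shows "(\<integral>\<^sup>+y. ennreal (wk a s x y) \<partial>bessel_measure (a - 1 / 2)) = ennreal (4 powr (a - 1))"
proof -
  define P where "P = (x / (4 * s))\<^sup>2"
  define s' where "s' = 1 / (4 * s)"
  have s': "0 < s'" using s by (simp add: s'_def)
  have "has_bochner_integral Rplus (\<lambda>y. exp (- (x\<^sup>2 * s')) / (2 * s powr a) * (y powr (2 * a - 1) * exp (- (s' * y\<^sup>2)) * bes a (P * y\<^sup>2)))
    (exp (- (x\<^sup>2 * s')) / (2 * s powr a) * (exp (P / s') / (2 * s' powr a)))"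
    by (rule has_bochner_integral_mult_right) (rule has_bochner_integral_gauss_bes1[OF a s'])
  moreover have "exp (- (x\<^sup>2 * s')) / (2 * s powr a) * (exp (P / s') / (2 * s' powr a)) = 4 powr (a - 1)"
  proof -
    have "P / s' = x\<^sup>2 * s'" using s by (simp add: P_def s'_def power2_eq_square field_simps)
    moreover have "s powr a * s' powr a = (1 / 4) powr a" using s by (simp add: s'_def flip: powr_mult)
    moreover have "(1 / 4) powr a = 1 / 4 powr a" by (simp add: powr_divide)
    moreover have "exp (- (x\<^sup>2 * s')) / (2 * s powr a) * (exp (x\<^sup>2 * s') / (2 * s' powr a))
        = (exp (- (x\<^sup>2 * s')) * exp (x\<^sup>2 * s')) / (4 * (s powr a * s' powr a))"
      by simp
    ultimately show ?thesis by (simp add: powr_diff flip: exp_add)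
  qed
  moreover have "exp (- (x\<^sup>2 * s')) / (2 * s powr a) * (y powr (2 * a - 1) * exp (- (s' * y\<^sup>2)) * bes a (P * y\<^sup>2))
      = y powr (2 * (a - 1 / 2)) * wk a s x y" for y
  proof -
    have "P * y\<^sup>2 = (x * y / (4 * s))\<^sup>2" by (simp add: P_def power2_eq_square)
    moreover have "exp (- (x\<^sup>2 * s')) * exp (- (s' * y\<^sup>2)) = exp (- ((x\<^sup>2 + y\<^sup>2) / (4 * s)))"
      by (simp add: s'_def add_divide_distrib flip: exp_add)
    ultimately show ?thesis unfolding wk_def by (simp add: mult_ac)
  qed
  ultimately have "has_bochner_integral Rplus (\<lambda>y. y powr (2 * (a - 1 / 2)) * wk a s x y) (4 powr (a - 1))"
    by simp
  then have "has_bochner_integral (bessel_measure (a - 1 / 2)) (wk a s x) (4 powr (a - 1))"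
    by (intro has_bochner_integral_bessel_measure borel_measurable_lebesgue_on_borel) (unfold wk_def, measurable)
  then show ?thesis
    using wk_nonneg[OF a] by (simp add: has_bochner_integral_iff nn_integral_eq_integral)
qed

lemma hop_integral_measurable:
  assumes "f \<in> borel_measurable Rplus"
  shows "(\<lambda>z. \<integral>x. f x * hk a z x \<partial>bessel_measure l) \<in> borel_measurable (bessel_measure r)"
proof -
  interpret sigma_finite_measure "bessel_measure l" by (rule sigma_finite_bessel_measure)
  have [measurable]: "f \<in> borel_measurable (bessel_measure l)"
    using assms by (simp add: measurable_bessel_measure)
  note [measurable] = hk_measurable
  show ?thesis by measurable
qed

lemma hop_measurable: "f \<in> borel_measurable Rplus \<Longrightarrow> hop a f \<in> borel_measurable Rplus"
  using borel_measurable_times[OF borel_measurable_const hop_integral_measurable[of f "a - 1 / 2" a "a - 1 / 2"], of "2 powr (1 - a)"]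
  unfolding hop_def measurable_bessel_measure .

lemma ennreal_abs_integral_le:
  fixes f :: "'a \<Rightarrow> real"
  shows "ennreal \<bar>\<integral>x. f x \<partial>M\<bar> \<le> (\<integral>\<^sup>+x. ennreal \<bar>f x\<bar> \<partial>M)"
proof (cases "integrable M f")
  case True
  then show ?thesis using integral_norm_bound_ennreal[OF True] by simp
qed (simp add: not_integrable_integral_eq)

text \<open>The Gaussian makes the triple integral absolutely convergent, and Weber's formula turns
  the damped square norm into the quadratic form of the heat kernel. Schur's test bounds this form
  by the row sums, and these do not depend on \<open>s\<close>.\<close>

lemma hop_weber:
  assumes a: "0 < a" and s: "0 < s" and ft: "f \<in> test_functions"
  shows "(\<integral>\<^sup>+z. ennreal (exp (- (s * z\<^sup>2)) * (\<integral>x. f x * hk a z x \<partial>bessel_measure (a - 1 / 2))\<^sup>2) \<partial>bessel_measure (a - 1 / 2))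
    \<le> ennreal (4 powr (a - 1)) * (\<integral>\<^sup>+x. ennreal ((f x)\<^sup>2) \<partial>bessel_measure (a - 1 / 2))"
proof -
  define m where "m = bessel_measure (a - 1 / 2)"
  interpret pair_sigma_finite m m
    unfolding m_def pair_sigma_finite_def by (simp add: sigma_finite_bessel_measure)
  obtain p q M where f: "0 < p" "p < q" "0 < M" "\<And>x. 0 < x \<Longrightarrow> f x \<noteq> 0 \<Longrightarrow> p \<le> x \<and> x \<le> q"
    "\<And>x. 0 < x \<Longrightarrow> \<bar>f x\<bar> \<le> M" "f \<in> borel_measurable Rplus"
    using test_functionsE[OF ft] by blast
  have fm [measurable]: "f \<in> borel_measurable m" using f(6) by (simp add: m_def measurable_bessel_measure)
  have fi: "integrable m f" unfolding m_def by (rule test_integrable[OF ft])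
  have sp: "space m = {0<..}" by (simp add: m_def)
  define w where "w = (\<lambda>z::real. exp (- (s * z\<^sup>2)))"
  define A where "A = (\<lambda>z. \<integral>x. f x * hk a z x \<partial>m)"
  define B where "B = (\<lambda>z. bes a ((q / 2)\<^sup>2 * z\<^sup>2))"
  have hkm: "(\<lambda>(z, x). hk a z x) \<in> borel_measurable (m \<Otimes>\<^sub>M m)"
    unfolding m_def by (rule hk_measurable)
  have wm: "w \<in> borel_measurable m"
    unfolding m_def w_def by (rule borel_measurable_bessel_measure) measurable
  have B1: "\<bar>hk a z x\<bar> \<le> B z" if "z \<in> space m" "x \<in> space m" "f x \<noteq> 0" for z x
    unfolding B_def using that f(4)[of x] a by (intro hk_bound) (auto simp: sp)
  have B2: "integrable m (\<lambda>z. w z * B z * B z)"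
    unfolding m_def w_def B_def by (rule integrable_weber_bound[OF a s])
  have B3: "0 \<le> B z" for z unfolding B_def by (rule bes_nonneg[OF a]) simp
  have W: "(\<integral>z. w z * hk a z x * hk a z y \<partial>m) = wk a s x y" for x y
    using weber_bessel_measure[OF a s, of x y] unfolding m_def w_def by (simp add: has_bochner_integral_iff)
  have w0: "0 \<le> w z" for z by (simp add: w_def)
  note T = triple_Fubini[OF M1.sigma_finite_measure_axioms M1.sigma_finite_measure_axioms fi fi hkm hkm wm w0 B1 B1 B2 B3 B3]
  have eq: "(\<integral>z. w z * A z * A z \<partial>m) = (\<integral>x. f x * (\<integral>y. f y * wk a s x y \<partial>m) \<partial>m)"
    using T(1) unfolding A_def W .
  have int: "integrable m (\<lambda>z. w z * A z * A z)"
    using T(2) unfolding A_def .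
  have wkm: "(\<lambda>(x, y). wk a s x y) \<in> borel_measurable (m \<Otimes>\<^sub>M m)"
    unfolding m_def by (rule measurable_pair_bessel) (unfold wk_def, measurable)
  note [measurable] = wkm
  have wk1: "(\<integral>\<^sup>+y. ennreal (wk a s x y) \<partial>m) = ennreal (4 powr (a - 1))" for x
    unfolding m_def by (rule nn_integral_wk[OF a s])
  have wkx: "wk a s x \<in> borel_measurable m" for x
    unfolding m_def by (rule borel_measurable_bessel_measure) (unfold wk_def, measurable)
  have w00: "0 \<le> wk a s x y" for x y by (rule wk_nonneg[OF a])
  let ?F = "\<integral>\<^sup>+x. ennreal ((f x)\<^sup>2) \<partial>m"
  let ?D = "ennreal (4 powr (a - 1))"
  have h1: "(\<integral>\<^sup>+x. \<integral>\<^sup>+y. ennreal ((f x)\<^sup>2) * ennreal (wk a s x y) \<partial>m \<partial>m) = ?D * ?F"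
  proof -
    have "(\<integral>\<^sup>+x. \<integral>\<^sup>+y. ennreal ((f x)\<^sup>2) * ennreal (wk a s x y) \<partial>m \<partial>m) = (\<integral>\<^sup>+x. ennreal ((f x)\<^sup>2) * ?D \<partial>m)"
      using wkx by (intro nn_integral_cong) (simp add: nn_integral_cmult wk1)
    then show ?thesis by (simp add: nn_integral_multc mult.commute)
  qed
  \<comment> \<open>Column sums equal row sums: the heat kernel is symmetric, and Tonelli exchanges
    the order.\<close>
  have h2: "(\<integral>\<^sup>+x. \<integral>\<^sup>+y. ennreal ((f y)\<^sup>2) * ennreal (wk a s x y) \<partial>m \<partial>m) = ?D * ?F"
  proof -
    have "(\<integral>\<^sup>+x. \<integral>\<^sup>+y. ennreal ((f y)\<^sup>2) * ennreal (wk a s x y) \<partial>m \<partial>m)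
        = (\<integral>\<^sup>+y. \<integral>\<^sup>+x. ennreal ((f y)\<^sup>2) * ennreal (wk a s x y) \<partial>m \<partial>m)"
      by (rule Fubini'[symmetric]) measurable
    then show ?thesis using h1 by (simp add: wk_commute)
  qed
  have "ennreal (\<integral>z. w z * A z * A z \<partial>m) \<le> (\<integral>\<^sup>+x. ennreal \<bar>f x * (\<integral>y. f y * wk a s x y \<partial>m)\<bar> \<partial>m)"
    unfolding eq by (rule order_trans[OF ennreal_leI[OF abs_ge_self] ennreal_abs_integral_le])
  also have "\<dots> \<le> (\<integral>\<^sup>+x. \<integral>\<^sup>+y. ennreal (\<bar>f x\<bar> * \<bar>f y * wk a s x y\<bar>) \<partial>m \<partial>m)"
  proof (rule nn_integral_mono)
    fix x
    have "ennreal \<bar>f x * (\<integral>y. f y * wk a s x y \<partial>m)\<bar> = ennreal \<bar>f x\<bar> * ennreal \<bar>\<integral>y. f y * wk a s x y \<partial>m\<bar>"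
      by (simp add: abs_mult ennreal_mult)
    also have "\<dots> \<le> ennreal \<bar>f x\<bar> * (\<integral>\<^sup>+y. ennreal \<bar>f y * wk a s x y\<bar> \<partial>m)"
      by (intro mult_left_mono ennreal_abs_integral_le) simp
    also have "\<dots> = (\<integral>\<^sup>+y. ennreal (\<bar>f x\<bar> * \<bar>f y * wk a s x y\<bar>) \<partial>m)"
      using wkx fm by (subst nn_integral_cmult[symmetric]) (auto simp: ennreal_mult)
    finally show "ennreal \<bar>f x * (\<integral>y. f y * wk a s x y \<partial>m)\<bar> \<le> (\<integral>\<^sup>+y. ennreal (\<bar>f x\<bar> * \<bar>f y * wk a s x y\<bar>) \<partial>m)" .
  qed
  also have "\<dots> \<le> (\<integral>\<^sup>+x. \<integral>\<^sup>+y. ennreal (1 / 2) * (ennreal ((f x)\<^sup>2) * ennreal (wk a s x y)) + ennreal (1 / 2) * (ennreal ((f y)\<^sup>2) * ennreal (wk a s x y)) \<partial>m \<partial>m)"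
  proof (intro nn_integral_mono)
    fix x y
    have "\<bar>f x\<bar> * \<bar>f y\<bar> \<le> 1 / 2 * (f x)\<^sup>2 + 1 / 2 * (f y)\<^sup>2"
      using sum_squares_ge_zero[of "\<bar>f x\<bar> - \<bar>f y\<bar>" 0] by (simp add: power2_eq_square algebra_simps)
    then have "(\<bar>f x\<bar> * \<bar>f y\<bar>) * wk a s x y \<le> (1 / 2 * (f x)\<^sup>2 + 1 / 2 * (f y)\<^sup>2) * wk a s x y"
      using w00 by (intro mult_right_mono)
    then have "\<bar>f x\<bar> * \<bar>f y * wk a s x y\<bar> \<le> 1 / 2 * ((f x)\<^sup>2 * wk a s x y) + 1 / 2 * ((f y)\<^sup>2 * wk a s x y)"
      using w00[of x y] by (simp add: abs_mult algebra_simps)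
    then have "ennreal (\<bar>f x\<bar> * \<bar>f y * wk a s x y\<bar>) \<le> ennreal (1 / 2 * ((f x)\<^sup>2 * wk a s x y) + 1 / 2 * ((f y)\<^sup>2 * wk a s x y))"
      by (rule ennreal_leI)
    also have "\<dots> = ennreal (1 / 2) * (ennreal ((f x)\<^sup>2) * ennreal (wk a s x y)) + ennreal (1 / 2) * (ennreal ((f y)\<^sup>2) * ennreal (wk a s x y))"
      using w00[of x y] by (simp only: ennreal_plus ennreal_mult mult_nonneg_nonneg zero_le_power2 zero_le_divide_1_iff zero_le_numeral)
    finally show "ennreal (\<bar>f x\<bar> * \<bar>f y * wk a s x y\<bar>) \<le> ennreal (1 / 2) * (ennreal ((f x)\<^sup>2) * ennreal (wk a s x y)) + ennreal (1 / 2) * (ennreal ((f y)\<^sup>2) * ennreal (wk a s x y))" .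
  qed
  also have "\<dots> = ennreal (1 / 2) * (?D * ?F) + ennreal (1 / 2) * (?D * ?F)"
  proof -
    have "(\<integral>\<^sup>+y. ennreal (1 / 2) * (ennreal ((f x)\<^sup>2) * ennreal (wk a s x y)) + ennreal (1 / 2) * (ennreal ((f y)\<^sup>2) * ennreal (wk a s x y)) \<partial>m)
        = ennreal (1 / 2) * (\<integral>\<^sup>+y. ennreal ((f x)\<^sup>2) * ennreal (wk a s x y) \<partial>m)
        + ennreal (1 / 2) * (\<integral>\<^sup>+y. ennreal ((f y)\<^sup>2) * ennreal (wk a s x y) \<partial>m)" for x
      using wkx[of x] fm by (subst nn_integral_add; simp add: nn_integral_cmult)
    moreover have "(\<integral>\<^sup>+x. ennreal (1 / 2) * (\<integral>\<^sup>+y. ennreal ((f x)\<^sup>2) * ennreal (wk a s x y) \<partial>m)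
        + ennreal (1 / 2) * (\<integral>\<^sup>+y. ennreal ((f y)\<^sup>2) * ennreal (wk a s x y) \<partial>m) \<partial>m)
      = ennreal (1 / 2) * (\<integral>\<^sup>+x. \<integral>\<^sup>+y. ennreal ((f x)\<^sup>2) * ennreal (wk a s x y) \<partial>m \<partial>m)
        + ennreal (1 / 2) * (\<integral>\<^sup>+x. \<integral>\<^sup>+y. ennreal ((f y)\<^sup>2) * ennreal (wk a s x y) \<partial>m \<partial>m)"
    proof -
      have "(\<lambda>x. \<integral>\<^sup>+y. ennreal ((f x)\<^sup>2) * ennreal (wk a s x y) \<partial>m) \<in> borel_measurable m" by measurable
      moreover have "(\<lambda>x. \<integral>\<^sup>+y. ennreal ((f y)\<^sup>2) * ennreal (wk a s x y) \<partial>m) \<in> borel_measurable m" by measurable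
      ultimately show ?thesis
        by (subst nn_integral_add) (auto simp: nn_integral_cmult simp del: ennreal_half)
    qed
    ultimately show ?thesis unfolding h1 h2 by simp
  qed
  also have "\<dots> = ?D * ?F"
  proof -
    have half: "ennreal (1 / 2) + ennreal (1 / 2) = 1" by (subst ennreal_plus[symmetric]) simp_all
    show ?thesis unfolding distrib_right[symmetric] half by simp
  qed
  finally have "ennreal (\<integral>z. w z * A z * A z \<partial>m) \<le> ?D * ?F" .
  moreover have "(\<integral>\<^sup>+z. ennreal (w z * A z * A z) \<partial>m) = ennreal (\<integral>z. w z * A z * A z \<partial>m)"
    by (rule nn_integral_eq_integral[OF int]) (simp add: mult.assoc w0)
  ultimately show ?thesis
    by (simp add: m_def w_def A_def power2_eq_square mult.assoc)
qed

text \<open>Since the damped bound is uniform in \<open>s\<close>, Fatou's lemma along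
  \<open>s = 1 / (n + 1)\<close> removes the damping. The factor \<open>2^(1 - a)\<close> of
  \<open>hop\<close> squares to \<open>4^(1 - a)\<close> and cancels the row sum exactly, which
  leaves the norm bound 1.\<close>

lemma hop_L2_bound:
  assumes a: "0 < a" and ft: "f \<in> test_functions"
  shows "(\<integral>\<^sup>+z. ennreal ((hop a f z)\<^sup>2) \<partial>bessel_measure (a - 1 / 2)) \<le> (\<integral>\<^sup>+x. ennreal ((f x)\<^sup>2) \<partial>bessel_measure (a - 1 / 2))"
proof -
  define m where "m = bessel_measure (a - 1 / 2)"
  define A where "A = (\<lambda>z. \<integral>x. f x * hk a z x \<partial>m)"
  have fm: "f \<in> borel_measurable Rplus" using ft by (simp add: test_functions_def)
  have Am [measurable]: "A \<in> borel_measurable m"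
    unfolding A_def m_def by (rule hop_integral_measurable[OF fm])
  have [measurable]: "(\<lambda>z. z) \<in> borel_measurable m"
    unfolding m_def by (rule borel_measurable_bessel_measure) measurable
  have lim: "(\<lambda>n. ennreal (exp (- (1 / real (Suc n) * z\<^sup>2)) * (A z)\<^sup>2)) \<longlonglongrightarrow> ennreal ((A z)\<^sup>2)" for z
  proof -
    have "(\<lambda>n. 1 / real (Suc n)) \<longlonglongrightarrow> 0" using LIMSEQ_inverse_real_of_nat by (simp add: divide_inverse)
    then have "(\<lambda>n. exp (- (1 / real (Suc n) * z\<^sup>2)) * (A z)\<^sup>2) \<longlonglongrightarrow> exp (- (0 * z\<^sup>2)) * (A z)\<^sup>2"
      by (intro tendsto_intros)
    then show ?thesis by simp
  qed
  have "(\<integral>\<^sup>+z. ennreal ((A z)\<^sup>2) \<partial>m) = (\<integral>\<^sup>+z. liminf (\<lambda>n. ennreal (exp (- (1 / real (Suc n) * z\<^sup>2)) * (A z)\<^sup>2)) \<partial>m)"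
    by (intro nn_integral_cong lim_imp_Liminf[symmetric] lim) simp
  also have "\<dots> \<le> liminf (\<lambda>n. \<integral>\<^sup>+z. ennreal (exp (- (1 / real (Suc n) * z\<^sup>2)) * (A z)\<^sup>2) \<partial>m)"
    by (rule nn_integral_liminf) measurable
  also have "\<dots> \<le> liminf (\<lambda>n. ennreal (4 powr (a - 1)) * (\<integral>\<^sup>+x. ennreal ((f x)\<^sup>2) \<partial>m))"
    unfolding A_def m_def by (intro Liminf_mono always_eventually allI hop_weber[OF a _ ft]) simp
  also have "\<dots> = ennreal (4 powr (a - 1)) * (\<integral>\<^sup>+x. ennreal ((f x)\<^sup>2) \<partial>m)"
    by (simp add: Liminf_const)
  finally have le: "(\<integral>\<^sup>+z. ennreal ((A z)\<^sup>2) \<partial>m) \<le> ennreal (4 powr (a - 1)) * (\<integral>\<^sup>+x. ennreal ((f x)\<^sup>2) \<partial>m)" .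
  have c: "(2 powr (1 - a))\<^sup>2 = (4::real) powr (1 - a)"
    by (simp add: power2_eq_square flip: powr_mult)
  have "(\<integral>\<^sup>+z. ennreal ((hop a f z)\<^sup>2) \<partial>m) = (\<integral>\<^sup>+z. ennreal (4 powr (1 - a)) * ennreal ((A z)\<^sup>2) \<partial>m)"
    unfolding hop_def A_def m_def[symmetric] power_mult_distrib c by (simp add: ennreal_mult)
  also have "\<dots> = ennreal (4 powr (1 - a)) * (\<integral>\<^sup>+z. ennreal ((A z)\<^sup>2) \<partial>m)"
    by (rule nn_integral_cmult) measurable
  also have "\<dots> \<le> ennreal (4 powr (1 - a)) * (ennreal (4 powr (a - 1)) * (\<integral>\<^sup>+x. ennreal ((f x)\<^sup>2) \<partial>m))"
    by (rule mult_left_mono[OF le]) simp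
  also have "\<dots> = (\<integral>\<^sup>+x. ennreal ((f x)\<^sup>2) \<partial>m)"
    by (simp add: mult.assoc[symmetric] flip: ennreal_mult powr_add)
  finally show ?thesis by (simp add: m_def)
qed

section \<open>The Hankel integrals expressed through \<open>hop\<close>\<close>

lemma bessel_J_eq:
  assumes v: "0 < v + 1" and z: "0 < z"
  shows "bessel_J v z = (z / 2) powr v * bes (v + 1) (- (z / 2)\<^sup>2)"
proof -
  have "bessel_J v z = (\<Sum>k. (z / 2) powr v * (bes_coeff (v + 1) k * (- (z / 2)\<^sup>2) ^ k))"
    unfolding bessel_J_def
  proof (rule suminf_cong)
    fix k
    have "(z / 2) powr (2 * real k + v) = (z / 2) powr v * (z / 2) ^ (2 * k)"
      using z powr_realpow[of "z / 2" "2 * k"] by (simp add: powr_add)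
    moreover have "(- (z / 2)\<^sup>2) ^ k = (-1) ^ k * (z / 2) ^ (2 * k)"
      by (subst power_minus) (simp add: power_mult)
    moreover have "rGamma (v + real k + 1) = rGamma (v + 1 + real k)" by (simp add: add_ac)
    ultimately show "(- 1) ^ k / fact k * rGamma (v + real k + 1) * (z / 2) powr (2 * real k + v)
        = (z / 2) powr v * (bes_coeff (v + 1) k * (- (z / 2)\<^sup>2) ^ k)"
      by (simp add: bes_coeff_def)
  qed
  also have "\<dots> = (z / 2) powr v * (\<Sum>k. bes_coeff (v + 1) k * (- (z / 2)\<^sup>2) ^ k)"
    using bes_sums[OF v] by (intro suminf_mult) (auto simp: sums_iff)
  finally show ?thesis by (simp add: bes_def)
qed

lemma hankel_integral_eq_hop:
  assumes l: "l > - 1 / 2" and x: "0 < x"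
  shows "hankel_integral l (l - 1 / 2) g x = hop (l + 1 / 2) g x"
proof -
  have "(x * y) powr (1 / 2 - l) * bessel_J (l - 1 / 2) (x * y) * g y = 2 powr (1 - (l + 1 / 2)) * (g y * hk (l + 1 / 2) x y)"
    if "0 < y" for y
  proof -
    have xy: "0 < x * y" using x that by simp
    have "bessel_J (l - 1 / 2) (x * y) = (x * y / 2) powr (l - 1 / 2) * hk (l + 1 / 2) x y"
    proof -
      have "l - 1 / 2 + 1 = l + 1 / 2" "0 < l - 1 / 2 + 1" using l by simp_all
      then show ?thesis using bessel_J_eq[OF _ xy, of "l - 1 / 2"] unfolding hk_def by metis
    qed
    moreover have "(x * y) powr (1 / 2 - l) * (x * y / 2) powr (l - 1 / 2) = 2 powr (1 / 2 - l)"
    proof -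
      have "(x * y) powr (1 / 2 - l) * (x * y) powr (l - 1 / 2) = (x * y) powr ((1 / 2 - l) + (l - 1 / 2))"
        by (simp only: powr_add)
      then have "(x * y) powr (1 / 2 - l) * (x * y) powr (l - 1 / 2) = 1"
        using x that by simp
      moreover have "(x * y / 2) powr (l - 1 / 2) = (x * y) powr (l - 1 / 2) * 2 powr (- (l - 1 / 2))"
        using xy powr_divide[of "x * y" 2 "l - 1 / 2"] unfolding powr_minus_divide by simp
      ultimately show ?thesis by simp
    qed
    ultimately show ?thesis by simp
  qed
  then have "hankel_integral l (l - 1 / 2) g x = (\<integral>y. 2 powr (1 - (l + 1 / 2)) * (g y * hk (l + 1 / 2) x y) \<partial>bessel_measure l)"
    unfolding hankel_integral_def by (intro Bochner_Integration.integral_cong) auto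
  then show ?thesis by (simp add: hop_def)
qed

lemma hankel_integral_conj_eq:
  assumes l: "l > - 1 / 2" and x: "0 < x"
  shows "hankel_integral l (l + 1 / 2) g x
    = 2 powr (- (l + 1 / 2)) * x * (\<integral>y. (y * g y) * hk (l + 3 / 2) x y \<partial>bessel_measure l)"
proof -
  have "(x * y) powr (1 / 2 - l) * bessel_J (l + 1 / 2) (x * y) * g y
      = 2 powr (- (l + 1 / 2)) * x * ((y * g y) * hk (l + 3 / 2) x y)"
    if "0 < y" for y
  proof -
    have xy: "0 < x * y" using x that by simp
    have "bessel_J (l + 1 / 2) (x * y) = (x * y / 2) powr (l + 1 / 2) * hk (l + 3 / 2) x y"
    proof -
      have "l + 1 / 2 + 1 = l + 3 / 2" "0 < l + 1 / 2 + 1" using l by simp_all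
      then show ?thesis using bessel_J_eq[OF _ xy, of "l + 1 / 2"] unfolding hk_def by metis
    qed
    moreover have "(x * y) powr (1 / 2 - l) * (x * y / 2) powr (l + 1 / 2) = 2 powr (- (l + 1 / 2)) * (x * y)"
    proof -
      have "(x * y) powr (1 / 2 - l) * (x * y) powr (l + 1 / 2) = (x * y) powr ((1 / 2 - l) + (l + 1 / 2))"
        by (simp only: powr_add)
      then have "(x * y) powr (1 / 2 - l) * (x * y) powr (l + 1 / 2) = x * y"
        using xy by simp
      moreover have "(x * y / 2) powr (l + 1 / 2) = (x * y) powr (l + 1 / 2) * 2 powr (- (l + 1 / 2))"
        using xy powr_divide[of "x * y" 2 "l + 1 / 2"] unfolding powr_minus_divide by simp
      ultimately show ?thesis by simp
    qed
    ultimately show ?thesis by simp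
  qed
  then have "hankel_integral l (l + 1 / 2) g x
      = (\<integral>y. 2 powr (- (l + 1 / 2)) * x * ((y * g y) * hk (l + 3 / 2) x y) \<partial>bessel_measure l)"
    unfolding hankel_integral_def by (intro Bochner_Integration.integral_cong) auto
  then show ?thesis by simp
qed

text \<open>The order \<open>\<lambda> + 1/2\<close> is the plain order for the parameter
  \<open>\<lambda> + 1\<close>, and \<open>y^2\<close> is the ratio of the two measures. So the
  conjugate transform is the plain one for \<open>\<lambda> + 1\<close>, conjugated with
  multiplication by the variable.\<close>

lemma hankel_integral_conj_eq_hop:
  assumes l: "l > - 1 / 2" and x: "0 < x" and g: "g \<in> borel_measurable Rplus"
  shows "hankel_integral l (l + 1 / 2) g x = x * hop (l + 3 / 2) (\<lambda>y. g y / y) x"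
proof -
  have id: "(\<lambda>y. y) \<in> borel_measurable (bessel_measure l)"
    by (rule borel_measurable_bessel_measure) measurable
  have gm: "g \<in> borel_measurable (bessel_measure l)"
    using g by (simp add: measurable_bessel_measure)
  have hm: "hk (l + 3 / 2) x \<in> borel_measurable (bessel_measure l)"
    by (rule borel_measurable_bessel_measure) (unfold hk_def, measurable)
  have "(\<integral>y. g y / y * hk (l + 3 / 2) x y \<partial>bessel_measure (l + 1))
      = (\<integral>y. y powr (2 * 1) *\<^sub>R (g y / y * hk (l + 3 / 2) x y) \<partial>bessel_measure l)"
    unfolding bessel_measure_add using id gm hm by (intro integral_density) (auto intro: borel_measurable_bessel_measure)
  also have "\<dots> = (\<integral>y. (y * g y) * hk (l + 3 / 2) x y \<partial>bessel_measure l)"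
    by (intro Bochner_Integration.integral_cong) (auto simp: power2_eq_square)
  finally have int: "(\<integral>y. g y / y * hk (l + 3 / 2) x y \<partial>bessel_measure (l + 1))
      = (\<integral>y. (y * g y) * hk (l + 3 / 2) x y \<partial>bessel_measure l)" .
  have eq: "l + 3 / 2 - 1 / 2 = l + 1" "1 - (l + 3 / 2) = - (l + 1 / 2)" by auto
  show ?thesis unfolding hankel_integral_conj_eq[OF l x] hop_def eq int by (simp only: mult_ac)
qed

lemma hankel_integral_L2_bound:
  assumes l: "l > - 1 / 2" and v: "v = l - 1 / 2 \<or> v = l + 1 / 2" and ft: "f \<in> test_functions"
  shows "(\<integral>\<^sup>+x. ennreal ((hankel_integral l v f x)\<^sup>2) \<partial>bessel_measure l) \<le> (\<integral>\<^sup>+x. ennreal ((f x)\<^sup>2) \<partial>bessel_measure l)"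
  using v
proof
  assume v: "v = l - 1 / 2"
  have "(\<integral>\<^sup>+x. ennreal ((hankel_integral l v f x)\<^sup>2) \<partial>bessel_measure l) = (\<integral>\<^sup>+x. ennreal ((hop (l + 1 / 2) f x)\<^sup>2) \<partial>bessel_measure l)"
    unfolding v by (rule nn_integral_cong) (simp add: hankel_integral_eq_hop[OF l])
  then show ?thesis using hop_L2_bound[OF _ ft, of "l + 1 / 2"] l by simp
next
  assume v: "v = l + 1 / 2"
  have fm: "f \<in> borel_measurable Rplus" using ft by (simp add: test_functions_def)
  have gt: "(\<lambda>y. f y / y) \<in> test_functions" by (rule test_divide[OF ft])
  then have gm: "(\<lambda>y. f y / y) \<in> borel_measurable Rplus" by (simp add: test_functions_def)
  \<comment> \<open>Multiplication by \<open>x\<close> carries the norm for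
    \<open>\<lambda> + 1\<close> to the norm for \<lambda>. Applied to the input and to the output,
    this reduces the conjugate case to \<open>hop_L2_bound\<close>.\<close>
  have sq: "(\<integral>\<^sup>+x. ennreal ((g x)\<^sup>2) \<partial>bessel_measure (l + 1)) = (\<integral>\<^sup>+x. ennreal ((x * g x)\<^sup>2) \<partial>bessel_measure l)"
    if "g \<in> borel_measurable Rplus" for g
  proof -
    have "(\<integral>\<^sup>+x. ennreal ((g x)\<^sup>2) \<partial>bessel_measure (l + 1)) = (\<integral>\<^sup>+x. ennreal (x powr (2 * 1)) * ennreal ((g x)\<^sup>2) \<partial>bessel_measure l)"
      unfolding bessel_measure_add using that
      by (intro nn_integral_density) (auto simp: measurable_bessel_measure intro!: powr_measurable_Rplus[of 2, simplified])
    also have "\<dots> = (\<integral>\<^sup>+x. ennreal ((x * g x)\<^sup>2) \<partial>bessel_measure l)"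
      by (intro nn_integral_cong) (simp add: power_mult_distrib flip: ennreal_mult)
    finally show ?thesis .
  qed
  have "(\<integral>\<^sup>+x. ennreal ((hankel_integral l v f x)\<^sup>2) \<partial>bessel_measure l)
      = (\<integral>\<^sup>+x. ennreal ((x * hop (l + 3 / 2) (\<lambda>y. f y / y) x)\<^sup>2) \<partial>bessel_measure l)"
    unfolding v by (rule nn_integral_cong) (simp add: hankel_integral_conj_eq_hop[OF l _ fm])
  also have "\<dots> = (\<integral>\<^sup>+x. ennreal ((hop (l + 3 / 2) (\<lambda>y. f y / y) x)\<^sup>2) \<partial>bessel_measure (l + 1))"
    by (rule sq[symmetric]) (rule hop_measurable[OF gm])
  also have "\<dots> \<le> (\<integral>\<^sup>+x. ennreal ((f x / x)\<^sup>2) \<partial>bessel_measure (l + 1))"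
  proof -
    have "l + 3 / 2 - 1 / 2 = l + 1" "0 < l + 3 / 2" using l by simp_all
    then show ?thesis using hop_L2_bound[OF _ gt, of "l + 3 / 2"] by metis
  qed
  also have "\<dots> = (\<integral>\<^sup>+x. ennreal ((x * (f x / x))\<^sup>2) \<partial>bessel_measure l)"
    by (rule sq[OF gm])
  also have "\<dots> = (\<integral>\<^sup>+x. ennreal ((f x)\<^sup>2) \<partial>bessel_measure l)"
    by (rule nn_integral_cong) simp
  finally show ?thesis .
qed

section \<open>Completeness of \<open>L^2\<close> and the continuous extension\<close>

lemma sq_le_2_sq: "((x::real) - z)\<^sup>2 \<le> 2 * (x - y)\<^sup>2 + 2 * (y - z)\<^sup>2"
  using sum_squares_ge_zero[of "(x - y) - (y - z)" 0] by (simp add: power2_eq_square algebra_simps)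

lemma nn_integral_sq_triangle:
  fixes u v w :: "'a \<Rightarrow> real"
  assumes [measurable]: "u \<in> borel_measurable M" "v \<in> borel_measurable M" "w \<in> borel_measurable M"
  shows "(\<integral>\<^sup>+x. ennreal ((u x - w x)\<^sup>2) \<partial>M)
    \<le> 2 * (\<integral>\<^sup>+x. ennreal ((u x - v x)\<^sup>2) \<partial>M) + 2 * (\<integral>\<^sup>+x. ennreal ((v x - w x)\<^sup>2) \<partial>M)"
proof -
  have "(\<integral>\<^sup>+x. ennreal ((u x - w x)\<^sup>2) \<partial>M) \<le> (\<integral>\<^sup>+x. 2 * ennreal ((u x - v x)\<^sup>2) + 2 * ennreal ((v x - w x)\<^sup>2) \<partial>M)"
  proof (rule nn_integral_mono)
    fix x
    have "ennreal ((u x - w x)\<^sup>2) \<le> ennreal (2 * (u x - v x)\<^sup>2 + 2 * (v x - w x)\<^sup>2)"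
      by (intro ennreal_leI sq_le_2_sq)
    then show "ennreal ((u x - w x)\<^sup>2) \<le> 2 * ennreal ((u x - v x)\<^sup>2) + 2 * ennreal ((v x - w x)\<^sup>2)"
      by (simp add: ennreal_mult)
  qed
  then show ?thesis by (simp add: nn_integral_add nn_integral_cmult)
qed

text \<open>Completeness of \<open>L^2\<close> in terms of \<open>nn_integral\<close> distances. A
  rapidly convergent subsequence has a limit almost everywhere, and Fatou's lemma turns the Cauchy
  condition into convergence of the whole sequence to that limit.\<close>

lemma Riesz_Fischer:
  fixes u :: "nat \<Rightarrow> 'a \<Rightarrow> real"
  assumes um [measurable]: "\<And>n. u n \<in> borel_measurable M"
    and cauchy: "\<And>e. 0 < e \<Longrightarrow> \<exists>K. \<forall>n\<ge>K. \<forall>k\<ge>K. (\<integral>\<^sup>+x. ennreal ((u n x - u k x)\<^sup>2) \<partial>M) \<le> ennreal e"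
  obtains H where "H \<in> borel_measurable M" "(\<lambda>n. \<integral>\<^sup>+x. ennreal ((u n x - H x)\<^sup>2) \<partial>M) \<longlonglongrightarrow> 0"
proof -
  have "\<exists>K. \<forall>n\<ge>K. \<forall>k\<ge>K. (\<integral>\<^sup>+x. ennreal ((u n x - u k x)\<^sup>2) \<partial>M) \<le> ennreal ((1/8) ^ i)" for i :: nat
    by (rule cauchy) simp
  then obtain K where K: "\<And>i n k. K i \<le> n \<Longrightarrow> K i \<le> k \<Longrightarrow> (\<integral>\<^sup>+x. ennreal ((u n x - u k x)\<^sup>2) \<partial>M) \<le> ennreal ((1/8) ^ i)"
    by metis
  \<comment> \<open>\<open>r i\<close> and \<open>r (Suc i)\<close> are at least \<open>K i\<close>,
    so the steps are as small as prescribed; \<open>r i\<close> is at least \<open>i\<close>, so the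
    subsequence runs to infinity.\<close>
  define r where "r i = i + (\<Sum>j\<le>i. K j)" for i
  have rK: "K i \<le> r i" "K i \<le> r (Suc i)" for i
    unfolding r_def using member_le_sum[of i "{..i}" K] by auto
  have ri: "i \<le> r i" for i by (simp add: r_def)
  \<comment> \<open>The squared norms of the steps are at most \<open>8^(-i)\<close>; weighted by
    \<open>4^i\<close> they still sum to a finite value. Finiteness of the weighted sum at
    \<open>x\<close> gives \<open>|d i x| \<le> sqrt C * 2^(-i)\<close>, so the increments are
    absolutely summable there.\<close>
  define d where "d i x = u (r (Suc i)) x - u (r i) x" for i x
  have [measurable]: "d i \<in> borel_measurable M" for i unfolding d_def by measurable
  have "(\<integral>\<^sup>+x. (\<Sum>i. ennreal (4 ^ i * (d i x)\<^sup>2)) \<partial>M) = (\<Sum>i. \<integral>\<^sup>+x. ennreal (4 ^ i * (d i x)\<^sup>2) \<partial>M)"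
    by (rule nn_integral_suminf) measurable
  also have "\<dots> \<le> (\<Sum>i. ennreal ((1/2) ^ i))"
  proof (intro suminf_le allI)
    fix i
    have "(\<integral>\<^sup>+x. ennreal (4 ^ i * (d i x)\<^sup>2) \<partial>M) = ennreal (4 ^ i) * (\<integral>\<^sup>+x. ennreal ((d i x)\<^sup>2) \<partial>M)"
      by (simp add: ennreal_mult nn_integral_cmult)
    also have "\<dots> \<le> ennreal (4 ^ i) * ennreal ((1/8) ^ i)"
      unfolding d_def using rK by (intro mult_left_mono K) auto
    also have "\<dots> = ennreal ((1/2) ^ i)"
      by (simp add: ennreal_mult[symmetric] power_mult_distrib[symmetric] del: power_one_over)
    finally show "(\<integral>\<^sup>+x. ennreal (4 ^ i * (d i x)\<^sup>2) \<partial>M) \<le> ennreal ((1/2) ^ i)" .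
  qed auto
  also have "\<dots> = ennreal (\<Sum>i. (1/2) ^ i)"
    by (rule suminf_ennreal2) (auto intro: summable_geometric)
  finally have "(\<integral>\<^sup>+x. (\<Sum>i. ennreal (4 ^ i * (d i x)\<^sup>2)) \<partial>M) \<noteq> \<infinity>"
    by (auto simp: top_unique)
  then have "AE x in M. (\<Sum>i. ennreal (4 ^ i * (d i x)\<^sup>2)) \<noteq> \<infinity>"
    by (intro nn_integral_PInf_AE) measurable
  then have conv: "AE x in M. convergent (\<lambda>i. u (r i) x)"
  proof eventually_elim
    case (elim x)
    define C where "C = enn2real (\<Sum>i. ennreal (4 ^ i * (d i x)\<^sup>2))"
    have C: "(\<Sum>i. ennreal (4 ^ i * (d i x)\<^sup>2)) = ennreal C"
      using elim unfolding C_def by (simp add: less_top)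
    have C0: "0 \<le> C" by (simp add: C_def)
    have "norm (d i x) \<le> sqrt C * (1/2) ^ i" for i
    proof -
      have "ennreal (4 ^ i * (d i x)\<^sup>2) \<le> ennreal C"
      proof -
        have "sum (\<lambda>i. ennreal (4 ^ i * (d i x)\<^sup>2)) {i} \<le> (\<Sum>i. ennreal (4 ^ i * (d i x)\<^sup>2))"
          by (rule sum_le_suminf) auto
        also have "sum (\<lambda>i. ennreal (4 ^ i * (d i x)\<^sup>2)) {i} = ennreal (4 ^ i * (d i x)\<^sup>2)"
          by simp
        finally show ?thesis unfolding C .
      qed
      then have "4 ^ i * (d i x)\<^sup>2 \<le> C" by (subst (asm) ennreal_le_iff[OF C0])
      moreover have "(2 ^ i * \<bar>d i x\<bar>)\<^sup>2 = 4 ^ i * (d i x)\<^sup>2"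
      proof -
        have "(2 ^ i)\<^sup>2 = (4 ^ i :: real)" by (simp add: power2_eq_square flip: power_mult_distrib)
        then show ?thesis by (simp add: power_mult_distrib)
      qed
      ultimately have "2 ^ i * \<bar>d i x\<bar> \<le> sqrt C" by (intro real_le_rsqrt) simp
      then show ?thesis by (simp add: field_simps power_one_over)
    qed
    moreover have "summable (\<lambda>i. sqrt C * (1/2) ^ i)"
      by (rule summable_mult, rule summable_geometric) simp
    ultimately have "summable (\<lambda>i. d i x)"
      using summable_comparison_test'[of "\<lambda>i. sqrt C * (1/2) ^ i" 0 "\<lambda>i. d i x"] by blast
    then have "convergent (\<lambda>n. \<Sum>i<n. d i x)" by (simp add: summable_iff_convergent)
    moreover have "(\<Sum>i<n. d i x) = u (r n) x - u (r 0) x" for n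
      unfolding d_def by (rule sum_lessThan_telescope)
    ultimately have "convergent (\<lambda>n. u (r n) x - u (r 0) x)" by simp
    from convergent_add[OF this convergent_const[of "u (r 0) x"]] show ?case by simp
  qed
  define H where "H x = lim (\<lambda>i. u (r i) x)" for x
  have Hm [measurable]: "H \<in> borel_measurable M"
    unfolding H_def by (rule borel_measurable_lim_metric) measurable
  have lim: "AE x in M. (\<lambda>i. u (r i) x) \<longlonglongrightarrow> H x"
    using conv by eventually_elim (simp add: H_def convergent_LIMSEQ_iff)
  have le: "(\<integral>\<^sup>+x. ennreal ((u n x - H x)\<^sup>2) \<partial>M) \<le> ennreal e"
    if k: "\<And>k. k \<ge> N \<Longrightarrow> (\<integral>\<^sup>+x. ennreal ((u n x - u k x)\<^sup>2) \<partial>M) \<le> ennreal e" for n e N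
  proof -
    have "(\<integral>\<^sup>+x. ennreal ((u n x - H x)\<^sup>2) \<partial>M) = (\<integral>\<^sup>+x. liminf (\<lambda>i. ennreal ((u n x - u (r i) x)\<^sup>2)) \<partial>M)"
    proof (rule nn_integral_cong_AE, use lim in eventually_elim)
      case (elim x)
      then have "(\<lambda>i. ennreal ((u n x - u (r i) x)\<^sup>2)) \<longlonglongrightarrow> ennreal ((u n x - H x)\<^sup>2)"
        by (intro tendsto_intros)
      from lim_imp_Liminf[OF _ this] show ?case by simp
    qed
    also have "\<dots> \<le> liminf (\<lambda>i. \<integral>\<^sup>+x. ennreal ((u n x - u (r i) x)\<^sup>2) \<partial>M)"
      by (rule nn_integral_liminf) measurable
    also have "\<dots> \<le> liminf (\<lambda>i. ennreal e)"
    proof (rule Liminf_mono)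
      show "\<forall>\<^sub>F i in sequentially. (\<integral>\<^sup>+x. ennreal ((u n x - u (r i) x)\<^sup>2) \<partial>M) \<le> ennreal e"
        unfolding eventually_sequentially using ri by (intro exI[of _ N] allI impI k) (metis order_trans)
    qed
    also have "\<dots> = ennreal e" by (simp add: Liminf_const)
    finally show ?thesis .
  qed
  have "(\<lambda>n. \<integral>\<^sup>+x. ennreal ((u n x - H x)\<^sup>2) \<partial>M) \<longlonglongrightarrow> 0"
  proof (rule order_tendstoI)
    fix y :: ennreal assume "0 < y"
    then obtain e where e: "0 < e" "ennreal e < y"
      by (metis dense ennreal_cases less_top ennreal_less_zero_iff not_less_iff_gr_or_eq ennreal_neq_top order_less_trans)
    from cauchy[OF e(1)] obtain N where N: "\<forall>n\<ge>N. \<forall>k\<ge>N. (\<integral>\<^sup>+x. ennreal ((u n x - u k x)\<^sup>2) \<partial>M) \<le> ennreal e" by blast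
    have "(\<integral>\<^sup>+x. ennreal ((u n x - H x)\<^sup>2) \<partial>M) \<le> ennreal e" if "N \<le> n" for n
      using N that by (intro le[of N]) auto
    then show "\<forall>\<^sub>F n in sequentially. (\<integral>\<^sup>+x. ennreal ((u n x - H x)\<^sup>2) \<partial>M) < y"
      using e(2) unfolding eventually_sequentially by (intro exI[of _ N]) (auto intro: order_le_less_trans)
  qed simp
  with Hm show thesis by (rule that)
qed

lemma tendsto_0_ennreal_iff:
  fixes f :: "nat \<Rightarrow> ennreal"
  shows "f \<longlonglongrightarrow> 0 \<longleftrightarrow> (\<forall>e>0. \<exists>K. \<forall>n\<ge>K. f n \<le> ennreal e)"
proof (intro iffI allI impI)
  fix e :: real assume "f \<longlonglongrightarrow> 0" "0 < e"
  then have "\<forall>\<^sub>F n in sequentially. f n < ennreal e" by (intro order_tendstoD(2)) auto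
  then show "\<exists>K. \<forall>n\<ge>K. f n \<le> ennreal e" unfolding eventually_sequentially by (auto intro: less_imp_le)
next
  assume *: "\<forall>e>0. \<exists>K. \<forall>n\<ge>K. f n \<le> ennreal e"
  show "f \<longlonglongrightarrow> 0"
  proof (rule order_tendstoI)
    fix y :: ennreal assume "0 < y"
    then obtain e where e: "0 < e" "ennreal e < y"
      by (metis dense ennreal_cases less_top ennreal_less_zero_iff not_less_iff_gr_or_eq ennreal_neq_top order_less_trans)
    then show "\<forall>\<^sub>F n in sequentially. f n < y"
      using * unfolding eventually_sequentially by (meson order_le_less_trans)
  qed simp
qed

lemma tendsto_0_le_ennreal:
  fixes f h :: "nat \<Rightarrow> ennreal"
  assumes "h \<longlonglongrightarrow> 0" "\<And>n. f n \<le> h n"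
  shows "f \<longlonglongrightarrow> 0"
  using assms(1) unfolding tendsto_0_ennreal_iff by (meson assms(2) order_trans)

text \<open>\<open>SOME\<close> has its property only if a witness exists. If some sequence of test
  functions converges to \<open>G\<close>, its images are Cauchy because \<open>T\<close> respects
  differences and is contractive, and their limit serves every other sequence as well. Otherwise the
  condition on sequences is vacuous and the zero function serves.\<close>

lemma L2_extension_props:
  assumes Tm: "\<And>f. f \<in> test_functions \<Longrightarrow> T f \<in> borel_measurable Rplus"
    and Tb: "\<And>f. f \<in> test_functions \<Longrightarrow> (\<integral>\<^sup>+x. ennreal ((T f x)\<^sup>2) \<partial>bessel_measure l) \<le> (\<integral>\<^sup>+x. ennreal ((f x)\<^sup>2) \<partial>bessel_measure l)"
    and Td: "\<And>f g x. f \<in> test_functions \<Longrightarrow> g \<in> test_functions \<Longrightarrow> 0 < x \<Longrightarrow> T (\<lambda>x. f x - g x) x = T f x - T g x"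
    and GL: "G \<in> L2 l"
  shows "L2_extension l T G \<in> L2 l \<and>
      (\<forall>g. (\<forall>n. g n \<in> test_functions) \<and> L2_tendsto l g G \<longrightarrow> L2_tendsto l (\<lambda>n. T (g n)) (L2_extension l T G))"
  unfolding L2_extension_def
proof (rule someI_ex[where P = "\<lambda>H. H \<in> L2 l \<and>
      (\<forall>g. (\<forall>n. g n \<in> test_functions) \<and> L2_tendsto l g G \<longrightarrow> L2_tendsto l (\<lambda>n. T (g n)) H)"])
  define m where "m = bessel_measure l"
  define N where "N u = (\<integral>\<^sup>+x. ennreal ((u x)\<^sup>2) \<partial>m)" for u :: "real \<Rightarrow> real"
  have ms: "borel_measurable m = borel_measurable Rplus" by (simp add: m_def measurable_bessel_measure)
  have Gm: "G \<in> borel_measurable m" using GL by (simp add: L2_def ms)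
  have tm: "f \<in> borel_measurable m" if "f \<in> test_functions" for f
    using that by (simp add: test_functions_def ms)
  have Tm': "T f \<in> borel_measurable m" if "f \<in> test_functions" for f
    using Tm[OF that] by (simp add: ms)
  have tri: "N (\<lambda>x. u x - w x) \<le> 2 * N (\<lambda>x. u x - v x) + 2 * N (\<lambda>x. v x - w x)"
    if "u \<in> borel_measurable m" "v \<in> borel_measurable m" "w \<in> borel_measurable m" for u v w
    unfolding N_def by (rule nn_integral_sq_triangle[OF that])
  have sym: "N (\<lambda>x. u x - v x) = N (\<lambda>x. v x - u x)" for u v
    unfolding N_def by (simp add: power2_commute)
  have TN: "N (\<lambda>x. T f x - T g x) \<le> N (\<lambda>x. f x - g x)" if "f \<in> test_functions" "g \<in> test_functions" for f g
  proof -
    have "N (\<lambda>x. T f x - T g x) = N (T (\<lambda>x. f x - g x))"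
      unfolding N_def by (rule nn_integral_cong) (simp add: m_def Td[OF that])
    also have "\<dots> \<le> N (\<lambda>x. f x - g x)"
      unfolding N_def m_def by (rule Tb[OF test_diff[OF that]])
    finally show ?thesis .
  qed
  have tends: "L2_tendsto l g H \<longleftrightarrow> (\<lambda>n. N (\<lambda>x. g n x - H x)) \<longlonglongrightarrow> 0" for g H
    by (simp add: L2_tendsto_def N_def m_def)
  show "\<exists>H. H \<in> L2 l \<and> (\<forall>g. (\<forall>n. g n \<in> test_functions) \<and> L2_tendsto l g G \<longrightarrow> L2_tendsto l (\<lambda>n. T (g n)) H)"
  proof (cases "\<exists>g. (\<forall>n. g n \<in> test_functions) \<and> L2_tendsto l g G")
    case False
    then show ?thesis by (intro exI[of _ "\<lambda>x. 0"]) (auto simp: L2_def)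
  next
    case True
    then obtain g0 where g0: "\<And>n. g0 n \<in> test_functions" "(\<lambda>n. N (\<lambda>x. g0 n x - G x)) \<longlonglongrightarrow> 0"
      by (auto simp: tends)
    have cauchy: "\<exists>K. \<forall>n\<ge>K. \<forall>k\<ge>K. (\<integral>\<^sup>+x. ennreal ((T (g0 n) x - T (g0 k) x)\<^sup>2) \<partial>m) \<le> ennreal e" if "0 < e" for e
    proof -
      have "0 < e / 4" using that by simp
      with g0(2) obtain K where K: "\<And>n. K \<le> n \<Longrightarrow> N (\<lambda>x. g0 n x - G x) \<le> ennreal (e / 4)"
        unfolding tendsto_0_ennreal_iff by blast
      have "N (\<lambda>x. T (g0 n) x - T (g0 k) x) \<le> ennreal e" if "K \<le> n" "K \<le> k" for n k
      proof -
        have "N (\<lambda>x. T (g0 n) x - T (g0 k) x) \<le> N (\<lambda>x. g0 n x - g0 k x)"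
          by (rule TN[OF g0(1) g0(1)])
        also have "\<dots> \<le> 2 * N (\<lambda>x. g0 n x - G x) + 2 * N (\<lambda>x. G x - g0 k x)"
          by (rule tri[OF tm[OF g0(1)] Gm tm[OF g0(1)]])
        also have "\<dots> \<le> 2 * ennreal (e / 4) + 2 * ennreal (e / 4)"
          using K[OF that(1)] K[OF that(2)] by (intro add_mono mult_left_mono) (auto simp: sym[of G])
        also have "2 * ennreal (e / 4) = ennreal (e / 2)"
          using ennreal_mult[of 2 "e / 4"] \<open>0 < e\<close> by simp
        also have "ennreal (e / 2) + ennreal (e / 2) = ennreal e"
          using \<open>0 < e\<close> by (subst ennreal_plus[symmetric]) auto
        finally show ?thesis .
      qed
      then show ?thesis unfolding N_def by blast
    qed
    obtain H where H: "H \<in> borel_measurable m" "(\<lambda>n. N (\<lambda>x. T (g0 n) x - H x)) \<longlonglongrightarrow> 0"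
      using Riesz_Fischer[of "\<lambda>n. T (g0 n)" m, OF Tm'[OF g0(1)] cauchy] unfolding N_def by blast
    have fin: "N f < \<infinity>" if "f \<in> test_functions" for f
    proof -
      obtain p q M where f: "0 < p" "p < q" "0 < M" "\<And>x. 0 < x \<Longrightarrow> f x \<noteq> 0 \<Longrightarrow> p \<le> x \<and> x \<le> q"
        "\<And>x. 0 < x \<Longrightarrow> \<bar>f x\<bar> \<le> M" "f \<in> borel_measurable Rplus"
        using test_functionsE[OF \<open>f \<in> test_functions\<close>] by blast
      have "N f \<le> (\<integral>\<^sup>+x. ennreal M * ennreal \<bar>f x\<bar> \<partial>m)"
        unfolding N_def
      proof (rule nn_integral_mono)
        fix x assume "x \<in> space m"
        then have "\<bar>f x\<bar> \<le> M" using f(5) by (simp add: m_def)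
        then have "(f x)\<^sup>2 \<le> M * \<bar>f x\<bar>"
          unfolding power2_eq_square by (metis abs_ge_zero abs_mult_self_eq mult_right_mono)
        then show "ennreal ((f x)\<^sup>2) \<le> ennreal M * ennreal \<bar>f x\<bar>"
          using f(3) by (simp add: ennreal_leI flip: ennreal_mult)
      qed
      also have "\<dots> = ennreal M * (\<integral>\<^sup>+x. ennreal \<bar>f x\<bar> \<partial>m)"
        using tm[OF that] by (intro nn_integral_cmult) auto
      also have "\<dots> < \<infinity>"
        using test_integrable[OF that, of l] by (simp add: integrable_iff_bounded m_def ennreal_mult_less_top)
      finally show ?thesis .
    qed
    have "N H < \<infinity>"
    proof -
      obtain n where n: "N (\<lambda>x. T (g0 n) x - H x) \<le> ennreal 1"
      proof -
        obtain K where "\<forall>n\<ge>K. N (\<lambda>x. T (g0 n) x - H x) \<le> ennreal 1"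
          using H(2) unfolding tendsto_0_ennreal_iff by (meson zero_less_one)
        then show thesis by (intro that[of K]) auto
      qed
      have "N (\<lambda>x. H x - 0) \<le> 2 * N (\<lambda>x. H x - T (g0 n) x) + 2 * N (\<lambda>x. T (g0 n) x - 0)"
        by (rule tri[OF H(1) Tm'[OF g0(1)]]) simp
      also have "\<dots> \<le> 2 * ennreal 1 + 2 * N (g0 n)"
        using n Tb[OF g0(1)[of n]] by (intro add_mono mult_left_mono) (auto simp: sym[of H] N_def m_def)
      also have "\<dots> < \<infinity>" using fin[OF g0(1)[of n]] by (simp add: ennreal_mult_less_top)
      finally show ?thesis by simp
    qed
    then have HL: "H \<in> L2 l" using H(1) by (simp add: L2_def N_def m_def ms[unfolded m_def])
    have "L2_tendsto l (\<lambda>n. T (g n)) H" if g: "\<And>n. g n \<in> test_functions" "L2_tendsto l g G" for g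
    proof -
      have g': "(\<lambda>n. N (\<lambda>x. g n x - G x)) \<longlonglongrightarrow> 0" using g(2) by (simp add: tends)
      \<comment> \<open>Comparison with the reference sequence \<open>g0\<close>: the images of
        \<open>g n\<close> and \<open>g0 n\<close> are no farther apart than the functions
        themselves, and both sequences approach \<open>G\<close>.\<close>
      have le: "N (\<lambda>x. T (g n) x - H x) \<le> 2 * (2 * N (\<lambda>x. g n x - G x) + 2 * N (\<lambda>x. g0 n x - G x)) + 2 * N (\<lambda>x. T (g0 n) x - H x)" for n
      proof -
        have "N (\<lambda>x. T (g n) x - H x) \<le> 2 * N (\<lambda>x. T (g n) x - T (g0 n) x) + 2 * N (\<lambda>x. T (g0 n) x - H x)"
          by (rule tri[OF Tm'[OF g(1)] Tm'[OF g0(1)] H(1)])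
        also have "\<dots> \<le> 2 * (2 * N (\<lambda>x. g n x - G x) + 2 * N (\<lambda>x. G x - g0 n x)) + 2 * N (\<lambda>x. T (g0 n) x - H x)"
          by (intro add_mono mult_left_mono order_trans[OF TN[OF g(1) g0(1)] tri[OF tm[OF g(1)] Gm tm[OF g0(1)]]]) auto
        finally show ?thesis by (simp add: sym[of G])
      qed
      have "(\<lambda>n. 2 * (2 * N (\<lambda>x. g n x - G x) + 2 * N (\<lambda>x. g0 n x - G x)) + 2 * N (\<lambda>x. T (g0 n) x - H x))
          \<longlonglongrightarrow> 2 * (2 * 0 + 2 * 0) + 2 * 0"
        using g' g0(2) H(2) by (intro tendsto_add ennreal_tendsto_cmult) auto
      then have "(\<lambda>n. 2 * (2 * N (\<lambda>x. g n x - G x) + 2 * N (\<lambda>x. g0 n x - G x)) + 2 * N (\<lambda>x. T (g0 n) x - H x)) \<longlonglongrightarrow> 0"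
        by simp
      then have "(\<lambda>n. N (\<lambda>x. T (g n) x - H x)) \<longlonglongrightarrow> 0"
        by (rule tendsto_0_le_ennreal) (rule le)
      then show ?thesis by (simp add: tends)
    qed
    with HL show ?thesis by blast
  qed
qed

section \<open>The Riesz transform in weak form\<close>

lemma hk_bound_const:
  assumes a: "0 < a" and "0 < x" "x \<le> q" "0 < z" "z \<le> r"
  shows "\<bar>hk a z x\<bar> \<le> bes a ((q * r / 2)\<^sup>2)"
  unfolding hk_def
proof (rule bes_abs_le[OF a])
  have "z * x \<le> q * r" using assms by (subst mult.commute) (intro mult_mono, auto)
  then have "(z * x / 2)\<^sup>2 \<le> (q * r / 2)\<^sup>2" using assms by (intro power_mono) auto
  then show "\<bar>- (z * x / 2)\<^sup>2\<bar> \<le> (q * r / 2)\<^sup>2" by simp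
qed

lemma hk_section_measurable: "hk a z \<in> borel_measurable (bessel_measure l)"
  by (rule borel_measurable_bessel_measure) (unfold hk_def, measurable)

lemma test_hk_integrable:
  assumes a: "0 < a" and ft: "f \<in> test_functions" and z: "0 < z"
  shows "integrable (bessel_measure l) (\<lambda>x. f x * hk a z x)"
proof -
  obtain p q M where f: "0 < p" "p < q" "0 < M" "\<And>x. 0 < x \<Longrightarrow> f x \<noteq> 0 \<Longrightarrow> p \<le> x \<and> x \<le> q"
    "\<And>x. 0 < x \<Longrightarrow> \<bar>f x\<bar> \<le> M" "f \<in> borel_measurable Rplus"
    using test_functionsE[OF ft] by blast
  define C where "C = bes a ((q * z / 2)\<^sup>2)"
  show ?thesis
  proof (rule Bochner_Integration.integrable_bound[OF integrable_mult_left[OF test_integrable[OF ft, of l], of C]])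
    show "(\<lambda>x. f x * hk a z x) \<in> borel_measurable (bessel_measure l)"
      using f(6) hk_section_measurable[of a z l] by (intro borel_measurable_times) (simp_all add: measurable_bessel_measure)
    show "AE x in bessel_measure l. norm (f x * hk a z x) \<le> norm (f x * C)"
    proof (rule AE_I2)
      fix x assume "x \<in> space (bessel_measure l)"
      then have x: "0 < x" by simp
      show "norm (f x * hk a z x) \<le> norm (f x * C)"
      proof (cases "f x = 0")
        case False
        have "\<bar>hk a z x\<bar> \<le> C"
          unfolding C_def using f(4)[OF x False] by (intro hk_bound_const[OF a x _ z order_refl]) simp
        then show ?thesis by (auto simp: abs_mult intro!: mult_left_mono)
      qed simp
    qed
  qed
qed

lemma hop_diff:
  assumes "0 < a" "f \<in> test_functions" "g \<in> test_functions" "0 < z"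
  shows "hop a (\<lambda>x. f x - g x) z = hop a f z - hop a g z"
  using test_hk_integrable[OF assms(1,2,4)] test_hk_integrable[OF assms(1,3,4)]
  by (simp add: hop_def left_diff_distrib right_diff_distrib)

lemma hankel_integral_diff:
  assumes l: "l > - 1 / 2" and v: "v = l - 1 / 2 \<or> v = l + 1 / 2"
    and t: "f \<in> test_functions" "g \<in> test_functions" and x: "0 < x"
  shows "hankel_integral l v (\<lambda>y. f y - g y) x = hankel_integral l v f x - hankel_integral l v g x"
  using v
proof
  assume v: "v = l - 1 / 2"
  show ?thesis
    unfolding v hankel_integral_eq_hop[OF l x] using l by (intro hop_diff t x) simp
next
  assume v: "v = l + 1 / 2"
  have m: "f \<in> borel_measurable Rplus" "g \<in> borel_measurable Rplus" "(\<lambda>y. f y - g y) \<in> borel_measurable Rplus"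
    using t test_diff[OF t] by (auto simp: test_functions_def)
  have "hop (l + 3 / 2) (\<lambda>y. f y / y - g y / y) x = hop (l + 3 / 2) (\<lambda>y. f y / y) x - hop (l + 3 / 2) (\<lambda>y. g y / y) x"
    using l by (intro hop_diff test_divide t x) simp
  then show ?thesis
    unfolding v hankel_integral_conj_eq_hop[OF l x m(1)] hankel_integral_conj_eq_hop[OF l x m(2)] hankel_integral_conj_eq_hop[OF l x m(3)]
    by (simp add: diff_divide_distrib right_diff_distrib)
qed

lemma hankel_integral_measurable:
  assumes l: "l > - 1 / 2" and v: "v = l - 1 / 2 \<or> v = l + 1 / 2" and f: "f \<in> borel_measurable Rplus"
  shows "hankel_integral l v f \<in> borel_measurable Rplus"
  using v
proof
  assume v: "v = l - 1 / 2"
  show ?thesis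
    using hop_measurable[OF f] by (rule measurable_cong[THEN iffD1, rotated])
      (simp add: v hankel_integral_eq_hop[OF l])
next
  assume v: "v = l + 1 / 2"
  have id: "(\<lambda>x::real. x) \<in> borel_measurable Rplus"
    by (rule borel_measurable_lebesgue_on_borel) measurable
  have "(\<lambda>x. x * hop (l + 3 / 2) (\<lambda>y. f y / y) x) \<in> borel_measurable Rplus"
    by (intro borel_measurable_times id hop_measurable borel_measurable_divide f)
  then show ?thesis
    by (rule measurable_cong[THEN iffD1, rotated]) (simp add: v hankel_integral_conj_eq_hop[OF l _ f])
qed

lemma hankel_integral_L2:
  assumes l: "l > - 1 / 2" and v: "v = l - 1 / 2 \<or> v = l + 1 / 2" and f: "f \<in> test_functions"
  shows "hankel_integral l v f \<in> L2 l"
proof -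
  obtain p q M where F: "0 < p" "p < q" "0 < M" "\<And>x. 0 < x \<Longrightarrow> f x \<noteq> 0 \<Longrightarrow> p \<le> x \<and> x \<le> q"
    "\<And>x. 0 < x \<Longrightarrow> \<bar>f x\<bar> \<le> M" "f \<in> borel_measurable Rplus"
    using test_functionsE[OF f] by blast
  have "(\<integral>\<^sup>+x. ennreal ((hankel_integral l v f x)\<^sup>2) \<partial>bessel_measure l) \<le> (\<integral>\<^sup>+x. ennreal ((f x)\<^sup>2) \<partial>bessel_measure l)"
    by (rule hankel_integral_L2_bound[OF l v f])
  also have "\<dots> \<le> (\<integral>\<^sup>+x. ennreal M * ennreal \<bar>f x\<bar> \<partial>bessel_measure l)"
  proof (rule nn_integral_mono)
    fix x assume "x \<in> space (bessel_measure l)"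
    then have "\<bar>f x\<bar> \<le> M" using F(5) by simp
    then have "(f x)\<^sup>2 \<le> M * \<bar>f x\<bar>"
      unfolding power2_eq_square by (metis abs_ge_zero abs_mult_self_eq mult_right_mono)
    then show "ennreal ((f x)\<^sup>2) \<le> ennreal M * ennreal \<bar>f x\<bar>"
      using F(3) by (simp add: ennreal_leI flip: ennreal_mult)
  qed
  also have "\<dots> = ennreal M * (\<integral>\<^sup>+x. ennreal \<bar>f x\<bar> \<partial>bessel_measure l)"
    using F(6) by (intro nn_integral_cmult) (simp add: measurable_bessel_measure)
  also have "\<dots> < \<infinity>"
    using test_integrable[OF f, of l] by (simp add: integrable_iff_bounded ennreal_mult_less_top)
  finally show ?thesis
    using hankel_integral_measurable[OF l v F(6)] by (simp add: L2_def)
qed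

lemma hankel_ext:
  assumes l: "l > - 1 / 2" and v: "v = l - 1 / 2 \<or> v = l + 1 / 2" and G: "G \<in> L2 l"
  shows "L2_extension l (hankel_integral l v) G \<in> L2 l"
    and "(\<And>n. g n \<in> test_functions) \<Longrightarrow> L2_tendsto l g G
      \<Longrightarrow> L2_tendsto l (\<lambda>n. hankel_integral l v (g n)) (L2_extension l (hankel_integral l v) G)"
  using L2_extension_props[of "hankel_integral l v" l G] hankel_integral_measurable[OF l v]
    hankel_integral_L2_bound[OF l v] hankel_integral_diff[OF l v] G
  by (auto simp: test_functions_def)

lemma L2_mult_integrable:
  assumes "f \<in> L2 l" "g \<in> L2 l"
  shows "integrable (bessel_measure l) (\<lambda>x. f x * g x)"
proof -
  have fm: "f \<in> borel_measurable (bessel_measure l)" and gm: "g \<in> borel_measurable (bessel_measure l)"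
    using assms by (simp_all add: L2_def measurable_bessel_measure)
  have "integrable (bessel_measure l) (\<lambda>x. (f x)\<^sup>2)" "integrable (bessel_measure l) (\<lambda>x. (g x)\<^sup>2)"
    using assms fm gm by (auto simp: L2_def integrable_iff_bounded)
  then have "integrable (bessel_measure l) (\<lambda>x. (f x)\<^sup>2 + (g x)\<^sup>2)" by (rule Bochner_Integration.integrable_add)
  then show ?thesis
  proof (rule Bochner_Integration.integrable_bound)
    show "(\<lambda>x. f x * g x) \<in> borel_measurable (bessel_measure l)" using fm gm by simp
    have "\<bar>a * b\<bar> \<le> a\<^sup>2 + b\<^sup>2" for a b :: real
    proof -
      have "0 \<le> (\<bar>a\<bar> - \<bar>b\<bar>)\<^sup>2" by simp
      then have "2 * (\<bar>a\<bar> * \<bar>b\<bar>) \<le> a\<^sup>2 + b\<^sup>2" by (simp add: power2_diff)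
      moreover have "0 \<le> \<bar>a\<bar> * \<bar>b\<bar>" by simp
      ultimately show ?thesis unfolding abs_mult by linarith
    qed
    then show "AE x in bessel_measure l. norm (f x * g x) \<le> norm ((f x)\<^sup>2 + (g x)\<^sup>2)" by simp
  qed
qed

text \<open>Cauchy-Schwarz, applied to squares so that the norms stay
  \<open>nn_integral\<close>s.\<close>

lemma L2_pairing_tendsto:
  assumes h: "\<And>n. h n \<in> L2 l" and H: "H \<in> L2 l" and G: "G \<in> L2 l" and lim: "L2_tendsto l h H"
  shows "(\<lambda>n. \<integral>x. h n x * G x \<partial>bessel_measure l) \<longlonglongrightarrow> (\<integral>x. H x * G x \<partial>bessel_measure l)"
proof -
  define m where "m = bessel_measure l"
  have meas: "h n \<in> borel_measurable m" "H \<in> borel_measurable m" "G \<in> borel_measurable m" for n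
    using h H G by (simp_all add: L2_def m_def measurable_bessel_measure)
  define N where "N n = (\<integral>\<^sup>+x. ennreal ((h n x - H x)\<^sup>2) \<partial>m)" for n
  define A where "A = (\<integral>\<^sup>+x. ennreal ((G x)\<^sup>2) \<partial>m)"
  have A: "A \<noteq> \<infinity>" using G by (auto simp: L2_def A_def m_def)
  have le: "ennreal (((\<integral>x. h n x * G x \<partial>m) - (\<integral>x. H x * G x \<partial>m))\<^sup>2) \<le> N n * A" for n
  proof -
    have "(\<integral>x. h n x * G x \<partial>m) - (\<integral>x. H x * G x \<partial>m) = (\<integral>x. (h n x - H x) * G x \<partial>m)"
      unfolding m_def using L2_mult_integrable[OF h G] L2_mult_integrable[OF H G] by (simp add: left_diff_distrib)
    then have "ennreal (((\<integral>x. h n x * G x \<partial>m) - (\<integral>x. H x * G x \<partial>m))\<^sup>2) = (ennreal \<bar>\<integral>x. (h n x - H x) * G x \<partial>m\<bar>)\<^sup>2"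
      by (simp add: ennreal_power)
    also have "\<dots> \<le> (\<integral>\<^sup>+x. ennreal \<bar>(h n x - H x) * G x\<bar> \<partial>m)\<^sup>2"
      by (intro power_mono ennreal_abs_integral_le) simp
    also have "\<dots> = (\<integral>\<^sup>+x. ennreal \<bar>h n x - H x\<bar> * ennreal \<bar>G x\<bar> \<partial>m)\<^sup>2"
      by (simp add: abs_mult ennreal_mult)
    also have "\<dots> \<le> (\<integral>\<^sup>+x. (ennreal \<bar>h n x - H x\<bar>)\<^sup>2 \<partial>m) * (\<integral>\<^sup>+x. (ennreal \<bar>G x\<bar>)\<^sup>2 \<partial>m)"
      using meas by (intro Cauchy_Schwarz_nn_integral) auto
    finally show ?thesis by (simp add: ennreal_power N_def A_def)
  qed
  have "(\<lambda>n. A * N n) \<longlonglongrightarrow> A * 0"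
    using lim A by (intro ennreal_tendsto_cmult) (simp_all add: L2_tendsto_def N_def m_def less_top)
  then have "(\<lambda>n. N n * A) \<longlonglongrightarrow> 0" by (simp add: mult.commute)
  then have "(\<lambda>n. ennreal (((\<integral>x. h n x * G x \<partial>m) - (\<integral>x. H x * G x \<partial>m))\<^sup>2)) \<longlonglongrightarrow> 0"
    by (rule tendsto_0_le_ennreal) (rule le)
  then have "(\<lambda>n. ((\<integral>x. h n x * G x \<partial>m) - (\<integral>x. H x * G x \<partial>m))\<^sup>2) \<longlonglongrightarrow> 0"
    by (subst (asm) ennreal_tendsto_0_iff) auto
  then have "(\<lambda>n. sqrt (((\<integral>x. h n x * G x \<partial>m) - (\<integral>x. H x * G x \<partial>m))\<^sup>2)) \<longlonglongrightarrow> sqrt 0"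
    by (rule tendsto_real_sqrt)
  then have "(\<lambda>n. (\<integral>x. h n x * G x \<partial>m) - (\<integral>x. H x * G x \<partial>m)) \<longlonglongrightarrow> 0"
    by (simp add: tendsto_rabs_zero_iff)
  then show ?thesis unfolding m_def by (simp add: LIM_zero_iff)
qed

lemma test_in_L2: "f \<in> L2 l" if ft: "f \<in> test_functions"
proof -
  obtain p q M where F: "0 < p" "p < q" "0 < M" "\<And>x. 0 < x \<Longrightarrow> f x \<noteq> 0 \<Longrightarrow> p \<le> x \<and> x \<le> q"
    "\<And>x. 0 < x \<Longrightarrow> \<bar>f x\<bar> \<le> M" "f \<in> borel_measurable Rplus"
    using test_functionsE[OF ft] by blast
  have "integrable (bessel_measure l) (\<lambda>x. (f x)\<^sup>2)"
  proof (rule Bochner_Integration.integrable_bound[OF integrable_mult_left[OF test_integrable[OF ft, of l], of M]])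
    show "AE x in bessel_measure l. norm ((f x)\<^sup>2) \<le> norm (f x * M)"
    proof (rule AE_I2)
      fix x assume "x \<in> space (bessel_measure l)"
      then have "\<bar>f x\<bar> * \<bar>f x\<bar> \<le> \<bar>f x\<bar> * M" using F(5) by (intro mult_left_mono) auto
      then show "norm ((f x)\<^sup>2) \<le> norm (f x * M)" using F(3) by (simp add: power2_eq_square abs_mult)
    qed
  qed (use F(6) in \<open>simp add: measurable_bessel_measure\<close>)
  then show ?thesis using F(6) by (simp add: L2_def integrable_iff_bounded)
qed

text \<open>The constant sequence \<open>f\<close> is admissible in the extension property, and this
  forces the chosen representative to agree almost everywhere with the integral.\<close>

lemma hankel_ae:
  assumes l: "l > - 1 / 2" and ft: "f \<in> test_functions"
  shows "AE x in Rplus. hankel l f x = hop (l + 1 / 2) f x" and "hankel l f \<in> L2 l"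
proof -
  show H: "hankel l f \<in> L2 l"
    unfolding hankel_def by (rule hankel_ext(1)[OF l _ test_in_L2[OF ft]]) simp
  have "L2_tendsto l (\<lambda>n. f) f" by (simp add: L2_tendsto_def)
  then have "L2_tendsto l (\<lambda>n. hankel_integral l (l - 1 / 2) f) (hankel l f)"
    unfolding hankel_def by (intro hankel_ext(2)[OF l _ test_in_L2[OF ft]]) (auto intro: ft)
  then have "(\<integral>\<^sup>+x. ennreal ((hankel_integral l (l - 1 / 2) f x - hankel l f x)\<^sup>2) \<partial>bessel_measure l) = 0"
    by (simp add: L2_tendsto_def LIMSEQ_const_iff)
  moreover have "hankel_integral l (l - 1 / 2) f \<in> borel_measurable (bessel_measure l)" "hankel l f \<in> borel_measurable (bessel_measure l)"
    using hankel_integral_measurable[OF l, of "l - 1 / 2" f] H ft by (simp_all add: measurable_bessel_measure L2_def test_functions_def)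
  ultimately have "AE x in bessel_measure l. hankel_integral l (l - 1 / 2) f x = hankel l f x"
    by (subst (asm) nn_integral_0_iff_AE) auto
  then have "AE x in Rplus. hankel_integral l (l - 1 / 2) f x = hankel l f x"
    by (simp add: AE_bessel_measure)
  then show "AE x in Rplus. hankel l f x = hop (l + 1 / 2) f x"
    using AE_space by eventually_elim (simp add: hankel_integral_eq_hop[OF l])
qed

lemma hk_commute: "hk a x y = hk a y x"
  by (simp add: hk_def mult.commute)

text \<open>The kernel is symmetric, so the transform is its own transpose. On two compact supports
  the kernel is bounded and Fubini's theorem applies.\<close>

lemma hankel_conj_pairing_test:
  assumes l: "l > - 1 / 2" and g: "g \<in> test_functions" and \<psi>: "\<psi> \<in> test_functions"
  shows "(\<integral>x. hankel_integral l (l + 1 / 2) g x * \<psi> x \<partial>bessel_measure l)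
    = (\<integral>z. g z * hankel_integral l (l + 1 / 2) \<psi> z \<partial>bessel_measure l)"
proof -
  define m where "m = bessel_measure l"
  define c where "c = (2::real) powr (- (l + 1 / 2))"
  define k where "k = hk (l + 3 / 2)"
  obtain p q M where f: "0 < p" "p < q" "0 < M" "\<And>x. 0 < x \<Longrightarrow> g x \<noteq> 0 \<Longrightarrow> p \<le> x \<and> x \<le> q"
    "\<And>x. 0 < x \<Longrightarrow> \<bar>g x\<bar> \<le> M" "g \<in> borel_measurable Rplus"
    using test_functionsE[OF g] by blast
  obtain p' q' M' where f': "0 < p'" "p' < q'" "0 < M'" "\<And>x. 0 < x \<Longrightarrow> \<psi> x \<noteq> 0 \<Longrightarrow> p' \<le> x \<and> x \<le> q'"
    "\<And>x. 0 < x \<Longrightarrow> \<bar>\<psi> x\<bar> \<le> M'" "\<psi> \<in> borel_measurable Rplus"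
    using test_functionsE[OF \<psi>] by blast
  have [measurable]: "g \<in> borel_measurable m" "\<psi> \<in> borel_measurable m"
    using f(6) f'(6) by (simp_all add: m_def measurable_bessel_measure)
  have [measurable]: "(\<lambda>x. x) \<in> borel_measurable m"
    unfolding m_def by (rule borel_measurable_bessel_measure) measurable
  have km: "(\<lambda>(z, x). k z x) \<in> borel_measurable (m \<Otimes>\<^sub>M m)"
    unfolding m_def k_def by (rule hk_measurable)
  note [measurable] = km
  define C where "C = bes (l + 3 / 2) ((q * q' / 2)\<^sup>2)"
  have K: "(\<lambda>(x, y). \<psi> x * x * (y * g y) * k x y) \<in> borel_measurable (m \<Otimes>\<^sub>M m)"
    by measurable
  have le: "\<bar>\<psi> x * x * (y * g y) * k x y\<bar> \<le> (\<bar>\<psi> x\<bar> * (q' * C)) * (\<bar>g y\<bar> * q)"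
    if "x \<in> space m" "y \<in> space m" for x y
  proof (cases "\<psi> x = 0 \<or> g y = 0")
    case False
    from that have x: "0 < x" and y: "0 < y" by (simp_all add: m_def)
    have xq: "x \<le> q'" and yq: "y \<le> q" using f(4)[OF y] f'(4)[OF x] False by auto
    have "\<bar>k x y\<bar> \<le> C"
      unfolding k_def C_def using l by (intro hk_bound_const y yq x xq) simp
    then have "(\<bar>\<psi> x\<bar> * x) * (y * \<bar>g y\<bar>) * \<bar>k x y\<bar> \<le> (\<bar>\<psi> x\<bar> * q') * (q * \<bar>g y\<bar>) * C"
      using x y xq yq by (intro mult_mono) auto
    then show ?thesis using x y by (simp add: abs_mult mult_ac)
  qed auto
  have i1: "integrable m (\<lambda>x. \<bar>\<psi> x\<bar> * (q' * C))"
    unfolding m_def using test_integrable[OF \<psi>, of l] by auto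
  have i2: "integrable m (\<lambda>y. \<bar>g y\<bar> * q)"
    unfolding m_def using test_integrable[OF g, of l] by auto
  have sf: "sigma_finite_measure m" unfolding m_def by (rule sigma_finite_bessel_measure)
  have F: "(\<integral>x. (\<integral>y. \<psi> x * x * (y * g y) * k x y \<partial>m) \<partial>m) = (\<integral>y. (\<integral>x. \<psi> x * x * (y * g y) * k x y \<partial>m) \<partial>m)"
    by (rule dominated_Fubini(1)[OF sf sf K i1 i2 le])
  have "(\<integral>x. hankel_integral l (l + 1 / 2) g x * \<psi> x \<partial>m) = (\<integral>x. c * (\<integral>y. \<psi> x * x * (y * g y) * k x y \<partial>m) \<partial>m)"
  proof (rule Bochner_Integration.integral_cong)
    fix x assume "x \<in> space m"
    then have x: "0 < x" by (simp add: m_def)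
    have "(\<integral>y. \<psi> x * x * (y * g y) * k x y \<partial>m) = \<psi> x * x * (\<integral>y. (y * g y) * k x y \<partial>m)"
      by (simp only: mult.assoc integral_mult_right_zero)
    then show "hankel_integral l (l + 1 / 2) g x * \<psi> x = c * (\<integral>y. \<psi> x * x * (y * g y) * k x y \<partial>m)"
      by (simp add: hankel_integral_conj_eq[OF l x] m_def c_def k_def)
  qed simp
  also have "\<dots> = c * (\<integral>y. (\<integral>x. \<psi> x * x * (y * g y) * k x y \<partial>m) \<partial>m)"
    by (simp add: F)
  also have "\<dots> = (\<integral>y. g y * hankel_integral l (l + 1 / 2) \<psi> y \<partial>m)"
    unfolding integral_mult_right_zero[symmetric]
  proof (rule Bochner_Integration.integral_cong)
    fix y assume "y \<in> space m"
    then have y: "0 < y" by (simp add: m_def)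
    have "(\<integral>x. \<psi> x * x * (y * g y) * k x y \<partial>m) = (\<integral>x. (y * g y) * ((x * \<psi> x) * k y x) \<partial>m)"
      by (simp add: k_def hk_commute[of _ y] mult_ac)
    also have "\<dots> = y * g y * (\<integral>x. (x * \<psi> x) * k y x \<partial>m)"
      by (simp only: integral_mult_right_zero)
    finally have e: "(\<integral>x. \<psi> x * x * (y * g y) * k x y \<partial>m) = y * g y * (\<integral>x. (x * \<psi> x) * k y x \<partial>m)" .
    have "(\<integral>x. c * (\<psi> x * x * (y * g y) * k x y) \<partial>m) = c * (y * g y * (\<integral>x. (x * \<psi> x) * k y x \<partial>m))"
      by (simp only: integral_mult_right_zero e)
    then show "(\<integral>x. c * (\<psi> x * x * (y * g y) * k x y) \<partial>m) = g y * hankel_integral l (l + 1 / 2) \<psi> y"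
      by (simp add: hankel_integral_conj_eq[OF l y] m_def c_def k_def)
  qed simp
  finally show ?thesis by (simp add: m_def)
qed

text \<open>The conjugate transform is applied to \<open>hankel l f\<close>, which is in
  \<open>L^2\<close> but need not be a test function, so it is accessible only as a limit. Cutting
  the transform of \<open>f\<close> off to \<open>[1/(n+1), n+1]\<close> gives test functions, for
  which the conjugate transform moves over to \<psi>; both sides then pass to the limit.\<close>

lemma hankel_pairing:
  assumes l: "l > - 1 / 2" and ft: "f \<in> test_functions" and \<psi>: "\<psi> \<in> test_functions"
  shows "(\<integral>x. bessel_riesz l f x * \<psi> x \<partial>bessel_measure l)
    = - (\<integral>z. hop (l + 1 / 2) f z * hankel_integral l (l + 1 / 2) \<psi> z \<partial>bessel_measure l)"
    and "integrable (bessel_measure l) (\<lambda>z. hop (l + 1 / 2) f z * hankel_integral l (l + 1 / 2) \<psi> z)"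
    and "bessel_riesz l f \<in> L2 l"
proof -
  define m where "m = bessel_measure l"
  let ?a = "l + 1 / 2"
  have a: "0 < ?a" using l by simp
  obtain p q M where f: "0 < p" "p < q" "0 < M" "\<And>x. 0 < x \<Longrightarrow> f x \<noteq> 0 \<Longrightarrow> p \<le> x \<and> x \<le> q"
    "\<And>x. 0 < x \<Longrightarrow> \<bar>f x\<bar> \<le> M" "f \<in> borel_measurable Rplus"
    using test_functionsE[OF ft] by blast
  have hm: "hop ?a f \<in> borel_measurable Rplus" by (rule hop_measurable[OF f(6)])
  have hF: "AE x in Rplus. hankel l f x = hop ?a f x" and FL: "hankel l f \<in> L2 l"
    by (rule hankel_ae[OF l ft])+
  have hL: "hop ?a f \<in> L2 l"
  proof -
    have "hankel_integral l (l - 1 / 2) f \<in> L2 l" by (rule hankel_integral_L2[OF l _ ft]) simp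
    moreover have "(\<integral>\<^sup>+x. ennreal ((hankel_integral l (l - 1 / 2) f x)\<^sup>2) \<partial>bessel_measure l)
        = (\<integral>\<^sup>+x. ennreal ((hop ?a f x)\<^sup>2) \<partial>bessel_measure l)"
      by (rule nn_integral_cong) (simp add: hankel_integral_eq_hop[OF l])
    ultimately show ?thesis using hm by (simp add: L2_def)
  qed
  \<comment> \<open>The cut-off is applied to \<open>hop\<close> and not to
    \<open>hankel l f\<close>: the former is an integral and bounded on bounded sets, the latter is
    determined only up to a null set.\<close>
  define g where "g n x = hop ?a f x * indicator {1 / real (Suc n)..real (Suc n)} x" for n x
  have gt: "g n \<in> test_functions" for n
  proof (rule test_functionsI[of _ "2 powr (1 - ?a) * ((\<integral>x. \<bar>f x\<bar> \<partial>m) * bes ?a ((q * real (Suc n) / 2)\<^sup>2))" "1 / real (Suc n)" "real (Suc n)"])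
    have "(indicator {1 / real (Suc n)..real (Suc n)} :: real \<Rightarrow> real) \<in> borel_measurable Rplus"
      by (rule borel_measurable_lebesgue_on_borel) measurable
    then show "g n \<in> borel_measurable Rplus" unfolding g_def using hm by (intro borel_measurable_times)
    fix z :: real assume z: "0 < z"
    define C where "C = bes ?a ((q * real (Suc n) / 2)\<^sup>2)"
    have C0: "0 \<le> C" unfolding C_def by (rule bes_nonneg[OF a]) simp
    have I0: "0 \<le> (\<integral>x. \<bar>f x\<bar> \<partial>m)" by (rule integral_nonneg_AE) simp
    show "\<bar>g n z\<bar> \<le> 2 powr (1 - ?a) * ((\<integral>x. \<bar>f x\<bar> \<partial>m) * bes ?a ((q * real (Suc n) / 2)\<^sup>2))"
      unfolding C_def[symmetric]
    proof (cases "z \<le> real (Suc n)")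
      case True
      have "\<bar>\<integral>x. f x * hk ?a z x \<partial>m\<bar> \<le> (\<integral>x. \<bar>f x * hk ?a z x\<bar> \<partial>m)" by (rule integral_abs_bound)
      also have "\<dots> \<le> (\<integral>x. \<bar>f x\<bar> * C \<partial>m)"
      proof (rule integral_mono)
        show "integrable m (\<lambda>x. \<bar>f x * hk ?a z x\<bar>)"
          unfolding m_def using test_hk_integrable[OF a ft z] by (rule integrable_abs)
        show "integrable m (\<lambda>x. \<bar>f x\<bar> * C)" unfolding m_def using test_integrable[OF ft, of l] by auto
        fix x assume "x \<in> space m"
        then have x: "0 < x" by (simp add: m_def)
        show "\<bar>f x * hk ?a z x\<bar> \<le> \<bar>f x\<bar> * C"
        proof (cases "f x = 0")
          case False
          have "\<bar>hk ?a z x\<bar> \<le> C" unfolding C_def using f(4)[OF x False] by (intro hk_bound_const[OF a x _ z True]) simp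
          then show ?thesis by (simp add: abs_mult mult_left_mono)
        qed simp
      qed
      also have "\<dots> = (\<integral>x. \<bar>f x\<bar> \<partial>m) * C" by simp
      finally have "\<bar>hop ?a f z\<bar> \<le> 2 powr (1 - ?a) * ((\<integral>x. \<bar>f x\<bar> \<partial>m) * C)"
        by (simp add: hop_def abs_mult m_def mult_left_mono)
      then show "\<bar>g n z\<bar> \<le> 2 powr (1 - ?a) * ((\<integral>x. \<bar>f x\<bar> \<partial>m) * C)"
        using C0 I0 by (auto simp: g_def indicator_def)
    qed (use C0 I0 in \<open>auto simp: g_def indicator_def\<close>)
    assume "g n z \<noteq> 0"
    then show "1 / real (Suc n) \<le> z \<and> z \<le> real (Suc n)"
      by (auto simp: g_def indicator_def split: if_splits)
  qed simp
  have gtends: "L2_tendsto l g (hankel l f)"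
    unfolding L2_tendsto_def m_def[symmetric]
  proof -
    have [measurable]: "hop ?a f \<in> borel_measurable m" "hankel l f \<in> borel_measurable m" "g n \<in> borel_measurable m" for n
      using hm FL gt[of n] by (simp_all add: m_def measurable_bessel_measure L2_def test_functions_def)
    have AEm: "AE x in m. hankel l f x = hop ?a f x"
      using hF unfolding m_def AE_bessel_measure .
    have "(\<lambda>n. \<integral>\<^sup>+x. ennreal ((g n x - hankel l f x)\<^sup>2) \<partial>m) \<longlonglongrightarrow> (\<integral>\<^sup>+x. 0 \<partial>m)"
    proof (rule nn_integral_dominated_convergence[where w = "\<lambda>x. ennreal ((hop ?a f x)\<^sup>2)"])
      show "(\<integral>\<^sup>+x. ennreal ((hop ?a f x)\<^sup>2) \<partial>m) < \<infinity>" using hL by (simp add: L2_def m_def)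
      show "AE x in m. ennreal ((g n x - hankel l f x)\<^sup>2) \<le> ennreal ((hop ?a f x)\<^sup>2)" for n
        using AEm by eventually_elim (auto simp: g_def indicator_def)
      show "AE x in m. (\<lambda>n. ennreal ((g n x - hankel l f x)\<^sup>2)) \<longlonglongrightarrow> 0"
        using AEm AE_space
      proof eventually_elim
        case (elim x)
        then have x: "0 < x" by (simp add: m_def)
        obtain N where N: "max x (1 / x) \<le> real N" using real_arch_simple by blast
        have "g n x = hankel l f x" if "N \<le> n" for n
        proof -
          have "x \<le> real (Suc n)" "1 / x \<le> real (Suc n)" using N that by linarith+
          then show ?thesis using x elim by (simp add: g_def indicator_def field_simps)
        qed
        then have "\<forall>\<^sub>F n in sequentially. ennreal ((g n x - hankel l f x)\<^sup>2) = 0"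
          unfolding eventually_sequentially by auto
        then show ?case by (rule tendsto_eventually)
      qed
    qed measurable
    then show "(\<lambda>n. \<integral>\<^sup>+x. ennreal ((g n x - hankel l f x)\<^sup>2) \<partial>m) \<longlonglongrightarrow> 0" by simp
  qed
  have hc: "hankel_conj l (hankel l f) \<in> L2 l"
    unfolding hankel_conj_def by (rule hankel_ext(1)[OF l _ FL]) simp
  have "bessel_riesz l f = (\<lambda>x. - hankel_conj l (hankel l f) x)" by (simp add: fun_eq_iff bessel_riesz_def)
  then show "bessel_riesz l f \<in> L2 l" using hc by (simp add: L2_def)
  have Tg: "L2_tendsto l (\<lambda>n. hankel_integral l (l + 1 / 2) (g n)) (hankel_conj l (hankel l f))"
    unfolding hankel_conj_def by (rule hankel_ext(2)[OF l _ FL gt gtends]) simp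
  have TL: "hankel_integral l (l + 1 / 2) h \<in> L2 l" if "h \<in> test_functions" for h
    by (rule hankel_integral_L2[OF l _ that]) simp
  have lim1: "(\<lambda>n. \<integral>x. hankel_integral l (l + 1 / 2) (g n) x * \<psi> x \<partial>m) \<longlonglongrightarrow> (\<integral>x. hankel_conj l (hankel l f) x * \<psi> x \<partial>m)"
    unfolding m_def by (rule L2_pairing_tendsto[OF TL[OF gt] hc test_in_L2[OF \<psi>] Tg])
  have lim2: "(\<lambda>n. \<integral>x. g n x * hankel_integral l (l + 1 / 2) \<psi> x \<partial>m) \<longlonglongrightarrow> (\<integral>x. hankel l f x * hankel_integral l (l + 1 / 2) \<psi> x \<partial>m)"
    unfolding m_def by (rule L2_pairing_tendsto[OF test_in_L2[OF gt] FL TL[OF \<psi>] gtends])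
  have "(\<integral>x. hankel_conj l (hankel l f) x * \<psi> x \<partial>m) = (\<integral>x. hankel l f x * hankel_integral l (l + 1 / 2) \<psi> x \<partial>m)"
    using LIMSEQ_unique[OF lim1] lim2 unfolding m_def hankel_conj_pairing_test[OF l gt \<psi>] by blast
  also have "\<dots> = (\<integral>x. hop ?a f x * hankel_integral l (l + 1 / 2) \<psi> x \<partial>m)"
  proof (rule integral_cong_AE)
    show "AE x in m. hankel l f x * hankel_integral l (l + 1 / 2) \<psi> x = hop ?a f x * hankel_integral l (l + 1 / 2) \<psi> x"
      using hF unfolding m_def AE_bessel_measure by eventually_elim simp
  qed (use FL hm TL[OF \<psi>] in \<open>auto simp: L2_def m_def measurable_bessel_measure intro!: borel_measurable_times\<close>)
  finally show "(\<integral>x. bessel_riesz l f x * \<psi> x \<partial>bessel_measure l)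
    = - (\<integral>z. hop (l + 1 / 2) f z * hankel_integral l (l + 1 / 2) \<psi> z \<partial>bessel_measure l)"
    by (simp add: bessel_riesz_def m_def)
  show "integrable (bessel_measure l) (\<lambda>z. hop (l + 1 / 2) f z * hankel_integral l (l + 1 / 2) \<psi> z)"
    by (rule L2_mult_integrable[OF hL TL[OF \<psi>]])
qed

section \<open>The kernel of the Riesz transform\<close>

text \<open>For integrands whose inner absolute integral is controlled although they need not have
  an integrable product bound, as happens with the factor
  \<open>s^(-1/2) * exp (- (s * z^2))\<close>.\<close>

lemma Fubini_bounded:
  fixes K :: "'a \<Rightarrow> 'b \<Rightarrow> real"
  assumes "sigma_finite_measure M" "sigma_finite_measure N"
    and K: "(\<lambda>(x, y). K x y) \<in> borel_measurable (M \<Otimes>\<^sub>M N)"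
    and H: "integrable N H"
    and le: "\<And>y. y \<in> space N \<Longrightarrow> (\<integral>\<^sup>+x. ennreal \<bar>K x y\<bar> \<partial>M) \<le> ennreal (H y)"
  shows "(\<integral>x. (\<integral>y. K x y \<partial>N) \<partial>M) = (\<integral>y. (\<integral>x. K x y \<partial>M) \<partial>N)"
proof -
  interpret pair_sigma_finite M N using assms(1,2) by (simp add: pair_sigma_finite_def)
  note [measurable] = K
  have "integrable (M \<Otimes>\<^sub>M N) (\<lambda>(x, y). K x y)"
  proof (rule integrableI_bounded)
    have "(\<integral>\<^sup>+p. ennreal (norm (case p of (x, y) \<Rightarrow> K x y)) \<partial>(M \<Otimes>\<^sub>M N)) = (\<integral>\<^sup>+y. \<integral>\<^sup>+x. ennreal \<bar>K x y\<bar> \<partial>M \<partial>N)"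
      by (subst nn_integral_snd[symmetric]) (auto simp: case_prod_unfold)
    also have "\<dots> \<le> (\<integral>\<^sup>+y. ennreal \<bar>H y\<bar> \<partial>N)"
      by (rule nn_integral_mono) (rule order_trans[OF le], auto intro: ennreal_leI)
    also have "\<dots> < \<infinity>" using H by (simp add: integrable_iff_bounded)
    finally show "(\<integral>\<^sup>+p. ennreal (norm (case p of (x, y) \<Rightarrow> K x y)) \<partial>(M \<Otimes>\<^sub>M N)) < \<infinity>" .
  qed (rule K)
  then show ?thesis by (rule Fubini_integral[symmetric])
qed

lemma nn_integral_subordination:
  assumes z: "0 < z"
  shows "(\<integral>\<^sup>+s. ennreal (s powr (- 1 / 2) * exp (- (s * z\<^sup>2))) \<partial>Rplus) = ennreal (sqrt pi / z)"
proof -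
  have "(\<integral>\<^sup>+s. ennreal (s powr (- 1 / 2) * exp (- (s * z\<^sup>2))) \<partial>Rplus)
      = (\<integral>\<^sup>+s. ennreal (s powr (1 * (1 / 2) - 1) * exp (- (z\<^sup>2 * s powr 1))) \<partial>Rplus)"
    by (rule nn_integral_cong) (simp add: mult.commute)
  also have "\<dots> = ennreal (Gamma (1 / 2) / (\<bar>1\<bar> * (z\<^sup>2) powr (1 / 2)))"
    using z by (intro nn_integral_powr_exp) auto
  also have "(z\<^sup>2) powr (1 / 2) = z" using z by (simp add: powr_half_sqrt)
  finally show ?thesis by (simp add: Gamma_one_half_real)
qed

definition wk' :: "real \<Rightarrow> real \<Rightarrow> real \<Rightarrow> real \<Rightarrow> real"
  where "wk' a s x y = exp (- ((x\<^sup>2 + y\<^sup>2) / (4 * s))) *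
    (bes a ((x * y / (4 * s))\<^sup>2) - y\<^sup>2 / (4 * s) * bes (a + 1) ((x * y / (4 * s))\<^sup>2)) / (2 * s powr (a + 1))"

lemma weber'_bessel_measure:
  assumes l: "l > - 1 / 2" and s: "0 < s"
  shows "has_bochner_integral (bessel_measure l)
    (\<lambda>z. (z\<^sup>2 * exp (- (s * z\<^sup>2))) * hk (l + 1 / 2) z y * hk (l + 3 / 2) z x) (wk' (l + 1 / 2) s x y)"
proof (rule has_bochner_integral_bessel_measure)
  show "(\<lambda>z. (z\<^sup>2 * exp (- (s * z\<^sup>2))) * hk (l + 1 / 2) z y * hk (l + 3 / 2) z x) \<in> borel_measurable Rplus"
    by (rule borel_measurable_lebesgue_on_borel) (unfold hk_def, measurable)
  have *: "- (x / 2)\<^sup>2 * z\<^sup>2 = - (z * x / 2)\<^sup>2" for x z :: real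
    by (simp add: power2_eq_square)
  have e: "(- (y / 2)\<^sup>2 + - (x / 2)\<^sup>2) / s = - ((x\<^sup>2 + y\<^sup>2) / (4 * s))"
    "- (y / 2)\<^sup>2 * - (x / 2)\<^sup>2 / s\<^sup>2 = (x * y / (4 * s))\<^sup>2"
    "- (y / 2)\<^sup>2 / s = - (y\<^sup>2 / (4 * s))"
    using s by (simp_all add: power2_eq_square field_simps)
  have a: "0 < l + 1 / 2" using l by simp
  have "has_bochner_integral Rplus (\<lambda>z. z powr (2 * (l + 1 / 2) + 1) * exp (- (s * z\<^sup>2)) * hk (l + 1 / 2) z y * hk (l + 1 / 2 + 1) z x) (wk' (l + 1 / 2) s x y)"
    using has_bochner_integral_weber'[OF a s, of "- (y / 2)\<^sup>2" "- (x / 2)\<^sup>2"]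
    unfolding * hk_def wk'_def e by simp
  moreover have "l + 1 / 2 + 1 = l + 3 / 2" by simp
  ultimately have 1: "has_bochner_integral Rplus (\<lambda>z. z powr (2 * (l + 1 / 2) + 1) * exp (- (s * z\<^sup>2)) * hk (l + 1 / 2) z y * hk (l + 3 / 2) z x) (wk' (l + 1 / 2) s x y)"
    by (simp only:)
  show "has_bochner_integral Rplus (\<lambda>z. z powr (2 * l) * ((z\<^sup>2 * exp (- (s * z\<^sup>2))) * hk (l + 1 / 2) z y * hk (l + 3 / 2) z x)) (wk' (l + 1 / 2) s x y)"
  proof (rule has_bochner_integral_cong[THEN iffD1, OF refl _ refl 1])
    fix z assume "z \<in> space Rplus"
    then have z: "0 < z" by simp
    have "2 * (l + 1 / 2) + 1 = 2 * l + 2" by simp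
    then have "z powr (2 * (l + 1 / 2) + 1) = z powr (2 * l) * z\<^sup>2" using z by (simp add: powr_add)
    then show "z powr (2 * (l + 1 / 2) + 1) * exp (- (s * z\<^sup>2)) * hk (l + 1 / 2) z y * hk (l + 3 / 2) z x
      = z powr (2 * l) * ((z\<^sup>2 * exp (- (s * z\<^sup>2))) * hk (l + 1 / 2) z y * hk (l + 3 / 2) z x)" by simp
  qed
qed

lemma test_times_ident: "(\<lambda>x. x * f x) \<in> test_functions" if ft: "f \<in> test_functions"
proof -
  obtain p q M where f: "0 < p" "p < q" "0 < M" "\<And>x. 0 < x \<Longrightarrow> f x \<noteq> 0 \<Longrightarrow> p \<le> x \<and> x \<le> q"
    "\<And>x. 0 < x \<Longrightarrow> \<bar>f x\<bar> \<le> M" "f \<in> borel_measurable Rplus"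
    using test_functionsE[OF ft] by blast
  have "(\<lambda>x. x * f x) \<in> borel_measurable Rplus"
    using f(6) borel_measurable_lebesgue_on_borel[of "\<lambda>x. x"] by (intro borel_measurable_times) auto
  then show ?thesis
  proof (rule test_functionsI[of _ "q * M" p q])
    fix x :: real assume x: "0 < x"
    show "\<bar>x * f x\<bar> \<le> q * M"
    proof (cases "f x = 0")
      case False
      then show ?thesis using f(4)[OF x False] f(5)[OF x] x by (auto simp: abs_mult intro!: mult_mono)
    qed (use f in auto)
  qed (use f in auto)
qed

text \<open>The conjugate transform carries one factor \<open>z\<close> and the damping another, so
  the weight is \<open>z^2 * exp (- (s * z^2))\<close>, the one of the mixed Weber integral. The
  constant is \<open>2^(1 - a) * 2^(-a) = 2^(-2\<lambda>)\<close> for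
  \<open>a = \<lambda> + 1/2\<close>.\<close>

lemma hankel_pairing_heat:
  assumes l: "l > - 1 / 2" and ft: "f \<in> test_functions" and \<psi>: "\<psi> \<in> test_functions" and s: "0 < s"
  shows "(\<integral>z. z * exp (- (s * z\<^sup>2)) * (hop (l + 1 / 2) f z * hankel_integral l (l + 1 / 2) \<psi> z) \<partial>bessel_measure l)
    = 2 powr (- 2 * l) * (\<integral>y. f y * (\<integral>x. (x * \<psi> x) * wk' (l + 1 / 2) s x y \<partial>bessel_measure l) \<partial>bessel_measure l)"
proof -
  define m where "m = bessel_measure l"
  let ?a = "l + 1 / 2"
  have a: "0 < ?a" "0 < l + 3 / 2" using l by simp_all
  obtain p q M where f: "0 < p" "p < q" "0 < M" "\<And>x. 0 < x \<Longrightarrow> f x \<noteq> 0 \<Longrightarrow> p \<le> x \<and> x \<le> q"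
    "\<And>x. 0 < x \<Longrightarrow> \<bar>f x\<bar> \<le> M" "f \<in> borel_measurable Rplus"
    using test_functionsE[OF ft] by blast
  obtain p' q' M' where f': "0 < p'" "p' < q'" "0 < M'" "\<And>x. 0 < x \<Longrightarrow> x * \<psi> x \<noteq> 0 \<Longrightarrow> p' \<le> x \<and> x \<le> q'"
    "\<And>x. 0 < x \<Longrightarrow> \<bar>x * \<psi> x\<bar> \<le> M'" "(\<lambda>x. x * \<psi> x) \<in> borel_measurable Rplus"
    using test_functionsE[OF test_times_ident[OF \<psi>]] by blast
  have sf: "sigma_finite_measure m" unfolding m_def by (rule sigma_finite_bessel_measure)
  have fi: "integrable m f" unfolding m_def by (rule test_integrable[OF ft])
  have gi: "integrable m (\<lambda>x. x * \<psi> x)" unfolding m_def by (rule test_integrable[OF test_times_ident[OF \<psi>]])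
  define w where "w = (\<lambda>z::real. z\<^sup>2 * exp (- (s * z\<^sup>2)))"
  define B1 where "B1 = (\<lambda>z. bes ?a ((q / 2)\<^sup>2 * z\<^sup>2))"
  define B2 where "B2 = (\<lambda>z. bes (l + 3 / 2) ((q' / 2)\<^sup>2 * z\<^sup>2))"
  have k1: "(\<lambda>(z, x). hk ?a z x) \<in> borel_measurable (m \<Otimes>\<^sub>M m)"
    and k2: "(\<lambda>(z, x). hk (l + 3 / 2) z x) \<in> borel_measurable (m \<Otimes>\<^sub>M m)"
    unfolding m_def by (rule hk_measurable)+
  have wm: "w \<in> borel_measurable m" unfolding m_def w_def by (rule borel_measurable_bessel_measure) measurable
  have w0: "0 \<le> w z" for z by (simp add: w_def)
  have b1: "\<bar>hk ?a z x\<bar> \<le> B1 z" if "z \<in> space m" "x \<in> space m" "f x \<noteq> 0" for z x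
    unfolding B1_def using that f(4)[of x] a by (intro hk_bound) (auto simp: m_def)
  have b2: "\<bar>hk (l + 3 / 2) z x\<bar> \<le> B2 z" if "z \<in> space m" "x \<in> space m" "x * \<psi> x \<noteq> 0" for z x
    unfolding B2_def using that f'(4)[of x] a by (intro hk_bound) (auto simp: m_def)
  have nn: "0 \<le> B1 z" "0 \<le> B2 z" for z
    unfolding B1_def B2_def using a by (auto intro!: bes_nonneg)
  have iB: "integrable m (\<lambda>z. w z * B1 z * B2 z)"
  proof -
    have "has_bochner_integral m (\<lambda>z. w z * B1 z * B2 z)
      (exp (((q / 2)\<^sup>2 + (q' / 2)\<^sup>2) / s) * (bes ?a ((q / 2)\<^sup>2 * (q' / 2)\<^sup>2 / s\<^sup>2) + (q / 2)\<^sup>2 / s * bes (?a + 1) ((q / 2)\<^sup>2 * (q' / 2)\<^sup>2 / s\<^sup>2)) / (2 * s powr (?a + 1)))"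
      unfolding m_def
    proof (rule has_bochner_integral_bessel_measure)
      show "(\<lambda>z. w z * B1 z * B2 z) \<in> borel_measurable Rplus"
        by (rule borel_measurable_lebesgue_on_borel) (unfold w_def B1_def B2_def, measurable)
      show "has_bochner_integral Rplus (\<lambda>z. z powr (2 * l) * (w z * B1 z * B2 z))
        (exp (((q / 2)\<^sup>2 + (q' / 2)\<^sup>2) / s) * (bes ?a ((q / 2)\<^sup>2 * (q' / 2)\<^sup>2 / s\<^sup>2) + (q / 2)\<^sup>2 / s * bes (?a + 1) ((q / 2)\<^sup>2 * (q' / 2)\<^sup>2 / s\<^sup>2)) / (2 * s powr (?a + 1)))"
      proof (rule has_bochner_integral_cong[THEN iffD1, OF refl _ refl has_bochner_integral_weber'[OF a(1) s]])
        fix z assume "z \<in> space Rplus"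
        then have z: "0 < z" by simp
        have "2 * ?a + 1 = 2 * l + 2" by simp
        then have "z powr (2 * ?a + 1) = z powr (2 * l) * z\<^sup>2" using z by (simp add: powr_add)
        moreover have "?a + 1 = l + 3 / 2" by simp
        ultimately show "z powr (2 * ?a + 1) * exp (- (s * z\<^sup>2)) * bes ?a ((q / 2)\<^sup>2 * z\<^sup>2) * bes (?a + 1) ((q' / 2)\<^sup>2 * z\<^sup>2)
          = z powr (2 * l) * (w z * B1 z * B2 z)"
          unfolding w_def B1_def B2_def by (simp only: mult.assoc)
      qed
    qed
    then show ?thesis by (simp add: has_bochner_integral_iff)
  qed
  have W: "(\<integral>z. w z * hk ?a z y * hk (l + 3 / 2) z x \<partial>m) = wk' ?a s x y" for x y
    using weber'_bessel_measure[OF l s, of y x] unfolding m_def w_def by (simp add: has_bochner_integral_iff)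
  have T: "(\<integral>z. w z * (\<integral>y. f y * hk ?a z y \<partial>m) * (\<integral>x. (x * \<psi> x) * hk (l + 3 / 2) z x \<partial>m) \<partial>m)
      = (\<integral>y. f y * (\<integral>x. (x * \<psi> x) * wk' ?a s x y \<partial>m) \<partial>m)"
    using triple_Fubini(1)[OF sf sf fi gi k1 k2 wm w0 b1 b2 iB nn] unfolding W .
  have "(\<integral>z. z * exp (- (s * z\<^sup>2)) * (hop ?a f z * hankel_integral l (l + 1 / 2) \<psi> z) \<partial>m)
    = (\<integral>z. 2 powr (- 2 * l) * (w z * (\<integral>y. f y * hk ?a z y \<partial>m) * (\<integral>x. (x * \<psi> x) * hk (l + 3 / 2) z x \<partial>m)) \<partial>m)"
  proof (rule Bochner_Integration.integral_cong)
    fix z assume "z \<in> space m"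
    then have z: "0 < z" by (simp add: m_def)
    have "(2::real) powr (1 - ?a) * 2 powr (- ?a) = 2 powr (- 2 * l)" by (simp flip: powr_add)
    then show "z * exp (- (s * z\<^sup>2)) * (hop ?a f z * hankel_integral l (l + 1 / 2) \<psi> z)
      = 2 powr (- 2 * l) * (w z * (\<integral>y. f y * hk ?a z y \<partial>m) * (\<integral>x. (x * \<psi> x) * hk (l + 3 / 2) z x \<partial>m))"
      unfolding hankel_integral_conj_eq[OF l z] hop_def w_def m_def[symmetric]
      by (simp add: m_def power2_eq_square mult_ac)
  qed simp
  also have "\<dots> = 2 powr (- 2 * l) * (\<integral>y. f y * (\<integral>x. (x * \<psi> x) * wk' ?a s x y \<partial>m) \<partial>m)"
    by (simp only: integral_mult_right_zero T)
  finally show ?thesis by (simp add: m_def)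
qed

lemma measurable_pair_Rplus_bessel:
  assumes "(\<lambda>(z, x). h z x) \<in> borel_measurable (borel \<Otimes>\<^sub>M borel :: (real \<times> real) measure)"
  shows "(\<lambda>(z, x). h z x) \<in> borel_measurable (Rplus \<Otimes>\<^sub>M bessel_measure r)"
proof -
  have "(\<lambda>p. (fst p, snd p)) \<in> measurable (Rplus \<Otimes>\<^sub>M bessel_measure r) (borel \<Otimes>\<^sub>M borel :: (real \<times> real) measure)"
    by (intro measurable_Pair measurable_compose[OF measurable_fst] measurable_compose[OF measurable_snd]
        borel_measurable_bessel_measure borel_measurable_lebesgue_on_borel) auto
  from measurable_compose[OF this assms] show ?thesis by (simp add: case_prod_unfold)
qed

text \<open>Integrating \<open>|K s z|\<close> over \<open>s\<close> gives exactly
  \<open>sqrt pi * |U z|\<close>, and \<open>U\<close> is integrable as a product of two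
  \<open>L^2\<close> functions. Hence the subordination integral can be moved outside.\<close>

lemma riesz_pairing_heat:
  assumes l: "l > - 1 / 2" and ft: "f \<in> test_functions" and \<psi>: "\<psi> \<in> test_functions"
  shows "(\<integral>x. bessel_riesz l f x * \<psi> x \<partial>bessel_measure l)
    = - (2 powr (- 2 * l) / sqrt pi) * (\<integral>s. s powr (- 1 / 2) *
      (\<integral>y. f y * (\<integral>x. (x * \<psi> x) * wk' (l + 1 / 2) s x y \<partial>bessel_measure l) \<partial>bessel_measure l) \<partial>Rplus)"
proof -
  define m where "m = bessel_measure l"
  define U where "U = (\<lambda>z. hop (l + 1 / 2) f z * hankel_integral l (l + 1 / 2) \<psi> z)"
  have Ui: "integrable m U" unfolding U_def m_def by (rule hankel_pairing(2)[OF l ft \<psi>])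
  define K where "K s z = (z * s powr (- 1 / 2) * exp (- (s * z\<^sup>2))) * U z" for s z
  have sf: "sigma_finite_measure m" unfolding m_def by (rule sigma_finite_bessel_measure)
  have Um: "U \<in> borel_measurable m" using Ui by (rule borel_measurable_integrable)
  have Km: "(\<lambda>(s, z). K s z) \<in> borel_measurable (Rplus \<Otimes>\<^sub>M m)"
  proof -
    have "(\<lambda>(s, z). z * s powr (- 1 / 2) * exp (- (s * z\<^sup>2))) \<in> borel_measurable (Rplus \<Otimes>\<^sub>M m)"
      unfolding m_def by (rule measurable_pair_Rplus_bessel) measurable
    moreover have "(\<lambda>p. U (snd p)) \<in> borel_measurable (Rplus \<Otimes>\<^sub>M m)"
      by (rule measurable_compose[OF measurable_snd Um])
    ultimately have "(\<lambda>p. (case p of (s, z) \<Rightarrow> z * s powr (- 1 / 2) * exp (- (s * z\<^sup>2))) * U (snd p)) \<in> borel_measurable (Rplus \<Otimes>\<^sub>M m)"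
      by (rule borel_measurable_times)
    then show ?thesis by (simp add: K_def case_prod_unfold)
  qed
  have subm: "(\<lambda>s. s powr (- 1 / 2) * exp (- (s * z\<^sup>2))) \<in> borel_measurable Rplus" for z
    by (rule borel_measurable_lebesgue_on_borel) measurable
  have le: "(\<integral>\<^sup>+s. ennreal \<bar>K s z\<bar> \<partial>Rplus) \<le> ennreal (sqrt pi * \<bar>U z\<bar>)" if "z \<in> space m" for z
  proof -
    have z: "0 < z" using that by (simp add: m_def)
    have "(\<integral>\<^sup>+s. ennreal \<bar>K s z\<bar> \<partial>Rplus) = (\<integral>\<^sup>+s. ennreal (z * \<bar>U z\<bar>) * ennreal (s powr (- 1 / 2) * exp (- (s * z\<^sup>2))) \<partial>Rplus)"
      using z by (intro nn_integral_cong) (simp add: K_def abs_mult mult_ac flip: ennreal_mult)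
    also have "\<dots> = ennreal (z * \<bar>U z\<bar>) * ennreal (sqrt pi / z)"
      using subm nn_integral_subordination[OF z] by (subst nn_integral_cmult) auto
    also have "\<dots> = ennreal (sqrt pi * \<bar>U z\<bar>)"
      using z by (simp add: mult_ac flip: ennreal_mult)
    finally show ?thesis by simp
  qed
  have "(\<integral>s. (\<integral>z. K s z \<partial>m) \<partial>Rplus) = (\<integral>z. (\<integral>s. K s z \<partial>Rplus) \<partial>m)"
    using Ui by (intro Fubini_bounded[OF sigma_finite_Rplus sf Km _ le]) auto
  also have "\<dots> = (\<integral>z. sqrt pi * U z \<partial>m)"
  proof (rule Bochner_Integration.integral_cong)
    fix z assume "z \<in> space m"
    then have z: "0 < z" by (simp add: m_def)
    have "(\<integral>s. s powr (- 1 / 2) * exp (- (s * z\<^sup>2)) \<partial>Rplus) = sqrt pi / z"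
      using z nn_integral_subordination[OF z] subm by (subst integral_eq_nn_integral) auto
    moreover have "K s z = (z * U z) * (s powr (- 1 / 2) * exp (- (s * z\<^sup>2)))" for s by (simp add: K_def)
    ultimately show "(\<integral>s. K s z \<partial>Rplus) = sqrt pi * U z" using z by simp
  qed simp
  finally have "(\<integral>z. U z \<partial>m) = (1 / sqrt pi) * (\<integral>s. (\<integral>z. K s z \<partial>m) \<partial>Rplus)" by simp
  also have "(\<integral>s. (\<integral>z. K s z \<partial>m) \<partial>Rplus) = (\<integral>s. 2 powr (- 2 * l) * (s powr (- 1 / 2) *
      (\<integral>y. f y * (\<integral>x. (x * \<psi> x) * wk' (l + 1 / 2) s x y \<partial>m) \<partial>m)) \<partial>Rplus)"
  proof (rule Bochner_Integration.integral_cong)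
    fix s :: real assume "s \<in> space Rplus"
    then have s: "0 < s" by simp
    have "K s z = s powr (- 1 / 2) * (z * exp (- (s * z\<^sup>2)) * U z)" for z by (simp add: K_def)
    then have "(\<integral>z. K s z \<partial>m) = s powr (- 1 / 2) * (\<integral>z. z * exp (- (s * z\<^sup>2)) * U z \<partial>m)" by simp
    then show "(\<integral>z. K s z \<partial>m) = 2 powr (- 2 * l) * (s powr (- 1 / 2) * (\<integral>y. f y * (\<integral>x. (x * \<psi> x) * wk' (l + 1 / 2) s x y \<partial>m) \<partial>m))"
      unfolding U_def m_def hankel_pairing_heat[OF l ft \<psi> s] by simp
  qed simp
  finally show ?thesis
    unfolding hankel_pairing(1)[OF l ft \<psi>] U_def m_def by simp
qed

section \<open>Coefficients of the kernel series and lower bounds for the series\<close>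

definition dcf :: "real \<Rightarrow> nat \<Rightarrow> real"
  where "dcf l k = Gamma (l + 2 + real (2 * k)) * bes_coeff (l + 3 / 2) k / 4 ^ k"

lemma dcf_pos: "0 < dcf l k" if "l > - 1 / 2"
  using that by (auto simp: dcf_def intro!: divide_pos_pos mult_pos_pos Gamma_real_pos bes_coeff_pos)

lemma Gamma_Suc_real: "Gamma (x + 1) = x * Gamma x" if "0 < x" for x :: real
proof -
  have "x \<notin> \<int>\<^sub>\<le>\<^sub>0" using that nonpos_Ints_nonpos[of x] by auto
  then show ?thesis by (rule Gamma_plus1)
qed

text \<open>The ratio of consecutive coefficients is \<open>1 + O(1/k^2)\<close>; this quadratic
  decay is what keeps them between positive constants.\<close>

lemma dcf_Suc:
  assumes l: "l > - 1 / 2"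
  shows "dcf l (Suc k) = dcf l k * (1 + l * (l + 1) / 4 / ((real k + 1) * (real k + l + 3 / 2)))"
proof -
  let ?x = "l + 2 + real (2 * k)"
  have "Gamma (l + 2 + real (2 * Suc k)) = Gamma (?x + 1 + 1)" by (simp add: algebra_simps)
  also have "\<dots> = (?x + 1) * (?x * Gamma ?x)"
    using l by (subst Gamma_Suc_real, simp, subst Gamma_Suc_real) simp_all
  finally have G: "Gamma (l + 2 + real (2 * Suc k)) = (?x + 1) * (?x * Gamma ?x)" .
  have B: "bes_coeff (l + 3 / 2) k = (l + 3 / 2 + real k) * real (Suc k) * bes_coeff (l + 3 / 2) (Suc k)"
    by (rule bes_coeff_Suc)
  have nz: "(l + 3 / 2 + real k) * real (Suc k) \<noteq> 0" using l by auto
  have "bes_coeff (l + 3 / 2) (Suc k) = bes_coeff (l + 3 / 2) k / ((l + 3 / 2 + real k) * real (Suc k))"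
    using nz unfolding B by (simp del: of_nat_Suc)
  then have "dcf l (Suc k) = dcf l k * ((?x + 1) * ?x / (4 * ((l + 3 / 2 + real k) * real (Suc k))))"
    unfolding dcf_def G by (simp add: mult_ac)
  also have "(?x + 1) * ?x / (4 * ((l + 3 / 2 + real k) * real (Suc k)))
      = 1 + l * (l + 1) / 4 / ((real k + 1) * (real k + l + 3 / 2))"
  proof -
    have "(?x + 1) * ?x = 4 * ((l + 3 / 2 + real k) * real (Suc k)) + l * (l + 1)"
      by (simp add: algebra_simps)
    moreover have "(l + 3 / 2 + real k) * real (Suc k) = (real k + 1) * (real k + l + 3 / 2)"
      by (simp add: algebra_simps)
    ultimately show ?thesis using nz by (simp add: add_divide_distrib)
  qed
  finally show ?thesis .
qed

text \<open>Up to the factor \<open>dcf l 0\<close>, the coefficients are partial products of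
  \<open>1 + v k\<close> with \<open>v\<close> absolutely summable. Each factor lies between
  \<open>exp (- 2 * |v k|)\<close> and \<open>exp |v k|\<close>.\<close>

lemma dcf_bounds:
  assumes l: "l > - 1 / 2"
  obtains c1 c2 where "0 < c1" "\<And>k. c1 \<le> dcf l k" "\<And>k. dcf l k \<le> c2"
proof -
  define \<mu> where "\<mu> = l * (l + 1) / 4"
  define v where "v k = \<mu> / ((real k + 1) * (real k + l + 3 / 2))" for k
  have v: "\<bar>v k\<bar> \<le> \<bar>\<mu>\<bar> * (1 / (real k + 1)\<^sup>2)" for k
  proof -
    have "(real k + 1)\<^sup>2 \<le> (real k + 1) * (real k + l + 3 / 2)"
      unfolding power2_eq_square using l by (intro mult_left_mono) auto
    then have "\<bar>\<mu>\<bar> / ((real k + 1) * (real k + l + 3 / 2)) \<le> \<bar>\<mu>\<bar> / (real k + 1)\<^sup>2"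
      using l by (intro divide_left_mono mult_pos_pos) auto
    then show ?thesis using l by (simp add: v_def abs_mult)
  qed
  have sm: "summable (\<lambda>k. 1 / (real k + 1)\<^sup>2)"
  proof -
    have "summable (\<lambda>k. inverse (real (Suc k) ^ 2))"
      using inverse_power_summable[of 2, where ?'a = real] by (subst summable_Suc_iff) simp
    then show ?thesis by (simp add: divide_inverse add.commute)
  qed
  define S where "S = (\<Sum>k. 1 / (real k + 1)\<^sup>2)"
  have Sle: "(\<Sum>k<n. \<bar>v k\<bar>) \<le> \<bar>\<mu>\<bar> * S" for n
  proof -
    have "(\<Sum>k<n. \<bar>v k\<bar>) \<le> (\<Sum>k<n. \<bar>\<mu>\<bar> * (1 / (real k + 1)\<^sup>2))" by (rule sum_mono) (rule v)
    also have "\<dots> \<le> \<bar>\<mu>\<bar> * S"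
      unfolding sum_distrib_left[symmetric] S_def using sm by (intro mult_left_mono sum_le_suminf) auto
    finally show ?thesis .
  qed
  have up: "dcf l n \<le> dcf l 0 * exp (\<Sum>k<n. \<bar>v k\<bar>)" for n
  proof (induction n)
    case (Suc n)
    have "dcf l (Suc n) = dcf l n * (1 + v n)" unfolding v_def \<mu>_def by (rule dcf_Suc[OF l])
    also have "\<dots> \<le> dcf l n * exp \<bar>v n\<bar>"
    proof (rule mult_left_mono)
      show "1 + v n \<le> exp \<bar>v n\<bar>" using exp_ge_add_one_self[of "\<bar>v n\<bar>"] by linarith
    qed (use dcf_pos[OF l, of n] in simp)
    also have "\<dots> \<le> (dcf l 0 * exp (\<Sum>k<n. \<bar>v k\<bar>)) * exp \<bar>v n\<bar>"
      by (intro mult_right_mono Suc) simp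
    finally show ?case by (simp add: exp_add mult_ac)
  qed simp
  \<comment> \<open>For negative \<lambda> also \<open>v k\<close> is negative. Then
    \<open>|\<mu>| \<le> 1/4\<close> keeps \<open>|v k|\<close> below \<open>1/2\<close>, where
    \<open>(1 - u) (1 + 2u) \<ge> 1\<close>.\<close>
  have v1: "exp (- 2 * \<bar>v k\<bar>) \<le> 1 + v k" for k
  proof (cases "0 \<le> l")
    case True
    then have "0 \<le> v k" by (simp add: v_def \<mu>_def)
    moreover have "exp (- 2 * \<bar>v k\<bar>) \<le> 1" by simp
    ultimately show ?thesis by linarith
  next
    case False
    have "\<bar>l * (l + 1)\<bar> \<le> 1 * 1" unfolding abs_mult using False l by (intro mult_mono) auto
    then have "\<bar>\<mu>\<bar> \<le> 1 / 4" by (simp add: \<mu>_def)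
    moreover have "1 / (real k + 1)\<^sup>2 \<le> 1" by (simp add: divide_le_eq_1 one_le_power)
    ultimately have "\<bar>\<mu>\<bar> * (1 / (real k + 1)\<^sup>2) \<le> 1 / 4 * 1" by (intro mult_mono) auto
    then have a: "\<bar>v k\<bar> \<le> 1 / 2" using v[of k] by linarith
    have "1 + 2 * \<bar>v k\<bar> \<le> exp (2 * \<bar>v k\<bar>)" by (rule exp_ge_add_one_self)
    moreover have "1 \<le> (1 - \<bar>v k\<bar>) * (1 + 2 * \<bar>v k\<bar>)"
      using mult_left_mono[OF a, of "\<bar>v k\<bar>"] by (simp add: algebra_simps)
    ultimately have "1 \<le> (1 - \<bar>v k\<bar>) * exp (2 * \<bar>v k\<bar>)"
      using a by (elim order_trans) (intro mult_left_mono, auto)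
    then have "exp (- 2 * \<bar>v k\<bar>) \<le> 1 - \<bar>v k\<bar>" by (simp add: exp_minus field_simps)
    then show ?thesis by linarith
  qed
  have lo: "dcf l 0 * exp (- 2 * (\<Sum>k<n. \<bar>v k\<bar>)) \<le> dcf l n" for n
  proof (induction n)
    case (Suc n)
    have "dcf l 0 * exp (- 2 * (\<Sum>k<Suc n. \<bar>v k\<bar>)) = (dcf l 0 * exp (- 2 * (\<Sum>k<n. \<bar>v k\<bar>))) * exp (- 2 * \<bar>v n\<bar>)"
      by (simp add: distrib_left exp_diff exp_minus divide_inverse)
    also have "\<dots> \<le> dcf l n * (1 + v n)"
      using dcf_pos[OF l, of n] by (intro mult_mono Suc v1) auto
    also have "\<dots> = dcf l (Suc n)" unfolding v_def \<mu>_def by (rule dcf_Suc[OF l, symmetric])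
    finally show ?case .
  qed simp
  show thesis
  proof (rule that[of "dcf l 0 * exp (- 2 * (\<bar>\<mu>\<bar> * S))" "dcf l 0 * exp (\<bar>\<mu>\<bar> * S)"])
    show "0 < dcf l 0 * exp (- 2 * (\<bar>\<mu>\<bar> * S))" using dcf_pos[OF l] by simp
    fix k
    have "dcf l 0 * exp (- 2 * (\<bar>\<mu>\<bar> * S)) \<le> dcf l 0 * exp (- 2 * (\<Sum>k<k. \<bar>v k\<bar>))"
      using Sle[of k] dcf_pos[OF l, of 0] by (intro mult_left_mono) auto
    then show "dcf l 0 * exp (- 2 * (\<bar>\<mu>\<bar> * S)) \<le> dcf l k" using lo[of k] by linarith
    have "dcf l 0 * exp (\<Sum>k<k. \<bar>v k\<bar>) \<le> dcf l 0 * exp (\<bar>\<mu>\<bar> * S)"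
      using Sle[of k] dcf_pos[OF l, of 0] by (intro mult_left_mono) auto
    then show "dcf l k \<le> dcf l 0 * exp (\<bar>\<mu>\<bar> * S)" using up[of k] by linarith
  qed
qed

lemma summable_dcf:
  assumes l: "l > - 1 / 2" and \<rho>: "0 \<le> \<rho>" "\<rho> < 1" and c: "\<And>k. \<bar>c k\<bar> \<le> C"
  shows "summable (\<lambda>k. dcf l k * \<rho> ^ k * c k)"
proof -
  obtain c1 c2 where c2: "0 < c1" "\<And>k. c1 \<le> dcf l k" "\<And>k. dcf l k \<le> c2" using dcf_bounds[OF l] by metis
  have "summable (\<lambda>k. c2 * C * \<rho> ^ k)" using \<rho> by (intro summable_mult[OF summable_geometric]) auto
  then show ?thesis
  proof (rule summable_comparison_test'[of _ 0])
    fix k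
    have "norm (dcf l k * \<rho> ^ k * c k) = dcf l k * \<bar>c k\<bar> * \<rho> ^ k"
      using dcf_pos[OF l, of k] \<rho> by (simp add: abs_mult)
    also have "\<dots> \<le> c2 * C * \<rho> ^ k"
      using dcf_pos[OF l, of k] c2(3)[of k] c[of k] \<rho> by (intro mult_right_mono mult_mono) auto
    finally show "norm (dcf l k * \<rho> ^ k * c k) \<le> c2 * C * \<rho> ^ k" .
  qed
qed

text \<open>The series of \<open>Kern\<close> below with \<open>\<lambda>\<close> replaced by \<open>- \<bar>\<lambda>\<bar>\<close>: at \<open>t = \<bar>\<tau>\<bar>\<close> it bounds the kernel from below
  on both sides of the diagonal.\<close>

definition Lser :: "real \<Rightarrow> real \<Rightarrow> real"
  where "Lser l t = (\<Sum>k. dcf l k * (1 - t\<^sup>2) ^ k * (t - \<bar>l\<bar> / (l + 1 + 2 * real k)))"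

text \<open>Once \<open>t\<close> reaches \<open>|\<lambda>| / (\<lambda> + 1)\<close>, the brackets
  are all nonnegative, the first being the smallest, and the term \<open>k = 0\<close> alone is a
  lower bound.\<close>

lemma Lser_far:
  assumes l: "l > - 1 / 2" and t: "\<bar>l\<bar> / (l + 1) \<le> t" "0 < t" "t < 1"
  shows "dcf l 0 * (t - \<bar>l\<bar> / (l + 1)) \<le> Lser l t"
proof -
  have \<rho>: "0 \<le> 1 - t\<^sup>2" "1 - t\<^sup>2 < 1" using t by (auto simp: power_le_one)
  have le: "\<bar>l\<bar> / (l + 1 + 2 * real k) \<le> \<bar>l\<bar> / (l + 1)" for k
    using l by (intro divide_left_mono) auto
  have "summable (\<lambda>k. dcf l k * (1 - t\<^sup>2) ^ k * (t - \<bar>l\<bar> / (l + 1 + 2 * real k)))"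
  proof (rule summable_dcf[OF l \<rho>])
    fix k
    have "0 \<le> \<bar>l\<bar> / (l + 1 + 2 * real k)" using l by simp
    then show "\<bar>t - \<bar>l\<bar> / (l + 1 + 2 * real k)\<bar> \<le> t" using le[of k] t by linarith
  qed
  moreover have "0 \<le> dcf l k * (1 - t\<^sup>2) ^ k * (t - \<bar>l\<bar> / (l + 1 + 2 * real k))" for k
  proof -
    have "0 \<le> t - \<bar>l\<bar> / (l + 1 + 2 * real k)" using le[of k] t by linarith
    then show ?thesis using dcf_pos[OF l, of k] \<rho> by (intro mult_nonneg_nonneg) auto
  qed
  ultimately have "(\<Sum>k\<in>{0}. dcf l k * (1 - t\<^sup>2) ^ k * (t - \<bar>l\<bar> / (l + 1 + 2 * real k))) \<le> Lser l t"
    unfolding Lser_def by (intro sum_le_suminf) auto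
  then show ?thesis by simp
qed

text \<open>The part with \<open>t\<close> is bounded below by a geometric series of size
  \<open>1 / t\<close>, since \<open>1 - \<rho> = t^2\<close>. The part with \<lambda> is at most a
  logarithmic series of size \<open>ln (1 / t)\<close>. For small \<open>t\<close> the first one
  wins.\<close>

lemma Lser_near:
  assumes l: "l > - 1 / 2"
  obtains \<epsilon> c where "0 < \<epsilon>" "\<epsilon> < 1" "0 < c" "\<And>t. 0 < t \<Longrightarrow> t < \<epsilon> \<Longrightarrow> c / t \<le> Lser l t"
proof -
  obtain c1 c2 where c: "0 < c1" "\<And>k. c1 \<le> dcf l k" "\<And>k. dcf l k \<le> c2" using dcf_bounds[OF l] by blast
  have c2: "0 < c2" using c(1) c(2)[of 0] c(3)[of 0] by linarith
  have main: "c1 / t - 2 * \<bar>l\<bar> * c2 * (- ln (t\<^sup>2) / (1 - t\<^sup>2)) \<le> Lser l t" if t: "0 < t" "t < 1" for t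
  proof -
    define \<rho> where "\<rho> = 1 - t\<^sup>2"
    have t2: "t\<^sup>2 < 1" using t by (simp add: power_less_one_iff)
    have \<rho>: "0 < \<rho>" "\<rho> < 1" using t t2 by (auto simp: \<rho>_def)
    have s1: "(\<lambda>k. c1 * t * \<rho> ^ k) sums (c1 / t)"
      using sums_mult[OF geometric_sums[of \<rho>], of "c1 * t"] \<rho> t by (simp add: \<rho>_def power2_eq_square)
    have "(\<lambda>n. - (\<rho> ^ n) / real n) sums ln (1 - \<rho>)" using ln_series'[of "- \<rho>"] \<rho> by simp
    then have "(\<lambda>n. \<rho> ^ n / real n) sums (- ln (1 - \<rho>))" using sums_minus by fastforce
    then have "(\<lambda>n. \<rho> ^ Suc n / real (Suc n)) sums (- ln (1 - \<rho>))"
      by (subst sums_Suc_iff) simp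
    from sums_divide[OF this, of \<rho>] have "(\<lambda>n. \<rho> ^ n / real (Suc n)) sums (- ln (1 - \<rho>) / \<rho>)"
      using \<rho> by simp
    from sums_mult[OF this, of "2 * \<bar>l\<bar> * c2"]
    have s2: "(\<lambda>n. 2 * \<bar>l\<bar> * c2 * (\<rho> ^ n / real (Suc n))) sums (2 * \<bar>l\<bar> * c2 * (- ln (t\<^sup>2) / (1 - t\<^sup>2)))"
      by (simp add: \<rho>_def)
    have s3: "(\<lambda>k. dcf l k * \<rho> ^ k * (t - \<bar>l\<bar> / (l + 1 + 2 * real k))) sums Lser l t"
      unfolding Lser_def \<rho>_def[symmetric]
    proof (rule summable_sums, rule summable_dcf[OF l])
      fix k
      have "0 \<le> \<bar>l\<bar> / (l + 1 + 2 * real k)" "\<bar>l\<bar> / (l + 1 + 2 * real k) \<le> \<bar>l\<bar> / (l + 1)"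
        using l by (auto intro!: divide_left_mono)
      then show "\<bar>t - \<bar>l\<bar> / (l + 1 + 2 * real k)\<bar> \<le> t + \<bar>l\<bar> / (l + 1)" using t by linarith
    qed (use \<rho> in auto)
    have "c1 * t * \<rho> ^ k - 2 * \<bar>l\<bar> * c2 * (\<rho> ^ k / real (Suc k)) \<le> dcf l k * \<rho> ^ k * (t - \<bar>l\<bar> / (l + 1 + 2 * real k))" for k
    proof -
      have "\<bar>l\<bar> / (l + 1 + 2 * real k) \<le> \<bar>l\<bar> / (real (Suc k) / 2)"
        using l by (intro divide_left_mono) auto
      then have 1: "\<bar>l\<bar> / (l + 1 + 2 * real k) \<le> 2 * \<bar>l\<bar> / real (Suc k)" by (simp add: mult.commute)
      have "dcf l k * (\<bar>l\<bar> / (l + 1 + 2 * real k)) \<le> c2 * (2 * \<bar>l\<bar> / real (Suc k))"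
        using l dcf_pos[OF l, of k] c(3)[of k] by (intro mult_mono 1) auto
      moreover have "c1 * t \<le> dcf l k * t" using c(2)[of k] t by simp
      ultimately have "c1 * t - c2 * (2 * \<bar>l\<bar> / real (Suc k)) \<le> dcf l k * (t - \<bar>l\<bar> / (l + 1 + 2 * real k))"
        by (simp add: right_diff_distrib)
      then have "(c1 * t - c2 * (2 * \<bar>l\<bar> / real (Suc k))) * \<rho> ^ k \<le> dcf l k * (t - \<bar>l\<bar> / (l + 1 + 2 * real k)) * \<rho> ^ k"
        using \<rho> by (intro mult_right_mono) auto
      moreover have "c1 * t * \<rho> ^ k - 2 * \<bar>l\<bar> * c2 * (\<rho> ^ k / real (Suc k)) = (c1 * t - c2 * (2 * \<bar>l\<bar> / real (Suc k))) * \<rho> ^ k"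
        by (simp add: left_diff_distrib)
      moreover have "dcf l k * \<rho> ^ k * (t - \<bar>l\<bar> / (l + 1 + 2 * real k)) = dcf l k * (t - \<bar>l\<bar> / (l + 1 + 2 * real k)) * \<rho> ^ k"
        by simp
      ultimately show ?thesis by (simp only:)
    qed
    then show ?thesis by (rule sums_le[OF _ sums_diff[OF s1 s2] s3])
  qed
  \<comment> \<open>The 6 comes from the estimate \<open>log\<close> below; the added 1 keeps
    \<kappa> positive for \<open>\<lambda> = 0\<close>. Below \<open>d\<close> one has
    \<open>\<kappa> * sqrt t \<le> c1 / 2\<close>, so half of \<open>c1 / t\<close>
    survives.\<close>
  define \<kappa> where "\<kappa> = 2 * \<bar>l\<bar> * c2 * 6 + 1"
  have \<kappa>: "0 < \<kappa>" using c2 by (simp add: \<kappa>_def add_nonneg_pos)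
  define d where "d = min (1 / 2) ((c1 / (2 * \<kappa>))\<^sup>2)"
  \<comment> \<open>Since \<open>t^2 = (sqrt t)^4\<close>, the logarithm is four times
    \<open>ln (1 / sqrt t) \<le> 1 / sqrt t\<close>; the denominator
    \<open>1 - t^2 \<ge> 2/3\<close> raises 4 to 6.\<close>
  have log: "t * (- ln (t\<^sup>2) / (1 - t\<^sup>2)) \<le> 6 * sqrt t" if t: "0 < t" "t < 1 / 2" for t :: real
  proof -
    have s: "0 < sqrt t" using t by simp
    have t4: "t\<^sup>2 \<le> 1 / 4" using power_mono[of t "1 / 2" 2] t by (simp add: power2_eq_square)
    have "t\<^sup>2 = (sqrt t) ^ 4" using t by (simp add: power4_eq_xxxx power2_eq_square)
    then have "- ln (t\<^sup>2) = 4 * ln (1 / sqrt t)" using s by (simp add: ln_realpow ln_div)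
    also have "\<dots> \<le> 4 * (1 / sqrt t)" using ln_le_minus_one[of "1 / sqrt t"] s by simp
    finally have 1: "- ln (t\<^sup>2) \<le> 4 * (1 / sqrt t)" .
    have "- ln (t\<^sup>2) / (1 - t\<^sup>2) \<le> (4 * (1 / sqrt t)) / (2 / 3)"
      using 1 t4 s by (intro frac_le) auto
    then have "t * (- ln (t\<^sup>2) / (1 - t\<^sup>2)) \<le> t * ((4 * (1 / sqrt t)) / (2 / 3))"
      using t by (intro mult_left_mono) auto
    also have "\<dots> = 6 * (t / sqrt t)" by simp
    also have "t / sqrt t = sqrt t" using t by (intro real_div_sqrt) simp
    finally show ?thesis .
  qed
  show thesis
  proof (rule that[of d "c1 / 2"])
    show "0 < d" "d < 1" using c(1) \<kappa> by (auto simp: d_def min_def)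
    fix t assume t: "0 < t" "t < d"
    then have t2: "t < 1 / 2" and "t < (c1 / (2 * \<kappa>))\<^sup>2" by (auto simp: d_def)
    then have "sqrt t \<le> c1 / (2 * \<kappa>)"
      using c(1) \<kappa> by (intro real_le_lsqrt) auto
    then have "\<kappa> * sqrt t \<le> c1 / 2" using \<kappa> by (simp add: field_simps)
    moreover have "2 * \<bar>l\<bar> * c2 * (t * (- ln (t\<^sup>2) / (1 - t\<^sup>2))) \<le> 2 * \<bar>l\<bar> * c2 * (6 * sqrt t)"
      using log[OF t(1) t2] c2 by (intro mult_left_mono) auto
    moreover have "2 * \<bar>l\<bar> * c2 * (6 * sqrt t) \<le> \<kappa> * sqrt t"
      using t by (simp add: \<kappa>_def algebra_simps)
    ultimately have "2 * \<bar>l\<bar> * c2 * (- ln (t\<^sup>2) / (1 - t\<^sup>2)) * t \<le> c1 / 2" by (simp only: mult_ac)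
    then have "2 * \<bar>l\<bar> * c2 * (- ln (t\<^sup>2) / (1 - t\<^sup>2)) \<le> c1 / 2 / t" using t(1) by (simp only: pos_le_divide_eq)
    then show "c1 / 2 / t \<le> Lser l t" using main[of t] t t2 by (simp add: field_simps)
  qed (use c in auto)
qed

text \<open>The Taylor coefficients are positive, so monotone convergence allows termwise
  integration; each term is the Gamma integral with \<open>r = -1\<close>. The resulting series
  enters through its sum \<open>S\<close>, to be identified separately for each order.\<close>

lemma nn_integral_inverse_bes:
  assumes \<alpha>: "0 < \<alpha>" and b: "0 < b" and c: "0 < c"
    and S: "(\<lambda>k. bes_coeff \<alpha> k * u ^ (2 * k) * (Gamma (b + real (2 * k)) / c ^ (2 * k))) sums S"
  shows "(\<integral>\<^sup>+s. ennreal (s powr (- b - 1) * exp (- (c / s)) * bes \<alpha> ((u / s)\<^sup>2)) \<partial>Rplus) = ennreal (S / c powr b)"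
proof -
  define F where "F k s = bes_coeff \<alpha> k * u ^ (2 * k) * (s powr (- (b + real (2 * k)) - 1) * exp (- (c / s)))" for k s
  have u0: "0 \<le> u ^ (2 * k)" for k by (simp add: power_mult)
  have F0: "0 \<le> F k s" for k s
    using bes_coeff_pos[OF \<alpha>, of k] u0[of k] by (simp add: F_def)
  have Fs: "(\<lambda>k. F k s) sums (s powr (- b - 1) * exp (- (c / s)) * bes \<alpha> ((u / s)\<^sup>2))" if s: "0 < s" for s
  proof -
    have "F k s = s powr (- b - 1) * exp (- (c / s)) * (bes_coeff \<alpha> k * ((u / s)\<^sup>2) ^ k)" for k
    proof -
      have "s powr (- (b + real (2 * k)) - 1) = s powr (- b - 1) / s ^ (2 * k)"
        using s powr_diff[of s "- b - 1" "real (2 * k)"] powr_realpow[OF s, of "2 * k"] by (simp add: algebra_simps)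
      then show ?thesis by (simp add: F_def power_divide power_mult)
    qed
    then show ?thesis using sums_mult[OF bes_sums[OF \<alpha>]] by simp
  qed
  have m: "(\<lambda>s. s powr (- (b + real (2 * k)) - 1) * exp (- (c / s))) \<in> borel_measurable Rplus" for k
    by (rule borel_measurable_lebesgue_on_borel) measurable
  have "(\<integral>\<^sup>+s. ennreal (s powr (- b - 1) * exp (- (c / s)) * bes \<alpha> ((u / s)\<^sup>2)) \<partial>Rplus) = (\<integral>\<^sup>+s. (\<Sum>k. ennreal (F k s)) \<partial>Rplus)"
  proof (rule nn_integral_cong)
    fix s assume "s \<in> space Rplus"
    then have s: "0 < s" by simp
    show "ennreal (s powr (- b - 1) * exp (- (c / s)) * bes \<alpha> ((u / s)\<^sup>2)) = (\<Sum>k. ennreal (F k s))"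
      using suminf_ennreal_eq[OF F0 Fs[OF s]] by simp
  qed
  also have "\<dots> = (\<Sum>k. \<integral>\<^sup>+s. ennreal (F k s) \<partial>Rplus)"
    using m by (intro nn_integral_suminf) (simp add: F_def)
  also have "\<dots> = (\<Sum>k. ennreal (bes_coeff \<alpha> k * u ^ (2 * k) * (Gamma (b + real (2 * k)) / c ^ (2 * k)) / c powr b))"
  proof (rule suminf_cong)
    fix k
    have bk: "0 < b + real (2 * k)" using b by simp
    have "(\<integral>\<^sup>+s. ennreal (F k s) \<partial>Rplus)
        = ennreal (bes_coeff \<alpha> k * u ^ (2 * k)) * (\<integral>\<^sup>+s. ennreal (s powr (- (b + real (2 * k)) - 1) * exp (- (c / s))) \<partial>Rplus)"
    proof -
      have "(\<integral>\<^sup>+s. ennreal (F k s) \<partial>Rplus) = (\<integral>\<^sup>+s. ennreal (bes_coeff \<alpha> k * u ^ (2 * k)) *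
          ennreal (s powr (- (b + real (2 * k)) - 1) * exp (- (c / s))) \<partial>Rplus)"
        unfolding F_def using bes_coeff_pos[OF \<alpha>, of k] u0[of k]
        by (intro nn_integral_cong ennreal_mult') (simp del: power_mult)
      also have "\<dots> = ennreal (bes_coeff \<alpha> k * u ^ (2 * k)) *
          (\<integral>\<^sup>+s. ennreal (s powr (- (b + real (2 * k)) - 1) * exp (- (c / s))) \<partial>Rplus)"
        by (rule nn_integral_cmult) (rule measurable_compose[OF m measurable_ennreal])
      finally show ?thesis .
    qed
    also have "(\<integral>\<^sup>+s. ennreal (s powr (- (b + real (2 * k)) - 1) * exp (- (c / s))) \<partial>Rplus)
        = (\<integral>\<^sup>+s. ennreal (s powr ((-1) * (b + real (2 * k)) - 1) * exp (- (c * s powr (-1)))) \<partial>Rplus)"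
      by (rule nn_integral_cong) (simp add: powr_minus_divide)
    also have "\<dots> = ennreal (Gamma (b + real (2 * k)) / (\<bar>-1\<bar> * c powr (b + real (2 * k))))"
      by (rule nn_integral_powr_exp[OF bk c]) simp
    also have "c powr (b + real (2 * k)) = c powr b * c ^ (2 * k)"
      using c powr_realpow[OF c, of "2 * k"] by (simp add: powr_add)
    finally show "(\<integral>\<^sup>+s. ennreal (F k s) \<partial>Rplus)
        = ennreal (bes_coeff \<alpha> k * u ^ (2 * k) * (Gamma (b + real (2 * k)) / c ^ (2 * k)) / c powr b)"
      using bes_coeff_pos[OF \<alpha>, of k] u0[of k] Gamma_real_pos[OF bk] c
      by (simp add: mult_ac flip: ennreal_mult)
  qed
  also have "\<dots> = ennreal (S / c powr b)"
  proof (rule suminf_ennreal_eq[OF _ sums_divide[OF S]])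
    fix k
    have "0 < Gamma (b + real (2 * k))" using b by (intro Gamma_real_pos) simp
    then show "0 \<le> bes_coeff \<alpha> k * u ^ (2 * k) * (Gamma (b + real (2 * k)) / c ^ (2 * k)) / c powr b"
      using bes_coeff_pos[OF \<alpha>, of k] u0[of k] c by simp
  qed
  finally show ?thesis .
qed

section \<open>The kernel in closed form\<close>

definition tau :: "real \<Rightarrow> real \<Rightarrow> real"
  where "tau x y = (x\<^sup>2 - y\<^sup>2) / (x\<^sup>2 + y\<^sup>2)"

text \<open>Off the diagonal, the integral over \<open>s\<close> of \<open>s^(-1/2)\<close> times
  \<open>wk'\<close>. Up to the factor \<open>x\<close> and a negative constant it is the kernel of
  the Riesz transform. Apart from homogeneity the heat-time integrals depend on
  \<open>x y / (x^2 + y^2)\<close> only through its square, which is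
  \<open>(1 - \<tau>^2) / 4\<close>.\<close>

definition Kern :: "real \<Rightarrow> real \<Rightarrow> real \<Rightarrow> real"
  where "Kern l x y = (\<Sum>k. dcf l k * (1 - (tau x y)\<^sup>2) ^ k * (tau x y + l / (l + 1 + 2 * real k)))
    * (4 / (x\<^sup>2 + y\<^sup>2)) powr (l + 1) / 4"

lemma tau_props:
  assumes "0 < x" "0 < y"
  shows "1 - (tau x y)\<^sup>2 = 4 * (x * y / (x\<^sup>2 + y\<^sup>2))\<^sup>2" "\<bar>tau x y\<bar> < 1" "tau x y = 0 \<longleftrightarrow> x = y"
    "0 < tau x y \<longleftrightarrow> y < x" "tau y x = - tau x y"
proof -
  have s: "0 < x\<^sup>2 + y\<^sup>2" using assms by (simp add: add_pos_pos)
  show "1 - (tau x y)\<^sup>2 = 4 * (x * y / (x\<^sup>2 + y\<^sup>2))\<^sup>2"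
  proof -
    have *: "(x\<^sup>2 + y\<^sup>2)\<^sup>2 - (x\<^sup>2 - y\<^sup>2)\<^sup>2 = 4 * (x * y)\<^sup>2" by (simp add: power2_eq_square algebra_simps)
    have "1 - (x\<^sup>2 - y\<^sup>2)\<^sup>2 / (x\<^sup>2 + y\<^sup>2)\<^sup>2 = ((x\<^sup>2 + y\<^sup>2)\<^sup>2 - (x\<^sup>2 - y\<^sup>2)\<^sup>2) / (x\<^sup>2 + y\<^sup>2)\<^sup>2"
      using s assms by (simp add: diff_divide_distrib)
    then show ?thesis unfolding * tau_def power_divide by simp
  qed
  have "\<bar>x\<^sup>2 - y\<^sup>2\<bar> < x\<^sup>2 + y\<^sup>2" using assms by (auto simp: abs_if)
  then show "\<bar>tau x y\<bar> < 1" using s by (simp add: tau_def)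
  show "tau x y = 0 \<longleftrightarrow> x = y" using s assms by (auto simp: tau_def)
  have "tau x y = (x - y) * ((x + y) / (x\<^sup>2 + y\<^sup>2))" by (simp add: tau_def power2_eq_square algebra_simps)
  moreover have "0 < (x + y) / (x\<^sup>2 + y\<^sup>2)" using s assms by simp
  ultimately show "0 < tau x y \<longleftrightarrow> y < x" by (simp only: zero_less_mult_iff) auto
  show "tau y x = - tau x y" by (simp add: tau_def add.commute minus_divide_left)
qed

text \<open>
  Both terms of the heat kernel derivative have positive Taylor coefficients, so each can be
  integrated termwise; their difference is the kernel of the Riesz transform.
\<close>

lemma Kern_integral:
  assumes l: "l > - 1 / 2" and x: "0 < x" and y: "0 < y" and xy: "x \<noteq> y"
    and c2: "\<And>k. dcf l k \<le> c2"
  shows "(\<integral>\<^sup>+s. ennreal \<bar>s powr (- 1 / 2) * wk' (l + 1 / 2) s x y\<bar> \<partial>Rplus)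
      \<le> ennreal (c2 / (tau x y)\<^sup>2 * (4 / (x\<^sup>2 + y\<^sup>2)) powr (l + 1))" (is ?le)
    and "(\<integral>s. s powr (- 1 / 2) * wk' (l + 1 / 2) s x y \<partial>Rplus) = Kern l x y" (is ?eq)
proof -
  define \<sigma> where "\<sigma> = x\<^sup>2 + y\<^sup>2"
  define c where "c = \<sigma> / 4"
  define u where "u = x * y / 4"
  define \<rho> where "\<rho> = 1 - (tau x y)\<^sup>2"
  have \<sigma>: "0 < \<sigma>" using x y by (simp add: \<sigma>_def add_pos_pos)
  have c: "0 < c" using \<sigma> by (simp add: c_def)
  have uc: "4 * (u / c)\<^sup>2 = \<rho>" using tau_props(1)[OF x y] by (simp add: \<rho>_def u_def c_def \<sigma>_def)
  have t0: "0 < (tau x y)\<^sup>2" using tau_props(3)[OF x y] xy by simp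
  have "0 \<le> 4 * (u / c)\<^sup>2" by simp
  then have \<rho>: "0 \<le> \<rho>" "\<rho> < 1" unfolding uc using t0 by (simp_all add: \<rho>_def)
  have c20: "0 \<le> c2" using dcf_pos[OF l, of 0] c2[of 0] by linarith
  have la: "0 < l + 1 / 2" "0 < l + 3 / 2" "0 < l + 1" "0 < l + 2" using l by simp_all
  have bca: "bes_coeff (l + 1 / 2) k = (l + 1 / 2 + real k) * bes_coeff (l + 3 / 2) k" for k
  proof -
    have "l + 3 / 2 + real k = l + 1 / 2 + real k + 1" by simp
    then show ?thesis
      unfolding bes_coeff_def by (simp only: rGamma_eq[of "l + 1 / 2 + real k"] times_divide_eq_right)
  qed
  have G: "Gamma (l + 2 + real (2 * k)) = (l + 1 + 2 * real k) * Gamma (l + 1 + real (2 * k))" for k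
    using Gamma_Suc_real[of "l + 1 + real (2 * k)"] l by (simp add: add_ac)
  have \<rho>k: "u ^ (2 * k) / c ^ (2 * k) = \<rho> ^ k / 4 ^ k" for k
  proof -
    have "(u / c)\<^sup>2 = \<rho> / 4" using uc by simp
    then show ?thesis by (simp only: power_divide[symmetric] power_mult)
  qed
  \<comment> \<open>Ratio of the two coefficient sequences. Because
    \<open>2 * e k - 1 = \<lambda> / (\<lambda> + 1 + 2k)\<close>, the combination
    \<open>2 * S1 - (1 - \<tau>) * S2\<close> reached below is the series of
    \<open>Kern\<close>.\<close>
  define e where "e k = (l + 1 / 2 + real k) / (l + 1 + 2 * real k)" for k
  have e: "0 \<le> e k" "e k \<le> 1" for k using l by (auto simp: e_def)
  have E1: "bes_coeff (l + 1 / 2) k * u ^ (2 * k) * (Gamma (l + 1 + real (2 * k)) / c ^ (2 * k)) = dcf l k * \<rho> ^ k * e k" for k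
  proof -
    have "bes_coeff (l + 1 / 2) k * u ^ (2 * k) * (Gamma (l + 1 + real (2 * k)) / c ^ (2 * k))
        = bes_coeff (l + 1 / 2) k * Gamma (l + 1 + real (2 * k)) * (u ^ (2 * k) / c ^ (2 * k))" by simp
    also have "\<dots> = dcf l k * \<rho> ^ k * e k"
      using l unfolding \<rho>k dcf_def G e_def bca by simp
    finally show ?thesis .
  qed
  have E2: "bes_coeff (l + 3 / 2) k * u ^ (2 * k) * (Gamma (l + 2 + real (2 * k)) / c ^ (2 * k)) = dcf l k * \<rho> ^ k * 1" for k
  proof -
    have "bes_coeff (l + 3 / 2) k * u ^ (2 * k) * (Gamma (l + 2 + real (2 * k)) / c ^ (2 * k))
        = bes_coeff (l + 3 / 2) k * Gamma (l + 2 + real (2 * k)) * (u ^ (2 * k) / c ^ (2 * k))" by simp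
    also have "\<dots> = dcf l k * \<rho> ^ k * 1"
      unfolding \<rho>k dcf_def by simp
    finally show ?thesis .
  qed
  define S1 where "S1 = (\<Sum>k. dcf l k * \<rho> ^ k * e k)"
  define S2 where "S2 = (\<Sum>k. dcf l k * \<rho> ^ k * 1)"
  have sum1: "(\<lambda>k. dcf l k * \<rho> ^ k * e k) sums S1"
    unfolding S1_def using e by (intro summable_sums summable_dcf[OF l \<rho>, of _ 1]) (simp add: abs_le_iff add_increasing2)
  have sum2: "(\<lambda>k. dcf l k * \<rho> ^ k * 1) sums S2"
    unfolding S2_def by (intro summable_sums summable_dcf[OF l \<rho>, of _ 1]) simp
  \<comment> \<open>Here \<open>1 - \<rho> = \<tau>^2\<close>, so the uniform coefficient bound sums
    to \<open>c2 / \<tau>^2\<close>.\<close>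
  have geo: "(\<lambda>k. c2 * \<rho> ^ k) sums (c2 / (tau x y)\<^sup>2)"
    using sums_mult[OF geometric_sums[of \<rho>], of c2] \<rho> by (simp add: \<rho>_def)
  have nn: "0 \<le> dcf l k * \<rho> ^ k" for k using dcf_pos[OF l, of k] \<rho> by simp
  have S2b: "0 \<le> S2" "S2 \<le> c2 / (tau x y)\<^sup>2"
  proof -
    show "0 \<le> S2" by (rule sums_le[OF _ sums_zero sum2]) (use nn in simp)
    have "dcf l k * \<rho> ^ k * 1 \<le> c2 * \<rho> ^ k" for k
      using mult_right_mono[OF c2[of k], of "\<rho> ^ k"] \<rho> by simp
    then show "S2 \<le> c2 / (tau x y)\<^sup>2" by (rule sums_le[OF _ sum2 geo])
  qed
  have S1b: "0 \<le> S1" "S1 \<le> S2"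
  proof -
    show "0 \<le> S1" by (rule sums_le[OF _ sums_zero sum1]) (use nn e in simp)
    show "S1 \<le> S2" by (rule sums_le[OF _ sum1 sum2]) (rule mult_left_mono[OF e(2) nn])
  qed
  define A where "A s = s powr (- (l + 1) - 1) * exp (- (c / s)) * bes (l + 1 / 2) ((u / s)\<^sup>2)" for s
  define B where "B s = s powr (- (l + 2) - 1) * exp (- (c / s)) * bes (l + 3 / 2) ((u / s)\<^sup>2)" for s
  have A: "(\<integral>\<^sup>+s. ennreal (A s) \<partial>Rplus) = ennreal (S1 / c powr (l + 1))"
    unfolding A_def by (rule nn_integral_inverse_bes[OF la(1) la(3) c]) (unfold E1, rule sum1)
  have B: "(\<integral>\<^sup>+s. ennreal (B s) \<partial>Rplus) = ennreal (S2 / c powr (l + 2))"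
    unfolding B_def by (rule nn_integral_inverse_bes[OF la(2) la(4) c]) (unfold E2, rule sum2)
  have A0: "0 \<le> A s" and B0: "0 \<le> B s" for s
    unfolding A_def B_def using la by (auto intro!: mult_nonneg_nonneg bes_nonneg)
  have Am: "A \<in> borel_measurable Rplus" "B \<in> borel_measurable Rplus"
    unfolding A_def B_def by (rule borel_measurable_lebesgue_on_borel, measurable)+
  have Ai: "has_bochner_integral Rplus A (S1 / c powr (l + 1))"
    using Am(1) A A0 S1b by (intro has_bochner_integral_nn_integral) auto
  have Bi: "has_bochner_integral Rplus B (S2 / c powr (l + 2))"
    using Am(2) B B0 S2b by (intro has_bochner_integral_nn_integral) auto
  have wk: "s powr (- 1 / 2) * wk' (l + 1 / 2) s x y = 1 / 2 * A s - y\<^sup>2 / 8 * B s" if s: "0 < s" for s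
  proof -
    have p1: "s powr (- 1 / 2) / s powr (l + 1 / 2 + 1) = s powr (- (l + 1) - 1)"
      by (simp flip: powr_diff)
    have p2: "s powr (- (l + 1) - 1) / s = s powr (- (l + 2) - 1)"
      using s powr_diff[of s "- (l + 1) - 1" 1] by simp
    have e1: "(x\<^sup>2 + y\<^sup>2) / (4 * s) = c / s" "x * y / (4 * s) = u / s" "l + 1 / 2 + 1 = l + 3 / 2"
      by (simp_all add: c_def \<sigma>_def u_def)
    define b1 where "b1 = bes (l + 1 / 2) ((u / s)\<^sup>2)"
    define b2 where "b2 = bes (l + 3 / 2) ((u / s)\<^sup>2)"
    have "s powr (- 1 / 2) * wk' (l + 1 / 2) s x y
        = 1 / 2 * ((s powr (- 1 / 2) / s powr (l + 1 / 2 + 1)) * exp (- (c / s)) * b1)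
        - y\<^sup>2 / 8 * (((s powr (- 1 / 2) / s powr (l + 1 / 2 + 1)) / s) * exp (- (c / s)) * b2)"
      unfolding wk'_def e1(1,2) b1_def b2_def e1(3)[symmetric] by (simp add: right_diff_distrib diff_divide_distrib mult_ac)
    then show ?thesis unfolding p1 p2 A_def B_def b1_def b2_def by simp
  qed
  have AB: "has_bochner_integral Rplus (\<lambda>s. 1 / 2 * A s - y\<^sup>2 / 8 * B s)
      (1 / 2 * (S1 / c powr (l + 1)) - y\<^sup>2 / 8 * (S2 / c powr (l + 2)))"
    by (intro has_bochner_integral_diff has_bochner_integral_mult_right Ai Bi)
  have cp: "c powr (l + 2) = c powr (l + 1) * c"
    using c powr_add[of c "l + 1" 1] by (simp add: add_ac)
  \<comment> \<open>Converts the factor \<open>y^2\<close> of the second term into an expression in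
    \<tau>; after that both terms share the power \<open>c^(- \<lambda> - 1)\<close>.\<close>
  have y2: "y\<^sup>2 / 8 / c = (1 - tau x y) / 4"
  proof -
    have "1 - tau x y = (\<sigma> - (x\<^sup>2 - y\<^sup>2)) / \<sigma>"
      using \<sigma> unfolding tau_def \<sigma>_def[symmetric] by (simp add: diff_divide_distrib)
    also have "\<sigma> - (x\<^sup>2 - y\<^sup>2) = 2 * y\<^sup>2" by (simp add: \<sigma>_def)
    finally show ?thesis by (simp add: c_def)
  qed
  have cinv: "(4 / (x\<^sup>2 + y\<^sup>2)) powr (l + 1) = 1 / c powr (l + 1)"
    using \<sigma> by (simp add: c_def \<sigma>_def powr_divide)
  have y28: "y\<^sup>2 / 8 * (S2 / c powr (l + 2)) = (1 - tau x y) / 4 * S2 / c powr (l + 1)"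
  proof -
    have "y\<^sup>2 / 8 * (S2 / c powr (l + 2)) = (y\<^sup>2 / 8 / c) * S2 / c powr (l + 1)" unfolding cp by simp
    then show ?thesis unfolding y2 .
  qed
  have "(\<integral>s. s powr (- 1 / 2) * wk' (l + 1 / 2) s x y \<partial>Rplus) = (\<integral>s. 1 / 2 * A s - y\<^sup>2 / 8 * B s \<partial>Rplus)"
    by (intro Bochner_Integration.integral_cong refl wk) simp
  also have "\<dots> = 1 / 2 * (S1 / c powr (l + 1)) - (1 - tau x y) / 4 * S2 / c powr (l + 1)"
    using has_bochner_integral_integral_eq[OF AB] unfolding y28 .
  also have "\<dots> = (2 * S1 - (1 - tau x y) * S2) * (1 / c powr (l + 1)) / 4"
    by (simp add: diff_divide_distrib left_diff_distrib)
  also have "2 * S1 - (1 - tau x y) * S2 = (\<Sum>k. dcf l k * \<rho> ^ k * (tau x y + l / (l + 1 + 2 * real k)))"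
  proof (rule sums_unique)
    have "dcf l k * \<rho> ^ k * (tau x y + l / (l + 1 + 2 * real k))
        = 2 * (dcf l k * \<rho> ^ k * e k) - (1 - tau x y) * (dcf l k * \<rho> ^ k * 1)" for k
    proof -
      have "tau x y + l / (l + 1 + 2 * real k) = 2 * e k - (1 - tau x y) * 1"
        using l by (simp add: e_def field_simps)
      then show ?thesis by (simp only: right_diff_distrib) (simp only: mult_ac)
    qed
    then show "(\<lambda>k. dcf l k * \<rho> ^ k * (tau x y + l / (l + 1 + 2 * real k))) sums (2 * S1 - (1 - tau x y) * S2)"
      using sums_diff[OF sums_mult[OF sum1, of 2] sums_mult[OF sum2, of "1 - tau x y"]] by simp
  qed
  finally show ?eq unfolding Kern_def cinv \<rho>_def .
  have "(\<integral>\<^sup>+s. ennreal \<bar>s powr (- 1 / 2) * wk' (l + 1 / 2) s x y\<bar> \<partial>Rplus)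
      \<le> (\<integral>\<^sup>+s. ennreal (1 / 2 * A s + y\<^sup>2 / 8 * B s) \<partial>Rplus)"
  proof (rule nn_integral_mono, rule ennreal_leI)
    fix s assume "s \<in> space Rplus"
    then have s: "0 < s" by simp
    have "0 \<le> y\<^sup>2 / 8 * B s" using B0 by simp
    then show "\<bar>s powr (- 1 / 2) * wk' (l + 1 / 2) s x y\<bar> \<le> 1 / 2 * A s + y\<^sup>2 / 8 * B s"
      unfolding wk[OF s] using A0[of s] by linarith
  qed
  also have "\<dots> = ennreal (1 / 2 * (S1 / c powr (l + 1)) + y\<^sup>2 / 8 * (S2 / c powr (l + 2)))"
  proof -
    have "has_bochner_integral Rplus (\<lambda>s. 1 / 2 * A s + y\<^sup>2 / 8 * B s)
      (1 / 2 * (S1 / c powr (l + 1)) + y\<^sup>2 / 8 * (S2 / c powr (l + 2)))"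
      by (intro has_bochner_integral_add has_bochner_integral_mult_right Ai Bi)
    then show ?thesis using A0 B0 by (subst nn_integral_eq_integral) (auto simp: has_bochner_integral_iff)
  qed
  also have "\<dots> \<le> ennreal (c2 / (tau x y)\<^sup>2 * (1 / c powr (l + 1)))"
  proof (rule ennreal_leI)
    have t1: "(1 - tau x y) / 4 \<le> 1 / 2" 
    proof -
      have "- 1 < tau x y" using tau_props(2)[OF x y] by (simp add: abs_less_iff)
      then show ?thesis by simp
    qed
    have "1 / 2 * S1 + (1 - tau x y) / 4 * S2 \<le> 1 / 2 * S2 + 1 / 2 * S2"
      using S1b S2b t1 by (intro add_mono mult_mono) auto
    also have "\<dots> \<le> c2 / (tau x y)\<^sup>2" using S2b by simp
    finally have "(1 / 2 * S1 + (1 - tau x y) / 4 * S2) * (1 / c powr (l + 1)) \<le> c2 / (tau x y)\<^sup>2 * (1 / c powr (l + 1))"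
      by (rule mult_right_mono) simp
    then show "1 / 2 * (S1 / c powr (l + 1)) + y\<^sup>2 / 8 * (S2 / c powr (l + 2)) \<le> c2 / (tau x y)\<^sup>2 * (1 / c powr (l + 1))"
      unfolding y28 by (simp add: distrib_right add_divide_distrib)
  qed
  finally show ?le unfolding cinv .
qed

text \<open>Uniformity away from the diagonal and from \<open>y = 0\<close>. This justifies the
  exchanges of integrals and bounds the kernel on separated supports.\<close>

lemma Kern_bound:
  assumes l: "l > - 1 / 2"
  obtains C where "0 < C" "\<And>x y p t. 0 < x \<Longrightarrow> 0 < p \<Longrightarrow> p \<le> y \<Longrightarrow> 0 < t \<Longrightarrow> t \<le> \<bar>tau x y\<bar> \<Longrightarrow>
    (\<integral>\<^sup>+s. ennreal \<bar>s powr (- 1 / 2) * wk' (l + 1 / 2) s x y\<bar> \<partial>Rplus) \<le> ennreal (C / t\<^sup>2 * (4 / p\<^sup>2) powr (l + 1))"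
proof -
  obtain c1 c2 where c: "0 < c1" "\<And>k. c1 \<le> dcf l k" "\<And>k. dcf l k \<le> c2" using dcf_bounds[OF l] by metis
  have c2: "0 < c2" using c(1) c(2)[of 0] c(3)[of 0] by linarith
  show thesis
  proof (rule that[OF c2])
    fix x y p t :: real assume *: "0 < x" "0 < p" "p \<le> y" "0 < t" "t \<le> \<bar>tau x y\<bar>"
    then have y: "0 < y" and xy: "x \<noteq> y" by (auto simp: tau_def)
    have "c2 / (tau x y)\<^sup>2 \<le> c2 / t\<^sup>2"
      using * c2 power_mono[of t "\<bar>tau x y\<bar>" 2] by (intro divide_left_mono) (auto intro!: mult_pos_pos simp: zero_less_power2)
    moreover have "(4 / (x\<^sup>2 + y\<^sup>2)) powr (l + 1) \<le> (4 / p\<^sup>2) powr (l + 1)"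
    proof (rule powr_mono2)
      have "p\<^sup>2 \<le> x\<^sup>2 + y\<^sup>2" using * power_mono[of p y 2] by (simp add: add_increasing)
      moreover have "0 < x\<^sup>2 + y\<^sup>2" using * by (simp add: add_pos_nonneg)
      ultimately show "4 / (x\<^sup>2 + y\<^sup>2) \<le> 4 / p\<^sup>2" using * by (intro divide_left_mono) auto
    qed (use l in auto)
    ultimately have "c2 / (tau x y)\<^sup>2 * (4 / (x\<^sup>2 + y\<^sup>2)) powr (l + 1) \<le> c2 / t\<^sup>2 * (4 / p\<^sup>2) powr (l + 1)"
      using c2 by (intro mult_mono) auto
    then show "(\<integral>\<^sup>+s. ennreal \<bar>s powr (- 1 / 2) * wk' (l + 1 / 2) s x y\<bar> \<partial>Rplus) \<le> ennreal (c2 / t\<^sup>2 * (4 / p\<^sup>2) powr (l + 1))"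
      using Kern_integral(1)[OF l *(1) y xy c(3)] by (meson ennreal_leI order_trans)
  qed
qed

section \<open>From pairings to pointwise lower bounds for the Riesz transform\<close>

lemma Kern_eq_integral:
  assumes l: "l > - 1 / 2" and "0 < x" "0 < y" "x \<noteq> y"
  shows "(\<integral>s. s powr (- 1 / 2) * wk' (l + 1 / 2) s x y \<partial>Rplus) = Kern l x y"
proof -
  obtain c1 c2 where "0 < c1" "\<And>k. c1 \<le> dcf l k" "\<And>k. dcf l k \<le> c2" using dcf_bounds[OF l] by metis
  then show ?thesis using Kern_integral(2)[OF assms] by blast
qed

lemma wk'_measurable3:
  "(\<lambda>(p, x). h (snd p) x * (fst p powr r * wk' a (fst p) x (snd p))) \<in> borel_measurable ((Rplus \<Otimes>\<^sub>M bessel_measure l) \<Otimes>\<^sub>M bessel_measure l)"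
  if h: "(\<lambda>(y, x). h y x) \<in> borel_measurable (bessel_measure l \<Otimes>\<^sub>M bessel_measure l)"
proof -
  let ?M = "(Rplus \<Otimes>\<^sub>M bessel_measure l) \<Otimes>\<^sub>M bessel_measure l"
  have m1: "(\<lambda>q. fst (fst q)) \<in> borel_measurable ?M"
    by (intro measurable_compose[OF measurable_fst] measurable_compose[OF measurable_fst borel_measurable_lebesgue_on_borel]) auto
  have m2: "(\<lambda>q. snd (fst q)) \<in> borel_measurable ?M"
    by (intro measurable_compose[OF measurable_fst] measurable_compose[OF measurable_snd borel_measurable_bessel_measure]) auto
  have m3: "(\<lambda>q. snd q) \<in> borel_measurable ?M"
    by (intro measurable_compose[OF measurable_snd borel_measurable_bessel_measure]) auto
  have "(\<lambda>q. fst (fst q) powr r * wk' a (fst (fst q)) (snd q) (snd (fst q))) \<in> borel_measurable ?M"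
    unfolding wk'_def using m1 m2 m3 by measurable
  moreover have "(\<lambda>q. h (snd (fst q)) (snd q)) \<in> borel_measurable ?M"
  proof -
    have "(\<lambda>q. (snd (fst q), snd q)) \<in> measurable ?M (bessel_measure l \<Otimes>\<^sub>M bessel_measure l)" by measurable
    from measurable_compose[OF this h] show ?thesis by simp
  qed
  ultimately show ?thesis by (simp add: case_prod_unfold)
qed

text \<open>Separation of the supports makes the integral over \<open>s\<close> absolutely
  convergent, uniformly in \<open>x\<close> and \<open>y\<close>, so it can be exchanged with the
  integral over \<open>y\<close> and then with the one over \<open>x\<close>.\<close>

lemma riesz_kernel:
  assumes l: "l > - 1 / 2" and ft: "f \<in> test_functions" and \<psi>: "\<psi> \<in> test_functions"
    and t0: "0 < t0" and sep: "\<And>x y. 0 < x \<Longrightarrow> 0 < y \<Longrightarrow> f y \<noteq> 0 \<Longrightarrow> \<psi> x \<noteq> 0 \<Longrightarrow> t0 \<le> \<bar>tau x y\<bar>"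
  shows "(\<integral>x. bessel_riesz l f x * \<psi> x \<partial>bessel_measure l)
    = - (2 powr (- 2 * l) / sqrt pi) * (\<integral>y. f y * (\<integral>x. (x * \<psi> x) * Kern l x y \<partial>bessel_measure l) \<partial>bessel_measure l)"
proof -
  define m where "m = bessel_measure l"
  obtain p q M where f: "0 < p" "p < q" "0 < M" "\<And>x. 0 < x \<Longrightarrow> f x \<noteq> 0 \<Longrightarrow> p \<le> x \<and> x \<le> q"
    "\<And>x. 0 < x \<Longrightarrow> \<bar>f x\<bar> \<le> M" "f \<in> borel_measurable Rplus"
    using test_functionsE[OF ft] by blast
  obtain C where C: "0 < C" "\<And>x y p t. 0 < x \<Longrightarrow> 0 < p \<Longrightarrow> p \<le> y \<Longrightarrow> 0 < t \<Longrightarrow> t \<le> \<bar>tau x y\<bar> \<Longrightarrow>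
    (\<integral>\<^sup>+s. ennreal \<bar>s powr (- 1 / 2) * wk' (l + 1 / 2) s x y\<bar> \<partial>Rplus) \<le> ennreal (C / t\<^sup>2 * (4 / p\<^sup>2) powr (l + 1))"
    using Kern_bound[OF l] by blast
  define D where "D = C / t0\<^sup>2 * (4 / p\<^sup>2) powr (l + 1)"
  have D0: "0 \<le> D" using C(1) by (simp add: D_def)
  define g where "g x = x * \<psi> x" for x
  have gt: "g \<in> test_functions" unfolding g_def by (rule test_times_ident[OF \<psi>])
  have gi: "integrable m g" and fi: "integrable m f" unfolding m_def by (rule test_integrable[OF gt], rule test_integrable[OF ft])
  have [measurable]: "g \<in> borel_measurable m" "f \<in> borel_measurable m" using gi fi by auto
  have sf: "sigma_finite_measure m" unfolding m_def by (rule sigma_finite_bessel_measure)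
  interpret m: sigma_finite_measure m by fact
  define h where "h s x y = s powr (- 1 / 2) * wk' (l + 1 / 2) s x y" for s x y
  have hD: "(\<integral>\<^sup>+s. ennreal \<bar>h s x y\<bar> \<partial>Rplus) \<le> ennreal D" if "0 < x" "0 < y" "f y \<noteq> 0" "g x \<noteq> 0" for x y
    unfolding h_def D_def using that f(4)[of y] sep[of x y] t0 f(1) by (intro C(2)) (auto simp: g_def)
  have gh: "(\<integral>\<^sup>+s. ennreal \<bar>g x * h s x y\<bar> \<partial>Rplus) \<le> ennreal (\<bar>g x\<bar> * D)" if "0 < x" "0 < y" "f y \<noteq> 0" for x y
  proof (cases "g x = 0")
    case False
    have hm: "(\<lambda>s. h s x y) \<in> borel_measurable Rplus"
      unfolding h_def wk'_def by (rule borel_measurable_lebesgue_on_borel) measurable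
    have "(\<integral>\<^sup>+s. ennreal \<bar>g x * h s x y\<bar> \<partial>Rplus) = (\<integral>\<^sup>+s. ennreal \<bar>g x\<bar> * ennreal \<bar>h s x y\<bar> \<partial>Rplus)"
      by (simp add: abs_mult ennreal_mult)
    also have "\<dots> = ennreal \<bar>g x\<bar> * (\<integral>\<^sup>+s. ennreal \<bar>h s x y\<bar> \<partial>Rplus)"
      using hm by (intro nn_integral_cmult) auto
    also have "\<dots> \<le> ennreal \<bar>g x\<bar> * ennreal D" using hD[OF that False] by (intro mult_left_mono) auto
    finally show ?thesis using D0 by (simp add: ennreal_mult)
  qed simp
  have m3: "(\<lambda>(p, x). g x * h (fst p) x (snd p)) \<in> borel_measurable ((Rplus \<Otimes>\<^sub>M m) \<Otimes>\<^sub>M m)"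
    unfolding h_def m_def
    by (rule wk'_measurable3[of "\<lambda>y x. g x"]) (use \<open>g \<in> borel_measurable m\<close> in \<open>simp add: m_def case_prod_unfold\<close>)
  define G where "G s y = (\<integral>x. g x * h s x y \<partial>m)" for s y
  have Gm: "(\<lambda>(s, y). G s y) \<in> borel_measurable (Rplus \<Otimes>\<^sub>M m)"
    using m.borel_measurable_lebesgue_integral[OF m3] by (simp add: G_def case_prod_unfold)
  have K1: "(\<lambda>(s, y). f y * G s y) \<in> borel_measurable (Rplus \<Otimes>\<^sub>M m)"
    using Gm by (auto simp: case_prod_unfold intro!: borel_measurable_times)
  have m2: "(\<lambda>(s, x). g x * h s x y) \<in> borel_measurable (Rplus \<Otimes>\<^sub>M m)" if y: "0 < y" for y
  proof -
    have "(\<lambda>q. ((fst q, y), snd q)) \<in> measurable (Rplus \<Otimes>\<^sub>M m) ((Rplus \<Otimes>\<^sub>M m) \<Otimes>\<^sub>M m)"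
      using y by (intro measurable_Pair measurable_fst measurable_snd measurable_const) (simp add: m_def)
    from measurable_compose[OF this m3] show ?thesis by (simp add: case_prod_unfold)
  qed
  interpret R: pair_sigma_finite Rplus m
    using sf sigma_finite_Rplus by (simp add: pair_sigma_finite_def)
  have le1: "(\<integral>\<^sup>+s. ennreal \<bar>f y * G s y\<bar> \<partial>Rplus) \<le> ennreal (\<bar>f y\<bar> * ((\<integral>x. \<bar>g x\<bar> \<partial>m) * D))" if "y \<in> space m" for y
  proof (cases "f y = 0")
    case False
    have y: "0 < y" using that by (simp add: m_def)
    have Gym: "(\<lambda>s. G s y) \<in> borel_measurable Rplus"
      using measurable_compose[OF measurable_Pair2'[OF that] Gm] by simp
    have "(\<integral>\<^sup>+s. ennreal \<bar>f y * G s y\<bar> \<partial>Rplus) = ennreal \<bar>f y\<bar> * (\<integral>\<^sup>+s. ennreal \<bar>G s y\<bar> \<partial>Rplus)"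
      using Gym by (subst nn_integral_cmult[symmetric]) (auto simp: abs_mult ennreal_mult)
    also have "(\<integral>\<^sup>+s. ennreal \<bar>G s y\<bar> \<partial>Rplus) \<le> (\<integral>\<^sup>+s. \<integral>\<^sup>+x. ennreal \<bar>g x * h s x y\<bar> \<partial>m \<partial>Rplus)"
      unfolding G_def by (intro nn_integral_mono ennreal_abs_integral_le)
    also have "\<dots> = (\<integral>\<^sup>+x. \<integral>\<^sup>+s. ennreal \<bar>g x * h s x y\<bar> \<partial>Rplus \<partial>m)"
      using m2[OF y] by (intro R.Fubini'[symmetric]) (simp add: case_prod_unfold)
    also have "\<dots> \<le> (\<integral>\<^sup>+x. ennreal (\<bar>g x\<bar> * D) \<partial>m)"
      using gh y False by (intro nn_integral_mono) (simp add: m_def)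
    also have "\<dots> = ennreal (\<integral>x. \<bar>g x\<bar> * D \<partial>m)"
      using gi D0 by (intro nn_integral_eq_integral) auto
    also have "ennreal \<bar>f y\<bar> * ennreal (\<integral>x. \<bar>g x\<bar> * D \<partial>m) = ennreal (\<bar>f y\<bar> * ((\<integral>x. \<bar>g x\<bar> \<partial>m) * D))"
      using D0 by (subst ennreal_mult[symmetric]) (auto intro!: mult_nonneg_nonneg integral_nonneg_AE)
    finally show ?thesis by (simp add: mult_left_mono)
  qed simp
  have "(\<integral>s. s powr (- 1 / 2) * (\<integral>y. f y * (\<integral>x. (x * \<psi> x) * wk' (l + 1 / 2) s x y \<partial>m) \<partial>m) \<partial>Rplus)
      = (\<integral>s. (\<integral>y. f y * G s y \<partial>m) \<partial>Rplus)"
  proof (rule Bochner_Integration.integral_cong)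
    fix s
    have "G s y = s powr (- 1 / 2) * (\<integral>x. g x * wk' (l + 1 / 2) s x y \<partial>m)" for y
      unfolding G_def h_def by (subst integral_mult_right_zero[symmetric]) (simp add: mult_ac)
    then have "(\<integral>y. f y * G s y \<partial>m) = (\<integral>y. s powr (- 1 / 2) * (f y * (\<integral>x. g x * wk' (l + 1 / 2) s x y \<partial>m)) \<partial>m)"
      by (simp add: mult_ac)
    then show "s powr (- 1 / 2) * (\<integral>y. f y * (\<integral>x. (x * \<psi> x) * wk' (l + 1 / 2) s x y \<partial>m) \<partial>m) = (\<integral>y. f y * G s y \<partial>m)"
      by (simp add: g_def)
  qed simp
  also have "\<dots> = (\<integral>y. (\<integral>s. f y * G s y \<partial>Rplus) \<partial>m)"
    using fi by (intro Fubini_bounded[OF sigma_finite_Rplus sf K1 _ le1]) auto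
  also have "\<dots> = (\<integral>y. f y * (\<integral>x. g x * Kern l x y \<partial>m) \<partial>m)"
  proof (rule Bochner_Integration.integral_cong)
    fix y assume "y \<in> space m"
    then have y: "0 < y" by (simp add: m_def)
    show "(\<integral>s. f y * G s y \<partial>Rplus) = f y * (\<integral>x. g x * Kern l x y \<partial>m)"
    proof (cases "f y = 0")
      case False
      have "(\<integral>s. G s y \<partial>Rplus) = (\<integral>x. (\<integral>s. g x * h s x y \<partial>Rplus) \<partial>m)"
        unfolding G_def
      proof (rule Fubini_bounded[OF sigma_finite_Rplus sf m2[OF y]])
        show "integrable m (\<lambda>x. \<bar>g x\<bar> * D)" using gi by auto
        fix x assume "x \<in> space m"
        then show "(\<integral>\<^sup>+s. ennreal \<bar>g x * h s x y\<bar> \<partial>Rplus) \<le> ennreal (\<bar>g x\<bar> * D)"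
          using gh y False by (simp add: m_def)
      qed
      also have "\<dots> = (\<integral>x. g x * Kern l x y \<partial>m)"
      proof (rule Bochner_Integration.integral_cong)
        fix x assume "x \<in> space m"
        then have x: "0 < x" by (simp add: m_def)
        show "(\<integral>s. g x * h s x y \<partial>Rplus) = g x * Kern l x y"
        proof (cases "g x = 0")
          case g: False
          have "x \<noteq> y" using sep[OF x y False] g t0 by (auto simp: g_def tau_def)
          from Kern_eq_integral[OF l x y this] show ?thesis by (simp add: h_def)
        qed simp
      qed simp
      finally show ?thesis by simp
    qed simp
  qed simp
  finally show ?thesis
    using riesz_pairing_heat[OF l ft \<psi>] unfolding m_def[symmetric] g_def by simp
qed

text \<open>The transform is known only through pairings, so the claim is tested with the indicator
  \<psi> of the set of points of \<open>J\<close> where it fails. There \<open>V\<close> is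
  negative, yet the kernel formula makes the integral of \<open>V * \<psi>\<close> nonnegative;
  hence the set is null.\<close>

lemma riesz_lower_bound:
  assumes l: "l > - 1 / 2" and ft: "f \<in> test_functions" and f0: "\<And>y. 0 < y \<Longrightarrow> 0 \<le> f y"
    and \<epsilon>: "\<epsilon> = 1 \<or> \<epsilon> = - 1"
    and J: "J \<subseteq> {c..d}" "0 < c" "J \<in> sets lebesgue" and \<kappa>: "\<kappa> \<in> borel_measurable borel" "\<And>x. x \<in> J \<Longrightarrow> \<bar>\<kappa> x\<bar> \<le> M"
    and t0: "0 < t0" and sep: "\<And>x y. x \<in> J \<Longrightarrow> 0 < y \<Longrightarrow> f y \<noteq> 0 \<Longrightarrow> t0 \<le> \<bar>tau x y\<bar>"
    and lower: "\<And>x y. x \<in> J \<Longrightarrow> 0 < y \<Longrightarrow> f y \<noteq> 0 \<Longrightarrow> \<kappa> x \<le> \<epsilon> * (x * Kern l x y)"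
  shows "AE x in Rplus. x \<in> J \<longrightarrow> 2 powr (- 2 * l) / sqrt pi * \<kappa> x * (\<integral>y. f y \<partial>bessel_measure l) \<le> \<bar>bessel_riesz l f x\<bar>"
proof -
  define m where "m = bessel_measure l"
  define D where "D = 2 powr (- 2 * l) / sqrt pi"
  have D: "0 < D" by (simp add: D_def)
  define F where "F = (\<integral>y. f y \<partial>m)"
  obtain p q M' where f: "0 < p" "p < q" "0 < M'" "\<And>x. 0 < x \<Longrightarrow> f x \<noteq> 0 \<Longrightarrow> p \<le> x \<and> x \<le> q"
    "\<And>x. 0 < x \<Longrightarrow> \<bar>f x\<bar> \<le> M'" "f \<in> borel_measurable Rplus"
    using test_functionsE[OF ft] by blast
  have fi: "integrable m f" unfolding m_def by (rule test_integrable[OF ft])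
  have RL: "bessel_riesz l f \<in> L2 l" by (rule hankel_pairing(3)[OF l ft ft])
  then have Rm: "bessel_riesz l f \<in> borel_measurable Rplus" by (simp add: L2_def)
  have \<kappa>m: "\<kappa> \<in> borel_measurable Rplus" by (rule borel_measurable_lebesgue_on_borel[OF \<kappa>(1)])
  \<comment> \<open>The sign is \<open>- \<epsilon>\<close> because the kernel formula for the
    pairing carries a minus, while \<epsilon> is the sign of \<open>Kern\<close>.\<close>
  define V where "V x = - \<epsilon> * bessel_riesz l f x - \<kappa> x * D * F" for x
  have Vm: "V \<in> borel_measurable Rplus" unfolding V_def using Rm \<kappa>m by auto
  define S where "S = {x \<in> space Rplus. x \<in> J \<and> V x < 0}"
  have Jp: "J \<in> sets Rplus" using J by (auto simp: sets_restrict_space intro!: image_eqI[of _ _ J])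
  have SS: "S \<in> sets Rplus"
  proof -
    have "{x \<in> space Rplus. V x < 0} \<in> sets Rplus" using Vm by measurable
    moreover have "S = J \<inter> {x \<in> space Rplus. V x < 0}" by (auto simp: S_def)
    ultimately show ?thesis using Jp by auto
  qed
  define \<psi> where "\<psi> = (indicator S :: real \<Rightarrow> real)"
  have \<psi>t: "\<psi> \<in> test_functions"
  proof (rule test_functionsI[of _ 1 c d])
    show "\<psi> \<in> borel_measurable Rplus" unfolding \<psi>_def using SS by (rule borel_measurable_indicator)
  qed (use J in \<open>auto simp: \<psi>_def S_def indicator_def split: if_splits\<close>)
  have \<psi>J: "x \<in> J" if "\<psi> x \<noteq> 0" for x using that by (auto simp: \<psi>_def S_def indicator_def split: if_splits)
  have \<psi>0: "0 \<le> \<psi> x" for x by (simp add: \<psi>_def)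
  have \<kappa>t: "(\<lambda>x. \<kappa> x * \<psi> x) \<in> test_functions"
  proof (rule test_functionsI[of _ "\<bar>M\<bar>" c d])
    show "(\<lambda>x. \<kappa> x * \<psi> x) \<in> borel_measurable Rplus"
      using \<kappa>m \<psi>t by (auto simp: test_functions_def intro!: borel_measurable_times)
    show "\<bar>\<kappa> x * \<psi> x\<bar> \<le> \<bar>M\<bar>" if "0 < x" for x
      using \<kappa>(2)[of x] \<psi>J[of x] by (cases "\<psi> x = 0") (auto simp: \<psi>_def indicator_def split: if_splits)
    show "c \<le> x \<and> x \<le> d" if "0 < x" "\<kappa> x * \<psi> x \<noteq> 0" for x
      using \<psi>J[of x] that J by auto
  qed (use J in simp)
  have \<kappa>i: "integrable m (\<lambda>x. \<kappa> x * \<psi> x)" unfolding m_def by (rule test_integrable[OF \<kappa>t])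
  have Ri: "integrable m (\<lambda>x. bessel_riesz l f x * \<psi> x)" unfolding m_def by (rule L2_mult_integrable[OF RL test_in_L2[OF \<psi>t]])
  define g where "g x = x * \<psi> x" for x
  have gt: "g \<in> test_functions" unfolding g_def by (rule test_times_ident[OF \<psi>t])
  have gi: "integrable m g" unfolding m_def by (rule test_integrable[OF gt])
  have g0: "0 \<le> g x" if "0 < x" for x using that \<psi>0 by (simp add: g_def)
  obtain C where C: "0 < C" "\<And>x y p t. 0 < x \<Longrightarrow> 0 < p \<Longrightarrow> p \<le> y \<Longrightarrow> 0 < t \<Longrightarrow> t \<le> \<bar>tau x y\<bar> \<Longrightarrow>
    (\<integral>\<^sup>+s. ennreal \<bar>s powr (- 1 / 2) * wk' (l + 1 / 2) s x y\<bar> \<partial>Rplus) \<le> ennreal (C / t\<^sup>2 * (4 / p\<^sup>2) powr (l + 1))"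
    using Kern_bound[OF l] by blast
  define B where "B = C / t0\<^sup>2 * (4 / p\<^sup>2) powr (l + 1)"
  have B0: "0 \<le> B" using C(1) by (simp add: B_def)
  have KB: "\<bar>Kern l x y\<bar> \<le> B" if x: "0 < x" and y: "0 < y" and nz: "f y \<noteq> 0" "\<psi> x \<noteq> 0" for x y
  proof -
    have t: "t0 \<le> \<bar>tau x y\<bar>" by (rule sep[OF \<psi>J[OF nz(2)] y nz(1)])
    then have "x \<noteq> y" using t0 by (auto simp: tau_def)
    from Kern_eq_integral[OF l x y this]
    have "Kern l x y = (\<integral>s. s powr (- 1 / 2) * wk' (l + 1 / 2) s x y \<partial>Rplus)" ..
    then have "ennreal \<bar>Kern l x y\<bar> \<le> (\<integral>\<^sup>+s. ennreal \<bar>s powr (- 1 / 2) * wk' (l + 1 / 2) s x y\<bar> \<partial>Rplus)"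
      using ennreal_abs_integral_le by simp
    also have "\<dots> \<le> ennreal B"
      unfolding B_def by (rule C(2)[OF x f(1) _ t0 t]) (use f(4)[OF y nz(1)] in simp)
    finally have "ennreal \<bar>Kern l x y\<bar> \<le> ennreal B" .
    then show ?thesis using B0 by simp
  qed
  have Km: "(\<lambda>(y, x). Kern l x y) \<in> borel_measurable (m \<Otimes>\<^sub>M m)"
    unfolding m_def by (rule measurable_pair_bessel) (unfold Kern_def tau_def, measurable)
  have gKm: "(\<lambda>(y, x). g x * Kern l x y) \<in> borel_measurable (m \<Otimes>\<^sub>M m)"
  proof -
    have "(\<lambda>q. g (snd q)) \<in> borel_measurable (m \<Otimes>\<^sub>M m)"
      using gi by (intro measurable_compose[OF measurable_snd]) auto
    then show ?thesis using Km by (simp add: case_prod_unfold)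
  qed
  interpret m: sigma_finite_measure m unfolding m_def by (rule sigma_finite_bessel_measure)
  define \<Phi> where "\<Phi> y = (\<integral>x. g x * Kern l x y \<partial>m)" for y
  have \<Phi>m: "\<Phi> \<in> borel_measurable m"
    unfolding \<Phi>_def using m.borel_measurable_lebesgue_integral[OF gKm] by simp
  have gKi: "integrable m (\<lambda>x. g x * Kern l x y)" and \<Phi>b: "\<bar>\<Phi> y\<bar> \<le> (\<integral>x. \<bar>g x\<bar> * B \<partial>m)" and \<Phi>l: "(\<integral>x. \<kappa> x * \<psi> x \<partial>m) \<le> \<epsilon> * \<Phi> y"
    if y: "0 < y" and nz: "f y \<noteq> 0" for y
  proof -
    have le: "\<bar>g x * Kern l x y\<bar> \<le> \<bar>g x\<bar> * B" if "x \<in> space m" for x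
    proof (cases "\<psi> x = 0")
      case False
      then show ?thesis using KB[of x y] y nz that by (simp add: m_def abs_mult mult_left_mono)
    qed (simp add: g_def)
    have Bi: "integrable m (\<lambda>x. \<bar>g x\<bar> * B)" using gi by auto
    have "y \<in> space m" using y by (simp add: m_def)
    then have "(\<lambda>x. g x * Kern l x y) \<in> borel_measurable m"
      using measurable_compose[OF measurable_Pair1' gKm, of y] by simp
    then show i: "integrable m (\<lambda>x. g x * Kern l x y)"
      by (rule Bochner_Integration.integrable_bound[OF Bi]) (rule AE_I2, use le B0 in \<open>simp add: abs_mult\<close>)
    have "\<bar>\<Phi> y\<bar> \<le> (\<integral>x. \<bar>g x * Kern l x y\<bar> \<partial>m)" unfolding \<Phi>_def by (rule integral_abs_bound)
    also have "\<dots> \<le> (\<integral>x. \<bar>g x\<bar> * B \<partial>m)" using i Bi le by (intro integral_mono) auto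
    finally show "\<bar>\<Phi> y\<bar> \<le> (\<integral>x. \<bar>g x\<bar> * B \<partial>m)" .
    have "(\<integral>x. \<kappa> x * \<psi> x \<partial>m) \<le> (\<integral>x. \<epsilon> * (g x * Kern l x y) \<partial>m)"
    proof (rule integral_mono[OF \<kappa>i integrable_mult_right[OF i]])
      fix x
      show "\<kappa> x * \<psi> x \<le> \<epsilon> * (g x * Kern l x y)"
      proof (cases "\<psi> x = 0")
        case False
        have "\<kappa> x * \<psi> x \<le> (\<epsilon> * (x * Kern l x y)) * \<psi> x"
          using lower[OF \<psi>J[OF False] y nz] \<psi>0 by (rule mult_right_mono)
        then show ?thesis by (simp add: g_def mult_ac)
      qed (simp add: g_def)
    qed
    then show "(\<integral>x. \<kappa> x * \<psi> x \<partial>m) \<le> \<epsilon> * \<Phi> y" by (simp add: \<Phi>_def)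
  qed
  have f\<Phi>i: "integrable m (\<lambda>y. f y * \<Phi> y)"
  proof (rule Bochner_Integration.integrable_bound[OF integrable_mult_left[OF fi, of "\<integral>x. \<bar>g x\<bar> * B \<partial>m"]])
    show "(\<lambda>y. f y * \<Phi> y) \<in> borel_measurable m" using fi \<Phi>m by (intro borel_measurable_times) auto
    show "AE y in m. norm (f y * \<Phi> y) \<le> norm (f y * (\<integral>x. \<bar>g x\<bar> * B \<partial>m))"
    proof (rule AE_I2)
      fix y assume "y \<in> space m"
      then have y: "0 < y" by (simp add: m_def)
      show "norm (f y * \<Phi> y) \<le> norm (f y * (\<integral>x. \<bar>g x\<bar> * B \<partial>m))"
        using \<Phi>b[OF y] by (cases "f y = 0") (auto simp: abs_mult intro!: mult_left_mono intro: order_trans)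
    qed
  qed
  have "F * (\<integral>x. \<kappa> x * \<psi> x \<partial>m) = (\<integral>y. f y * (\<integral>x. \<kappa> x * \<psi> x \<partial>m) \<partial>m)" by (simp add: F_def)
  also have "\<dots> \<le> (\<integral>y. \<epsilon> * (f y * \<Phi> y) \<partial>m)"
  proof (rule integral_mono[OF integrable_mult_left[OF fi] integrable_mult_right[OF f\<Phi>i]])
    fix y assume "y \<in> space m"
    then have y: "0 < y" by (simp add: m_def)
    show "f y * (\<integral>x. \<kappa> x * \<psi> x \<partial>m) \<le> \<epsilon> * (f y * \<Phi> y)"
      using mult_left_mono[OF \<Phi>l[OF y] f0[OF y]] by (cases "f y = 0") (auto simp: mult_ac)
  qed
  also have "\<dots> = \<epsilon> * (\<integral>y. f y * \<Phi> y \<partial>m)" by simp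
  finally have main: "F * (\<integral>x. \<kappa> x * \<psi> x \<partial>m) \<le> \<epsilon> * (\<integral>y. f y * \<Phi> y \<partial>m)" .
  have RK: "(\<integral>x. bessel_riesz l f x * \<psi> x \<partial>m) = - D * (\<integral>y. f y * \<Phi> y \<partial>m)"
    unfolding m_def D_def \<Phi>_def g_def
    by (rule riesz_kernel[OF l ft \<psi>t t0]) (use sep \<psi>J in blast)
  have Vi: "integrable m (\<lambda>x. V x * \<psi> x)" and Veq: "(\<integral>x. V x * \<psi> x \<partial>m)
      = - \<epsilon> * (\<integral>x. bessel_riesz l f x * \<psi> x \<partial>m) - D * F * (\<integral>x. \<kappa> x * \<psi> x \<partial>m)"
  proof -
    have e: "V x * \<psi> x = - \<epsilon> * (bessel_riesz l f x * \<psi> x) - D * F * (\<kappa> x * \<psi> x)" for x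
      by (simp add: V_def algebra_simps)
    show "integrable m (\<lambda>x. V x * \<psi> x)" unfolding e using Ri \<kappa>i by (intro Bochner_Integration.integrable_diff integrable_mult_right)
    show "(\<integral>x. V x * \<psi> x \<partial>m) = - \<epsilon> * (\<integral>x. bessel_riesz l f x * \<psi> x \<partial>m) - D * F * (\<integral>x. \<kappa> x * \<psi> x \<partial>m)"
      unfolding e using Ri \<kappa>i by (subst Bochner_Integration.integral_diff) (auto intro!: integrable_mult_right)
  qed
  have "(\<integral>x. V x * \<psi> x \<partial>m) = D * (\<epsilon> * (\<integral>y. f y * \<Phi> y \<partial>m) - F * (\<integral>x. \<kappa> x * \<psi> x \<partial>m))"
    unfolding Veq RK by (simp add: algebra_simps)
  then have ge: "0 \<le> (\<integral>x. V x * \<psi> x \<partial>m)" using main D by simp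
  have le0: "V x * \<psi> x \<le> 0" for x
    by (auto simp: \<psi>_def S_def indicator_def)
  have "(\<integral>x. - (V x * \<psi> x) \<partial>m) = 0"
    using ge integral_nonneg_AE[of "\<lambda>x. - (V x * \<psi> x)" m] le0 by simp
  then have "AE x in m. - (V x * \<psi> x) = 0"
    using Vi le0 by (subst (asm) integral_nonneg_eq_0_iff_AE) auto
  then have "AE x in Rplus. - (V x * \<psi> x) = 0" unfolding m_def AE_bessel_measure .
  then show ?thesis
    using AE_space
  proof eventually_elim
    case (elim x)
    show ?case
    proof
      assume xJ: "x \<in> J"
      have "0 \<le> V x"
      proof (rule ccontr)
        assume "\<not> 0 \<le> V x"
        then show False using elim xJ by (simp add: \<psi>_def S_def)
      qed
      then have "\<kappa> x * D * F \<le> \<bar>bessel_riesz l f x\<bar>" using \<epsilon> by (auto simp: V_def)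
      then show "2 powr (- 2 * l) / sqrt pi * \<kappa> x * (\<integral>y. f y \<partial>bessel_measure l) \<le> \<bar>bessel_riesz l f x\<bar>"
        by (simp add: D_def F_def m_def mult_ac)
    qed
  qed
qed

text \<open>Multiplication by the sign of \<open>x - y\<close> turns \<tau> into its modulus, while
  the term with \<lambda> becomes at worst the one with \<open>- |\<lambda>|\<close>.\<close>

lemma Kern_Lser:
  assumes l: "l > - 1 / 2" and x: "0 < x" and y: "0 < y" and xy: "x \<noteq> y"
  shows "Lser l \<bar>tau x y\<bar> * (4 / (x\<^sup>2 + y\<^sup>2)) powr (l + 1) / 4 \<le> (if y < x then 1 else - 1) * Kern l x y"
proof -
  define \<epsilon> :: real where "\<epsilon> = (if y < x then 1 else - 1)"
  define \<rho> where "\<rho> = 1 - (tau x y)\<^sup>2"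
  have \<epsilon>t: "\<epsilon> * tau x y = \<bar>tau x y\<bar>" using tau_props(3,4)[OF x y] xy by (auto simp: \<epsilon>_def)
  have t0: "0 < (tau x y)\<^sup>2" using tau_props(3)[OF x y] xy by simp
  have "0 \<le> \<rho>" unfolding \<rho>_def tau_props(1)[OF x y] by simp
  moreover have "\<rho> < 1" using t0 unfolding \<rho>_def by linarith
  ultimately have \<rho>: "0 \<le> \<rho>" "\<rho> < 1" by auto
  have lk: "0 \<le> \<bar>l\<bar> / (l + 1 + 2 * real k)" "\<bar>l\<bar> / (l + 1 + 2 * real k) \<le> \<bar>l\<bar> / (l + 1)"
    "\<bar>l / (l + 1 + 2 * real k)\<bar> = \<bar>l\<bar> / (l + 1 + 2 * real k)" for k
    using l by (auto intro!: divide_left_mono simp: abs_divide)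
  have s1: "(\<lambda>k. dcf l k * \<rho> ^ k * (\<bar>tau x y\<bar> - \<bar>l\<bar> / (l + 1 + 2 * real k))) sums Lser l \<bar>tau x y\<bar>"
    unfolding Lser_def \<rho>_def power2_abs
  proof (rule summable_sums, rule summable_dcf[OF l])
    fix k show "\<bar>\<bar>tau x y\<bar> - \<bar>l\<bar> / (l + 1 + 2 * real k)\<bar> \<le> \<bar>tau x y\<bar> + \<bar>l\<bar> / (l + 1)"
      using lk[of k] by linarith
  qed (use \<rho> in \<open>auto simp: \<rho>_def\<close>)
  have "(\<lambda>k. dcf l k * \<rho> ^ k * (tau x y + l / (l + 1 + 2 * real k))) sums (\<Sum>k. dcf l k * \<rho> ^ k * (tau x y + l / (l + 1 + 2 * real k)))"
  proof (rule summable_sums, rule summable_dcf[OF l \<rho>])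
    fix k show "\<bar>tau x y + l / (l + 1 + 2 * real k)\<bar> \<le> \<bar>tau x y\<bar> + \<bar>l\<bar> / (l + 1)"
      using lk[of k] by linarith
  qed
  from sums_mult[OF this, of \<epsilon>]
  have s2: "(\<lambda>k. \<epsilon> * (dcf l k * \<rho> ^ k * (tau x y + l / (l + 1 + 2 * real k)))) sums (\<epsilon> * (\<Sum>k. dcf l k * \<rho> ^ k * (tau x y + l / (l + 1 + 2 * real k))))" .
  have "Lser l \<bar>tau x y\<bar> \<le> \<epsilon> * (\<Sum>k. dcf l k * \<rho> ^ k * (tau x y + l / (l + 1 + 2 * real k)))"
  proof (rule sums_le[OF _ s1 s2])
    fix k
    have "\<bar>tau x y\<bar> - \<bar>l\<bar> / (l + 1 + 2 * real k) \<le> \<epsilon> * (tau x y + l / (l + 1 + 2 * real k))"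
    proof -
      define c where "c = l / (l + 1 + 2 * real k)"
      have "- \<bar>c\<bar> \<le> c" "- \<bar>c\<bar> \<le> - c" using abs_ge_minus_self[of c] abs_ge_self[of c] by linarith+
      then have "- \<bar>c\<bar> \<le> \<epsilon> * c" unfolding \<epsilon>_def by simp
      then have "\<bar>tau x y\<bar> - \<bar>c\<bar> \<le> \<epsilon> * (tau x y + c)" unfolding distrib_left \<epsilon>t by linarith
      then show ?thesis unfolding c_def lk(3) .
    qed
    then have "dcf l k * \<rho> ^ k * (\<bar>tau x y\<bar> - \<bar>l\<bar> / (l + 1 + 2 * real k)) \<le> dcf l k * \<rho> ^ k * (\<epsilon> * (tau x y + l / (l + 1 + 2 * real k)))"
      using dcf_pos[OF l, of k] \<rho> by (intro mult_left_mono) auto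
    then show "dcf l k * \<rho> ^ k * (\<bar>tau x y\<bar> - \<bar>l\<bar> / (l + 1 + 2 * real k)) \<le> \<epsilon> * (dcf l k * \<rho> ^ k * (tau x y + l / (l + 1 + 2 * real k)))"
      by (simp only: mult_ac)
  qed
  then have "Lser l \<bar>tau x y\<bar> * ((4 / (x\<^sup>2 + y\<^sup>2)) powr (l + 1) / 4)
      \<le> \<epsilon> * (\<Sum>k. dcf l k * \<rho> ^ k * (tau x y + l / (l + 1 + 2 * real k))) * ((4 / (x\<^sup>2 + y\<^sup>2)) powr (l + 1) / 4)"
    by (rule mult_right_mono) simp
  then show ?thesis unfolding Kern_def \<rho>_def[symmetric] \<epsilon>_def[symmetric] by (simp add: mult.assoc)
qed

lemma set_nn_integral_Rplus:
  "E \<subseteq> {0<..} \<Longrightarrow> (\<integral>\<^sup>+x\<in>E. f x \<partial>lebesgue) = (\<integral>\<^sup>+x. f x * indicator E x \<partial>Rplus)" for f :: "real \<Rightarrow> ennreal"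
  by (subst nn_integral_restrict_space) (auto intro!: nn_integral_cong simp: indicator_def)

lemma sets_RplusI: "E \<in> sets lebesgue \<Longrightarrow> E \<subseteq> {0<..} \<Longrightarrow> E \<in> sets Rplus"
  by (auto simp: sets_restrict_space intro!: image_eqI[of _ _ E])

section \<open>From the weak type estimate to \<open>A\<^sub>p\<close>\<close>

text \<open>The weak type estimate for the indicator of \<open>E\<close>, at the level
  \<open>s\<close> equal to half of the lower bound for \<open>|R f|\<close> on \<open>J\<close>;
  the half gives the strict inequality of the level set. The conclusion is free of division, so the
  case where \<open>E\<close> has measure 0 is trivial.\<close>

lemma weak_type_pair:
  assumes l: "l > - 1 / 2" and wm: "w \<in> borel_measurable Rplus" and C: "0 < C"
    and A1: "\<And>s f. 0 < s \<Longrightarrow> f \<in> test_functions \<Longrightarrow>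
      (\<integral>\<^sup>+x\<in>{x. 0 < x \<and> s < \<bar>bessel_riesz l f x\<bar>}. w x \<partial>lebesgue) \<le> ennreal (C / s) * (\<integral>\<^sup>+x\<in>{0<..}. ennreal \<bar>f x\<bar> * w x \<partial>lebesgue)"
    and E: "E \<in> sets lebesgue" "E \<subseteq> {p..q}" "0 < p" and J: "J \<in> sets lebesgue" "J \<subseteq> {c..d}" "0 < c"
    and \<epsilon>: "\<epsilon> = 1 \<or> \<epsilon> = - 1" and t0: "0 < t0" and \<kappa>: "0 < \<kappa>"
    and sep: "\<And>x y. x \<in> J \<Longrightarrow> y \<in> E \<Longrightarrow> t0 \<le> \<bar>tau x y\<bar>"
    and lower: "\<And>x y. x \<in> J \<Longrightarrow> y \<in> E \<Longrightarrow> \<kappa> \<le> \<epsilon> * (x * Kern l x y)"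
  shows "(\<integral>\<^sup>+x\<in>J. w x \<partial>lebesgue) * ennreal (\<kappa> * measure (bessel_measure l) E)
    \<le> ennreal (2 * C * sqrt pi / 2 powr (- 2 * l)) * (\<integral>\<^sup>+x\<in>E. w x \<partial>lebesgue)"
proof -
  define D where "D = 2 powr (- 2 * l) / sqrt pi"
  have D: "0 < D" by (simp add: D_def)
  have Ep: "E \<subseteq> {0<..}" and Jp: "J \<subseteq> {0<..}" using E J by force+
  define f where "f = (indicator E :: real \<Rightarrow> real)"
  have ER: "E \<in> sets Rplus" by (rule sets_RplusI[OF E(1) Ep])
  have ft: "f \<in> test_functions"
  proof (rule test_functionsI[of _ 1 p q])
    show "f \<in> borel_measurable Rplus" unfolding f_def using ER by (rule borel_measurable_indicator)
  qed (use E in \<open>auto simp: f_def indicator_def split: if_splits\<close>)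
  define F where "F = measure (bessel_measure l) E"
  have F: "(\<integral>y. f y \<partial>bessel_measure l) = F"
    unfolding f_def F_def using ER Ep by (simp add: sets_bessel_measure Int_absorb2)
  show ?thesis
  proof (cases "F = 0")
    case False
    then have F0: "0 < F" using measure_nonneg[of "bessel_measure l" E] by (simp add: F_def less_le)
    define s where "s = D * \<kappa> * F / 2"
    have s: "0 < s" using D \<kappa> F0 by (simp add: s_def)
    have "AE x in Rplus. x \<in> J \<longrightarrow> 2 powr (- 2 * l) / sqrt pi * \<kappa> * (\<integral>y. f y \<partial>bessel_measure l) \<le> \<bar>bessel_riesz l f x\<bar>"
      by (rule riesz_lower_bound[OF l ft _ \<epsilon> J(2,3,1) _ _ t0, of "\<lambda>_. \<kappa>" \<kappa>])
         (use sep lower \<kappa> in \<open>auto simp: f_def indicator_def split: if_splits\<close>)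
    then have ae: "AE x in Rplus. x \<in> J \<longrightarrow> s < \<bar>bessel_riesz l f x\<bar>"
    proof eventually_elim
      case (elim x)
      have "s < D * \<kappa> * F" using D \<kappa> F0 by (simp add: s_def)
      then show ?case using elim unfolding F D_def[symmetric] by auto
    qed
    have "(\<integral>\<^sup>+x\<in>J. w x \<partial>lebesgue) = (\<integral>\<^sup>+x. w x * indicator J x \<partial>Rplus)"
      by (rule set_nn_integral_Rplus[OF Jp])
    also have "\<dots> \<le> (\<integral>\<^sup>+x. w x * indicator {x. 0 < x \<and> s < \<bar>bessel_riesz l f x\<bar>} x \<partial>Rplus)"
    proof (rule nn_integral_mono_AE)
      show "AE x in Rplus. w x * indicator J x \<le> w x * indicator {x. 0 < x \<and> s < \<bar>bessel_riesz l f x\<bar>} x"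
        using ae by eventually_elim (use Jp in \<open>auto simp: indicator_def\<close>)
    qed
    also have "\<dots> = (\<integral>\<^sup>+x\<in>{x. 0 < x \<and> s < \<bar>bessel_riesz l f x\<bar>}. w x \<partial>lebesgue)"
      by (rule set_nn_integral_Rplus[symmetric]) auto
    also have "\<dots> \<le> ennreal (C / s) * (\<integral>\<^sup>+x\<in>{0<..}. ennreal \<bar>f x\<bar> * w x \<partial>lebesgue)"
      by (rule A1[OF s ft])
    also have "(\<integral>\<^sup>+x\<in>{0<..}. ennreal \<bar>f x\<bar> * w x \<partial>lebesgue) = (\<integral>\<^sup>+x\<in>E. w x \<partial>lebesgue)"
      using Ep by (intro nn_integral_cong) (auto simp: f_def indicator_def)
    finally have "(\<integral>\<^sup>+x\<in>J. w x \<partial>lebesgue) * ennreal (\<kappa> * F) \<le> ennreal (C / s) * (\<integral>\<^sup>+x\<in>E. w x \<partial>lebesgue) * ennreal (\<kappa> * F)"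
      by (rule mult_right_mono) simp
    also have "\<dots> = ennreal (C / s * (\<kappa> * F)) * (\<integral>\<^sup>+x\<in>E. w x \<partial>lebesgue)"
    proof -
      have e: "ennreal (C / s * (\<kappa> * F)) = ennreal (C / s) * ennreal (\<kappa> * F)"
        using C s \<kappa> F0 by (intro ennreal_mult) auto
      show ?thesis unfolding e by (simp only: mult_ac)
    qed
    also have "C / s * (\<kappa> * F) = 2 * C * sqrt pi / 2 powr (- 2 * l)"
      using D \<kappa> F0 by (simp add: s_def D_def field_simps)
    finally show ?thesis by (simp add: F_def)
  qed (simp add: F_def)
qed

text \<open>Bounds for all subsets \<open>E\<close> force a pointwise bound: for the set where
  \<open>C w \<le> \<beta> x^(2\<lambda>)\<close>, with measure \<open>F\<close>, the hypothesis
  gives \<open>v F \<le> \<beta> F\<close>, and \<open>\<beta> < v\<close> leaves only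
  \<open>F = 0\<close>.\<close>

lemma weight_lower_bound:
  assumes wm: "w \<in> borel_measurable Rplus" and C: "0 < C"
    and I: "I \<in> sets lebesgue" "I \<subseteq> {p..q}" "0 < p"
    and le: "\<And>E. E \<in> sets lebesgue \<Longrightarrow> E \<subseteq> I \<Longrightarrow> v * ennreal (measure (bessel_measure l) E) \<le> ennreal C * (\<integral>\<^sup>+x\<in>E. w x \<partial>lebesgue)"
    and \<beta>: "0 \<le> \<beta>" "ennreal \<beta> < v"
  shows "AE x in Rplus. x \<in> I \<longrightarrow> ennreal (\<beta> * x powr (2 * l)) \<le> ennreal C * w x"
proof -
  have Ip: "I \<subseteq> {0<..}" using I by force
  have IR: "I \<in> sets Rplus" by (rule sets_RplusI[OF I(1) Ip])
  define E where "E = {x \<in> space Rplus. x \<in> I \<and> ennreal C * w x \<le> ennreal (\<beta> * x powr (2 * l))}"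
  have ER: "E \<in> sets Rplus"
  proof -
    have "(\<lambda>x. ennreal (\<beta> * x powr (2 * l))) \<in> borel_measurable Rplus"
      using powr_measurable_Rplus[of "2 * l"] by auto
    then have "{x \<in> space Rplus. ennreal C * w x \<le> ennreal (\<beta> * x powr (2 * l))} \<in> sets Rplus"
      using wm by measurable
    moreover have "E = I \<inter> {x \<in> space Rplus. ennreal C * w x \<le> ennreal (\<beta> * x powr (2 * l))}" by (auto simp: E_def)
    ultimately show ?thesis using IR by auto
  qed
  then have EL: "E \<in> sets lebesgue" by (auto simp: sets_restrict_space)
  have Ep: "E \<subseteq> {0<..}" using ER sets.sets_into_space by fastforce
  have EB: "E \<in> sets (bessel_measure l)" using ER by (simp add: sets_bessel_measure)
  have fin: "emeasure (bessel_measure l) E < \<infinity>"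
  proof -
    have "E \<subseteq> {p..q}" using I by (auto simp: E_def)
    then have "emeasure (bessel_measure l) E \<le> emeasure (bessel_measure l) {p..q}"
      using I(3) by (intro emeasure_mono) (auto simp: sets_bessel_measure intro!: sets_RplusI)
    then show ?thesis using emeasure_bessel_measure_Icc[OF I(3), of l q] by (simp add: order_le_less_trans)
  qed
  define F where "F = measure (bessel_measure l) E"
  have eF: "emeasure (bessel_measure l) E = ennreal F"
    unfolding F_def using fin by (intro emeasure_eq_ennreal_measure) auto
  have "v * ennreal F \<le> ennreal C * (\<integral>\<^sup>+x\<in>E. w x \<partial>lebesgue)"
    unfolding F_def by (rule le[OF EL]) (auto simp: E_def)
  also have "\<dots> = (\<integral>\<^sup>+x. ennreal C * (w x * indicator E x) \<partial>Rplus)"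
    using wm ER unfolding set_nn_integral_Rplus[OF Ep] by (intro nn_integral_cmult[symmetric]) auto
  also have "\<dots> \<le> (\<integral>\<^sup>+x. ennreal \<beta> * (ennreal (x powr (2 * l)) * indicator E x) \<partial>Rplus)"
    using \<beta>(1) by (intro nn_integral_mono) (auto simp: E_def indicator_def ennreal_mult)
  also have "\<dots> = ennreal \<beta> * (\<integral>\<^sup>+x. ennreal (x powr (2 * l)) * indicator E x \<partial>Rplus)"
    using ER powr_measurable_Rplus[of "2 * l"] by (intro nn_integral_cmult) auto
  also have "(\<integral>\<^sup>+x. ennreal (x powr (2 * l)) * indicator E x \<partial>Rplus) = ennreal F"
    unfolding eF[symmetric] bessel_measure_def using ER powr_measurable_Rplus[of "2 * l"]
    by (intro emeasure_density[symmetric]) auto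
  finally have "v * ennreal F \<le> ennreal \<beta> * ennreal F" .
  then have "F = 0"
  proof (rule contrapos_pp)
    assume "F \<noteq> 0"
    then have "0 < F" using measure_nonneg[of "bessel_measure l" E] by (simp add: F_def less_le)
    then have "ennreal \<beta> * ennreal F < v * ennreal F"
      using \<beta> by (intro ennreal_mult_strict_right_mono) auto
    then show "\<not> v * ennreal F \<le> ennreal \<beta> * ennreal F" by simp
  qed
  then have "E \<in> null_sets (bessel_measure l)" using EB eF by (auto intro!: null_setsI)
  then have "AE x in Rplus. x \<notin> E" using AE_not_in[of E "bessel_measure l"] by (simp add: AE_bessel_measure)
  then show ?thesis
    using AE_space by eventually_elim (auto simp: E_def not_le intro: less_imp_le)
qed

section \<open>Powers on the extended half line\<close>

lemma epowr_ennreal: "0 < x \<Longrightarrow> epowr (ennreal x) r = ennreal (x powr r)"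
  by (auto simp: epowr_def)

lemma epowr_ennreal_nonneg: "0 \<le> x \<Longrightarrow> 0 < r \<Longrightarrow> epowr (ennreal x) r = ennreal (x powr r)"
  by (cases "x = 0") (auto simp: epowr_def)

lemma epowr_0 [simp]: "0 < r \<Longrightarrow> epowr 0 r = 0"
  by (simp add: epowr_def)

lemma epowr_top [simp]: "0 < r \<Longrightarrow> epowr top r = top"
  by (simp add: epowr_def)

lemma epowr_mono: "x \<le> y \<Longrightarrow> 0 < r \<Longrightarrow> epowr x r \<le> epowr y r"
proof (cases y rule: ennreal_cases)
  case (real v)
  assume *: "x \<le> y" "0 < r"
  then obtain u where u: "x = ennreal u" "0 \<le> u" using real by (cases x rule: ennreal_cases) (auto simp: top_unique)
  then have "u \<le> v" using * real by (simp add: ennreal_le_iff)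
  then show ?thesis using * u real by (simp add: epowr_ennreal_nonneg powr_mono2 ennreal_leI)
qed simp

lemma epowr_antimono_real:
  assumes "0 < y" "ennreal y \<le> x" "r < 0"
  shows "epowr x r \<le> ennreal (y powr r)"
proof (cases x rule: ennreal_cases)
  case (real u)
  then have "y \<le> u" using assms by (simp add: ennreal_le_iff)
  then have "0 < u" using assms by linarith
  then show ?thesis using real assms \<open>y \<le> u\<close> by (simp add: epowr_ennreal powr_mono2' ennreal_leI)
qed (use assms in \<open>simp add: epowr_def\<close>)

text \<open>Positive exponents are essential: for \<open>r < 0\<close> the factors 0 and \<infinity>
  give \<infinity> on the left and 0 on the right.\<close>

lemma epowr_mult:
  assumes r: "0 < r"
  shows "epowr (x * y) r = epowr x r * epowr y r"
proof (cases x rule: ennreal_cases)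
  case x: (real u)
  show ?thesis
  proof (cases y rule: ennreal_cases)
    case y: (real v)
    then show ?thesis using x r by (simp add: epowr_ennreal_nonneg powr_mult flip: ennreal_mult)
  next
    case top
    then show ?thesis using x r by (cases "u = 0") (auto simp: epowr_ennreal ennreal_mult_top)
  qed
next
  case x: top
  show ?thesis
  proof (cases "y = 0")
    case False
    then have "epowr y r \<noteq> 0"
      using r by (cases y rule: ennreal_cases) (auto simp: epowr_ennreal_nonneg less_top)
    then show ?thesis using x r False by (simp add: ennreal_top_mult)
  qed (use x r in simp)
qed

lemma epowr_epowr:
  assumes "r \<noteq> 0" "q \<noteq> 0"
  shows "epowr (epowr x r) q = epowr x (r * q)"
proof (cases x rule: ennreal_cases)
  case (real u)
  then show ?thesis
    using assms by (cases "u = 0") (auto simp: epowr_def powr_powr zero_less_mult_iff not_less le_less)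
qed (use assms in \<open>auto simp: epowr_def zero_less_mult_iff not_less le_less\<close>)

section \<open>Power weights and the kernel on companion intervals\<close>

lemma powr_set_integral:
  assumes s: "- 1 < s" and ab: "0 \<le> a" "a < b"
  shows "(\<integral>\<^sup>+t\<in>{a<..<b}. ennreal (t powr s) \<partial>lebesgue) = ennreal ((b powr (s + 1) - a powr (s + 1)) / (s + 1))"
proof -
  have "((\<lambda>t. t powr s) has_integral (b powr (s + 1) / (s + 1) - a powr (s + 1) / (s + 1))) {a..b}"
  proof (rule fundamental_theorem_of_calculus_interior)
    show "continuous_on {a..b} (\<lambda>t. t powr (s + 1) / (s + 1))"
      using s ab by (intro continuous_on_divide continuous_on_powr' continuous_on_id continuous_on_const) auto
    fix t assume t: "t \<in> {a<..<b}"
    have "((\<lambda>t. t powr (s + 1)) has_real_derivative (s + 1) * t powr (s + 1 - 1)) (at t)"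
      using t ab by (intro has_real_derivative_powr) auto
    from DERIV_cdivide[OF this, of "s + 1"]
    show "((\<lambda>t. t powr (s + 1) / (s + 1)) has_vector_derivative t powr s) (at t)"
      using s by (simp add: has_real_derivative_iff_has_vector_derivative)
  qed (use ab in auto)
  then have "((\<lambda>t. t powr s) has_integral (b powr (s + 1) / (s + 1) - a powr (s + 1) / (s + 1))) {a<..<b}"
    by (simp add: has_integral_Icc_iff_Ioo)
  then have "(\<integral>\<^sup>+t. ennreal (indicator {a<..<b} t * t powr s) \<partial>lborel) = ennreal (b powr (s + 1) / (s + 1) - a powr (s + 1) / (s + 1))"
    by (intro nn_integral_has_integral_lebesgue) auto
  moreover have "(\<integral>\<^sup>+t\<in>{a<..<b}. ennreal (t powr s) \<partial>lebesgue) = (\<integral>\<^sup>+t. ennreal (indicator {a<..<b} t * t powr s) \<partial>lebesgue)"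
    by (intro nn_integral_cong) (auto simp: indicator_def)
  moreover have "\<dots> = (\<integral>\<^sup>+t. ennreal (indicator {a<..<b} t * t powr s) \<partial>lborel)"
    by (rule nn_integral_completion) measurable
  ultimately show ?thesis by (simp add: diff_divide_distrib)
qed

text \<open>For \<open>\<alpha> = 2\<lambda> + 1\<close> and up to constants, the first bound
  compares the integral of \<open>t^(2\<lambda>)\<close> with \<nu> divided by \<open>b\<close>; the
  second bounds \<nu> from below by \<open>b^(2\<lambda>+1) (b - a)\<close>. Both remain sharp for
  short intervals.\<close>

lemma powr_diff_bounds:
  assumes "0 < \<alpha>" "0 \<le> a" "a \<le> (b::real)"
  shows "b * (b powr \<alpha> - a powr \<alpha>) \<le> b powr (\<alpha> + 1) - a powr (\<alpha> + 1)"
    and "b powr \<alpha> * (b - a) \<le> b powr (\<alpha> + 1) - a powr (\<alpha> + 1)"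
proof -
  have e: "b powr (\<alpha> + 1) = b powr \<alpha> * b" "a powr (\<alpha> + 1) = a powr \<alpha> * a"
    using assms by (auto simp: powr_add)
  have "a powr \<alpha> * a \<le> a powr \<alpha> * b" using assms by (intro mult_left_mono) auto
  then show "b * (b powr \<alpha> - a powr \<alpha>) \<le> b powr (\<alpha> + 1) - a powr (\<alpha> + 1)"
    unfolding e by (simp add: algebra_simps)
  have "a powr \<alpha> * a \<le> b powr \<alpha> * a" using assms by (intro mult_right_mono powr_mono2) auto
  then show "b powr \<alpha> * (b - a) \<le> b powr (\<alpha> + 1) - a powr (\<alpha> + 1)"
    unfolding e by (simp add: algebra_simps)
qed

text \<open>For \<open>-1 < r < 0\<close> the power drops over \<open>[b, K b]\<close> by the factor
  \<open>K^r\<close>, at worst \<open>1 / K\<close>, and this crude loss also covers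
  \<open>r \<ge> 0\<close>. It serves for \<open>r = 2\<lambda>\<close>.\<close>

lemma powr_lower_bound:
  assumes "- 1 < r" "1 \<le> K" "0 < b" "b \<le> y" "y \<le> K * (b::real)"
  shows "b powr r / K \<le> y powr r"
proof (cases "0 \<le> r")
  case True
  have "b powr r / K \<le> b powr r" using assms by (simp add: divide_le_eq mult_le_cancel_left1)
  also have "\<dots> \<le> y powr r" using assms True by (intro powr_mono2) auto
  finally show ?thesis .
next
  case False
  have "b powr r / K = b powr r * K powr (- 1)" using assms by (simp add: powr_minus_divide)
  also have "\<dots> \<le> b powr r * K powr r" using assms by (intro mult_left_mono powr_mono) auto
  also have "\<dots> = (K * b) powr r" using assms by (simp add: powr_mult)
  also have "\<dots> \<le> y powr r" using assms False by (intro powr_mono2') auto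
  finally show ?thesis .
qed

lemma measure_bessel_Icc_ge:
  assumes l: "l > - 1 / 2" and K: "1 \<le> K" "0 < b" "b \<le> u" "u \<le> v" "v \<le> K * b"
  shows "b powr (2 * l) / K * (v - u) \<le> measure (bessel_measure l) {u..v}"
proof -
  have u: "0 < u" using K by linarith
  have sR: "{u..v} \<in> sets Rplus" using u by (intro sets_RplusI) auto
  have "ennreal (b powr (2 * l) / K * (v - u)) = ennreal (b powr (2 * l) / K) * emeasure Rplus {u..v}"
  proof -
    have em: "emeasure Rplus {u..v} = ennreal (v - u)" using u K by (subst emeasure_restrict_space) auto
    show ?thesis unfolding em by (rule ennreal_mult) (use K in auto)
  qed
  also have "\<dots> = (\<integral>\<^sup>+x. ennreal (b powr (2 * l) / K) * indicator {u..v} x \<partial>Rplus)"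
    using sR by (rule nn_integral_cmult_indicator[symmetric])
  also have "\<dots> \<le> (\<integral>\<^sup>+x. ennreal (x powr (2 * l)) * indicator {u..v} x \<partial>Rplus)"
  proof (rule nn_integral_mono)
    fix x
    show "ennreal (b powr (2 * l) / K) * indicator {u..v} x \<le> ennreal (x powr (2 * l)) * indicator {u..v} x"
      using powr_lower_bound[of "2 * l" K b x] l K by (auto simp: indicator_def intro: ennreal_leI)
  qed
  also have "\<dots> = emeasure (bessel_measure l) {u..v}"
    unfolding bessel_measure_def using sR powr_measurable_Rplus[of "2 * l"] by (intro emeasure_density[symmetric]) auto
  also have "\<dots> = ennreal (measure (bessel_measure l) {u..v})"
    using emeasure_bessel_measure_Icc[OF u, of l v] by (intro emeasure_eq_ennreal_measure) auto
  finally show ?thesis by (simp add: ennreal_le_iff measure_nonneg)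
qed

text \<open>In the window from \<open>3b/4\<close> to \<open>3b/2\<close> the modulus of \<tau> lies
  between \<open>h / (3b)\<close> and \<open>9h / b\<close>. The choice
  \<open>\<eta> \<le> \<epsilon> / 9\<close> puts it into the range of \<open>Lser_near\<close>,
  which gives \<open>b / h\<close>; with the homogeneity factor \<open>b^(-2\<lambda>-2)\<close> and
  the factor \<open>x\<close> this becomes \<open>b^(-2\<lambda>) / h\<close>.\<close>

lemma Kern_near:
  assumes l: "l > - 1 / 2"
  obtains \<eta> c where "0 < \<eta>" "\<eta> \<le> 1 / 4" "0 < c"
    "\<And>b h x y. 0 < h \<Longrightarrow> h < \<eta> * b \<Longrightarrow> 3 / 4 * b \<le> x \<Longrightarrow> x \<le> 3 / 2 * b \<Longrightarrow> 3 / 4 * b \<le> y \<Longrightarrow> y \<le> 3 / 2 * b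
      \<Longrightarrow> h \<le> \<bar>x - y\<bar> \<Longrightarrow> \<bar>x - y\<bar> \<le> 3 * h
      \<Longrightarrow> h / (3 * b) \<le> \<bar>tau x y\<bar> \<and> c * b powr (- 2 * l) / h \<le> (if y < x then 1 else - 1) * (x * Kern l x y)"
proof -
  obtain \<epsilon> c' where \<epsilon>: "0 < \<epsilon>" "\<epsilon> < 1" and c': "0 < c'" and L: "\<And>t. 0 < t \<Longrightarrow> t < \<epsilon> \<Longrightarrow> c' / t \<le> Lser l t"
    using Lser_near[OF l] by metis
  \<comment> \<open>Product of three lower bounds: \<open>3/4\<close> from
    \<open>x \<ge> 3b/4\<close>, \<open>c' / 9\<close> from \<open>|\<tau>| \<le> 9h / b\<close>,
    and \<open>8/9\<close> from \<open>x^2 + y^2 \<le> 9/2 * b^2\<close>.\<close>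
  define c where "c = 3 / 4 * (c' / 9) * ((8 / 9) powr (l + 1) / 4)"
  show thesis
  proof (rule that[of "min (1 / 4) (\<epsilon> / 9)" c])
    show "0 < c" using c' by (simp add: c_def)
    fix b h x y :: real
    assume h: "0 < h" "h < min (1 / 4) (\<epsilon> / 9) * b" and x: "3 / 4 * b \<le> x" "x \<le> 3 / 2 * b"
      and y: "3 / 4 * b \<le> y" "y \<le> 3 / 2 * b" and xy: "h \<le> \<bar>x - y\<bar>" "\<bar>x - y\<bar> \<le> 3 * h"
    have b: "0 < b" using h \<epsilon> by (smt (verit) min_less_iff_conj mult_nonneg_nonpos divide_pos_pos)
    have "min (1 / 4) (\<epsilon> / 9) * b \<le> \<epsilon> / 9 * b" using b by (intro mult_right_mono) auto
    then have h2: "h < \<epsilon> / 9 * b" using h by linarith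
    have xp: "0 < x" and yp: "0 < y" using x y b by linarith+
    have ne: "x \<noteq> y" using xy h by auto
    define \<sigma> where "\<sigma> = x\<^sup>2 + y\<^sup>2"
    have \<sigma>u: "\<sigma> \<le> 9 / 2 * b\<^sup>2"
      using power_mono[OF x(2), of 2] power_mono[OF y(2), of 2] xp yp unfolding \<sigma>_def power_mult_distrib by (simp add: power2_eq_square)
    have \<sigma>l: "9 / 8 * b\<^sup>2 \<le> \<sigma>"
      using power_mono[OF x(1), of 2] power_mono[OF y(1), of 2] b unfolding \<sigma>_def power_mult_distrib by (simp add: power2_eq_square)
    have \<sigma>p: "0 < \<sigma>" using xp yp by (simp add: \<sigma>_def add_pos_pos)
    have tau: "\<bar>tau x y\<bar> = \<bar>x - y\<bar> * ((x + y) / \<sigma>)"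
    proof -
      have "x\<^sup>2 - y\<^sup>2 = (x - y) * (x + y)" by (simp add: power2_eq_square algebra_simps)
      then show ?thesis unfolding tau_def \<sigma>_def[symmetric] using \<sigma>p xp yp by (simp add: abs_mult)
    qed
    have r1: "1 / (3 * b) \<le> (x + y) / \<sigma>"
    proof -
      have "(3 / 2 * b) / (9 / 2 * b\<^sup>2) \<le> (x + y) / \<sigma>" using x y b \<sigma>p \<sigma>u by (intro frac_le) auto
      then show ?thesis using b by (simp add: power2_eq_square)
    qed
    have r2: "(x + y) / \<sigma> \<le> 3 / b"
    proof -
      have "(x + y) / \<sigma> \<le> (3 * b) / (9 / 8 * b\<^sup>2)" using x y b \<sigma>p \<sigma>l by (intro frac_le) auto
      also have "\<dots> \<le> 3 / b" using b by (simp add: power2_eq_square divide_simps)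
      finally show ?thesis .
    qed
    have t1: "h / (3 * b) \<le> \<bar>tau x y\<bar>"
      using mult_mono[OF xy(1) r1] b h unfolding tau by simp
    have t2: "\<bar>tau x y\<bar> \<le> 9 * h / b"
      using mult_mono[OF xy(2) r2] b h xp yp \<sigma>p unfolding tau by simp
    have t3: "\<bar>tau x y\<bar> < \<epsilon>"
    proof -
      have "9 * h / b < \<epsilon>" using h2 b by (simp add: field_simps)
      then show ?thesis using t2 by linarith
    qed
    have t0: "0 < \<bar>tau x y\<bar>" using t1 h b by (smt (verit) divide_pos_pos)
    have "0 < 9 * h / b * \<bar>tau x y\<bar>" using h b t0 by (intro mult_pos_pos) auto
    then have "c' / (9 * h / b) \<le> c' / \<bar>tau x y\<bar>" using t2 c' by (intro divide_left_mono) auto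
    also have "\<dots> \<le> Lser l \<bar>tau x y\<bar>" by (rule L[OF t0 t3])
    finally have L1: "c' / 9 * (b / h) \<le> Lser l \<bar>tau x y\<bar>" by simp
    have "(8 / 9) powr (l + 1) * b powr (- 2 * l - 2) = (8 / (9 * b\<^sup>2)) powr (l + 1)"
    proof -
      have "(8 / (9 * b\<^sup>2)) powr (l + 1) = (8 / 9 * b powr (- 2)) powr (l + 1)"
        using b by (simp add: powr_minus_divide)
      also have "\<dots> = (8 / 9) powr (l + 1) * (b powr (- 2)) powr (l + 1)" by (rule powr_mult)
      also have "(b powr (- 2)) powr (l + 1) = b powr (- 2 * l - 2)"
      proof -
        have e: "- 2 * (l + 1) = - 2 * l - 2" by simp
        show ?thesis by (simp only: powr_powr e)
      qed
      finally show ?thesis ..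
    qed
    also have "\<dots> \<le> (4 / \<sigma>) powr (l + 1)"
    proof (rule powr_mono2)
      have "4 / (9 / 2 * b\<^sup>2) \<le> 4 / \<sigma>" using \<sigma>u \<sigma>p b by (intro divide_left_mono) auto
      then show "8 / (9 * b\<^sup>2) \<le> 4 / \<sigma>" by simp
    qed (use l in auto)
    finally have P: "(8 / 9) powr (l + 1) * b powr (- 2 * l - 2) \<le> (4 / \<sigma>) powr (l + 1)" .
    have bb: "b powr (- 2 * l) = b * b * b powr (- 2 * l - 2)"
      using b powr_add[of b "- 2 * l - 2" 2] by (simp add: power2_eq_square mult_ac)
    have "c * b powr (- 2 * l) / h = 3 / 4 * b * ((c' / 9 * (b / h)) * ((8 / 9) powr (l + 1) * b powr (- 2 * l - 2)) / 4)"
      unfolding c_def bb by simp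
    also have "\<dots> \<le> x * (Lser l \<bar>tau x y\<bar> * (4 / \<sigma>) powr (l + 1) / 4)"
      using x b c' h L1 P by (intro mult_mono divide_right_mono) (auto intro!: order_trans[OF _ L1])
    also have "\<dots> \<le> x * ((if y < x then 1 else - 1) * Kern l x y)"
      using Kern_Lser[OF l xp yp ne] xp unfolding \<sigma>_def by (intro mult_left_mono) auto
    finally show "h / (3 * b) \<le> \<bar>tau x y\<bar> \<and> c * b powr (- 2 * l) / h \<le> (if y < x then 1 else - 1) * (x * Kern l x y)"
      using t1 by (simp add: mult_ac)
  qed (use \<epsilon> in auto)
qed

text \<open>For negative \<lambda> the inequality \<open>|\<lambda>| / (\<lambda> + 1) < 1\<close>
  is exactly \<open>\<lambda> > -1/2\<close>. So a large \<open>N\<close> brings the modulus of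
  \<tau> above the threshold of \<open>Lser_far\<close>. The factor \<open>x\<close> stays in the
  bound: it is small when \<open>x\<close> is the point of \<open>(0, b]\<close>, and this is the
  loss that long intervals have to make good.\<close>

lemma Kern_far:
  assumes l: "l > - 1 / 2"
  obtains N c t0 where "2 \<le> N" "0 < c" "0 < t0"
    "\<And>b x y. 0 < b \<Longrightarrow> (0 < x \<and> x \<le> b \<and> N * b \<le> y \<and> y \<le> 2 * N * b) \<or> (0 < y \<and> y \<le> b \<and> N * b \<le> x \<and> x \<le> 2 * N * b)
      \<Longrightarrow> t0 \<le> \<bar>tau x y\<bar> \<and> c * x * b powr (- 2 * l - 2) \<le> (if y < x then 1 else - 1) * (x * Kern l x y)"
proof -
  define \<tau>0 where "\<tau>0 = \<bar>l\<bar> / (l + 1)"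
  have \<tau>0: "0 \<le> \<tau>0" "\<tau>0 < 1" using l by (auto simp: \<tau>0_def divide_less_eq)
  \<comment> \<open>The midpoint leaves room on both sides: \<open>t1 - \<tau>0\<close> enters the
    constant and \<open>1 - t1\<close> determines \<open>N\<close>.\<close>
  define t1 where "t1 = (1 + \<tau>0) / 2"
  have t1: "0 < t1" "t1 < 1" "\<tau>0 < t1" using \<tau>0 by (auto simp: t1_def)
  define N where "N = max 2 (2 / (1 - t1))"
  have N: "2 \<le> N" "2 / (1 - t1) \<le> N" by (auto simp: N_def)
  have N2: "2 / (1 + N\<^sup>2) \<le> 1 - t1"
  proof -
    have "2 \<le> N * (1 - t1)" using N(2) t1 by (simp add: pos_divide_le_eq)
    also have "\<dots> \<le> (1 + N\<^sup>2) * (1 - t1)"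
    proof (rule mult_right_mono)
      have "N * 1 \<le> N * N" using N by (intro mult_left_mono) auto
      then show "N \<le> 1 + N\<^sup>2" by (simp add: power2_eq_square)
    qed (use t1 in simp)
    finally have "2 \<le> (1 - t1) * (1 + N\<^sup>2)" by (simp only: mult.commute)
    moreover have "0 < 1 + N\<^sup>2" by (simp add: add_pos_nonneg)
    ultimately show ?thesis by (simp only: pos_divide_le_eq)
  qed
  define c where "c = dcf l 0 * (t1 - \<tau>0) * ((4 / (5 * N\<^sup>2)) powr (l + 1) / 4)"
  show thesis
  proof (rule that[of N c t1])
    show "0 < c" using t1 N dcf_pos[OF l, of 0] by (simp add: c_def)
    fix b x y :: real
    assume b: "0 < b" and xy: "(0 < x \<and> x \<le> b \<and> N * b \<le> y \<and> y \<le> 2 * N * b) \<or> (0 < y \<and> y \<le> b \<and> N * b \<le> x \<and> x \<le> 2 * N * b)"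
    have key: "t1 \<le> \<bar>tau u v\<bar> \<and> u\<^sup>2 + v\<^sup>2 \<le> 5 * N\<^sup>2 * b\<^sup>2 \<and> u < v" if "0 < u" "u \<le> b" "N * b \<le> v" "v \<le> 2 * N * b" for u v
    proof -
      have Nu: "N * u \<le> v" using mult_left_mono[OF that(2), of N] that(3) N by linarith
      have "1 * u < N * u" using that N by (intro mult_strict_right_mono) auto
      then have uv: "u < v" using Nu by linarith
      have s: "0 < u\<^sup>2 + v\<^sup>2" using that by (simp add: add_pos_nonneg)
      have "(1 + N\<^sup>2) * u\<^sup>2 \<le> u\<^sup>2 + v\<^sup>2"
        using power_mono[OF Nu, of 2] that N by (simp add: power_mult_distrib distrib_right)
      moreover have N0: "0 < 1 + N\<^sup>2" by (simp add: add_pos_nonneg)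
      ultimately have "u\<^sup>2 * (1 + N\<^sup>2) \<le> 1 * (u\<^sup>2 + v\<^sup>2)" by (simp add: mult.commute)
      then have "u\<^sup>2 / (u\<^sup>2 + v\<^sup>2) \<le> 1 / (1 + N\<^sup>2)" using s N0 by (simp only: pos_divide_le_eq times_divide_eq_left pos_le_divide_eq mult_1)
      moreover have "\<bar>tau u v\<bar> = 1 - 2 * (u\<^sup>2 / (u\<^sup>2 + v\<^sup>2))"
      proof -
        have "u\<^sup>2 \<le> v\<^sup>2" using uv that by (intro power_mono) auto
        then have "\<bar>tau u v\<bar> = (v\<^sup>2 - u\<^sup>2) / (u\<^sup>2 + v\<^sup>2)" using s by (simp add: tau_def abs_divide)
        also have "v\<^sup>2 - u\<^sup>2 = (u\<^sup>2 + v\<^sup>2) - 2 * u\<^sup>2" by simp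
        also have "((u\<^sup>2 + v\<^sup>2) - 2 * u\<^sup>2) / (u\<^sup>2 + v\<^sup>2) = 1 - 2 * (u\<^sup>2 / (u\<^sup>2 + v\<^sup>2))"
        proof -
          have "(S - 2 * A) / S = 1 - 2 * (A / S)" if "0 < S" for S A :: real
            using that by (simp add: diff_divide_distrib)
          from this[OF s] show ?thesis .
        qed
        finally show ?thesis .
      qed
      ultimately have A: "t1 \<le> \<bar>tau u v\<bar>" using N2 by simp
      have "u\<^sup>2 \<le> b\<^sup>2" "v\<^sup>2 \<le> (2 * N * b)\<^sup>2" using that uv by (auto intro!: power_mono)
      moreover have "1 * b\<^sup>2 \<le> N\<^sup>2 * b\<^sup>2" using N by (intro mult_right_mono) (auto simp: one_le_power)
      ultimately have "u\<^sup>2 + v\<^sup>2 \<le> 5 * N\<^sup>2 * b\<^sup>2" by (simp add: power_mult_distrib)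
      with A uv show ?thesis by simp
    qed
    have Nb: "0 < N * b" using N b by simp
    have xp: "0 < x" and yp: "0 < y" using xy Nb by auto
    have T: "t1 \<le> \<bar>tau x y\<bar>" and S: "x\<^sup>2 + y\<^sup>2 \<le> 5 * N\<^sup>2 * b\<^sup>2" and ne: "x \<noteq> y"
      using key[of x y] key[of y x] xy tau_props(5)[OF xp yp] by (auto simp: add.commute)
    define \<sigma> where "\<sigma> = x\<^sup>2 + y\<^sup>2"
    have \<sigma>p: "0 < \<sigma>" using xp yp by (simp add: \<sigma>_def add_pos_pos)
    have "dcf l 0 * (\<bar>tau x y\<bar> - \<tau>0) \<le> Lser l \<bar>tau x y\<bar>"
      unfolding \<tau>0_def using T t1 tau_props(2)[OF xp yp] by (intro Lser_far[OF l]) (auto simp: \<tau>0_def)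
    moreover have "dcf l 0 * (t1 - \<tau>0) \<le> dcf l 0 * (\<bar>tau x y\<bar> - \<tau>0)"
      using T dcf_pos[OF l, of 0] by (intro mult_left_mono) auto
    ultimately have L1: "dcf l 0 * (t1 - \<tau>0) \<le> Lser l \<bar>tau x y\<bar>" by linarith
    have "(4 / (5 * N\<^sup>2)) powr (l + 1) * b powr (- 2 * l - 2) = (4 / (5 * N\<^sup>2 * b\<^sup>2)) powr (l + 1)"
    proof -
      have "(4 / (5 * N\<^sup>2 * b\<^sup>2)) powr (l + 1) = (4 / (5 * N\<^sup>2) * b powr (- 2)) powr (l + 1)"
        using b by (simp add: powr_minus_divide)
      also have "\<dots> = (4 / (5 * N\<^sup>2)) powr (l + 1) * (b powr (- 2)) powr (l + 1)" by (rule powr_mult)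
      also have "(b powr (- 2)) powr (l + 1) = b powr (- 2 * l - 2)"
      proof -
        have e: "- 2 * (l + 1) = - 2 * l - 2" by simp
        show ?thesis by (simp only: powr_powr e)
      qed
      finally show ?thesis ..
    qed
    also have "\<dots> \<le> (4 / \<sigma>) powr (l + 1)"
      using S \<sigma>p b N l unfolding \<sigma>_def[symmetric] by (intro powr_mono2 divide_left_mono) auto
    finally have P: "(4 / (5 * N\<^sup>2)) powr (l + 1) * b powr (- 2 * l - 2) \<le> (4 / \<sigma>) powr (l + 1)" .
    have D0: "0 \<le> dcf l 0 * (t1 - \<tau>0)" using dcf_pos[OF l, of 0] t1 by simp
    have "c * x * b powr (- 2 * l - 2) = x * ((dcf l 0 * (t1 - \<tau>0)) * ((4 / (5 * N\<^sup>2)) powr (l + 1) * b powr (- 2 * l - 2)) / 4)"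
      unfolding c_def by simp
    also have "\<dots> \<le> x * (Lser l \<bar>tau x y\<bar> * (4 / \<sigma>) powr (l + 1) / 4)"
      using xp L1 P D0 by (intro mult_left_mono divide_right_mono mult_mono) (auto intro: order_trans[OF D0 L1])
    also have "\<dots> \<le> x * ((if y < x then 1 else - 1) * Kern l x y)"
      using Kern_Lser[OF l xp yp ne] xp unfolding \<sigma>_def by (intro mult_left_mono) auto
    finally show "t1 \<le> \<bar>tau x y\<bar> \<and> c * x * b powr (- 2 * l - 2) \<le> (if y < x then 1 else - 1) * (x * Kern l x y)"
      using T by (simp add: mult_ac)
  qed (use N t1 in auto)
qed

section \<open>The weak type class is contained in every \<open>A_p\<close> class with
  \<open>p > 1\<close>\<close>

lemma set_nn_integral_powr_density_le:
  fixes w :: "real \<Rightarrow> ennreal"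
  assumes p: "0 < p" and I: "I \<in> sets lebesgue" "I \<subseteq> {0<..b}" and wm: "w \<in> borel_measurable Rplus"
  shows "(\<integral>\<^sup>+t\<in>I. mu_density p w t \<partial>lebesgue) \<le> ennreal (b powr p) * (\<integral>\<^sup>+t\<in>I. w t \<partial>lebesgue)"
proof -
  have Ip: "I \<subseteq> {0<..}" using I by auto
  have IR: "I \<in> sets Rplus" by (rule sets_RplusI[OF I(1) Ip])
  have "(\<integral>\<^sup>+t\<in>I. mu_density p w t \<partial>lebesgue) = (\<integral>\<^sup>+t. mu_density p w t * indicator I t \<partial>Rplus)"
    by (rule set_nn_integral_Rplus[OF Ip])
  also have "\<dots> \<le> (\<integral>\<^sup>+t. ennreal (b powr p) * (w t * indicator I t) \<partial>Rplus)"
    using I p by (intro nn_integral_mono) (auto simp: mu_density_def indicator_def intro!: mult_right_mono ennreal_leI powr_mono2)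
  also have "\<dots> = ennreal (b powr p) * (\<integral>\<^sup>+t. w t * indicator I t \<partial>Rplus)"
    using wm IR by (intro nn_integral_cmult) auto
  finally show ?thesis unfolding set_nn_integral_Rplus[OF Ip] .
qed

text \<open>Under \<open>w \<ge> \<theta> t^(2\<lambda>)\<close> the density of \<sigma> is at most
  \<open>\<theta>^(-1/(p-1)) t^(2\<lambda>)\<close>, because
  \<open>2\<lambda>p' - 2\<lambda>/(p-1) = 2\<lambda>\<close>. The power \<open>p - 1\<close> turns
  the constant into \<open>1 / \<theta>\<close>, so afterwards only the ratio
  \<open>X / \<theta>\<close> matters.\<close>

lemma Ap_product_bound:
  assumes p: "1 < p" and l: "l > - 1 / 2" and ab: "0 < a" "a < b" and \<theta>: "0 < \<theta>" and X: "0 \<le> X"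
    and w: "AE t in Rplus. t \<in> {a..b} \<longrightarrow> ennreal (\<theta> * t powr (2 * l)) \<le> w t"
    and mu: "(\<integral>\<^sup>+t\<in>{a<..<b}. mu_density p w t \<partial>lebesgue) \<le> ennreal X"
  shows "(\<integral>\<^sup>+t\<in>{a<..<b}. mu_density p w t \<partial>lebesgue) * epowr (\<integral>\<^sup>+t\<in>{a<..<b}. sigma_density l p w t \<partial>lebesgue) (p - 1)
    \<le> ennreal (X / \<theta> * ((b powr (2 * l + 2) - a powr (2 * l + 2)) / ((2 * l + 1) * b)) powr (p - 1))"
proof -
  define r where "r = - 1 / (p - 1)"
  have r: "r < 0" using p by (simp add: r_def)
  define V where "V = (b powr (2 * l + 2) - a powr (2 * l + 2)) / ((2 * l + 1) * b)"
  have V1: "(b powr (2 * l + 1) - a powr (2 * l + 1)) / (2 * l + 1) \<le> V"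
  proof -
    have "b * (b powr (2 * l + 1) - a powr (2 * l + 1)) \<le> b powr (2 * l + 2) - a powr (2 * l + 2)"
      using powr_diff_bounds(1)[of "2 * l + 1" a b] l ab by (simp add: add.assoc)
    then have "b * (b powr (2 * l + 1) - a powr (2 * l + 1)) / ((2 * l + 1) * b) \<le> V"
      unfolding V_def using l ab by (intro divide_right_mono) auto
    then show ?thesis using ab by simp
  qed
  have V0: "0 \<le> V" using V1 powr_mono2[of "2 * l + 1" a b] l ab by (intro order_trans[OF _ V1] divide_nonneg_pos) auto
  have Ip: "{a<..<b} \<subseteq> {0<..}" using ab by auto
  have "(\<integral>\<^sup>+t\<in>{a<..<b}. sigma_density l p w t \<partial>lebesgue) = (\<integral>\<^sup>+t. sigma_density l p w t * indicator {a<..<b} t \<partial>Rplus)"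
    by (rule set_nn_integral_Rplus[OF Ip])
  also have "\<dots> \<le> (\<integral>\<^sup>+t. ennreal (\<theta> powr r) * (ennreal (t powr (2 * l)) * indicator {a<..<b} t) \<partial>Rplus)"
  proof (rule nn_integral_mono_AE)
    show "AE t in Rplus. sigma_density l p w t * indicator {a<..<b} t \<le> ennreal (\<theta> powr r) * (ennreal (t powr (2 * l)) * indicator {a<..<b} t)"
      using w AE_space
    proof eventually_elim
      case (elim t)
      then have t: "0 < t" by simp
      show ?case
      proof (cases "t \<in> {a<..<b}")
        case True
        then have "ennreal (\<theta> * t powr (2 * l)) \<le> w t" using elim by simp
        then have "epowr (w t) r \<le> ennreal ((\<theta> * t powr (2 * l)) powr r)"
          using \<theta> t r by (intro epowr_antimono_real) auto
        then have "sigma_density l p w t \<le> ennreal (t powr (2 * l * conj_exp p)) * ennreal ((\<theta> * t powr (2 * l)) powr r)"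
          unfolding sigma_density_def r_def by (rule mult_left_mono) simp
        also have "\<dots> = ennreal (t powr (2 * l * conj_exp p) * (\<theta> * t powr (2 * l)) powr r)"
          by (simp add: ennreal_mult)
        also have "t powr (2 * l * conj_exp p) * (\<theta> * t powr (2 * l)) powr r = \<theta> powr r * t powr (2 * l)"
        proof -
          have "p / (p - 1) + - 1 / (p - 1) = 1" using p by (simp flip: diff_divide_distrib)
          then have "2 * l * conj_exp p + 2 * l * r = 2 * l"
            unfolding conj_exp_def r_def distrib_left[symmetric] by simp
          then have "t powr (2 * l * conj_exp p) * t powr (2 * l * r) = t powr (2 * l)" by (simp flip: powr_add)
          then show ?thesis using \<theta> t by (simp add: powr_mult powr_powr)
        qed
        finally show ?thesis using True by (simp add: ennreal_mult)
      qed simp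
    qed
  qed
  also have "\<dots> = ennreal (\<theta> powr r) * (\<integral>\<^sup>+t. ennreal (t powr (2 * l)) * indicator {a<..<b} t \<partial>Rplus)"
  proof (rule nn_integral_cmult)
    have "{a<..<b} \<in> sets Rplus" using ab by (intro sets_RplusI) auto
    then show "(\<lambda>t. ennreal (t powr (2 * l)) * indicator {a<..<b} t) \<in> borel_measurable Rplus"
      using powr_measurable_Rplus[of "2 * l"] by auto
  qed
  also have "(\<integral>\<^sup>+t. ennreal (t powr (2 * l)) * indicator {a<..<b} t \<partial>Rplus) = ennreal ((b powr (2 * l + 1) - a powr (2 * l + 1)) / (2 * l + 1))"
    unfolding set_nn_integral_Rplus[OF Ip, symmetric] using l ab by (intro powr_set_integral) auto
  also have "ennreal (\<theta> powr r) * \<dots> \<le> ennreal (\<theta> powr r) * ennreal V"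
    using V1 by (intro mult_left_mono ennreal_leI) auto
  also have "\<dots> = ennreal (\<theta> powr r * V)" using V0 by (simp add: ennreal_mult)
  finally have "epowr (\<integral>\<^sup>+t\<in>{a<..<b}. sigma_density l p w t \<partial>lebesgue) (p - 1) \<le> epowr (ennreal (\<theta> powr r * V)) (p - 1)"
    using p by (intro epowr_mono) auto
  also have "\<dots> = ennreal ((\<theta> powr r * V) powr (p - 1))"
    using V0 p by (intro epowr_ennreal_nonneg) auto
  also have "(\<theta> powr r * V) powr (p - 1) = 1 / \<theta> * V powr (p - 1)"
  proof -
    have "r * (p - 1) = - 1" using p by (simp add: r_def)
    then have "(\<theta> powr r) powr (p - 1) = 1 / \<theta>" using \<theta> by (simp add: powr_powr powr_minus_divide)
    then show ?thesis using V0 by (simp add: powr_mult)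
  qed
  finally have "(\<integral>\<^sup>+t\<in>{a<..<b}. mu_density p w t \<partial>lebesgue) * epowr (\<integral>\<^sup>+t\<in>{a<..<b}. sigma_density l p w t \<partial>lebesgue) (p - 1)
      \<le> ennreal X * ennreal (1 / \<theta> * V powr (p - 1))"
    by (rule mult_mono[OF mu]) auto
  also have "\<dots> = ennreal (X / \<theta> * V powr (p - 1))"
    using X \<theta> by (simp flip: ennreal_mult)
  finally show ?thesis by (simp add: V_def)
qed

text \<open>An infinite \<open>v\<close> would make \<open>w\<close> infinite almost everywhere on
  \<open>[a, b]\<close>, contrary to the finiteness of \<open>w\<close>. For finite positive
  \<open>v\<close> the strict inequality in \<open>weight_lower_bound\<close> is met by
  \<open>v / 2\<close>, the origin of the factor 2.\<close>

lemma weight_lower: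
  assumes wm: "w \<in> borel_measurable Rplus" and wfin: "AE t in Rplus. w t < \<infinity>" and C: "0 < C"
    and ab: "0 < a" "a < b"
    and le: "\<And>E. E \<in> sets lebesgue \<Longrightarrow> E \<subseteq> {a..b} \<Longrightarrow> v * ennreal (measure (bessel_measure l) E) \<le> ennreal C * (\<integral>\<^sup>+x\<in>E. w x \<partial>lebesgue)"
  obtains v0 where "0 \<le> v0" "v = ennreal v0" "AE t in Rplus. t \<in> {a..b} \<longrightarrow> ennreal (v0 / (2 * C) * t powr (2 * l)) \<le> w t"
proof -
  have lb: "AE x in Rplus. x \<in> {a..b} \<longrightarrow> ennreal (\<beta> * x powr (2 * l)) \<le> ennreal C * w x" if "0 \<le> \<beta>" "ennreal \<beta> < v" for \<beta>
    by (rule weight_lower_bound[OF wm C _ order_refl ab(1) le that]) auto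
  have vfin: "v \<noteq> \<infinity>"
  proof
    assume v: "v = \<infinity>"
    have "AE x in Rplus. \<forall>n::nat. x \<in> {a..b} \<longrightarrow> ennreal (real n * x powr (2 * l)) \<le> ennreal C * w x"
      unfolding AE_all_countable using v by (intro allI lb) auto
    then have "AE x in Rplus. x \<notin> {a..b}"
      using wfin AE_space
    proof eventually_elim
      case (elim x)
      show ?case
      proof
        assume x: "x \<in> {a..b}"
        obtain u where u: "w x = ennreal u" "0 \<le> u" using elim by (cases "w x" rule: ennreal_cases) auto
        have xp: "0 < x powr (2 * l)" using elim by simp
        obtain n where n: "C * u / x powr (2 * l) < real n" using reals_Archimedean2 by blast
        have "ennreal (real n * x powr (2 * l)) \<le> ennreal (C * u)"
          using elim x u C by (simp add: ennreal_mult)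
        then have "real n * x powr (2 * l) \<le> C * u" using C u by (simp add: ennreal_le_iff)
        then show False using n xp by (simp add: divide_less_eq)
      qed
    qed
    then have "emeasure Rplus {x \<in> space Rplus. \<not> x \<notin> {a..b}} = 0"
      by (subst (asm) AE_iff_measurable[OF _ refl]) (use ab in \<open>auto simp: sets_restrict_space intro!: image_eqI[of _ _ "{a..b}"]\<close>)
    moreover have "{x \<in> space Rplus. \<not> x \<notin> {a..b}} = {a..b}" using ab by auto
    moreover have "emeasure Rplus {a..b} = ennreal (b - a)"
      using ab by (subst emeasure_restrict_space) auto
    ultimately show False using ab by simp
  qed
  then obtain v0 where v0: "v = ennreal v0" "0 \<le> v0" by (cases v rule: ennreal_cases) auto
  have "AE t in Rplus. t \<in> {a..b} \<longrightarrow> ennreal (v0 / (2 * C) * t powr (2 * l)) \<le> w t"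
  proof (cases "v0 = 0")
    case False
    then have "ennreal (v0 / 2) < v" unfolding v0(1) using v0(2) by (intro ennreal_lessI) auto
    then have "AE t in Rplus. t \<in> {a..b} \<longrightarrow> ennreal (v0 / 2 * t powr (2 * l)) \<le> ennreal C * w t"
      using v0 by (intro lb) auto
    then show ?thesis
    proof eventually_elim
      case (elim t)
      show ?case
      proof
        assume "t \<in> {a..b}"
        then have "ennreal (1 / C) * ennreal (v0 / 2 * t powr (2 * l)) \<le> ennreal (1 / C) * (ennreal C * w t)"
          using elim by (intro mult_left_mono) auto
        then show "ennreal (v0 / (2 * C) * t powr (2 * l)) \<le> w t"
          using C v0 by (simp add: mult.assoc[symmetric] flip: ennreal_mult) (simp add: mult_ac)
      qed
    qed
  qed simp
  with v0 show thesis by (intro that)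
qed

text \<open>Applied with \<open>x\<close> the mass of an interval: the finite product supplied by
  \<open>weight_lower\<close> shows that the mass itself is finite.\<close>

lemma ennreal_mult_eq_ennreal:
  assumes "x * ennreal k = ennreal v" "0 < k" "0 \<le> v"
  obtains u where "x = ennreal u" "0 \<le> u" "v = u * k"
proof (cases x rule: ennreal_cases)
  case (real u)
  then have "ennreal (u * k) = ennreal v" using assms(1,2) by (subst ennreal_mult) auto
  then have "v = u * k" using real assms(2,3) by (subst (asm) ennreal_inj) auto
  with real show thesis by (intro that)
next
  case top
  then have "top = ennreal v" using assms(1,2) by (simp add: ennreal_top_mult)
  then show thesis by simp
qed

text \<open>The kernel is controlled only at separated points, so every comparison between subsets
  of \<open>[a, b]\<close> passes through the companion. The outcome is a pair of \<theta> and
  \<open>X\<close> with \<open>X / \<theta>\<close> at most of order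
  \<open>b^p (b - a) b^(2\<lambda>)\<close>, which \<open>Ap_product_bound\<close> turns into a
  bound of order \<open>\<nu>^p\<close>.\<close>

lemma A1_imp_Ap:
  assumes l: "l > - 1 / 2" and p: "1 < p" and w: "weight w" and A: "A1_condition l w"
  shows "Ap_condition p l w"
proof -
  have wm: "w \<in> borel_measurable Rplus" and wfin: "AE t in Rplus. w t < \<infinity>" using w by (auto simp: weight_def)
  obtain C0 where C0: "0 < C0" and A1: "\<And>s f. 0 < s \<Longrightarrow> f \<in> test_functions \<Longrightarrow>
      (\<integral>\<^sup>+x\<in>{x. 0 < x \<and> s < \<bar>bessel_riesz l f x\<bar>}. w x \<partial>lebesgue) \<le> ennreal (C0 / s) * (\<integral>\<^sup>+x\<in>{0<..}. ennreal \<bar>f x\<bar> * w x \<partial>lebesgue)"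
    using A unfolding A1_condition_def by blast
  define C where "C = 2 * C0 * sqrt pi / 2 powr (- 2 * l)"
  have C: "0 < C" using C0 by (simp add: C_def)
  define W where "W E = (\<integral>\<^sup>+x\<in>E. w x \<partial>lebesgue)" for E
  have pair: "W J * ennreal (\<kappa> * measure (bessel_measure l) E) \<le> ennreal C * W E"
    if "E \<in> sets lebesgue" "E \<subseteq> {pa..pb}" "0 < pa" "J \<in> sets lebesgue" "J \<subseteq> {da..db}" "0 < da"
      "\<epsilon> = 1 \<or> \<epsilon> = - 1" "0 < t" "0 < \<kappa>"
      "\<And>x y. x \<in> J \<Longrightarrow> y \<in> E \<Longrightarrow> t \<le> \<bar>tau x y\<bar>" "\<And>x y. x \<in> J \<Longrightarrow> y \<in> E \<Longrightarrow> \<kappa> \<le> \<epsilon> * (x * Kern l x y)"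
    for E J pa pb da db \<epsilon> t \<kappa>
    unfolding C_def W_def by (rule weak_type_pair[OF l wm C0 _ that]) (rule A1)
  obtain \<eta> c where \<eta>: "0 < \<eta>" "\<eta> \<le> 1 / 4" and c: "0 < c" and near:
    "\<And>b h x y. 0 < h \<Longrightarrow> h < \<eta> * b \<Longrightarrow> 3 / 4 * b \<le> x \<Longrightarrow> x \<le> 3 / 2 * b \<Longrightarrow> 3 / 4 * b \<le> y \<Longrightarrow> y \<le> 3 / 2 * b
      \<Longrightarrow> h \<le> \<bar>x - y\<bar> \<Longrightarrow> \<bar>x - y\<bar> \<le> 3 * h
      \<Longrightarrow> h / (3 * b) \<le> \<bar>tau x y\<bar> \<and> c * b powr (- 2 * l) / h \<le> (if y < x then 1 else - 1) * (x * Kern l x y)"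
    using Kern_near[OF l] by metis
  obtain N c' t0 where N: "2 \<le> N" and c': "0 < c'" and t0: "0 < t0" and far:
    "\<And>b x y. 0 < b \<Longrightarrow> (0 < x \<and> x \<le> b \<and> N * b \<le> y \<and> y \<le> 2 * N * b) \<or> (0 < y \<and> y \<le> b \<and> N * b \<le> x \<and> x \<le> 2 * N * b)
      \<Longrightarrow> t0 \<le> \<bar>tau x y\<bar> \<and> c' * x * b powr (- 2 * l - 2) \<le> (if y < x then 1 else - 1) * (x * Kern l x y)"
    using Kern_far[OF l] by metis
  \<comment> \<open>Ratio of the geometric series in the long case: a gain of
    \<open>2^(-n p)\<close> against a loss of \<open>2^n\<close>.\<close>
  define q where "q = (1 / 2) powr (p - 1)"
  have q: "0 < q" "q < 1"
    using gr_one_powr[of 2 "p - 1"] p by (auto simp: q_def powr_divide)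
  \<comment> \<open>\<open>K1\<close> is what remains of \<open>2 C^2 / (\<kappa>^2 mJ)\<close> once
    the lower bound for \<open>mJ\<close> is inserted and \<open>b\<close> and \<open>h\<close> are
    split off. \<open>K2\<close> collects the constants of the long case, with
    \<open>1 / \<eta>\<close> from \<open>b \<le> (b - a) / \<eta>\<close>.\<close>
  define K1 where "K1 = 4 * C\<^sup>2 / c\<^sup>2"
  define K2 where "K2 = 8 * C\<^sup>2 / (c'\<^sup>2 * (1 - q) * \<eta>)"
  define K where "K = max K1 K2"
  have K12: "0 < K1" "0 < K2" using C c c' q \<eta> by (auto simp: K1_def K2_def)
  then have K: "0 < K" by (simp add: K_def)
  \<comment> \<open>The alternative of a vanishing \<mu>-integral absorbs the case
    \<open>\<omega> = 0\<close>, in which the construction gives no positive \<theta>.\<close>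
  have main: "(\<integral>\<^sup>+t\<in>{a<..<b}. mu_density p w t \<partial>lebesgue) = 0 \<or>
      (\<exists>\<theta> X. 0 < \<theta> \<and> 0 \<le> X \<and> (AE t in Rplus. t \<in> {a..b} \<longrightarrow> ennreal (\<theta> * t powr (2 * l)) \<le> w t) \<and>
        (\<integral>\<^sup>+t\<in>{a<..<b}. mu_density p w t \<partial>lebesgue) \<le> ennreal X \<and>
        X / \<theta> \<le> K * b powr p * ((b - a) * b powr (2 * l)))" if ab: "0 < a" "a < b" for a b
  proof -
    have b: "0 < b" using ab by simp
    have muW: "(\<integral>\<^sup>+t\<in>{a<..<b}. mu_density p w t \<partial>lebesgue) \<le> ennreal (b powr p) * W {a..b}"
    proof -
      have "(\<integral>\<^sup>+t\<in>{a<..<b}. mu_density p w t \<partial>lebesgue) \<le> (\<integral>\<^sup>+t\<in>{a..b}. mu_density p w t \<partial>lebesgue)"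
        by (intro nn_integral_mono) (auto simp: indicator_def)
      also have "\<dots> \<le> ennreal (b powr p) * W {a..b}"
        unfolding W_def using p ab wm by (intro set_nn_integral_powr_density_le) auto
      finally show ?thesis .
    qed
    show ?thesis
    proof (cases "b - a < \<eta> * b")
      case True
      \<comment> \<open>short interval: the companion is the translate by \<open>2h\<close>, where the kernel is about \<open>1 / h\<close>\<close>
      define h where "h = b - a"
      have h: "0 < h" "h < \<eta> * b" using ab True by (auto simp: h_def)
      have "\<eta> * b \<le> 1 / 4 * b" using \<eta> b by (intro mult_right_mono) auto
      then have h4: "h < 1 / 4 * b" using h by linarith
      have a34: "3 / 4 * b \<le> a" using h4 by (simp add: h_def)
      define \<kappa> where "\<kappa> = c * b powr (- 2 * l) / h"
      have \<kappa>: "0 < \<kappa>" using c b h by (simp add: \<kappa>_def)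
      let ?J = "{b + h..b + 2 * h}"
      have kn: "h / (3 * b) \<le> \<bar>tau x y\<bar> \<and> \<kappa> \<le> (if y < x then 1 else - 1) * (x * Kern l x y)"
        if "(x \<in> ?J \<and> y \<in> {a..b}) \<or> (y \<in> ?J \<and> x \<in> {a..b})" for x y
      proof -
        have "h \<le> \<bar>x - y\<bar> \<and> \<bar>x - y\<bar> \<le> 3 * h \<and> 3 / 4 * b \<le> x \<and> x \<le> 3 / 2 * b \<and> 3 / 4 * b \<le> y \<and> y \<le> 3 / 2 * b"
          using that
        proof
          assume "x \<in> ?J \<and> y \<in> {a..b}"
          then have "b + h \<le> x" "x \<le> b + 2 * h" "a \<le> y" "y \<le> b" by auto
          moreover from this have "\<bar>x - y\<bar> = x - y" using h by simp
          ultimately show ?thesis using h h4 a34 h_def by linarith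
        next
          assume "y \<in> ?J \<and> x \<in> {a..b}"
          then have "b + h \<le> y" "y \<le> b + 2 * h" "a \<le> x" "x \<le> b" by auto
          moreover from this have "\<bar>x - y\<bar> = y - x" using h by simp
          ultimately show ?thesis using h h4 a34 h_def by linarith
        qed
        then show ?thesis unfolding \<kappa>_def using near[OF h, of x y] by blast
      qed
      define mJ where "mJ = measure (bessel_measure l) ?J"
      have mJ: "b powr (2 * l) / 2 * h \<le> mJ"
        using measure_bessel_Icc_ge[OF l, of 2 b "b + h" "b + 2 * h"] b h h4 by (simp add: mJ_def)
      have p1: "W ?J * ennreal (\<kappa> * measure (bessel_measure l) E) \<le> ennreal C * W E" if E: "E \<in> sets lebesgue" "E \<subseteq> {a..b}" for E
      proof (rule pair[where pa = a and pb = b and da = "b + h" and db = "b + 2 * h" and \<epsilon> = 1 and t = "h / (3 * b)"])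
        fix x y assume xy: "x \<in> ?J" "y \<in> E"
        then have "y < x" using E h by force
        then show "h / (3 * b) \<le> \<bar>tau x y\<bar>" "\<kappa> \<le> 1 * (x * Kern l x y)" using kn[of x y] xy E by auto
      qed (use E ab b h \<kappa> in auto)
      have p2: "W {a..b} * ennreal (\<kappa> * mJ) \<le> ennreal C * W ?J"
        unfolding mJ_def
      proof (rule pair[where pa = "b + h" and pb = "b + 2 * h" and da = a and db = b and \<epsilon> = "- 1" and t = "h / (3 * b)"])
        fix x y assume xy: "x \<in> {a..b}" "y \<in> ?J"
        then have "x < y" using h by force
        then show "h / (3 * b) \<le> \<bar>tau x y\<bar>" "\<kappa> \<le> - 1 * (x * Kern l x y)" using kn[of x y] xy by auto
      qed (use ab b h \<kappa> in auto)
      \<comment> \<open>The two directions chained: the mass of \<open>[a, b]\<close> is controlled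
        by that of the companion, and the latter by the mass of an arbitrary
        \<open>E\<close>.\<close>
      have le: "(W {a..b} * ennreal (\<kappa> * mJ * \<kappa>)) * ennreal (measure (bessel_measure l) E) \<le> ennreal (C\<^sup>2) * (\<integral>\<^sup>+x\<in>E. w x \<partial>lebesgue)"
        if E: "E \<in> sets lebesgue" "E \<subseteq> {a..b}" for E
      proof -
        have mJ0: "0 \<le> mJ" by (simp add: mJ_def)
        have "(W {a..b} * ennreal (\<kappa> * mJ * \<kappa>)) * ennreal (measure (bessel_measure l) E)
            = (W {a..b} * ennreal (\<kappa> * mJ)) * ennreal (\<kappa> * measure (bessel_measure l) E)"
        proof -
          have e1: "ennreal (\<kappa> * mJ * \<kappa>) = ennreal (\<kappa> * mJ) * ennreal \<kappa>" using \<kappa> mJ0 by (intro ennreal_mult) auto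
          have e2: "ennreal (\<kappa> * measure (bessel_measure l) E) = ennreal \<kappa> * ennreal (measure (bessel_measure l) E)"
            using \<kappa> by (intro ennreal_mult) auto
          show ?thesis unfolding e1 e2 by (simp only: mult.assoc)
        qed
        also have "\<dots> \<le> (ennreal C * W ?J) * ennreal (\<kappa> * measure (bessel_measure l) E)"
          by (rule mult_right_mono[OF p2]) simp
        also have "\<dots> = ennreal C * (W ?J * ennreal (\<kappa> * measure (bessel_measure l) E))" by (simp only: mult.assoc)
        also have "\<dots> \<le> ennreal C * (ennreal C * W E)" by (rule mult_left_mono[OF p1[OF E]]) simp
        also have "\<dots> = ennreal (C\<^sup>2) * W E" using C by (simp add: power2_eq_square ennreal_mult mult.assoc)
        finally show ?thesis by (simp add: W_def)
      qed
      have C2: "0 < C\<^sup>2" using C by simp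
      obtain v0 where v0: "0 \<le> v0" "W {a..b} * ennreal (\<kappa> * mJ * \<kappa>) = ennreal v0"
        "AE t in Rplus. t \<in> {a..b} \<longrightarrow> ennreal (v0 / (2 * C\<^sup>2) * t powr (2 * l)) \<le> w t"
        by (rule weight_lower[OF wm wfin C2 ab le])
      have "0 < b powr (2 * l) / 2 * h" using b h by simp
      then have mJp: "0 < mJ" using mJ by linarith
      have \<kappa>J: "0 < \<kappa> * mJ * \<kappa>" using \<kappa> mJp by simp
      obtain \<omega> where \<omega>: "W {a..b} = ennreal \<omega>" "0 \<le> \<omega>" and v\<omega>: "v0 = \<omega> * (\<kappa> * mJ * \<kappa>)"
        by (rule ennreal_mult_eq_ennreal[OF v0(2) \<kappa>J v0(1)])
      show ?thesis
      proof (cases "\<omega> = 0")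
        case True
        then show ?thesis using muW \<omega> by simp
      next
        case False
        then have \<omega>p: "0 < \<omega>" using \<omega> by simp
        define \<theta> where "\<theta> = v0 / (2 * C\<^sup>2)"
        have \<theta>: "0 < \<theta>" unfolding \<theta>_def v\<omega> using \<omega>p \<kappa>J C by simp
        have "b powr p * \<omega> / \<theta> = 2 * C\<^sup>2 * b powr p / (\<kappa> * mJ * \<kappa>)"
          unfolding \<theta>_def v\<omega> using \<omega>p by (simp add: mult_ac)
        also have "\<dots> \<le> 2 * C\<^sup>2 * b powr p / (\<kappa> * (b powr (2 * l) / 2 * h) * \<kappa>)"
          using mJ \<kappa> \<kappa>J b h by (intro divide_left_mono mult_right_mono mult_left_mono) (auto intro!: mult_pos_pos)
        also have "\<dots> = K1 * b powr p * (h * b powr (2 * l))"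
        proof -
          have "\<kappa> * (b powr (2 * l) / 2 * h) * \<kappa> = c\<^sup>2 / (2 * (h * b powr (2 * l)))"
            unfolding \<kappa>_def using b h by (simp add: powr_minus_divide power2_eq_square field_simps)
          then show ?thesis by (simp add: K1_def)
        qed
        also have "\<dots> \<le> K * b powr p * (h * b powr (2 * l))"
          using h b by (intro mult_right_mono) (auto simp: K_def)
        finally have X: "b powr p * \<omega> / \<theta> \<le> K * b powr p * ((b - a) * b powr (2 * l))" by (simp add: h_def)
        have "(\<integral>\<^sup>+t\<in>{a<..<b}. mu_density p w t \<partial>lebesgue) \<le> ennreal (b powr p * \<omega>)"
          using muW \<omega> by (simp add: ennreal_mult)
        then show ?thesis
          using \<theta> \<omega> X v0(3) unfolding \<theta>_def[symmetric]
          by (intro disjI2 exI[of _ \<theta>] exI[of _ "b powr p * \<omega>"]) auto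
      qed
    next
      case False
      \<comment> \<open>Long interval: \<open>[N b, 2 N b]\<close> is so far away that the leading term of the kernel dominates. On
        \<open>[b / 2\<^sup>n\<^sup>+\<^sup>1, b / 2\<^sup>n]\<close> the estimate loses \<open>2\<^sup>n\<close>, which \<open>t\<^sup>p\<close> compensates because \<open>p > 1\<close>.\<close>
      then have \<eta>b: "\<eta> * b \<le> b - a" by simp
      let ?J = "{N * b..2 * N * b}"
      have Nb: "b \<le> N * b" using N b by simp
      define mJ where "mJ = measure (bessel_measure l) ?J"
      have mJ: "b powr (2 * l) * b / 2 \<le> mJ"
      proof -
        have "b powr (2 * l) / (2 * N) * (2 * N * b - N * b) \<le> mJ"
          unfolding mJ_def using N b Nb by (intro measure_bessel_Icc_ge[OF l]) auto
        moreover have "b powr (2 * l) / (2 * N) * (2 * N * b - N * b) = b powr (2 * l) * b / 2"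
          using N by (simp add: field_simps)
        ultimately show ?thesis by simp
      qed
      define \<kappa>1 where "\<kappa>1 = c' * b * b powr (- 2 * l - 2)"
      have \<kappa>1: "0 < \<kappa>1" using c' b by (simp add: \<kappa>1_def)
      have p1: "W ?J * ennreal (\<kappa>1 * measure (bessel_measure l) E) \<le> ennreal C * W E" if E: "E \<in> sets lebesgue" "E \<subseteq> {a..b}" for E
      proof (rule pair[where pa = a and pb = b and da = "N * b" and db = "2 * N * b" and \<epsilon> = 1 and t = t0])
        fix x y assume xy: "x \<in> ?J" "y \<in> E"
        then have y: "0 < y" "y \<le> b" and x: "N * b \<le> x" "x \<le> 2 * N * b" using E ab by auto
        have "2 * b \<le> N * b" using N b by (intro mult_right_mono) auto
        then have "y < x" using x y b by linarith
        moreover have "\<kappa>1 \<le> c' * x * b powr (- 2 * l - 2)"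
          unfolding \<kappa>1_def using c' x Nb by (intro mult_right_mono mult_left_mono) auto
        moreover have "t0 \<le> \<bar>tau x y\<bar> \<and> c' * x * b powr (- 2 * l - 2) \<le> (if y < x then 1 else - 1) * (x * Kern l x y)"
          by (rule far) (use b x y in auto)
        ultimately show "t0 \<le> \<bar>tau x y\<bar>" "\<kappa>1 \<le> 1 * (x * Kern l x y)" by (simp_all only: if_True) (elim conjE, linarith)
      qed (use E ab b N Nb t0 \<kappa>1 in auto)
      \<comment> \<open>Stated for every left end \<open>r\<close> because \<mu> will be split
        dyadically. The loss \<open>b / r\<close> is the factor \<open>x\<close> of the kernel
        bound, taken at its smallest value \<open>r\<close>.\<close>
      have p2: "W {r..b} \<le> ennreal (2 * C / c' * (b / r)) * W ?J" if r: "0 < r" "r \<le> b" for r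
      proof -
        define \<kappa>2 where "\<kappa>2 = c' * r * b powr (- 2 * l - 2)"
        have \<kappa>2: "0 < \<kappa>2" using c' r b by (simp add: \<kappa>2_def)
        have "W {r..b} * ennreal (\<kappa>2 * mJ) \<le> ennreal C * W ?J"
          unfolding mJ_def
        proof (rule pair[where pa = "N * b" and pb = "2 * N * b" and da = r and db = b and \<epsilon> = "- 1" and t = t0])
          fix x y assume xy: "x \<in> {r..b}" "y \<in> ?J"
          then have x: "0 < x" "r \<le> x" "x \<le> b" and y: "N * b \<le> y" "y \<le> 2 * N * b" using r by auto
          have "2 * b \<le> N * b" using N b by (intro mult_right_mono) auto
          then have "x < y" using x y b by linarith
          moreover have "\<kappa>2 \<le> c' * x * b powr (- 2 * l - 2)"
            unfolding \<kappa>2_def using c' x by (intro mult_right_mono mult_left_mono) auto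
          ultimately show "t0 \<le> \<bar>tau x y\<bar>" "\<kappa>2 \<le> - 1 * (x * Kern l x y)" using far[of b x y] b x y by auto
        qed (use r b N t0 \<kappa>2 in auto)
        moreover have "c' * (r / b) / 2 \<le> \<kappa>2 * mJ"
        proof -
          have "b powr (- 2 * l - 2) * (b powr (2 * l) * b) = 1 / b"
            using b by (simp add: powr_diff powr_minus_divide power2_eq_square)
          then have "c' * (r / b) / 2 = c' * r / 2 * (b powr (- 2 * l - 2) * (b powr (2 * l) * b))" by simp
          also have "\<dots> = \<kappa>2 * (b powr (2 * l) * b / 2)"
            unfolding \<kappa>2_def by (simp only: times_divide_eq_left times_divide_eq_right mult_ac)
          also have "\<dots> \<le> \<kappa>2 * mJ" using mJ \<kappa>2 by (intro mult_left_mono) auto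
          finally show ?thesis .
        qed
        ultimately have "W {r..b} * ennreal (c' * (r / b) / 2) \<le> ennreal C * W ?J"
          by (meson ennreal_leI mult_left_mono order_trans zero_le)
        then have "W {r..b} * ennreal (c' * (r / b) / 2) * ennreal (2 * (b / r) / c') \<le> ennreal C * W ?J * ennreal (2 * (b / r) / c')"
          by (rule mult_right_mono) simp
        moreover have "W {r..b} * ennreal (c' * (r / b) / 2) * ennreal (2 * (b / r) / c') = W {r..b}"
          using c' r b by (simp add: mult.assoc flip: ennreal_mult)
        moreover have "ennreal C * W ?J * ennreal (2 * (b / r) / c') = ennreal (2 * C / c' * (b / r)) * W ?J"
        proof -
          have "ennreal (2 * C / c' * (b / r)) = ennreal C * ennreal (2 * (b / r) / c')"
            using C c' r b by (subst ennreal_mult[symmetric]) (auto simp: field_simps)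
          then show ?thesis by (simp only: mult_ac)
        qed
        ultimately show ?thesis by simp
      qed
      have le: "(W ?J * ennreal \<kappa>1) * ennreal (measure (bessel_measure l) E) \<le> ennreal C * (\<integral>\<^sup>+x\<in>E. w x \<partial>lebesgue)"
        if E: "E \<in> sets lebesgue" "E \<subseteq> {a..b}" for E
        using p1[OF E] \<kappa>1 by (simp add: W_def ennreal_mult mult.assoc)
      obtain v0 where v0: "0 \<le> v0" "W ?J * ennreal \<kappa>1 = ennreal v0"
        "AE t in Rplus. t \<in> {a..b} \<longrightarrow> ennreal (v0 / (2 * C) * t powr (2 * l)) \<le> w t"
        by (rule weight_lower[OF wm wfin C ab le])
      obtain \<omega> where \<omega>: "W ?J = ennreal \<omega>" "0 \<le> \<omega>" and v\<omega>: "v0 = \<omega> * \<kappa>1"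
        by (rule ennreal_mult_eq_ennreal[OF v0(2) \<kappa>1 v0(1)])
      \<comment> \<open>Sum of the geometric series with terms
        \<open>4 * C / c' * b^p * \<omega> * q^n\<close>.\<close>
      define X where "X = 4 * C / c' * b powr p * \<omega> / (1 - q)"
      have X0: "0 \<le> X" using C c' \<omega> q by (simp add: X_def)
      have muX: "(\<integral>\<^sup>+t\<in>{a<..<b}. mu_density p w t \<partial>lebesgue) \<le> ennreal X"
      proof -
        \<comment> \<open>All these intervals end at \<open>b\<close>, since \<open>p2\<close>
          bounds the mass of \<open>[r, b]\<close>. Their overlap is harmless: each \<open>t\<close>
          only has to be covered by one suitable term of the sum.\<close>
        let ?I = "\<lambda>n::nat. {b * (1 / 2) ^ Suc n..b}"
        have Ip: "{a<..<b} \<subseteq> {0<..}" using ab by auto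
        have Ip': "?I n \<subseteq> {0<..}" for n using b by (auto intro: order_less_le_trans[of 0 "b * (1 / 2) ^ Suc n"] simp del: power_Suc)
        have pw: "mu_density p w t * indicator {a<..<b} t \<le> (\<Sum>n. ennreal ((b * (1 / 2) ^ n) powr p) * (w t * indicator (?I n) t))" for t
        proof (cases "t \<in> {a<..<b}")
          case True
          then have t: "0 < t" "t < b" using ab by auto
          \<comment> \<open>Minimality gives the second half of
            \<open>b * 2^(-n-1) \<le> t \<le> b * 2^(-n)\<close>; for \<open>n = 0\<close> it is
            \<open>t < b\<close>.\<close>
          define n where "n = (LEAST n. b * (1 / 2) ^ Suc n \<le> t)"
          have "\<exists>n. b * (1 / 2) ^ Suc n \<le> t"
          proof -
            obtain n where "(1 / 2) ^ n < t / b" using real_arch_pow_inv[of "t / b" "1 / 2"] t b by auto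
            then have "b * (1 / 2) ^ n < t" using b by (simp add: field_simps)
            moreover have "b * (1 / 2) ^ Suc n \<le> b * (1 / 2) ^ n" using b by simp
            ultimately show ?thesis by (intro exI[of _ n]) linarith
          qed
          then have n1: "b * (1 / 2) ^ Suc n \<le> t" unfolding n_def by (rule LeastI_ex)
          have n2: "t \<le> b * (1 / 2) ^ n"
          proof (cases n)
            case 0
            then show ?thesis using t by simp
          next
            case (Suc k)
            then have "\<not> b * (1 / 2) ^ Suc k \<le> t" using not_less_Least[of k "\<lambda>n. b * (1 / 2) ^ Suc n \<le> t"] unfolding n_def[symmetric] by simp
            then show ?thesis using Suc by simp
          qed
          have "mu_density p w t * indicator {a<..<b} t \<le> ennreal ((b * (1 / 2) ^ n) powr p) * (w t * indicator (?I n) t)"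
            using True t n1 n2 p by (auto simp: mu_density_def indicator_def intro!: mult_right_mono ennreal_leI powr_mono2)
          also have "\<dots> = sum (\<lambda>n. ennreal ((b * (1 / 2) ^ n) powr p) * (w t * indicator (?I n) t)) {n}" by simp
          also have "\<dots> \<le> (\<Sum>n. ennreal ((b * (1 / 2) ^ n) powr p) * (w t * indicator (?I n) t))"
            by (rule sum_le_suminf) auto
          finally show ?thesis .
        qed simp
        have m: "(\<lambda>t. w t * indicator (?I n) t) \<in> borel_measurable Rplus" for n
        proof -
          have "?I n \<in> sets Rplus" using Ip' by (intro sets_RplusI) auto
          then show ?thesis using wm by auto
        qed
        have "(\<integral>\<^sup>+t\<in>{a<..<b}. mu_density p w t \<partial>lebesgue) = (\<integral>\<^sup>+t. mu_density p w t * indicator {a<..<b} t \<partial>Rplus)"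
          by (rule set_nn_integral_Rplus[OF Ip])
        also have "\<dots> \<le> (\<integral>\<^sup>+t. (\<Sum>n. ennreal ((b * (1 / 2) ^ n) powr p) * (w t * indicator (?I n) t)) \<partial>Rplus)"
          by (intro nn_integral_mono pw)
        also have "\<dots> = (\<Sum>n. \<integral>\<^sup>+t. ennreal ((b * (1 / 2) ^ n) powr p) * (w t * indicator (?I n) t) \<partial>Rplus)"
          by (rule nn_integral_suminf) (rule borel_measurable_times_ennreal[OF borel_measurable_const m])
        also have "\<dots> = (\<Sum>n. ennreal ((b * (1 / 2) ^ n) powr p) * W (?I n))"
          unfolding W_def set_nn_integral_Rplus[OF Ip'] by (rule suminf_cong) (rule nn_integral_cmult[OF m])
        also have "\<dots> \<le> (\<Sum>n. ennreal (4 * C / c' * b powr p * \<omega> * q ^ n))"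
        proof (intro suminf_le allI)
          fix n :: nat
          define u where "u = (1 / 2 :: real) ^ n"
          have u: "0 < u" "u \<le> 1" by (auto simp: u_def power_le_one)
          have "W (?I n) \<le> ennreal (2 * C / c' * (b / (b * (1 / 2) ^ Suc n))) * W ?J"
            using b u by (intro p2) (auto simp: u_def)
          also have "b / (b * (1 / 2) ^ Suc n) = 2 / u" using b by (simp add: u_def)
          finally have "ennreal ((b * u) powr p) * W (?I n) \<le> ennreal ((b * u) powr p) * (ennreal (2 * C / c' * (2 / u)) * ennreal \<omega>)"
            unfolding \<omega> by (rule mult_left_mono) simp
          also have "\<dots> = ennreal ((b * u) powr p * (2 * C / c' * (2 / u) * \<omega>))"
          proof -
            have "ennreal ((b * u) powr p) * (ennreal k * ennreal \<omega>) = ennreal ((b * u) powr p * (k * \<omega>))" if "0 \<le> k" for k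
              using that \<omega>(2) by (simp add: ennreal_mult)
            then show ?thesis using C c' u by simp
          qed
          also have "(b * u) powr p * (2 * C / c' * (2 / u) * \<omega>) = 4 * C / c' * b powr p * \<omega> * (u powr p / u)"
            using b u by (simp add: powr_mult)
          also have "u powr p / u = q ^ n"
          proof -
            have "u powr p / u = u powr (p - 1)" using u by (simp add: powr_diff)
            also have "\<dots> = ((1 / 2) powr real n) powr (p - 1)" by (simp add: u_def powr_realpow)
            also have "\<dots> = q powr real n" by (simp add: q_def powr_powr mult.commute)
            also have "\<dots> = q ^ n" using q by (simp add: powr_realpow)
            finally show ?thesis .
          qed
          finally show "ennreal ((b * (1 / 2) ^ n) powr p) * W (?I n) \<le> ennreal (4 * C / c' * b powr p * \<omega> * q ^ n)"
            by (simp add: u_def)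
        qed auto
        also have "\<dots> = ennreal X"
        proof (rule suminf_ennreal_eq)
          show "(\<lambda>n. 4 * C / c' * b powr p * \<omega> * q ^ n) sums X"
            using sums_mult[OF geometric_sums[of q], of "4 * C / c' * b powr p * \<omega>"] q by (simp add: X_def)
        qed (use C c' \<omega> q in auto)
        finally show ?thesis .
      qed
      show ?thesis
      proof (cases "\<omega> = 0")
        case True
        then show ?thesis using muX by (simp add: X_def)
      next
        case False
        then have \<omega>p: "0 < \<omega>" using \<omega> by simp
        define \<theta> where "\<theta> = v0 / (2 * C)"
        have \<theta>: "0 < \<theta>" unfolding \<theta>_def v\<omega> using \<omega>p \<kappa>1 C by simp
        have "X / \<theta> = 8 * C\<^sup>2 / (c' * (1 - q)) * b powr p / \<kappa>1"
          unfolding \<theta>_def v\<omega> X_def using \<omega>p by (simp add: power2_eq_square mult_ac)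
        also have "\<dots> = 8 * C\<^sup>2 / (c'\<^sup>2 * (1 - q)) * b powr p * (b * b powr (2 * l))"
        proof -
          have "1 / \<kappa>1 = 1 / c' * (b * b powr (2 * l))"
            unfolding \<kappa>1_def using b by (simp add: powr_diff powr_minus_divide power2_eq_square)
          then have "8 * C\<^sup>2 / (c' * (1 - q)) * b powr p * (1 / \<kappa>1) = 8 * C\<^sup>2 / (c' * (1 - q)) * b powr p * (1 / c' * (b * b powr (2 * l)))" by simp
          then show ?thesis by (simp add: power2_eq_square)
        qed
        also have "\<dots> \<le> 8 * C\<^sup>2 / (c'\<^sup>2 * (1 - q)) * b powr p * ((b - a) / \<eta> * b powr (2 * l))"
        proof -
          have "0 \<le> 8 * C\<^sup>2 / (c'\<^sup>2 * (1 - q))" using q by (intro divide_nonneg_nonneg mult_nonneg_nonneg) auto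
          moreover have "b \<le> (b - a) / \<eta>" using \<eta>b \<eta> by (simp add: le_divide_eq mult.commute)
          ultimately show ?thesis by (intro mult_left_mono mult_right_mono mult_nonneg_nonneg powr_ge_zero)
        qed
        also have "\<dots> = K2 * b powr p * ((b - a) * b powr (2 * l))"
          by (simp add: K2_def)
        also have "\<dots> \<le> K * b powr p * ((b - a) * b powr (2 * l))"
          using ab by (intro mult_right_mono) (auto simp: K_def)
        finally have "X / \<theta> \<le> K * b powr p * ((b - a) * b powr (2 * l))" .
        then show ?thesis
          using \<theta> X0 muX v0(3) unfolding \<theta>_def[symmetric] by blast
      qed
    qed
  qed
  \<comment> \<open>The added 1 produces the strict inequality of the definition.\<close>
  define C' where "C' = K / (2 * l + 1) powr (p - 1) + 1"
  have C': "0 < C'" using K l by (simp add: C'_def add_nonneg_pos)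
  show ?thesis
    unfolding Ap_condition_def
  proof (intro exI[of _ C'] conjI allI impI C')
    fix a b :: real assume ab: "0 < a \<and> a < b"
    define \<nu> where "\<nu> = b powr (2 * l + 2) - a powr (2 * l + 2)"
    have "0 < b powr (2 * l + 1) * (b - a)" using ab by simp
    also have "\<dots> \<le> \<nu>" using powr_diff_bounds(2)[of "2 * l + 1" a b] l ab by (simp add: \<nu>_def add.assoc)
    finally have \<nu>: "0 < \<nu>" .
    have \<nu>2: "b powr (2 * l + 1) * (b - a) \<le> \<nu>"
      using powr_diff_bounds(2)[of "2 * l + 1" a b] l ab by (simp add: \<nu>_def add.assoc)
    have \<nu>e: "C' * (b powr (2 * (l + 1)) - a powr (2 * (l + 1))) powr p = C' * \<nu> powr p" by (simp add: \<nu>_def)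
    let ?P = "(\<integral>\<^sup>+t\<in>{a<..<b}. mu_density p w t \<partial>lebesgue) * epowr (\<integral>\<^sup>+t\<in>{a<..<b}. sigma_density l p w t \<partial>lebesgue) (p - 1)"
    have "?P \<le> ennreal (K / (2 * l + 1) powr (p - 1) * \<nu> powr p)"
    proof (cases "(\<integral>\<^sup>+t\<in>{a<..<b}. mu_density p w t \<partial>lebesgue) = 0")
      case False
      then obtain \<theta> X where *: "0 < \<theta>" "0 \<le> X" "AE t in Rplus. t \<in> {a..b} \<longrightarrow> ennreal (\<theta> * t powr (2 * l)) \<le> w t"
        "(\<integral>\<^sup>+t\<in>{a<..<b}. mu_density p w t \<partial>lebesgue) \<le> ennreal X" "X / \<theta> \<le> K * b powr p * ((b - a) * b powr (2 * l))"
        using main[of a b] ab by blast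
      have "?P \<le> ennreal (X / \<theta> * (\<nu> / ((2 * l + 1) * b)) powr (p - 1))"
        unfolding \<nu>_def using ab by (intro Ap_product_bound[OF p l _ _ *(1-4)]) auto
      also have "\<dots> \<le> ennreal (K / (2 * l + 1) powr (p - 1) * \<nu> powr p)"
      proof (rule ennreal_leI)
        have "X / \<theta> * (\<nu> / ((2 * l + 1) * b)) powr (p - 1)
            \<le> K * b powr p * ((b - a) * b powr (2 * l)) * (\<nu> / ((2 * l + 1) * b)) powr (p - 1)"
          using *(5) by (intro mult_right_mono) auto
        also have "\<dots> = K * b powr p * ((b - a) * b powr (2 * l)) * (\<nu> powr (p - 1) / ((2 * l + 1) powr (p - 1) * b powr (p - 1)))"
          using \<nu> l ab by (simp add: powr_divide powr_mult)
        also have "K * b powr p * ((b - a) * b powr (2 * l)) * (\<nu> powr (p - 1) / ((2 * l + 1) powr (p - 1) * b powr (p - 1)))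
            = K / (2 * l + 1) powr (p - 1) * ((b powr (2 * l) * (b powr p / b powr (p - 1)) * (b - a)) * \<nu> powr (p - 1))"
          by simp
        also have "b powr p / b powr (p - 1) = b" using ab by (simp flip: powr_diff)
        also have "b powr (2 * l) * b = b powr (2 * l + 1)" using ab by (simp add: powr_add)
        also have "K / (2 * l + 1) powr (p - 1) * ((b powr (2 * l + 1) * (b - a)) * \<nu> powr (p - 1))
            \<le> K / (2 * l + 1) powr (p - 1) * (\<nu> * \<nu> powr (p - 1))"
          using \<nu>2 K by (intro mult_left_mono mult_right_mono) auto
        also have "\<nu> * \<nu> powr (p - 1) = \<nu> powr p" using \<nu> by (simp add: powr_diff)
        finally show "X / \<theta> * (\<nu> / ((2 * l + 1) * b)) powr (p - 1) \<le> K / (2 * l + 1) powr (p - 1) * \<nu> powr p" .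
      qed
      finally show ?thesis .
    qed simp
    also have "\<dots> < ennreal (C' * \<nu> powr p)"
      using \<nu> K by (intro ennreal_lessI) (auto simp: C'_def distrib_right add_nonneg_pos)
    finally show "?P < ennreal (C' * (b powr (2 * (l + 1)) - a powr (2 * (l + 1))) powr p)" unfolding \<nu>e .
  qed
qed

section \<open>Duality, nesting and doubling for \<open>A\<^sub>p\<close>\<close>

lemma weight_props:
  assumes "weight w"
  shows "w \<in> borel_measurable Rplus" "AE t in Rplus. w t < \<infinity>" "\<not> (AE t in Rplus. w t = 0)"
  using assms by (auto simp: weight_def)

lemma Ioo_Rplus: "0 \<le> a \<Longrightarrow> {a<..<b} \<in> sets Rplus" for a b :: real
  by (intro sets_RplusI) auto

lemma set_nn_integral_Ioo_Rplus:
  "0 \<le> a \<Longrightarrow> (\<integral>\<^sup>+t\<in>{a<..<b}. f t \<partial>lebesgue) = (\<integral>\<^sup>+t. f t * indicator {a<..<b} t \<partial>Rplus)" for f :: "real \<Rightarrow> ennreal"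
  by (rule set_nn_integral_Rplus) auto

lemma ennreal_powr_measurable: "(\<lambda>t. ennreal (t powr r)) \<in> borel_measurable Rplus"
  using powr_measurable_Rplus[of r] by auto

lemma epowr_measurable: "(\<lambda>x. epowr x r) \<in> borel_measurable borel"
  unfolding epowr_def by measurable

lemma density_measurable:
  assumes "w \<in> borel_measurable Rplus"
  shows "mu_density p w \<in> borel_measurable Rplus" "sigma_density l p w \<in> borel_measurable Rplus"
    "dual_weight l p w \<in> borel_measurable Rplus"
  unfolding mu_density_def sigma_density_def dual_weight_def
  using assms ennreal_powr_measurable measurable_compose[OF assms epowr_measurable] by (auto intro!: borel_measurable_times_ennreal)

lemma conj_exp_props:
  assumes "1 < p"
  shows "1 < conj_exp p" "conj_exp (conj_exp p) = p" "conj_exp p - 1 = 1 / (p - 1)" "1 / p + 1 / conj_exp p = 1"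
proof -
  have 1: "conj_exp p - 1 = 1 / (p - 1)" using assms by (simp add: conj_exp_def diff_divide_eq_iff divide_diff_eq_iff)
  then show "conj_exp p - 1 = 1 / (p - 1)" .
  have "0 < 1 / (p - 1)" using assms by simp
  then show "1 < conj_exp p" using 1 by linarith
  show "conj_exp (conj_exp p) = p"
    unfolding conj_exp_def[of "conj_exp p"] 1 using assms by (simp add: conj_exp_def)
  show "1 / p + 1 / conj_exp p = 1" using assms by (simp add: conj_exp_def diff_divide_distrib)
qed

lemma mu_density_dual: "0 < t \<Longrightarrow> mu_density (conj_exp p) (dual_weight l p w) t = sigma_density l p w t"
proof -
  assume t: "0 < t"
  have "conj_exp p + (2 * l - 1) * conj_exp p = 2 * l * conj_exp p" by (simp add: algebra_simps)
  then have "t powr conj_exp p * t powr ((2 * l - 1) * conj_exp p) = t powr (2 * l * conj_exp p)"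
    by (simp flip: powr_add)
  then show ?thesis by (simp add: mu_density_def dual_weight_def sigma_density_def mult.assoc[symmetric] flip: ennreal_mult)
qed

lemma dual_weight_eq:
  assumes p: "1 < p" and t: "0 < t" and w: "w t < \<infinity>" "0 < w t"
  obtains u where "0 < u" "w t = ennreal u" "dual_weight l p w t = ennreal (t powr ((2 * l - 1) * conj_exp p) * u powr (- 1 / (p - 1)))"
proof -
  obtain u where u: "w t = ennreal u" "0 \<le> u" using w by (cases "w t" rule: ennreal_cases) auto
  then have up: "0 < u" using w by simp
  show thesis
    by (rule that[OF up u(1)]) (use up in \<open>simp add: dual_weight_def u(1) epowr_ennreal flip: ennreal_mult\<close>)
qed

text \<open>Negative powers exchange 0 and \<infinity>. These two equivalences decide whether the
  dual is a weight.\<close>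

lemma dual_weight_finite_iff:
  assumes p: "1 < p" and t: "0 < t"
  shows "dual_weight l p w t < \<infinity> \<longleftrightarrow> 0 < w t" "dual_weight l p w t = 0 \<longleftrightarrow> w t = \<infinity>"
proof -
  have r: "- 1 / (p - 1) < 0" using p by simp
  have tp: "0 < t powr ((2 * l - 1) * conj_exp p)" using t by simp
  have "(dual_weight l p w t < \<infinity> \<longleftrightarrow> 0 < w t) \<and> (dual_weight l p w t = 0 \<longleftrightarrow> w t = \<infinity>)"
  proof (cases "w t" rule: ennreal_cases)
    case (real u)
    show ?thesis
    proof (cases "u = 0")
      case True
      then show ?thesis using real r tp p by (simp add: dual_weight_def epowr_def ennreal_mult_top)
    next
      case False
      then have "0 < u" using real by simp
      then show ?thesis using real tp by (simp add: dual_weight_def epowr_ennreal flip: ennreal_mult)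
    qed
  qed (use r p in \<open>simp add: dual_weight_def epowr_def\<close>)
  then show "dual_weight l p w t < \<infinity> \<longleftrightarrow> 0 < w t" "dual_weight l p w t = 0 \<longleftrightarrow> w t = \<infinity>" by auto
qed

lemma sigma_density_dual:
  assumes p: "1 < p" and t: "0 < t" and w: "w t < \<infinity>"
  shows "sigma_density l (conj_exp p) (dual_weight l p w) t = mu_density p w t"
proof -
  have c: "- 1 / (conj_exp p - 1) = - (p - 1)" "conj_exp (conj_exp p) = p"
    using conj_exp_props[OF p] p by simp_all
  show ?thesis
  proof (cases "w t = 0")
    case True
    have "dual_weight l p w t = \<infinity>" using dual_weight_finite_iff(1)[of p t l w] p t True by (simp add: less_top[symmetric])
    then show ?thesis using True p conj_exp_props(1)[OF p] by (simp add: sigma_density_def mu_density_def c epowr_def ennreal_mult_top)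
  next
    case False
    then have w0: "0 < w t" by (simp add: zero_less_iff_neq_zero)
    obtain u where u: "0 < u" "w t = ennreal u" "dual_weight l p w t = ennreal (t powr ((2 * l - 1) * conj_exp p) * u powr (- 1 / (p - 1)))"
      by (rule dual_weight_eq[where t = t and w = w and l = l, OF p t w w0])
    have v: "0 < t powr ((2 * l - 1) * conj_exp p) * u powr (- 1 / (p - 1))" using t u by simp
    have e1: "(2 * l - 1) * conj_exp p * - (p - 1) = - ((2 * l - 1) * p)" "- 1 / (p - 1) * - (p - 1) = 1"
    proof -
      have nz: "p - 1 \<noteq> 0" using p by simp
      then have "conj_exp p * (p - 1) = p" by (simp add: conj_exp_def)
      then show "(2 * l - 1) * conj_exp p * - (p - 1) = - ((2 * l - 1) * p)" by (simp only: mult.assoc mult_minus_right)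
      have "- 1 / c * - c = 1" if "c \<noteq> 0" for c :: real using that by simp
      then show "- 1 / (p - 1) * - (p - 1) = 1" using nz .
    qed
    have "(t powr ((2 * l - 1) * conj_exp p) * u powr (- 1 / (p - 1))) powr (- (p - 1)) = t powr (- ((2 * l - 1) * p)) * u"
      unfolding powr_mult powr_powr e1 using u by simp
    moreover have "t powr (2 * l * p) * t powr (- ((2 * l - 1) * p)) = t powr p"
    proof -
      have "2 * l * p + - ((2 * l - 1) * p) = p" by (simp add: algebra_simps)
      then show ?thesis by (simp flip: powr_add)
    qed
    ultimately show ?thesis
      unfolding sigma_density_def mu_density_def c u(3) epowr_ennreal[OF v]
      using u by (simp add: mult.assoc[symmetric] flip: ennreal_mult)
  qed
qed

section \<open>The product in the \<open>A_p\<close> condition, its dual and the change of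
  \<lambda>\<close>

definition Ap_prod :: "real \<Rightarrow> real \<Rightarrow> (real \<Rightarrow> ennreal) \<Rightarrow> real \<Rightarrow> real \<Rightarrow> ennreal"
  where "Ap_prod p l w a b = (\<integral>\<^sup>+t\<in>{a<..<b}. mu_density p w t \<partial>lebesgue)
        * epowr (\<integral>\<^sup>+t\<in>{a<..<b}. sigma_density l p w t \<partial>lebesgue) (p - 1)"

text \<open>This is \<open>(2\<lambda> + 2) \<nu>\<^sub>\<lambda>((a, b))\<close>.\<close>

definition nut :: "real \<Rightarrow> real \<Rightarrow> real \<Rightarrow> real"
  where "nut l a b = b powr (2 * (l + 1)) - a powr (2 * (l + 1))"

lemma nut_pos: "0 < nut l a b" if "l > - 1 / 2" "0 \<le> a" "a < b"
  unfolding nut_def using that by (simp add: powr_less_mono2)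

lemma Ap_condition_iff:
  "Ap_condition p l w \<longleftrightarrow> (\<exists>C>0. \<forall>a b. 0 < a \<and> a < b \<longrightarrow> Ap_prod p l w a b < ennreal (C * nut l a b powr p))"
  by (simp add: Ap_condition_def Ap_prod_def nut_def)

text \<open>Strictness is bought with the constant: \<open>C + 1\<close> works because
  \<open>nut\<close> is positive.\<close>

lemma Ap_conditionI:
  assumes l: "l > - 1 / 2" and C: "0 \<le> C"
    and le: "\<And>a b. 0 < a \<Longrightarrow> a < b \<Longrightarrow> Ap_prod p l w a b \<le> ennreal (C * nut l a b powr p)"
  shows "Ap_condition p l w"
  unfolding Ap_condition_iff
proof (intro exI[of _ "C + 1"] conjI allI impI)
  show "0 < C + 1" using C by simp
  fix a b :: real assume ab: "0 < a \<and> a < b"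
  have "0 < nut l a b powr p" using nut_pos[OF l, of a b] ab by simp
  then have "ennreal (C * nut l a b powr p) < ennreal ((C + 1) * nut l a b powr p)"
    using C by (intro ennreal_lessI) (auto simp: distrib_right add_nonneg_pos)
  then show "Ap_prod p l w a b < ennreal ((C + 1) * nut l a b powr p)"
    using le[of a b] ab by simp
qed

text \<open>Dualising swaps the two integrals, and the exponents fit because
  \<open>(p - 1) (p' - 1) = 1\<close>.\<close>

lemma Ap_prod_dual:
  assumes p: "1 < p" and ab: "0 \<le> a" and w: "weight w"
  shows "Ap_prod (conj_exp p) l (dual_weight l p w) a b = epowr (Ap_prod p l w a b) (1 / (p - 1))"
proof -
  have 1: "(\<integral>\<^sup>+t\<in>{a<..<b}. mu_density (conj_exp p) (dual_weight l p w) t \<partial>lebesgue) = (\<integral>\<^sup>+t\<in>{a<..<b}. sigma_density l p w t \<partial>lebesgue)"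
    using ab by (intro nn_integral_cong) (auto simp: indicator_def mu_density_dual)
  have 2: "(\<integral>\<^sup>+t\<in>{a<..<b}. sigma_density l (conj_exp p) (dual_weight l p w) t \<partial>lebesgue) = (\<integral>\<^sup>+t\<in>{a<..<b}. mu_density p w t \<partial>lebesgue)"
    unfolding set_nn_integral_Ioo_Rplus[OF ab]
  proof (rule nn_integral_cong_AE)
    show "AE t in Rplus. sigma_density l (conj_exp p) (dual_weight l p w) t * indicator {a<..<b} t = mu_density p w t * indicator {a<..<b} t"
      using weight_props(2)[OF w] AE_space by eventually_elim (simp add: sigma_density_dual[OF p])
  qed
  have r: "0 < 1 / (p - 1)" using p by simp
  have "epowr (epowr x (p - 1)) (1 / (p - 1)) = x" for x
  proof -
    have "epowr (epowr x (p - 1)) (1 / (p - 1)) = epowr x 1" using p epowr_epowr[of "p - 1" "1 / (p - 1)" x] by simp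
    also have "\<dots> = x" by (cases x rule: ennreal_cases) (auto simp: epowr_def)
    finally show ?thesis .
  qed
  then show ?thesis
    unfolding Ap_prod_def 1 2 conj_exp_props(3)[OF p] epowr_mult[OF r] by (simp add: mult.commute)
qed

text \<open>Finiteness of the product forces the weight to be positive almost everywhere.\<close>

lemma Ap_imp_pos:
  assumes l: "l > - 1 / 2" and p: "1 < p" and w: "weight w" and A: "Ap_condition p l w"
  shows "AE t in Rplus. 0 < w t"
proof -
  note wp = weight_props[OF w]
  obtain C where C: "\<And>a b. 0 < a \<Longrightarrow> a < b \<Longrightarrow> Ap_prod p l w a b < ennreal (C * nut l a b powr p)"
    using A unfolding Ap_condition_iff by blast
  \<comment> \<open>An exhaustion of the half line. Some member carries part of \<open>w\<close>, so
    each larger one has a nonzero \<mu>-integral and hence a finite \<sigma>-integral; the density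
    of \<sigma> is infinite wherever \<open>w\<close> vanishes.\<close>
  let ?I = "\<lambda>n. {1 / real (Suc n)<..<real (Suc n)}"
  have ev: "\<exists>n0. \<forall>n\<ge>n0. t \<in> ?I n" if t: "0 < t" for t
  proof -
    obtain N where N: "max t (1 / t) < real N" using reals_Archimedean2 by blast
    have "t \<in> ?I n" if "N \<le> n" for n
    proof -
      have "t < real (Suc n)" "1 / t < real (Suc n)" using N that by linarith+
      then show ?thesis using t by (simp add: field_simps)
    qed
    then show ?thesis by blast
  qed
  have "\<exists>m. \<not> (AE t in Rplus. t \<in> ?I m \<longrightarrow> w t = 0)"
  proof (rule ccontr)
    assume "\<not> (\<exists>m. \<not> (AE t in Rplus. t \<in> ?I m \<longrightarrow> w t = 0))"
    then have "AE t in Rplus. \<forall>m. t \<in> ?I m \<longrightarrow> w t = 0" unfolding AE_all_countable by blast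
    then have "AE t in Rplus. w t = 0"
      using AE_space
    proof eventually_elim
      case (elim t)
      then obtain n where "t \<in> ?I n" using ev[of t] by auto
      then show ?case using elim by blast
    qed
    then show False using wp(3) by blast
  qed
  then obtain m where m: "\<not> (AE t in Rplus. t \<in> ?I m \<longrightarrow> w t = 0)" by blast
  have each: "AE t in Rplus. t \<in> ?I n \<longrightarrow> 0 < w t" if n: "m \<le> n" "1 \<le> n" for n
  proof -
    define a where "a = 1 / real (Suc n)"
    define b where "b = real (Suc n)"
    have ab: "0 < a" "a < b" using n by (auto simp: a_def b_def divide_less_eq intro!: less_1_mult)
    have sub: "?I m \<subseteq> {a<..<b}"
    proof -
      have "a \<le> 1 / real (Suc m)" unfolding a_def using n by (intro divide_left_mono) auto
      moreover have "real (Suc m) \<le> b" unfolding b_def using n by simp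
      ultimately show ?thesis by auto
    qed
    have mm: "(\<lambda>t. mu_density p w t * indicator {a<..<b} t) \<in> borel_measurable Rplus"
      and sm: "(\<lambda>t. sigma_density l p w t * indicator {a<..<b} t) \<in> borel_measurable Rplus"
      using density_measurable[OF wp(1)] Ioo_Rplus[of a b] ab by auto
    have mu: "(\<integral>\<^sup>+t\<in>{a<..<b}. mu_density p w t \<partial>lebesgue) \<noteq> 0"
    proof
      assume "(\<integral>\<^sup>+t\<in>{a<..<b}. mu_density p w t \<partial>lebesgue) = 0"
      then have "AE t in Rplus. mu_density p w t * indicator {a<..<b} t = 0"
        using mm ab by (subst (asm) set_nn_integral_Ioo_Rplus) (auto simp: nn_integral_0_iff_AE)
      then have "AE t in Rplus. t \<in> ?I m \<longrightarrow> w t = 0"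
        using AE_space by eventually_elim (use sub in \<open>auto simp: mu_density_def indicator_def split: if_splits\<close>)
      then show False using m by blast
    qed
    have "(\<integral>\<^sup>+t\<in>{a<..<b}. sigma_density l p w t \<partial>lebesgue) \<noteq> \<infinity>"
    proof
      assume "(\<integral>\<^sup>+t\<in>{a<..<b}. sigma_density l p w t \<partial>lebesgue) = \<infinity>"
      then have "Ap_prod p l w a b = \<infinity>" using mu p by (simp add: Ap_prod_def ennreal_mult_top)
      then show False using C[OF ab] by simp
    qed
    then have "AE t in Rplus. sigma_density l p w t * indicator {a<..<b} t \<noteq> \<infinity>"
      using sm ab unfolding set_nn_integral_Ioo_Rplus[OF less_imp_le[OF ab(1)]] by (intro nn_integral_PInf_AE) auto
    then show ?thesis
      using AE_space
    proof eventually_elim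
      case (elim t)
      show ?case
      proof
        assume "t \<in> ?I n"
        then have "sigma_density l p w t \<noteq> \<infinity>" using elim by (simp add: a_def b_def)
        then show "0 < w t"
          using elim p by (cases "w t = 0") (auto simp: sigma_density_def epowr_def ennreal_mult_top zero_less_iff_neq_zero)
      qed
    qed
  qed
  have "AE t in Rplus. \<forall>n. m + 1 \<le> n \<longrightarrow> t \<in> ?I n \<longrightarrow> 0 < w t"
    unfolding AE_all_countable using each by auto
  then show ?thesis
    using AE_space
  proof eventually_elim
    case (elim t)
    then obtain n0 where "\<forall>n\<ge>n0. t \<in> ?I n" using ev[of t] by auto
    then have "t \<in> ?I (max n0 (m + 1))" by simp
    then show ?case using elim(1)[rule_format, of "max n0 (m + 1)"] by simp
  qed
qed

lemma dual_weight_weight: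
  assumes p: "1 < p" and w: "weight w" and pos: "AE t in Rplus. 0 < w t"
  shows "weight (dual_weight l p w)"
  unfolding weight_def
proof (intro conjI)
  show "dual_weight l p w \<in> borel_measurable Rplus" by (rule density_measurable[OF weight_props(1)[OF w]])
  show "AE t in Rplus. dual_weight l p w t < \<infinity>"
    using pos AE_space by eventually_elim (use p dual_weight_finite_iff in auto)
  show "\<not> (AE t in Rplus. dual_weight l p w t = 0)"
  proof
    assume "AE t in Rplus. dual_weight l p w t = 0"
    then have "AE t in Rplus. w t = \<infinity>"
      using AE_space by eventually_elim (use p dual_weight_finite_iff in auto)
    then have "AE t in Rplus. False" using weight_props(2)[OF w] by eventually_elim simp
    then have "AE t in Rplus. w t = 0" by eventually_elim simp
    then show False using weight_props(3)[OF w] by blast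
  qed
qed

text \<open>Both directions raise the inequality to a power, by \<open>Ap_prod_dual\<close>, and the
  exponents of \<open>nut\<close> match since \<open>p' = p / (p - 1)\<close>. In the forward
  direction the finiteness of the dual weight rests on \<open>w\<close> being positive almost
  everywhere, which the condition itself provides.\<close>

lemma dual_factor:
  assumes l: "l > - 1 / 2" and p: "1 < p" and w: "weight w"
  shows "Ap_condition p l w \<longleftrightarrow> weight (dual_weight l p w) \<and> Ap_condition (conj_exp p) l (dual_weight l p w)"
proof
  have r: "0 < 1 / (p - 1)" using p by simp
  have c: "conj_exp p = p * (1 / (p - 1))" by (simp add: conj_exp_def)
  assume A: "Ap_condition p l w"
  then obtain C where C: "0 < C" "\<And>a b. 0 < a \<Longrightarrow> a < b \<Longrightarrow> Ap_prod p l w a b < ennreal (C * nut l a b powr p)"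
    unfolding Ap_condition_iff by blast
  have "Ap_condition (conj_exp p) l (dual_weight l p w)"
  proof (rule Ap_conditionI[OF l])
    show "0 \<le> C powr (1 / (p - 1))" by simp
    fix a b :: real assume ab: "0 < a" "a < b"
    have "Ap_prod (conj_exp p) l (dual_weight l p w) a b \<le> epowr (ennreal (C * nut l a b powr p)) (1 / (p - 1))"
      unfolding Ap_prod_dual[OF p less_imp_le[OF ab(1)] w] by (rule epowr_mono[OF less_imp_le[OF C(2)[OF ab]] r])
    also have "\<dots> = ennreal (C powr (1 / (p - 1)) * nut l a b powr conj_exp p)"
      unfolding c using C(1) r by (subst epowr_ennreal_nonneg) (auto simp only: powr_mult powr_powr, auto)
    finally show "Ap_prod (conj_exp p) l (dual_weight l p w) a b \<le> ennreal (C powr (1 / (p - 1)) * nut l a b powr conj_exp p)" .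
  qed
  then show "weight (dual_weight l p w) \<and> Ap_condition (conj_exp p) l (dual_weight l p w)"
    using dual_weight_weight[OF p w Ap_imp_pos[OF l p w A]] by blast
next
  have r: "0 < p - 1" using p by simp
  have c: "p = conj_exp p * (p - 1)" using p by (simp add: conj_exp_def)
  assume "weight (dual_weight l p w) \<and> Ap_condition (conj_exp p) l (dual_weight l p w)"
  then obtain C where C: "0 < C" "\<And>a b. 0 < a \<Longrightarrow> a < b \<Longrightarrow> Ap_prod (conj_exp p) l (dual_weight l p w) a b < ennreal (C * nut l a b powr conj_exp p)"
    unfolding Ap_condition_iff by blast
  show "Ap_condition p l w"
  proof (rule Ap_conditionI[OF l])
    show "0 \<le> C powr (p - 1)" by simp
    fix a b :: real assume ab: "0 < a" "a < b"
    have "Ap_prod p l w a b = epowr (epowr (Ap_prod p l w a b) (1 / (p - 1))) (p - 1)"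
    proof -
      have "epowr x 1 = x" for x by (cases x rule: ennreal_cases) (auto simp: epowr_def)
      then show ?thesis using p by (subst epowr_epowr) auto
    qed
    also have "\<dots> \<le> epowr (ennreal (C * nut l a b powr conj_exp p)) (p - 1)"
      unfolding Ap_prod_dual[OF p less_imp_le[OF ab(1)] w, symmetric] by (rule epowr_mono[OF less_imp_le[OF C(2)[OF ab]] r])
    also have "\<dots> = ennreal ((C * nut l a b powr conj_exp p) powr (p - 1))"
      using C(1) r by (intro epowr_ennreal_nonneg) auto
    also have "(C * nut l a b powr conj_exp p) powr (p - 1) = C powr (p - 1) * nut l a b powr p"
      unfolding powr_mult powr_powr c[symmetric] ..
    finally show "Ap_prod p l w a b \<le> ennreal (C powr (p - 1) * nut l a b powr p)" .
  qed
qed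

text \<open>Let \<open>d = 2 (\<lambda>2 - \<lambda>1)\<close>. Bounding the extra power of
  \<open>t\<close> by that of \<open>b\<close> costs \<open>b^(d q')\<close> in the
  \<sigma>-integral, that is \<open>b^(d q)\<close> in the product. This is absorbed because
  \<open>b^d\<close> times \<open>nut\<close> for \<lambda>1 is at most \<open>nut\<close> for
  \<lambda>2, by \<open>a^d \<le> b^d\<close>.\<close>

lemma nesting_l:
  assumes q: "1 < q" and l: "l1 > - 1 / 2" "l1 < l2" and A: "Ap_condition q l1 w" and wm: "w \<in> borel_measurable Rplus"
  shows "Ap_condition q l2 w"
proof -
  obtain C where C: "0 < C" "\<And>a b. 0 < a \<Longrightarrow> a < b \<Longrightarrow> Ap_prod q l1 w a b < ennreal (C * nut l1 a b powr q)"
    using A unfolding Ap_condition_iff by blast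
  define d where "d = 2 * (l2 - l1)"
  have d: "0 < d" using l by (simp add: d_def)
  have cp: "0 < conj_exp q" using conj_exp_props(1)[OF q] by simp
  have q1: "0 < q - 1" using q by simp
  have l2: "l2 > - 1 / 2" using l by simp
  show ?thesis
  proof (rule Ap_conditionI[OF l2])
    show "0 \<le> C" using C by simp
    fix a b :: real assume ab: "0 < a" "a < b"
    have a0: "0 \<le> a" using ab by simp
    have "(\<integral>\<^sup>+t\<in>{a<..<b}. sigma_density l2 q w t \<partial>lebesgue)
        \<le> (\<integral>\<^sup>+t. ennreal (b powr (d * conj_exp q)) * (sigma_density l1 q w t * indicator {a<..<b} t) \<partial>Rplus)"
      unfolding set_nn_integral_Ioo_Rplus[OF a0]
    proof (rule nn_integral_mono)
      fix t
      show "sigma_density l2 q w t * indicator {a<..<b} t \<le> ennreal (b powr (d * conj_exp q)) * (sigma_density l1 q w t * indicator {a<..<b} t)"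
      proof (cases "t \<in> {a<..<b}")
        case True
        have "2 * l2 * conj_exp q = d * conj_exp q + 2 * l1 * conj_exp q" by (simp add: d_def algebra_simps)
        then have "t powr (2 * l2 * conj_exp q) = t powr (d * conj_exp q) * t powr (2 * l1 * conj_exp q)" by (simp add: powr_add)
        also have "\<dots> \<le> b powr (d * conj_exp q) * t powr (2 * l1 * conj_exp q)"
          using True ab d cp by (intro mult_right_mono powr_mono2) auto
        finally have "ennreal (t powr (2 * l2 * conj_exp q)) \<le> ennreal (b powr (d * conj_exp q)) * ennreal (t powr (2 * l1 * conj_exp q))"
          by (simp add: ennreal_leI flip: ennreal_mult)
        then have "ennreal (t powr (2 * l2 * conj_exp q)) * epowr (w t) (- 1 / (q - 1))
            \<le> ennreal (b powr (d * conj_exp q)) * ennreal (t powr (2 * l1 * conj_exp q)) * epowr (w t) (- 1 / (q - 1))"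
          by (rule mult_right_mono) simp
        then show ?thesis using True by (simp add: sigma_density_def mult.assoc)
      qed simp
    qed
    also have "\<dots> = ennreal (b powr (d * conj_exp q)) * (\<integral>\<^sup>+t\<in>{a<..<b}. sigma_density l1 q w t \<partial>lebesgue)"
      unfolding set_nn_integral_Ioo_Rplus[OF a0]
      using density_measurable(2)[OF wm] Ioo_Rplus[OF a0, of b] by (intro nn_integral_cmult) auto
    finally have "epowr (\<integral>\<^sup>+t\<in>{a<..<b}. sigma_density l2 q w t \<partial>lebesgue) (q - 1)
        \<le> epowr (ennreal (b powr (d * conj_exp q)) * (\<integral>\<^sup>+t\<in>{a<..<b}. sigma_density l1 q w t \<partial>lebesgue)) (q - 1)"
      using q1 by (rule epowr_mono)
    also have "\<dots> = ennreal (b powr (d * q)) * epowr (\<integral>\<^sup>+t\<in>{a<..<b}. sigma_density l1 q w t \<partial>lebesgue) (q - 1)"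
    proof -
      have "d * conj_exp q * (q - 1) = d * q" using q by (simp add: conj_exp_def)
      then have "epowr (ennreal (b powr (d * conj_exp q))) (q - 1) = ennreal (b powr (d * q))"
        using ab by (subst epowr_ennreal) (auto simp only: powr_powr powr_gt_zero)
      then show ?thesis by (simp only: epowr_mult[OF q1])
    qed
    finally have "Ap_prod q l2 w a b \<le> (\<integral>\<^sup>+t\<in>{a<..<b}. mu_density q w t \<partial>lebesgue) *
        (ennreal (b powr (d * q)) * epowr (\<integral>\<^sup>+t\<in>{a<..<b}. sigma_density l1 q w t \<partial>lebesgue) (q - 1))"
      unfolding Ap_prod_def by (rule mult_left_mono) simp
    also have "\<dots> = ennreal (b powr (d * q)) * Ap_prod q l1 w a b"
      unfolding Ap_prod_def by (simp only: mult_ac)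
    also have "\<dots> \<le> ennreal (b powr (d * q)) * ennreal (C * nut l1 a b powr q)"
      using C(2)[OF ab] by (intro mult_left_mono) auto
    also have "\<dots> = ennreal (C * (b powr d * nut l1 a b) powr q)"
      using C(1) by (simp add: powr_mult powr_powr mult_ac flip: ennreal_mult)
    also have "\<dots> \<le> ennreal (C * nut l2 a b powr q)"
    proof (intro ennreal_leI mult_left_mono powr_mono2)
      have e: "x powr (2 * (l2 + 1)) = x powr d * x powr (2 * (l1 + 1))" for x
      proof -
        have "2 * (l2 + 1) = d + 2 * (l1 + 1)" by (simp add: d_def)
        then show ?thesis by (simp only: powr_add)
      qed
      have "a powr d * a powr (2 * (l1 + 1)) \<le> b powr d * a powr (2 * (l1 + 1))"
        using ab d by (intro mult_right_mono powr_mono2) auto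
      then show "b powr d * nut l1 a b \<le> nut l2 a b" unfolding nut_def e by (simp add: right_diff_distrib)
      show "0 \<le> b powr d * nut l1 a b" using nut_pos[OF l(1) a0 ab(2)] by simp
    qed (use q C in auto)
    finally show "Ap_prod q l2 w a b \<le> ennreal (C * nut l2 a b powr q)" .
  qed
qed

section \<open>Hoelder's inequality, the characteristic and nesting in \<open>p\<close>\<close>

lemma epowr_1 [simp]: "epowr x 1 = x"
  by (cases x rule: ennreal_cases) (auto simp: epowr_def)

text \<open>Weighted arithmetic-geometric mean with free scales \<open>A\<close> and
  \<open>B\<close>. In Hoelder's inequality they are the two integrals, and the right side then
  integrates to the product of their powers.\<close>

lemma epowr_Young:
  assumes \<theta>: "0 < \<theta>" "\<theta> < 1" and AB: "0 < A" "0 < B"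
  shows "epowr x \<theta> * epowr y (1 - \<theta>)
    \<le> ennreal (A powr \<theta> * B powr (1 - \<theta>)) * (ennreal (\<theta> / A) * x + ennreal ((1 - \<theta>) / B) * y)"
proof (cases "x = \<infinity> \<or> y = \<infinity>")
  case True
  have "0 < \<theta> / A" "0 < (1 - \<theta>) / B" and K: "0 < A powr \<theta> * B powr (1 - \<theta>)" using assms by auto
  have T: "ennreal c * top = top" if "0 < c" for c using that by (simp add: ennreal_mult_top)
  have "ennreal (\<theta> / A) * x + ennreal ((1 - \<theta>) / B) * y = top"
  proof (cases "x = top")
    case True
    show ?thesis unfolding True T[OF \<open>0 < \<theta> / A\<close>] by simp
  next
    case False
    with True have y: "y = top" by simp
    show ?thesis unfolding y T[OF \<open>0 < (1 - \<theta>) / B\<close>] by simp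
  qed
  then show ?thesis by (simp only: T[OF K]) simp
next
  case False
  obtain u where u: "x = ennreal u" "0 \<le> u" using False by (cases x rule: ennreal_cases) auto
  obtain v where v: "y = ennreal v" "0 \<le> v" using False by (cases y rule: ennreal_cases) auto
  define K where "K = A powr \<theta> * B powr (1 - \<theta>)"
  have K: "0 < K" using AB by (simp add: K_def)
  have c: "0 \<le> \<theta> / A" "0 \<le> (1 - \<theta>) / B" using \<theta> AB by auto
  have "u powr \<theta> * v powr (1 - \<theta>) \<le> K * (\<theta> / A * u + (1 - \<theta>) / B * v)"
  proof (cases "u = 0 \<or> v = 0")
    case True
    have "0 \<le> K * (\<theta> / A * u + (1 - \<theta>) / B * v)"
      using K c u v by (intro mult_nonneg_nonneg add_nonneg_nonneg) auto
    with True show ?thesis by auto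
  next
    case False
    have "(u / A) powr \<theta> * (v / B) powr (1 - \<theta>) \<le> \<theta> * (u / A) + (1 - \<theta>) * (v / B)"
      using False u v \<theta> AB by (intro Youngs_inequality_0) auto
    then have "K * ((u / A) powr \<theta> * (v / B) powr (1 - \<theta>)) \<le> K * (\<theta> * (u / A) + (1 - \<theta>) * (v / B))"
      using K by (intro mult_left_mono) auto
    moreover have "K * ((u / A) powr \<theta> * (v / B) powr (1 - \<theta>)) = u powr \<theta> * v powr (1 - \<theta>)"
      unfolding K_def using AB u v by (simp add: powr_divide)
    ultimately show ?thesis by simp
  qed
  then have "ennreal (u powr \<theta>) * ennreal (v powr (1 - \<theta>)) \<le> ennreal (K * (\<theta> / A * u + (1 - \<theta>) / B * v))"
    by (subst ennreal_mult[symmetric]) (auto intro: ennreal_leI)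
  also have "\<dots> = ennreal K * ennreal (\<theta> / A * u + (1 - \<theta>) / B * v)"
    using K c u v by (intro ennreal_mult add_nonneg_nonneg mult_nonneg_nonneg) auto
  also have "ennreal (\<theta> / A * u + (1 - \<theta>) / B * v) = ennreal (\<theta> / A * u) + ennreal ((1 - \<theta>) / B * v)"
    using c u v by (intro ennreal_plus mult_nonneg_nonneg) auto
  also have "ennreal (\<theta> / A * u) = ennreal (\<theta> / A) * ennreal u" using c u by (intro ennreal_mult) auto
  also have "ennreal ((1 - \<theta>) / B * v) = ennreal ((1 - \<theta>) / B) * ennreal v" using c v by (intro ennreal_mult) auto
  finally show ?thesis
    using \<theta> u v by (simp only: u v K_def epowr_ennreal_nonneg diff_gt_0_iff_gt)
qed

text \<open>The exponents \<theta> and \<open>1 - \<theta>\<close> sit on the functions, which suits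
  both uses: \<open>\<theta> = 1/p\<close> for \<mu> and \<sigma>, and the interpolation between two
  exponents. Zero and infinite integrals are split off because the scales in
  \<open>epowr_Young\<close> must be positive reals.\<close>

lemma nn_integral_Hoelder:
  assumes \<theta>: "0 < \<theta>" "\<theta> < 1" and f: "f \<in> borel_measurable M" and g: "g \<in> borel_measurable M"
  shows "(\<integral>\<^sup>+x. epowr (f x) \<theta> * epowr (g x) (1 - \<theta>) \<partial>M)
    \<le> epowr (\<integral>\<^sup>+x. f x \<partial>M) \<theta> * epowr (\<integral>\<^sup>+x. g x \<partial>M) (1 - \<theta>)"
proof -
  have \<theta>': "0 < 1 - \<theta>" using \<theta> by simp
  let ?F = "\<integral>\<^sup>+x. f x \<partial>M" and ?G = "\<integral>\<^sup>+x. g x \<partial>M"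
  have zero: "epowr x r \<noteq> 0" if "x \<noteq> 0" "0 < r" for x r
    using that by (cases x rule: ennreal_cases) (auto simp: epowr_ennreal_nonneg)
  consider "?F = 0 \<or> ?G = 0" | "?F \<noteq> 0" "?G \<noteq> 0" "?F = \<infinity> \<or> ?G = \<infinity>" | "?F \<noteq> 0" "?G \<noteq> 0" "?F \<noteq> \<infinity>" "?G \<noteq> \<infinity>" by blast
  then show ?thesis
  proof cases
    case 1
    then have "AE x in M. epowr (f x) \<theta> * epowr (g x) (1 - \<theta>) = 0"
    proof
      assume "?F = 0"
      then have "AE x in M. f x = 0" using f by (simp add: nn_integral_0_iff_AE)
      then show ?thesis by eventually_elim (use \<theta> in simp)
    next
      assume "?G = 0"
      then have "AE x in M. g x = 0" using g by (simp add: nn_integral_0_iff_AE)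
      then show ?thesis by eventually_elim (use \<theta>' in simp)
    qed
    then have "(\<integral>\<^sup>+x. epowr (f x) \<theta> * epowr (g x) (1 - \<theta>) \<partial>M) = (\<integral>\<^sup>+x. 0 \<partial>M)" by (rule nn_integral_cong_AE)
    then show ?thesis by simp
  next
    case 2
    have "epowr ?F \<theta> * epowr ?G (1 - \<theta>) = top"
      using 2(3)
    proof
      assume "?F = \<infinity>"
      then show ?thesis using zero[OF 2(2) \<theta>'] \<theta> by (simp add: ennreal_top_mult)
    next
      assume "?G = \<infinity>"
      then show ?thesis using zero[OF 2(1) \<theta>(1)] \<theta>' by (simp add: ennreal_mult_top)
    qed
    then show ?thesis by simp
  next
    case 3
    obtain A where A: "?F = ennreal A" "0 < A" using 3 by (cases ?F rule: ennreal_cases) (auto simp: less_le)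
    obtain B where B: "?G = ennreal B" "0 < B" using 3 by (cases ?G rule: ennreal_cases) (auto simp: less_le)
    let ?K = "ennreal (A powr \<theta> * B powr (1 - \<theta>))"
    have m: "(\<lambda>x. ennreal (\<theta> / A) * f x) \<in> borel_measurable M" "(\<lambda>x. ennreal ((1 - \<theta>) / B) * g x) \<in> borel_measurable M"
      using f g by auto
    have "(\<integral>\<^sup>+x. epowr (f x) \<theta> * epowr (g x) (1 - \<theta>) \<partial>M)
        \<le> (\<integral>\<^sup>+x. ?K * (ennreal (\<theta> / A) * f x + ennreal ((1 - \<theta>) / B) * g x) \<partial>M)"
      by (intro nn_integral_mono epowr_Young \<theta> A B)
    also have "\<dots> = ?K * ((\<integral>\<^sup>+x. ennreal (\<theta> / A) * f x \<partial>M) + (\<integral>\<^sup>+x. ennreal ((1 - \<theta>) / B) * g x \<partial>M))"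
      using m by (subst nn_integral_cmult) (auto simp: nn_integral_add)
    also have "\<dots> = ?K * (ennreal (\<theta> / A) * ennreal A + ennreal ((1 - \<theta>) / B) * ennreal B)"
      using f g by (simp only: nn_integral_cmult A B)
    also have "ennreal (\<theta> / A) * ennreal A = ennreal \<theta>" using A \<theta> by (simp flip: ennreal_mult)
    also have "ennreal ((1 - \<theta>) / B) * ennreal B = ennreal (1 - \<theta>)" using B \<theta> by (simp flip: ennreal_mult)
    also have "ennreal \<theta> + ennreal (1 - \<theta>) = 1" using \<theta> by (simp flip: ennreal_plus)
    also have "?K * 1 = epowr ?F \<theta> * epowr ?G (1 - \<theta>)"
      using A B by (simp add: epowr_ennreal ennreal_mult)
    finally show ?thesis .
  qed
qed

lemma set_nn_integral_Hoelder:
  assumes \<theta>: "0 < \<theta>" "\<theta> < 1" and a: "0 \<le> a"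
    and f: "f \<in> borel_measurable Rplus" and g: "g \<in> borel_measurable Rplus"
    and h: "AE t in Rplus. h t \<le> epowr (f t) \<theta> * epowr (g t) (1 - \<theta>)"
  shows "(\<integral>\<^sup>+t\<in>{a<..<b}. h t \<partial>lebesgue)
    \<le> epowr (\<integral>\<^sup>+t\<in>{a<..<b}. f t \<partial>lebesgue) \<theta> * epowr (\<integral>\<^sup>+t\<in>{a<..<b}. g t \<partial>lebesgue) (1 - \<theta>)"
proof -
  let ?i = "indicator {a<..<b} :: real \<Rightarrow> ennreal"
  have m: "(\<lambda>t. f t * ?i t) \<in> borel_measurable Rplus" "(\<lambda>t. g t * ?i t) \<in> borel_measurable Rplus"
    using f g Ioo_Rplus[OF a, of b] by auto
  have "(\<integral>\<^sup>+t. h t * ?i t \<partial>Rplus) \<le> (\<integral>\<^sup>+t. epowr (f t * ?i t) \<theta> * epowr (g t * ?i t) (1 - \<theta>) \<partial>Rplus)"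
  proof (rule nn_integral_mono_AE)
    show "AE t in Rplus. h t * ?i t \<le> epowr (f t * ?i t) \<theta> * epowr (g t * ?i t) (1 - \<theta>)"
      using h by eventually_elim (auto simp: indicator_def)
  qed
  also have "\<dots> \<le> epowr (\<integral>\<^sup>+t. f t * ?i t \<partial>Rplus) \<theta> * epowr (\<integral>\<^sup>+t. g t * ?i t \<partial>Rplus) (1 - \<theta>)"
    by (rule nn_integral_Hoelder[OF \<theta> m])
  finally show ?thesis unfolding set_nn_integral_Ioo_Rplus[OF a] .
qed

text \<open>The case \<open>\<theta> = 1/p\<close>: the product of the \<open>1/p\<close>-power of
  the \<mu>-density and the \<open>(1 - 1/p)\<close>-power of the \<sigma>-density is
  \<open>t^(2\<lambda>+1)\<close>, since the powers of \<open>w\<close> cancel where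
  \<open>0 < w < \<infinity>\<close>.\<close>

lemma nu_powr_le_Ap_prod:
  assumes p: "1 < p" and w: "weight w" and pos: "AE t in Rplus. 0 < w t" and a: "0 \<le> a"
  shows "epowr (nu l {a<..<b}) p \<le> Ap_prod p l w a b"
proof -
  note wp = weight_props[OF w]
  have \<theta>: "0 < 1 / p" "1 / p < 1" using p by auto
  have "AE t in Rplus. ennreal (t powr (2 * l + 1)) \<le> epowr (mu_density p w t) (1 / p) * epowr (sigma_density l p w t) (1 - 1 / p)"
    using pos wp(2) AE_space
  proof eventually_elim
    case (elim t)
    then have t: "0 < t" by simp
    obtain u where u: "w t = ennreal u" "0 \<le> u" using elim by (cases "w t" rule: ennreal_cases) auto
    with elim have u0: "0 < u" by simp
    have m: "mu_density p w t = ennreal (t powr p * u)" "sigma_density l p w t = ennreal (t powr (2 * l * conj_exp p) * u powr (- 1 / (p - 1)))"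
      using u u0 by (simp_all add: mu_density_def sigma_density_def epowr_ennreal ennreal_mult)
    have e: "2 * l * conj_exp p * (1 - 1 / p) = 2 * l" "- 1 / (p - 1) * (1 - 1 / p) = - (1 / p)" "p * (1 / p) = 1"
      using p by (simp_all add: conj_exp_def field_simps)
    have 1: "epowr (mu_density p w t) (1 / p) = ennreal (t * u powr (1 / p))"
      unfolding m by (subst epowr_ennreal) (use t u0 in simp, use t in \<open>simp only: powr_mult powr_powr e powr_one\<close>)
    have 2: "epowr (sigma_density l p w t) (1 - 1 / p) = ennreal (t powr (2 * l) * u powr (- (1 / p)))"
      unfolding m by (subst epowr_ennreal) (use t u0 in simp, simp only: powr_mult powr_powr e)
    have "(t * u powr (1 / p)) * (t powr (2 * l) * u powr (- (1 / p))) = t powr (2 * l + 1)"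
      using t u0 by (simp add: powr_add powr_minus)
    then have "epowr (mu_density p w t) (1 / p) * epowr (sigma_density l p w t) (1 - 1 / p) = ennreal (t powr (2 * l + 1))"
      unfolding 1 2 using t by (subst ennreal_mult[symmetric]) auto
    then show ?case by simp
  qed
  then have "nu l {a<..<b} \<le> epowr (\<integral>\<^sup>+t\<in>{a<..<b}. mu_density p w t \<partial>lebesgue) (1 / p)
      * epowr (\<integral>\<^sup>+t\<in>{a<..<b}. sigma_density l p w t \<partial>lebesgue) (1 - 1 / p)" (is "_ \<le> epowr ?M _ * epowr ?S _")
    unfolding nu_def by (rule set_nn_integral_Hoelder[OF \<theta> a density_measurable(1,2)[OF wp(1)]])
  then have "epowr (nu l {a<..<b}) p \<le> epowr (epowr ?M (1 / p) * epowr ?S (1 - 1 / p)) p"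
    using p by (intro epowr_mono) auto
  also have "\<dots> = epowr ?M (1 / p * p) * epowr ?S ((1 - 1 / p) * p)"
  proof -
    have "0 < p" "1 / p \<noteq> 0" "p \<noteq> 0" "1 - 1 / p \<noteq> 0" using p by auto
    then show ?thesis by (simp only: epowr_mult epowr_epowr not_False_eq_True)
  qed
  also have "1 / p * p = 1" using p by simp
  also have "(1 - 1 / p) * p = p - 1" using p by (simp add: left_diff_distrib)
  finally show ?thesis by (simp add: Ap_prod_def)
qed

lemma nu_Ioo:
  assumes l: "l > - 1 / 2" and ab: "0 \<le> a" "a < b"
  shows "nu l {a<..<b} = ennreal (nut l a b / (2 * l + 2))"
  unfolding nu_def nut_def using l ab by (subst powr_set_integral) (auto simp: algebra_simps)

text \<open>A single interval already contributes at least 1 to the supremum; \<open>(1, 2)\<close>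
  is taken.\<close>

lemma Ap_char_ge_1:
  assumes l: "l > - 1 / 2" and p: "1 < p" and w: "weight w" and A: "Ap_condition p l w"
  shows "1 \<le> Ap_char p l w"
proof -
  define v where "v = nut l 1 2 / (2 * l + 2)"
  have v: "0 < v" unfolding v_def using nut_pos[OF l, of 1 2] l by simp
  have n: "nu l {1<..<2} = ennreal v" unfolding v_def using nu_Ioo[OF l] by simp
  let ?M = "\<integral>\<^sup>+t\<in>{1<..<2}. mu_density p w t \<partial>lebesgue" and ?S = "\<integral>\<^sup>+t\<in>{1<..<2}. sigma_density l p w t \<partial>lebesgue"
  have iv: "inverse (ennreal v) = ennreal (1 / v)" using v by (simp add: inverse_ennreal inverse_eq_divide)
  have p1: "0 < p - 1" using p by simp
  have "v powr p * (1 / v * (1 / v) powr (p - 1)) = 1"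
    using v by (simp add: powr_divide powr_diff)
  then have "1 = ennreal (v powr p) * (ennreal (1 / v) * ennreal ((1 / v) powr (p - 1)))"
    using v by (simp flip: ennreal_mult ennreal_1)
  also have "\<dots> = epowr (nu l {1<..<2}) p * (ennreal (1 / v) * epowr (ennreal (1 / v)) (p - 1))"
    using v by (simp add: n epowr_ennreal)
  also have "\<dots> \<le> Ap_prod p l w 1 2 * (ennreal (1 / v) * epowr (ennreal (1 / v)) (p - 1))"
    using nu_powr_le_Ap_prod[OF p w Ap_imp_pos[OF l p w A], of 1] by (intro mult_right_mono) auto
  also have "\<dots> = (?M / nu l {1<..<2}) * epowr (?S / nu l {1<..<2}) (p - 1)"
    unfolding n divide_ennreal_def iv epowr_mult[OF p1] Ap_prod_def by (simp only: mult_ac)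
  also have "\<dots> \<le> Ap_char p l w"
    unfolding Ap_char_def by (rule SUP_upper2[of "(1, 2)"]) auto
  finally show ?thesis .
qed

text \<open>With \<open>\<theta> = (p1 - 1) / (p2 - 1)\<close> the \<sigma>-density for
  \<open>p2\<close> is the \<theta>-power of the one for \<open>p1\<close> times the
  \<open>(1 - \<theta>)\<close>-power of \<open>t^(2\<lambda>)\<close>. Hoelder's inequality costs
  the power \<open>p2 - p1\<close> of the integral of \<open>t^(2\<lambda>)\<close>, and
  \<open>t^p2 \<le> b^(p2-p1) t^p1\<close> costs the same power of \<open>b\<close>. The product of
  these two bases is at most a multiple of \<open>nut\<close>.\<close>

lemma nesting_p:
  assumes l: "l > - 1 / 2" and p: "1 < p1" "p1 < p2" and w: "weight w" and A: "Ap_condition p1 l w"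
  shows "Ap_condition p2 l w"
proof -
  note wp = weight_props[OF w]
  have pos: "AE t in Rplus. 0 < w t" by (rule Ap_imp_pos[OF l p(1) w A])
  obtain C where C: "0 < C" "\<And>a b. 0 < a \<Longrightarrow> a < b \<Longrightarrow> Ap_prod p1 l w a b < ennreal (C * nut l a b powr p1)"
    using A unfolding Ap_condition_iff by blast
  define \<theta> where "\<theta> = (p1 - 1) / (p2 - 1)"
  have \<theta>: "0 < \<theta>" "\<theta> < 1" using p by (auto simp: \<theta>_def)
  have \<theta>p: "\<theta> * (p2 - 1) = p1 - 1" "(1 - \<theta>) * (p2 - 1) = p2 - p1"
  proof -
    show "\<theta> * (p2 - 1) = p1 - 1" using p by (simp add: \<theta>_def)
    moreover have "(1 - \<theta>) * (p2 - 1) = (p2 - 1) - \<theta> * (p2 - 1)" by (simp only: left_diff_distrib mult_1)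
    ultimately show "(1 - \<theta>) * (p2 - 1) = p2 - p1" by linarith
  qed
  have l1: "0 < 2 * l + 1" using l by simp
  have dens: "AE t in Rplus. sigma_density l p2 w t \<le> epowr (sigma_density l p1 w t) \<theta> * epowr (ennreal (t powr (2 * l))) (1 - \<theta>)"
    using pos wp(2) AE_space
  proof eventually_elim
    case (elim t)
    then have t: "0 < t" by simp
    obtain u where u: "w t = ennreal u" "0 \<le> u" using elim by (cases "w t" rule: ennreal_cases) auto
    with elim have u0: "0 < u" by simp
    have m: "sigma_density l p w t = ennreal (t powr (2 * l * conj_exp p) * u powr (- 1 / (p - 1)))" for p
      using u u0 by (simp add: sigma_density_def epowr_ennreal ennreal_mult)
    have e: "- 1 / (p1 - 1) * \<theta> = - 1 / (p2 - 1)" using p by (simp add: \<theta>_def)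
    have "conj_exp p1 * \<theta> = p1 / (p2 - 1)" using p by (simp add: conj_exp_def \<theta>_def)
    moreover have "1 - \<theta> = (p2 - p1) / (p2 - 1)"
    proof -
      have "1 - (x - 1) / (y - 1) = (y - x) / (y - 1)" if "1 < y" for x y :: real using that by (simp add: field_simps)
      then show ?thesis using p by (simp only: \<theta>_def)
    qed
    ultimately have "conj_exp p1 * \<theta> + (1 - \<theta>) = conj_exp p2" by (simp only: conj_exp_def add_divide_distrib[symmetric] add_diff_cancel_left' diff_add_cancel le_add_diff_inverse add_diff_eq)
    then have e2: "2 * l * conj_exp p1 * \<theta> + 2 * l * (1 - \<theta>) = 2 * l * conj_exp p2"
      by (simp only: distrib_left[symmetric] mult.assoc)
    have 1: "epowr (sigma_density l p1 w t) \<theta> = ennreal (t powr (2 * l * conj_exp p1 * \<theta>) * u powr (- 1 / (p2 - 1)))"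
      unfolding m by (subst epowr_ennreal) (use t u0 in simp, simp only: powr_mult powr_powr e)
    have 2: "epowr (ennreal (t powr (2 * l))) (1 - \<theta>) = ennreal (t powr (2 * l * (1 - \<theta>)))"
      by (subst epowr_ennreal) (use t in simp, simp only: powr_powr)
    have "epowr (sigma_density l p1 w t) \<theta> * epowr (ennreal (t powr (2 * l))) (1 - \<theta>)
        = ennreal (t powr (2 * l * conj_exp p1 * \<theta>) * u powr (- 1 / (p2 - 1)) * t powr (2 * l * (1 - \<theta>)))"
      unfolding 1 2 by (subst ennreal_mult[symmetric]) auto
    also have "t powr (2 * l * conj_exp p1 * \<theta>) * u powr (- 1 / (p2 - 1)) * t powr (2 * l * (1 - \<theta>))
        = t powr (2 * l * conj_exp p2) * u powr (- 1 / (p2 - 1))"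
      unfolding e2[symmetric] powr_add by (simp only: mult_ac)
    finally show ?case by (simp only: m order_refl)
  qed
  have c0: "0 \<le> C * (1 / (2 * l + 1)) powr (p2 - p1)" using C by simp
  show ?thesis
  proof (rule Ap_conditionI[OF l c0])
    fix a b :: real assume ab: "0 < a" "a < b"
    then have a0: "0 \<le> a" by simp
    define \<tau> where "\<tau> = (b powr (2 * l + 1) - a powr (2 * l + 1)) / (2 * l + 1)"
    have \<tau>: "0 < \<tau>" unfolding \<tau>_def using l1 ab by (simp add: powr_less_mono2)
    let ?M1 = "\<integral>\<^sup>+t\<in>{a<..<b}. mu_density p1 w t \<partial>lebesgue" and ?M2 = "\<integral>\<^sup>+t\<in>{a<..<b}. mu_density p2 w t \<partial>lebesgue"
    let ?S1 = "\<integral>\<^sup>+t\<in>{a<..<b}. sigma_density l p1 w t \<partial>lebesgue" and ?S2 = "\<integral>\<^sup>+t\<in>{a<..<b}. sigma_density l p2 w t \<partial>lebesgue"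
    have "?S2 \<le> epowr ?S1 \<theta> * epowr (\<integral>\<^sup>+t\<in>{a<..<b}. ennreal (t powr (2 * l)) \<partial>lebesgue) (1 - \<theta>)"
      by (rule set_nn_integral_Hoelder[OF \<theta> a0 density_measurable(2)[OF wp(1)] ennreal_powr_measurable dens])
    also have "(\<integral>\<^sup>+t\<in>{a<..<b}. ennreal (t powr (2 * l)) \<partial>lebesgue) = ennreal \<tau>"
      unfolding \<tau>_def using l ab by (intro powr_set_integral) auto
    finally have "epowr ?S2 (p2 - 1) \<le> epowr (epowr ?S1 \<theta> * epowr (ennreal \<tau>) (1 - \<theta>)) (p2 - 1)"
      using p by (intro epowr_mono) auto
    also have "\<dots> = epowr ?S1 (\<theta> * (p2 - 1)) * epowr (ennreal \<tau>) ((1 - \<theta>) * (p2 - 1))"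
    proof -
      have "0 < p2 - 1" "p2 - 1 \<noteq> 0" "\<theta> \<noteq> 0" "1 - \<theta> \<noteq> 0" using p \<theta> by auto
      then show ?thesis by (simp only: epowr_mult epowr_epowr not_False_eq_True)
    qed
    also have "\<dots> = epowr ?S1 (p1 - 1) * ennreal (\<tau> powr (p2 - p1))"
      unfolding \<theta>p using \<tau> by (simp add: epowr_ennreal)
    finally have S: "epowr ?S2 (p2 - 1) \<le> epowr ?S1 (p1 - 1) * ennreal (\<tau> powr (p2 - p1))" .
    have "?M2 \<le> (\<integral>\<^sup>+t. ennreal (b powr (p2 - p1)) * (mu_density p1 w t * indicator {a<..<b} t) \<partial>Rplus)"
      unfolding set_nn_integral_Ioo_Rplus[OF a0]
    proof (rule nn_integral_mono)
      fix t
      show "mu_density p2 w t * indicator {a<..<b} t \<le> ennreal (b powr (p2 - p1)) * (mu_density p1 w t * indicator {a<..<b} t)"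
      proof (cases "t \<in> {a<..<b}")
        case True
        have "p2 = (p2 - p1) + p1" by simp
        then have "t powr p2 = t powr (p2 - p1) * t powr p1" by (metis powr_add)
        also have "\<dots> \<le> b powr (p2 - p1) * t powr p1"
          using True ab p by (intro mult_right_mono powr_mono2) auto
        finally have "ennreal (t powr p2) \<le> ennreal (b powr (p2 - p1)) * ennreal (t powr p1)"
          by (subst ennreal_mult[symmetric]) (auto intro: ennreal_leI)
        then have "ennreal (t powr p2) * w t \<le> ennreal (b powr (p2 - p1)) * ennreal (t powr p1) * w t"
          by (rule mult_right_mono) simp
        then show ?thesis using True by (simp add: mu_density_def mult.assoc)
      qed simp
    qed
    also have "\<dots> = ennreal (b powr (p2 - p1)) * ?M1"
      unfolding set_nn_integral_Ioo_Rplus[OF a0]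
      using density_measurable(1)[OF wp(1)] Ioo_Rplus[OF a0, of b] by (intro nn_integral_cmult) auto
    finally have "Ap_prod p2 l w a b \<le> (ennreal (b powr (p2 - p1)) * ?M1) * (epowr ?S1 (p1 - 1) * ennreal (\<tau> powr (p2 - p1)))"
      unfolding Ap_prod_def by (rule mult_mono[OF _ S]) auto
    also have "\<dots> = (ennreal (b powr (p2 - p1)) * ennreal (\<tau> powr (p2 - p1))) * Ap_prod p1 l w a b"
      unfolding Ap_prod_def by (simp only: mult_ac)
    also have "ennreal (b powr (p2 - p1)) * ennreal (\<tau> powr (p2 - p1)) = ennreal ((b * \<tau>) powr (p2 - p1))"
      by (subst ennreal_mult[symmetric]) (auto simp: powr_mult)
    also have "ennreal ((b * \<tau>) powr (p2 - p1)) * Ap_prod p1 l w a b \<le> ennreal ((b * \<tau>) powr (p2 - p1)) * ennreal (C * nut l a b powr p1)"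
      using C(2)[OF ab] by (intro mult_left_mono) auto
    also have "\<dots> = ennreal ((b * \<tau>) powr (p2 - p1) * (C * nut l a b powr p1))"
      using C(1) by (subst ennreal_mult) auto
    also have "\<dots> \<le> ennreal (C * (1 / (2 * l + 1)) powr (p2 - p1) * nut l a b powr p2)"
    proof (rule ennreal_leI)
      have "b * (b powr (2 * l + 1) - a powr (2 * l + 1)) \<le> nut l a b"
        using powr_diff_bounds(1)[of "2 * l + 1" a b] l ab by (simp add: nut_def algebra_simps)
      then have "b * \<tau> \<le> 1 / (2 * l + 1) * nut l a b"
        unfolding \<tau>_def using l1 by (simp add: divide_right_mono)
      then have "(b * \<tau>) powr (p2 - p1) \<le> (1 / (2 * l + 1) * nut l a b) powr (p2 - p1)"
        using \<tau> ab p by (intro powr_mono2) auto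
      also have "\<dots> = (1 / (2 * l + 1)) powr (p2 - p1) * nut l a b powr (p2 - p1)" by (rule powr_mult)
      finally have "(b * \<tau>) powr (p2 - p1) * (C * nut l a b powr p1)
          \<le> (1 / (2 * l + 1)) powr (p2 - p1) * nut l a b powr (p2 - p1) * (C * nut l a b powr p1)"
        using C(1) by (intro mult_right_mono) auto
      also have "\<dots> = C * (1 / (2 * l + 1)) powr (p2 - p1) * (nut l a b powr (p2 - p1) * nut l a b powr p1)" by (simp only: mult_ac)
      also have "nut l a b powr (p2 - p1) * nut l a b powr p1 = nut l a b powr p2" by (simp flip: powr_add)
      finally show "(b * \<tau>) powr (p2 - p1) * (C * nut l a b powr p1) \<le> C * (1 / (2 * l + 1)) powr (p2 - p1) * nut l a b powr p2" .
    qed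
    finally show "Ap_prod p2 l w a b \<le> ennreal (C * (1 / (2 * l + 1)) powr (p2 - p1) * nut l a b powr p2)" .
  qed
qed

section \<open>Doubling\<close>

lemma emeasure_density_Ioo:
  assumes "f \<in> borel_measurable Rplus" "0 \<le> a"
  shows "emeasure (density Rplus f) {a<..<b} = (\<integral>\<^sup>+t\<in>{a<..<b}. f t \<partial>lebesgue)"
  unfolding set_nn_integral_Ioo_Rplus[OF assms(2)] by (rule emeasure_density[OF assms(1) Ioo_Rplus[OF assms(2)]])

lemma set_nn_integral_Ioo_mono:
  fixes f :: "real \<Rightarrow> ennreal"
  assumes "a' \<le> a" "b \<le> b'"
  shows "(\<integral>\<^sup>+t\<in>{a<..<b}. f t \<partial>lebesgue) \<le> (\<integral>\<^sup>+t\<in>{a'<..<b'}. f t \<partial>lebesgue)"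
  by (rule nn_integral_mono) (use assms in \<open>auto simp: indicator_def\<close>)

lemma set_nn_integral_Ioo_pos:
  assumes f: "f \<in> borel_measurable Rplus" and pos: "AE t in Rplus. 0 < f t" and ab: "0 \<le> a" "a < b"
  shows "(\<integral>\<^sup>+t\<in>{a<..<b}. f t \<partial>lebesgue) \<noteq> 0"
proof
  let ?i = "indicator {a<..<b} :: real \<Rightarrow> ennreal"
  assume "(\<integral>\<^sup>+t\<in>{a<..<b}. f t \<partial>lebesgue) = 0"
  moreover have m: "(\<lambda>t. f t * ?i t) \<in> borel_measurable Rplus" using f Ioo_Rplus[OF ab(1), of b] by auto
  ultimately have "AE t in Rplus. f t * ?i t = 0"
    unfolding set_nn_integral_Ioo_Rplus[OF ab(1)] by (simp add: nn_integral_0_iff_AE)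
  then have "AE t in Rplus. ?i t = 0" using pos by eventually_elim auto
  then have "(\<integral>\<^sup>+t. ?i t \<partial>Rplus) = (\<integral>\<^sup>+t. 0 \<partial>Rplus)" by (rule nn_integral_cong_AE)
  then have "emeasure Rplus {a<..<b} = 0" using Ioo_Rplus[OF ab(1), of b] by simp
  moreover have "emeasure Rplus {a<..<b} = ennreal (b - a)"
    using ab by (subst emeasure_restrict_space) auto
  ultimately show False using ab by simp
qed

text \<open>Continuity from below along the left ends \<open>b / (n + 2)\<close>; the 2 keeps them
  strictly below \<open>b\<close> from \<open>n = 0\<close> on.\<close>

lemma set_nn_integral_Ioo_0_limit:
  assumes f: "f \<in> borel_measurable Rplus" and b: "0 < b"
    and le: "\<And>a. 0 < a \<Longrightarrow> a < b \<Longrightarrow> x * (\<integral>\<^sup>+t\<in>{a<..<b}. f t \<partial>lebesgue) \<le> D"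
  shows "x * (\<integral>\<^sup>+t\<in>{0<..<b}. f t \<partial>lebesgue) \<le> D"
proof -
  let ?A = "\<lambda>n::nat. {b / (real n + 2)<..<b}"
  have pos: "0 < b / (real n + 2)" "b / (real n + 2) < b" for n :: nat
    using b by (auto simp: divide_less_eq)
  have U: "(\<Union>n. ?A n) = {0<..<b}"
  proof
    show "(\<Union>n. ?A n) \<subseteq> {0<..<b}" using pos(1) by (auto intro: less_trans[OF pos(1)])
    show "{0<..<b} \<subseteq> (\<Union>n. ?A n)"
    proof
      fix t assume t: "t \<in> {0<..<b}"
      obtain n :: nat where "b / t < real n" using reals_Archimedean2 by blast
      then have "b / t < real n + 2" by simp
      then have "b / (real n + 2) < t" using t by (simp add: divide_less_eq mult.commute)
      then show "t \<in> (\<Union>n. ?A n)" using t by auto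
    qed
  qed
  have inc: "incseq ?A"
  proof (rule incseq_SucI)
    fix n :: nat
    have "b / (real (Suc n) + 2) \<le> b / (real n + 2)" using b by (intro divide_left_mono) auto
    then show "?A n \<subseteq> ?A (Suc n)" by auto
  qed
  have s: "range ?A \<subseteq> sets (density Rplus f)" using Ioo_Rplus[OF less_imp_le[OF pos(1)]] by auto
  have "(SUP n. emeasure (density Rplus f) (?A n)) = emeasure (density Rplus f) {0<..<b}"
    unfolding U[symmetric] by (rule SUP_emeasure_incseq[OF s inc])
  then have "(SUP n. \<integral>\<^sup>+t\<in>?A n. f t \<partial>lebesgue) = (\<integral>\<^sup>+t\<in>{0<..<b}. f t \<partial>lebesgue)"
    by (simp only: emeasure_density_Ioo[OF f order_refl] emeasure_density_Ioo[OF f less_imp_le[OF pos(1)]])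
  then have "x * (\<integral>\<^sup>+t\<in>{0<..<b}. f t \<partial>lebesgue) = x * (SUP n. \<integral>\<^sup>+t\<in>?A n. f t \<partial>lebesgue)" by simp
  also have "\<dots> = (SUP n. x * (\<integral>\<^sup>+t\<in>?A n. f t \<partial>lebesgue))" by (rule SUP_mult_left_ennreal)
  also have "\<dots> \<le> D" by (rule SUP_least) (rule le[OF pos])
  finally show ?thesis .
qed

text \<open>Passing to the limit \<open>a \<rightarrow> 0\<close> one factor at a time avoids any continuity of \<open>epowr\<close>: raising
  to the power \<open>1 / (p - 1)\<close> makes the second factor linear.\<close>

lemma Ap_prod_le:
  assumes l: "l > - 1 / 2" and p: "1 < p" and wm: "w \<in> borel_measurable Rplus" and C: "0 < C"
    and le: "\<And>a b. 0 < a \<Longrightarrow> a < b \<Longrightarrow> Ap_prod p l w a b < ennreal (C * nut l a b powr p)"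
    and ab: "0 \<le> a" "a < b"
  shows "Ap_prod p l w a b \<le> ennreal (C * nut l a b powr p)"
proof (cases "a = 0")
  case False
  then show ?thesis using le[of a b] ab by simp
next
  case True
  have b: "0 < b" using ab True by simp
  let ?M = "\<lambda>a. \<integral>\<^sup>+t\<in>{a<..<b}. mu_density p w t \<partial>lebesgue"
  let ?S = "\<lambda>a. \<integral>\<^sup>+t\<in>{a<..<b}. sigma_density l p w t \<partial>lebesgue"
  let ?D = "ennreal (C * nut l 0 b powr p)"
  note dm = density_measurable[OF wm]
  have r: "0 < p - 1" "0 < 1 / (p - 1)" "p - 1 \<noteq> 0" "1 / (p - 1) \<noteq> 0" using p by auto
  have r1: "(p - 1) * (1 / (p - 1)) = 1" "1 / (p - 1) * (p - 1) = 1" using p by auto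
  \<comment> \<open>Two independent left ends, so that each limit can be taken with the other
    integral fixed; both integrals are enlarged to the smaller end, where the condition
    applies.\<close>
  have 1: "epowr (?S a') (p - 1) * ?M a \<le> ?D" if a: "0 < a" "a < b" "0 < a'" "a' < b" for a a'
  proof -
    define m where "m = min a a'"
    have m: "0 < m" "m < b" "m \<le> a" "m \<le> a'" using a by (auto simp: m_def)
    have "epowr (?S a') (p - 1) * ?M a \<le> epowr (?S m) (p - 1) * ?M m"
      using m r by (intro mult_mono epowr_mono set_nn_integral_Ioo_mono) auto
    also have "\<dots> = Ap_prod p l w m b" by (simp add: Ap_prod_def mult.commute)
    also have "\<dots> \<le> ennreal (C * nut l m b powr p)" by (rule less_imp_le[OF le[OF m(1,2)]])
    also have "\<dots> \<le> ?D"
      using C p nut_pos[OF l less_imp_le[OF m(1)] m(2)] by (intro ennreal_leI mult_left_mono powr_mono2) (auto simp: nut_def)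
    finally show ?thesis .
  qed
  have 2: "epowr (?S a') (p - 1) * ?M 0 \<le> ?D" if "0 < a'" "a' < b" for a'
    by (rule set_nn_integral_Ioo_0_limit[OF dm(1) b]) (rule 1[OF _ _ that])
  have "epowr (?M 0) (1 / (p - 1)) * ?S a' \<le> epowr ?D (1 / (p - 1))" if "0 < a'" "a' < b" for a'
  proof -
    have "epowr (epowr (?S a') (p - 1) * ?M 0) (1 / (p - 1)) \<le> epowr ?D (1 / (p - 1))"
      by (rule epowr_mono[OF 2[OF that] r(2)])
    then show ?thesis by (simp only: epowr_mult[OF r(2)] epowr_epowr[OF r(3,4)] r1 epowr_1 mult.commute)
  qed
  then have "epowr (?M 0) (1 / (p - 1)) * ?S 0 \<le> epowr ?D (1 / (p - 1))"
    by (rule set_nn_integral_Ioo_0_limit[OF dm(2) b])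
  then have "epowr (epowr (?M 0) (1 / (p - 1)) * ?S 0) (p - 1) \<le> epowr (epowr ?D (1 / (p - 1))) (p - 1)"
    using r(1) by (rule epowr_mono)
  then have "?M 0 * epowr (?S 0) (p - 1) \<le> ?D"
    by (simp only: epowr_mult[OF r(1)] epowr_epowr[OF r(4,3)] r1 epowr_1)
  then show ?thesis unfolding True Ap_prod_def .
qed

text \<open>Up to constants, \<open>nut\<close> on \<open>(a', b')\<close> is at most
  \<open>b'^(2\<lambda>+1) (b' - a')\<close>, and on \<open>(a, b)\<close> it is at least
  \<open>b^(2\<lambda>+1) (b - a)\<close>. The right end of \<open>2B\<close> is
  \<open>(3b - a) / 2\<close>, the origin of \<open>3/2\<close>.\<close>

lemma nut_double:
  assumes l: "l > - 1 / 2" and ab: "0 \<le> a" "a < b"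
    and ab': "0 \<le> a'" "a' < b'" "b' \<le> 3 / 2 * b" "b' - a' \<le> 2 * (b - a)"
  shows "nut l a' b' \<le> (4 * (l + 1) * (3 / 2) powr (2 * l + 1)) * nut l a b"
proof -
  define \<alpha> where "\<alpha> = 2 * l + 1"
  have \<alpha>: "0 < \<alpha>" using l by (simp add: \<alpha>_def)
  have nut: "nut l x y = y powr (\<alpha> + 1) - x powr (\<alpha> + 1)" for x y
    by (simp add: nut_def \<alpha>_def algebra_simps)
  have "ennreal ((b' powr (\<alpha> + 1) - a' powr (\<alpha> + 1)) / (\<alpha> + 1)) = (\<integral>\<^sup>+t\<in>{a'<..<b'}. ennreal (t powr \<alpha>) \<partial>lebesgue)"
    using powr_set_integral[of \<alpha> a' b'] \<alpha> ab' by simp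
  also have "\<dots> \<le> (\<integral>\<^sup>+t. ennreal (b' powr \<alpha>) * indicator {a'<..<b'} t \<partial>lebesgue)"
    using \<alpha> ab' by (intro nn_integral_mono) (auto simp: indicator_def intro!: ennreal_leI powr_mono2)
  also have "\<dots> = ennreal (b' powr \<alpha>) * ennreal (b' - a')" using ab' by (subst nn_integral_cmult_indicator) auto
  also have "\<dots> = ennreal (b' powr \<alpha> * (b' - a'))" using ab' by (subst ennreal_mult) auto
  finally have "nut l a' b' / (\<alpha> + 1) \<le> b' powr \<alpha> * (b' - a')"
    using ab' by (subst (asm) ennreal_le_iff) (auto simp: nut)
  also have "\<dots> \<le> (3 / 2 * b) powr \<alpha> * (2 * (b - a))"
    using ab ab' \<alpha> by (intro mult_mono powr_mono2) auto
  also have "\<dots> = 2 * (3 / 2) powr \<alpha> * (b powr \<alpha> * (b - a))"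
    unfolding powr_mult by (simp only: mult_ac)
  also have "\<dots> \<le> 2 * (3 / 2) powr \<alpha> * nut l a b"
    unfolding nut using powr_diff_bounds(2)[OF \<alpha>, of a b] ab by (intro mult_left_mono) auto
  finally have "nut l a' b' \<le> (\<alpha> + 1) * (2 * (3 / 2) powr \<alpha> * nut l a b)"
    using \<alpha> by (simp add: divide_le_eq mult.commute)
  then show ?thesis by (simp add: \<alpha>_def algebra_simps)
qed

text \<open>Hoelder's inequality on \<open>B\<close>, with \<sigma>(B) enlarged to \<sigma>(2B), and
  the condition on \<open>2B\<close> share the factor \<open>\<sigma>(2B)^(p-1)\<close>. It cancels:
  it is nonzero because the \<sigma>-density is positive almost everywhere, and finite because its
  product with the nonzero \<mu>(2B) is finite.\<close>

lemma doubling_mu: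
  assumes l: "l > - 1 / 2" and p: "1 < p" and w: "weight w" and A: "Ap_condition p l w"
  shows "doubling (density Rplus (mu_density p w))"
proof -
  note wp = weight_props[OF w]
  note dm = density_measurable[OF wp(1)]
  have pos: "AE t in Rplus. 0 < w t" by (rule Ap_imp_pos[OF l p w A])
  have mu_pos: "AE t in Rplus. 0 < mu_density p w t"
    using pos AE_space by eventually_elim (simp add: mu_density_def ennreal_zero_less_mult_iff)
  have sigma_pos: "AE t in Rplus. 0 < sigma_density l p w t"
    using wp(2) AE_space
  proof eventually_elim
    case (elim t)
    have "dual_weight l p w t \<noteq> 0" using dual_weight_finite_iff(2)[of p t l w] p elim by auto
    then have "epowr (w t) (- 1 / (p - 1)) \<noteq> 0" by (auto simp: dual_weight_def)
    then show ?case using elim by (simp add: sigma_density_def ennreal_zero_less_mult_iff zero_less_iff_neq_zero)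
  qed
  obtain C where C: "0 < C" "\<And>a b. 0 < a \<Longrightarrow> a < b \<Longrightarrow> Ap_prod p l w a b < ennreal (C * nut l a b powr p)"
    using A unfolding Ap_condition_iff by blast
  define K where "K = 4 * (l + 1) * (3 / 2) powr (2 * l + 1)"
  have K: "0 < K" using l by (simp add: K_def)
  \<comment> \<open>\<open>K\<close> is the doubling constant of \<open>nut\<close> and
    \<open>2\<lambda> + 2\<close> converts \<open>nut\<close> into \<nu>; both occur to the power
    \<open>p\<close>.\<close>
  define D where "D = C * (K * (2 * l + 2)) powr p"
  have D: "0 < D" using C K l by (simp add: D_def)
  have r: "0 < p - 1" using p by simp
  show ?thesis
    unfolding doubling_def
  proof (intro exI[of _ D] conjI allI impI D)
    fix a b :: real assume ab: "0 \<le> a \<and> a < b"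
    \<comment> \<open>\<open>2B\<close> may reach below 0. Its trace on the half line is again an
      interval, possibly with left end 0, which is why \<open>Ap_prod_le\<close> is applied instead
      of the condition itself.\<close>
    define a' where "a' = max 0 ((a + b) / 2 - (b - a))"
    define b' where "b' = (a + b) / 2 + (b - a)"
    have B': "{(a + b) / 2 - (b - a)<..<(a + b) / 2 + (b - a)} \<inter> {0<..} = {a'<..<b'}"
      by (auto simp: a'_def b'_def)
    have ab': "0 \<le> a'" "a' \<le> a" "b \<le> b'" "a' < b'" "b' \<le> 3 / 2 * b" "b' - a' \<le> 2 * (b - a)"
      using ab by (auto simp: a'_def b'_def max_def field_simps)
    let ?M = "\<integral>\<^sup>+t\<in>{a<..<b}. mu_density p w t \<partial>lebesgue" and ?M' = "\<integral>\<^sup>+t\<in>{a'<..<b'}. mu_density p w t \<partial>lebesgue"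
    let ?S = "\<integral>\<^sup>+t\<in>{a<..<b}. sigma_density l p w t \<partial>lebesgue" and ?S' = "\<integral>\<^sup>+t\<in>{a'<..<b'}. sigma_density l p w t \<partial>lebesgue"
    have em: "emeasure (density Rplus (mu_density p w)) {a<..<b} = ?M" "emeasure (density Rplus (mu_density p w)) {a'<..<b'} = ?M'"
      using ab ab' by (intro emeasure_density_Ioo dm; simp)+
    have M0: "?M' \<noteq> 0" by (rule set_nn_integral_Ioo_pos[OF dm(1) mu_pos ab'(1,4)])
    have S0: "?S' \<noteq> 0" by (rule set_nn_integral_Ioo_pos[OF dm(2) sigma_pos ab'(1,4)])
    have Ap': "?M' * epowr ?S' (p - 1) \<le> ennreal (C * nut l a' b' powr p)"
      using Ap_prod_le[OF l p wp(1) C ab'(1,4)] by (simp add: Ap_prod_def)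
    have Sp0: "epowr ?S' (p - 1) \<noteq> 0" using S0 r by (cases ?S' rule: ennreal_cases) (auto simp: epowr_ennreal_nonneg)
    have "?M' * epowr ?S' (p - 1) \<noteq> top" using Ap' by (auto simp: top_unique)
    then have fin: "?M' \<noteq> top" "epowr ?S' (p - 1) \<noteq> top"
      using M0 Sp0 by (auto simp: ennreal_mult_eq_top_iff)
    define n where "n = nut l a b"
    have n: "0 < n" unfolding n_def using nut_pos[OF l] ab by simp
    have "ennreal ((n / (2 * l + 2)) powr p) \<le> ?M * epowr ?S (p - 1)"
      using nu_powr_le_Ap_prod[OF p w pos, of a l b] nu_Ioo[OF l, of a b] ab n l
      by (simp add: n_def epowr_ennreal Ap_prod_def)
    also have "\<dots> \<le> ?M * epowr ?S' (p - 1)"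
      using ab' r by (intro mult_left_mono epowr_mono set_nn_integral_Ioo_mono) auto
    finally have lower: "ennreal ((n / (2 * l + 2)) powr p) \<le> ?M * epowr ?S' (p - 1)" .
    have "?M' * epowr ?S' (p - 1) \<le> ennreal (C * nut l a' b' powr p)" by (rule Ap')
    also have "\<dots> \<le> ennreal (D * (n / (2 * l + 2)) powr p)"
    proof (rule ennreal_leI)
      have "nut l a' b' \<le> K * n"
        unfolding n_def K_def using ab ab' by (intro nut_double[OF l]) auto
      then have "nut l a' b' powr p \<le> (K * n) powr p"
        using nut_pos[OF l ab'(1,4)] p by (intro powr_mono2) auto
      also have "K * n = K * (2 * l + 2) * (n / (2 * l + 2))" using l by simp
      also have "(K * (2 * l + 2) * (n / (2 * l + 2))) powr p = (K * (2 * l + 2)) powr p * (n / (2 * l + 2)) powr p"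
        by (rule powr_mult)
      finally show "C * nut l a' b' powr p \<le> D * (n / (2 * l + 2)) powr p"
        unfolding D_def mult.assoc[of C] using C(1) by (intro mult_left_mono) auto
    qed
    also have "\<dots> = ennreal D * ennreal ((n / (2 * l + 2)) powr p)" using D by (intro ennreal_mult) auto
    also have "\<dots> \<le> ennreal D * (?M * epowr ?S' (p - 1))" by (rule mult_left_mono[OF lower]) simp
    finally have "?M' * epowr ?S' (p - 1) \<le> (ennreal D * ?M) * epowr ?S' (p - 1)" by (simp only: mult.assoc)
    then have le: "?M' \<le> ennreal D * ?M"
      using Sp0 fin(2) by (simp add: ennreal_mult_le_mult_iff mult.commute[of _ "epowr ?S' (p - 1)"])
    show "0 < emeasure (density Rplus (mu_density p w)) ({(a + b) / 2 - (b - a)<..<(a + b) / 2 + (b - a)} \<inter> {0<..})"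
      unfolding B' em using M0 by (simp add: zero_less_iff_neq_zero)
    show "emeasure (density Rplus (mu_density p w)) ({(a + b) / 2 - (b - a)<..<(a + b) / 2 + (b - a)} \<inter> {0<..})
        \<le> ennreal D * emeasure (density Rplus (mu_density p w)) {a<..<b}"
      unfolding B' em by (rule le)
    have "?M \<le> ?M'" using ab' by (intro set_nn_integral_Ioo_mono)
    then have "?M < top" using fin(1) by (simp add: less_top order_le_less_trans)
    then show "ennreal D * emeasure (density Rplus (mu_density p w)) {a<..<b} < \<infinity>"
      unfolding em by (simp add: ennreal_mult_less_top)
  qed
qed

text \<open>The density of \<sigma> is the \<mu>-density of the dual weight for the exponent
  \<open>p'\<close>, so doubling of \<mu> applies to the dual.\<close>

lemma doubling_sigma:
  assumes l: "l > - 1 / 2" and p: "1 < p" and w: "weight w" and A: "Ap_condition p l w"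
  shows "doubling (density Rplus (sigma_density l p w))"
proof -
  have d: "weight (dual_weight l p w)" "Ap_condition (conj_exp p) l (dual_weight l p w)"
    using dual_factor[OF l p w] A by auto
  note wm = weight_props(1)[OF w] and dm = weight_props(1)[OF d(1)]
  have "density Rplus (sigma_density l p w) = density Rplus (mu_density (conj_exp p) (dual_weight l p w))"
  proof (rule density_cong)
    show "AE t in Rplus. sigma_density l p w t = mu_density (conj_exp p) (dual_weight l p w) t"
      using AE_space by eventually_elim (simp add: mu_density_dual)
  qed (rule density_measurable[OF wm] density_measurable[OF dm])+
  then show ?thesis using doubling_mu[OF l conj_exp_props(1)[OF p] d] by simp
qed

theorem proposition1p4:
  fixes l p :: real
  assumes "l > - 1 / 2" and "l \<noteq> 0" and "1 < p"
  shows "(\<forall>w. w \<in> A_class p l \<longrightarrow> Ap_char p l w \<ge> 1) \<and>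
    (\<forall>w. w \<in> A_class p l \<longrightarrow>
      doubling (density Rplus (mu_density p w)) \<and>
      doubling (density Rplus (sigma_density l p w))) \<and>
    (\<forall>w. weight w \<longrightarrow> (w \<in> A_class p l \<longleftrightarrow> dual_weight l p w \<in> A_class (conj_exp p) l)) \<and>
    (\<forall>l' p1 p2 :: real. l' > - 1 / 2 \<and> l' \<noteq> 0 \<and> 1 \<le> p1 \<and> p1 < p2 \<longrightarrow>
      A_class p1 l' \<subseteq> A_class p2 l') \<and>
    (\<forall>q l1 l2 :: real. 1 < q \<and> l1 > - 1 / 2 \<and> l1 < l2 \<and> l1 \<noteq> 0 \<and> l2 \<noteq> 0 \<longrightarrow>
      A_class q l1 \<subseteq> A_class q l2)"
proof -
  have A: "w \<in> A_class q m \<longleftrightarrow> weight w \<and> Ap_condition q m w" if "1 < q" for q m w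
    using that by (simp add: A_class_def)
  note l = assms(1) and p = assms(3)
  have char: "\<forall>w. w \<in> A_class p l \<longrightarrow> Ap_char p l w \<ge> 1"
    using Ap_char_ge_1[OF l p] A[OF p] by blast
  have doub: "\<forall>w. w \<in> A_class p l \<longrightarrow>
      doubling (density Rplus (mu_density p w)) \<and> doubling (density Rplus (sigma_density l p w))"
    using doubling_mu[OF l p] doubling_sigma[OF l p] A[OF p] by blast
  have dual: "\<forall>w. weight w \<longrightarrow> (w \<in> A_class p l \<longleftrightarrow> dual_weight l p w \<in> A_class (conj_exp p) l)"
    using dual_factor[OF l p] A[OF p] A[OF conj_exp_props(1)[OF p]] by blast
  \<comment> \<open>Only the smaller exponent can be 1. The larger class is therefore always given
    by the integral condition, and the weak type class enters solely through
    \<open>A1_imp_Ap\<close>.\<close>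
  have nest_p: "A_class p1 l' \<subseteq> A_class p2 l'" if "l' > - 1 / 2" "1 \<le> p1" "p1 < p2" for l' p1 p2
  proof
    fix w assume w: "w \<in> A_class p1 l'"
    have p2: "1 < p2" using that by simp
    show "w \<in> A_class p2 l'"
    proof (cases "p1 = 1")
      case True
      then have "weight w" "A1_condition l' w" using w by (simp_all add: A_class_def)
      then show ?thesis using A1_imp_Ap[OF that(1) p2] A[OF p2] by blast
    next
      case False
      then have p1: "1 < p1" using that by simp
      then show ?thesis using w nesting_p[OF that(1) p1 that(3)] A[OF p1] A[OF p2] by blast
    qed
  qed
  have nest_l: "A_class q l1 \<subseteq> A_class q l2" if "1 < q" "l1 > - 1 / 2" "l1 < l2" for q l1 l2
    using nesting_l[OF that] weight_props(1) A[OF that(1)] by blast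
  show ?thesis using char doub dual nest_p nest_l by blast
qed

end
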